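(* Let $\mathscr{A}$ be an AB5-abelian category, let $Q$ be a left-rooted quiver and let $\mathscr{X}$ be a set of projective objects of $\mathscr{A}$. Then (i) $\Phi(\bigoplus\mathscr{X})=\bigoplus f_*(\mathscr{X})=\bigoplus\Phi(\mathscr{X})$; (ii) $\Phi(\operatorname{Add}\mathscr{X})=\operatorname{Add}f_*(\mathscr{X})=\operatorname{Add}\Phi(\mathscr{X})$. If $\mathscr{A}$ has enough projectives, then (iii) $\Phi(\operatorname{Proj}(\mathscr{A}))=\operatorname{Proj}(\operatorname{Rep}(Q,\mathscr{A}))$. If $\mathscr{A}$ is locally finitely presented and generated by $\operatorname{proj}(\mathscr{A})$, then (iv) $\Phi(\varinjlim\operatorname{proj}(\mathscr{A}))=\varinjlim\operatorname{proj}(\operatorname{Rep}(Q,\mathscr{A}))$.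
   Context: An abelian category is AB5 if it is cocomplete with exact filtered colimits, and Grothendieck if it moreover has a generator. It is locally finitely presented if it is Grothendieck and generated by its finitely presented objects (those $X$ for which $\operatorname{Hom}(X,-)$ commutes with filtered colimits). An object $X$ is finitely generated if $\varinjlim\operatorname{Hom}(X,Y_i)\to\operatorname{Hom}(X,\varinjlim Y_i)$ is injective for every filtered system $\{Y_i\}$. A class $\mathscr{S}$ generates $\mathscr{A}$ if a morphism $f:X\to Y$ is zero whenever $fg=0$ for all $g:S\to X$ with $S\in\mathscr{S}$. $\operatorname{Proj}$ denotes the projective objects and $\operatorname{proj}$ the finitely generated projective objects. $\bigoplus\mathscr{Y}$ is the class of all (possibly infinite) direct sums of objects of $\mathscr{Y}$, $\operatorname{Add}\mathscr{Y}$ the class of direct summands of such sums, and $\varinjlim\mathscr{Y}$ the class of colimits of filtered systems of objects of $\mathscr{Y}$. A quiver $Q$ is a directed graph (possibly infinite) with vertex set $Q_0$; it is left-rooted if there is no infinite sequence of composable arrows $\cdots\to\bullet\to\bullet$. $\operatorname{Rep}(Q,\mathscr{A})$ is the category of functors from the path category of $Q$ to $\mathscr{A}$. For $v\in Q_0$, $f_v:\mathscr{A}\to\operatorname{Rep}(Q,\mathscr{A})$ is the left adjoint of evaluation at $v$, $f_v(X)(w)=\bigoplus_{v\leadsto w}X$ (sum over paths from $v$ to $w$), and $f_*(\mathscr{X})=\{f_v(X)\mid v\in Q_0,X\in\mathscr{X}\}$. $\Phi(\mathscr{X})$ is the class of all $F\in\operatorname{Rep}(Q,\mathscr{A})$ such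 that for every $v\in Q_0$ the canonical map $\varphi_v^F:\bigoplus_{w\to v}F(w)\to F(v)$ (sum over all arrows with target $v$) is monic and has cokernel in $\mathscr{X}$.
   Formalization: In (i), the equality ⊕f_*(X)=⊕Φ(X) is asserted only when X contains a zero object (otherwise only ⊕Φ(X)⊆⊕f_*(X)); as printed it fails, e.g. for two vertices without arrows and X={k} in Vect_k. *)

theory Defs
  imports "HOL-Algebra.Group" "HOL-Library.FuncSet"
begin

unbundle cardinal_syntax

section \<open>Size\<close>

text \<open>
  Set-indexed and class-sized collections are told apart relative to a regular uncountable
  cardinal, given as the cardinality of a type: a set is small if it has strictly fewer elements.
  If that cardinal is inaccessible, small means belonging to a Grothendieck universe, up to
  bijection. Coproducts, colimits and filtered systems are always the small ones. Every small
  diagram is isomorphic to one whose index category has its objects and arrows in that type,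
  so only these are quantified over.
\<close>

definition regular_universe :: "'u itself \<Rightarrow> bool" where
  "regular_universe U \<longleftrightarrow> regularCard |UNIV :: 'u set| \<and> natLeq <o |UNIV :: 'u set|"

definition small :: "'u itself \<Rightarrow> 'a set \<Rightarrow> bool" where
  "small U S \<longleftrightarrow> |S| <o |UNIV :: 'u set|"

section \<open>Categories and functors\<close>

record ('o, 'm) cat =
  Ob :: "'o set"
  Mor :: "'m set"
  Dom :: "'m \<Rightarrow> 'o"
  Cod :: "'m \<Rightarrow> 'o"
  Ide :: "'o \<Rightarrow> 'm"
  Comp :: "'m \<Rightarrow> 'm \<Rightarrow> 'm"  (infixl "\<cdot>\<index>" 70)

definition Hom :: "('o, 'm) cat \<Rightarrow> 'o \<Rightarrow> 'o \<Rightarrow> 'm set" where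
  "Hom C X Y = {f \<in> Mor C. Dom C f = X \<and> Cod C f = Y}"

locale category =
  fixes C :: "('o, 'm) cat" (structure)
  assumes Dom_Ob: "f \<in> Mor C \<Longrightarrow> Dom C f \<in> Ob C"
    and Cod_Ob: "f \<in> Mor C \<Longrightarrow> Cod C f \<in> Ob C"
    and Ide_Hom: "X \<in> Ob C \<Longrightarrow> Ide C X \<in> Hom C X X"
    and Comp_Hom: "f \<in> Hom C X Y \<Longrightarrow> g \<in> Hom C Y Z \<Longrightarrow> g \<cdot> f \<in> Hom C X Z"
    and Comp_Ide: "f \<in> Hom C X Y \<Longrightarrow> f \<cdot> Ide C X = f"
    and Ide_Comp: "f \<in> Hom C X Y \<Longrightarrow> Ide C Y \<cdot> f = f"
    and Comp_assoc: "f \<in> Hom C W X \<Longrightarrow> g \<in> Hom C X Y \<Longrightarrow> h \<in> Hom C Y Z \<Longrightarrow>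
      (h \<cdot> g) \<cdot> f = h \<cdot> (g \<cdot> f)"

record ('a, 'b, 'o, 'm) func =
  fob :: "'a \<Rightarrow> 'o"
  fmor :: "'b \<Rightarrow> 'm"

definition is_functor :: "('a, 'b) cat \<Rightarrow> ('o, 'm) cat \<Rightarrow> ('a, 'b, 'o, 'm) func \<Rightarrow> bool" where
  "is_functor J C F \<longleftrightarrow>
     (\<forall>x \<in> Ob J. fob F x \<in> Ob C) \<and>
     (\<forall>x y. \<forall>u \<in> Hom J x y. fmor F u \<in> Hom C (fob F x) (fob F y)) \<and>
     (\<forall>x \<in> Ob J. fmor F (Ide J x) = Ide C (fob F x)) \<and>
     (\<forall>x y z. \<forall>u \<in> Hom J x y. \<forall>v \<in> Hom J y z.
        fmor F (v \<cdot>\<^bsub>J\<^esub> u) = fmor F v \<cdot>\<^bsub>C\<^esub> fmor F u)"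

definition nat_trans :: "('a, 'b) cat \<Rightarrow> ('o, 'm) cat \<Rightarrow> ('a, 'b, 'o, 'm) func \<Rightarrow>
    ('a, 'b, 'o, 'm) func \<Rightarrow> ('a \<Rightarrow> 'm) \<Rightarrow> bool" where
  "nat_trans J C F G t \<longleftrightarrow>
     (\<forall>x \<in> Ob J. t x \<in> Hom C (fob F x) (fob G x)) \<and>
     (\<forall>x y. \<forall>u \<in> Hom J x y. t y \<cdot>\<^bsub>C\<^esub> fmor F u = fmor G u \<cdot>\<^bsub>C\<^esub> t x)"

text \<open>
  Functors and natural transformations are made \<^const>\<open>undefined\<close> off their domains, so that
  equal ones are equal as HOL functions.
\<close>

definition fun_cat :: "('a, 'b) cat \<Rightarrow> ('o, 'm) cat \<Rightarrow>
    (('a, 'b, 'o, 'm) func,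
     ('a, 'b, 'o, 'm) func \<times> ('a \<Rightarrow> 'm) \<times> ('a, 'b, 'o, 'm) func) cat" where
  "fun_cat J C = (let
      Fs = {F. is_functor J C F \<and> fob F \<in> extensional (Ob J) \<and> fmor F \<in> extensional (Mor J)}
    in \<lparr> Ob = Fs,
         Mor = {(F, t, G). F \<in> Fs \<and> G \<in> Fs \<and> nat_trans J C F G t \<and> t \<in> extensional (Ob J)},
         Dom = (\<lambda>(F, t, G). F),
         Cod = (\<lambda>(F, t, G). G),
         Ide = (\<lambda>F. (F, (\<lambda>x \<in> Ob J. Ide C (fob F x)), F)),
         Comp = (\<lambda>(F', s, H) (F, t, G). (F, (\<lambda>x \<in> Ob J. s x \<cdot>\<^bsub>C\<^esub> t x), H)) \<rparr>)"

definition eval_at :: "'a \<Rightarrow> (('a, 'b, 'o, 'm) func,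
    ('a, 'b, 'o, 'm) func \<times> ('a \<Rightarrow> 'm) \<times> ('a, 'b, 'o, 'm) func, 'o, 'm) func" where
  "eval_at v = \<lparr> fob = (\<lambda>F. fob F v), fmor = (\<lambda>(F, t, G). t v) \<rparr>"

text \<open>
  The object \<open>F\<close> with the unit \<open>u\<close> is the value at \<open>X\<close> of a left adjoint of \<open>R : C \<rightarrow> D\<close>.
\<close>

definition universal_arrow :: "('a, 'b) cat \<Rightarrow> ('o, 'm) cat \<Rightarrow> ('a, 'b, 'o, 'm) func \<Rightarrow>
    'o \<Rightarrow> 'a \<Rightarrow> 'm \<Rightarrow> bool" where
  "universal_arrow C D R X F u \<longleftrightarrow>
     F \<in> Ob C \<and> u \<in> Hom D X (fob R F) \<and>
     (\<forall>G \<in> Ob C. \<forall>g \<in> Hom D X (fob R G).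
        \<exists>!h. h \<in> Hom C F G \<and> fmor R h \<cdot>\<^bsub>D\<^esub> u = g)"

definition monic :: "('o, 'm) cat \<Rightarrow> 'm \<Rightarrow> bool" where
  "monic C f \<longleftrightarrow> f \<in> Mor C \<and>
     (\<forall>W. \<forall>g \<in> Hom C W (Dom C f). \<forall>h \<in> Hom C W (Dom C f).
        f \<cdot>\<^bsub>C\<^esub> g = f \<cdot>\<^bsub>C\<^esub> h \<longrightarrow> g = h)"

definition epic :: "('o, 'm) cat \<Rightarrow> 'm \<Rightarrow> bool" where
  "epic C f \<longleftrightarrow> f \<in> Mor C \<and>
     (\<forall>Z. \<forall>g \<in> Hom C (Cod C f) Z. \<forall>h \<in> Hom C (Cod C f) Z.
        g \<cdot>\<^bsub>C\<^esub> f = h \<cdot>\<^bsub>C\<^esub> f \<longrightarrow> g = h)"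

section \<open>Coproducts and colimits\<close>

definition is_coproduct :: "('o, 'm) cat \<Rightarrow> 'i set \<Rightarrow> ('i \<Rightarrow> 'o) \<Rightarrow> 'o \<Rightarrow> ('i \<Rightarrow> 'm) \<Rightarrow> bool" where
  "is_coproduct C I X S inc \<longleftrightarrow>
     S \<in> Ob C \<and> (\<forall>i \<in> I. X i \<in> Ob C \<and> inc i \<in> Hom C (X i) S) \<and>
     (\<forall>T \<in> Ob C. \<forall>f. (\<forall>i \<in> I. f i \<in> Hom C (X i) T) \<longrightarrow>
        (\<exists>!h. h \<in> Hom C S T \<and> (\<forall>i \<in> I. h \<cdot>\<^bsub>C\<^esub> inc i = f i)))"

definition is_cocone :: "('o, 'm) cat \<Rightarrow> ('a, 'b) cat \<Rightarrow> ('a, 'b, 'o, 'm) func \<Rightarrow>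
    'o \<Rightarrow> ('a \<Rightarrow> 'm) \<Rightarrow> bool" where
  "is_cocone C J D L l \<longleftrightarrow>
     L \<in> Ob C \<and> (\<forall>j \<in> Ob J. l j \<in> Hom C (fob D j) L) \<and>
     (\<forall>i j. \<forall>u \<in> Hom J i j. l j \<cdot>\<^bsub>C\<^esub> fmor D u = l i)"

definition is_colimit :: "('o, 'm) cat \<Rightarrow> ('a, 'b) cat \<Rightarrow> ('a, 'b, 'o, 'm) func \<Rightarrow>
    'o \<Rightarrow> ('a \<Rightarrow> 'm) \<Rightarrow> bool" where
  "is_colimit C J D L l \<longleftrightarrow>
     is_cocone C J D L l \<and>
     (\<forall>M m. is_cocone C J D M m \<longrightarrow>
        (\<exists>!h. h \<in> Hom C L M \<and> (\<forall>j \<in> Ob J. h \<cdot>\<^bsub>C\<^esub> l j = m j)))"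

definition small_cat :: "'u itself \<Rightarrow> ('a, 'b) cat \<Rightarrow> bool" where
  "small_cat U J \<longleftrightarrow> category J \<and> small U (Ob J) \<and> small U (Mor J)"

definition filtered :: "('a, 'b) cat \<Rightarrow> bool" where
  "filtered J \<longleftrightarrow>
     Ob J \<noteq> {} \<and>
     (\<forall>i \<in> Ob J. \<forall>j \<in> Ob J. \<exists>k. Hom J i k \<noteq> {} \<and> Hom J j k \<noteq> {}) \<and>
     (\<forall>i j. \<forall>u \<in> Hom J i j. \<forall>v \<in> Hom J i j.
        \<exists>k. \<exists>w \<in> Hom J j k. w \<cdot>\<^bsub>J\<^esub> u = w \<cdot>\<^bsub>J\<^esub> v)"

definition cocomplete :: "'u itself \<Rightarrow> ('o, 'm) cat \<Rightarrow> bool" where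
  "cocomplete U C \<longleftrightarrow>
     (\<forall>(J :: ('u, 'u) cat) D. small_cat U J \<and> is_functor J C D \<longrightarrow> (\<exists>L l. is_colimit C J D L l))"

definition filtered_system :: "'u itself \<Rightarrow> ('o, 'm) cat \<Rightarrow> ('u, 'u) cat \<Rightarrow>
    ('u, 'u, 'o, 'm) func \<Rightarrow> bool" where
  "filtered_system U C J D \<longleftrightarrow> small_cat U J \<and> filtered J \<and> is_functor J C D"

section \<open>Abelian categories\<close>

definition zero_ob :: "('o, 'm) cat \<Rightarrow> 'o \<Rightarrow> bool" where
  "zero_ob C Z \<longleftrightarrow> Z \<in> Ob C \<and> (\<forall>X \<in> Ob C. (\<exists>!f. f \<in> Hom C X Z) \<and> (\<exists>!f. f \<in> Hom C Z X))"

definition zero_mor :: "('o, 'm) cat \<Rightarrow> 'm \<Rightarrow> bool" where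
  "zero_mor C f \<longleftrightarrow> f \<in> Mor C \<and>
     (\<exists>Z. zero_ob C Z \<and> (\<exists>g \<in> Hom C (Dom C f) Z. \<exists>h \<in> Hom C Z (Cod C f). f = h \<cdot>\<^bsub>C\<^esub> g))"

definition is_kernel :: "('o, 'm) cat \<Rightarrow> 'm \<Rightarrow> 'm \<Rightarrow> bool" where
  "is_kernel C f k \<longleftrightarrow>
     f \<in> Mor C \<and> k \<in> Mor C \<and> Cod C k = Dom C f \<and> zero_mor C (f \<cdot>\<^bsub>C\<^esub> k) \<and>
     (\<forall>W. \<forall>g \<in> Hom C W (Dom C f). zero_mor C (f \<cdot>\<^bsub>C\<^esub> g) \<longrightarrow>
        (\<exists>!h. h \<in> Hom C W (Dom C k) \<and> k \<cdot>\<^bsub>C\<^esub> h = g))"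

definition is_cokernel :: "('o, 'm) cat \<Rightarrow> 'm \<Rightarrow> 'm \<Rightarrow> bool" where
  "is_cokernel C f c \<longleftrightarrow>
     f \<in> Mor C \<and> c \<in> Mor C \<and> Dom C c = Cod C f \<and> zero_mor C (c \<cdot>\<^bsub>C\<^esub> f) \<and>
     (\<forall>Z. \<forall>g \<in> Hom C (Cod C f) Z. zero_mor C (g \<cdot>\<^bsub>C\<^esub> f) \<longrightarrow>
        (\<exists>!h. h \<in> Hom C (Cod C c) Z \<and> h \<cdot>\<^bsub>C\<^esub> c = g))"

definition short_exact :: "('o, 'm) cat \<Rightarrow> 'm \<Rightarrow> 'm \<Rightarrow> bool" where
  "short_exact C f g \<longleftrightarrow> is_kernel C g f \<and> is_cokernel C f g"

definition preadditive :: "('o, 'm) cat \<Rightarrow> ('m \<Rightarrow> 'm \<Rightarrow> 'm) \<Rightarrow> bool" where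
  "preadditive C pl \<longleftrightarrow>
     category C \<and>
     (\<forall>X \<in> Ob C. \<forall>Y \<in> Ob C. \<exists>z. comm_group \<lparr> carrier = Hom C X Y, mult = pl, one = z \<rparr>) \<and>
     (\<forall>X Y Z. \<forall>f \<in> Hom C X Y. \<forall>f' \<in> Hom C X Y. \<forall>g \<in> Hom C Y Z. \<forall>g' \<in> Hom C Y Z.
        g \<cdot>\<^bsub>C\<^esub> pl f f' = pl (g \<cdot>\<^bsub>C\<^esub> f) (g \<cdot>\<^bsub>C\<^esub> f') \<and>
        pl g g' \<cdot>\<^bsub>C\<^esub> f = pl (g \<cdot>\<^bsub>C\<^esub> f) (g' \<cdot>\<^bsub>C\<^esub> f))"

definition has_biproducts :: "('o, 'm) cat \<Rightarrow> ('m \<Rightarrow> 'm \<Rightarrow> 'm) \<Rightarrow> bool" where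
  "has_biproducts C pl \<longleftrightarrow>
     (\<forall>X \<in> Ob C. \<forall>Y \<in> Ob C. \<exists>S. \<exists>i \<in> Hom C X S. \<exists>j \<in> Hom C Y S. \<exists>p \<in> Hom C S X. \<exists>q \<in> Hom C S Y.
        p \<cdot>\<^bsub>C\<^esub> i = Ide C X \<and> q \<cdot>\<^bsub>C\<^esub> j = Ide C Y \<and>
        pl (i \<cdot>\<^bsub>C\<^esub> p) (j \<cdot>\<^bsub>C\<^esub> q) = Ide C S)"

text \<open>
  The addition of an abelian category is determined by its underlying category, so being abelian
  is a property of the latter.
\<close>

definition abelian :: "('o, 'm) cat \<Rightarrow> bool" where
  "abelian C \<longleftrightarrow>
     (\<exists>pl. preadditive C pl \<and> has_biproducts C pl) \<and>
     (\<exists>Z. zero_ob C Z) \<and>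
     (\<forall>f \<in> Mor C. (\<exists>k. is_kernel C f k) \<and> (\<exists>c. is_cokernel C f c)) \<and>
     (\<forall>f. monic C f \<longrightarrow> (\<exists>g. is_kernel C g f)) \<and>
     (\<forall>f. epic C f \<longrightarrow> (\<exists>g. is_cokernel C g f))"

text \<open>
  Exactness of the colimit functor from systems over \<open>J\<close> to \<open>C\<close>; a sequence of systems is exact
  if it is so at every index, and \<open>a\<close>, \<open>b\<close> are the maps it induces on the colimits.
\<close>

definition exact_filtered_colimits :: "'u itself \<Rightarrow> ('o, 'm) cat \<Rightarrow> bool" where
  "exact_filtered_colimits U C \<longleftrightarrow>
     (\<forall>(J :: ('u, 'u) cat) D D' D'' s t L l L' l' L'' l'' a b.
        filtered_system U C J D' \<and> filtered_system U C J D \<and> filtered_system U C J D'' \<and>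
        nat_trans J C D' D s \<and> nat_trans J C D D'' t \<and>
        (\<forall>j \<in> Ob J. short_exact C (s j) (t j)) \<and>
        is_colimit C J D' L' l' \<and> is_colimit C J D L l \<and> is_colimit C J D'' L'' l'' \<and>
        a \<in> Hom C L' L \<and> (\<forall>j \<in> Ob J. a \<cdot>\<^bsub>C\<^esub> l' j = l j \<cdot>\<^bsub>C\<^esub> s j) \<and>
        b \<in> Hom C L L'' \<and> (\<forall>j \<in> Ob J. b \<cdot>\<^bsub>C\<^esub> l j = l'' j \<cdot>\<^bsub>C\<^esub> t j)
        \<longrightarrow> short_exact C a b)"

definition AB5 :: "'u itself \<Rightarrow> ('o, 'm) cat \<Rightarrow> bool" where
  "AB5 U C \<longleftrightarrow> abelian C \<and> cocomplete U C \<and> exact_filtered_colimits U C"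

definition generates :: "('o, 'm) cat \<Rightarrow> 'o set \<Rightarrow> bool" where
  "generates C \<S> \<longleftrightarrow>
     (\<forall>f \<in> Mor C. (\<forall>S \<in> \<S>. \<forall>g \<in> Hom C S (Dom C f). zero_mor C (f \<cdot>\<^bsub>C\<^esub> g)) \<longrightarrow> zero_mor C f)"

text \<open>
  Hom-sets are not required to be small in general. Of local smallness, only its instance for the
  generator is kept: as long as the cardinal need not be inaccessible, smallness of all hom-sets
  would be too strong (over the first uncountable cardinal it leaves only zero categories).
\<close>

definition grothendieck :: "'u itself \<Rightarrow> ('o, 'm) cat \<Rightarrow> bool" where
  "grothendieck U C \<longleftrightarrow>
     AB5 U C \<and> (\<exists>G \<in> Ob C. generates C {G} \<and> (\<forall>X \<in> Ob C. small U (Hom C G X)))"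

text \<open>
  The colimit of the sets \<open>Hom C X (fob D j)\<close> over a filtered category \<open>J\<close> is a quotient of
  their disjoint union; a cocone \<open>l\<close> on \<open>D\<close> with vertex \<open>L\<close> induces a map from it to
  \<open>Hom C X L\<close>.
\<close>

definition Hom_union :: "('o, 'm) cat \<Rightarrow> ('a, 'b) cat \<Rightarrow> ('a, 'b, 'o, 'm) func \<Rightarrow> 'o \<Rightarrow>
    ('a \<times> 'm) set" where
  "Hom_union C J D X = Sigma (Ob J) (\<lambda>j. Hom C X (fob D j))"

definition Hom_colim :: "('o, 'm) cat \<Rightarrow> ('a, 'b) cat \<Rightarrow> ('a, 'b, 'o, 'm) func \<Rightarrow> 'o \<Rightarrow>
    ('a \<times> 'm) set set" where
  "Hom_colim C J D X = Hom_union C J D X //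
     {((i, f), (j, g)). (i, f) \<in> Hom_union C J D X \<and> (j, g) \<in> Hom_union C J D X \<and>
        (\<exists>k. \<exists>u \<in> Hom J i k. \<exists>v \<in> Hom J j k. fmor D u \<cdot>\<^bsub>C\<^esub> f = fmor D v \<cdot>\<^bsub>C\<^esub> g)}"

definition Hom_colim_map :: "('o, 'm) cat \<Rightarrow> ('a \<Rightarrow> 'm) \<Rightarrow> ('a \<times> 'm) set \<Rightarrow> 'm" where
  "Hom_colim_map C l K = the_elem ((\<lambda>(j, f). l j \<cdot>\<^bsub>C\<^esub> f) ` K)"

definition fin_generated :: "'u itself \<Rightarrow> ('o, 'm) cat \<Rightarrow> 'o \<Rightarrow> bool" where
  "fin_generated U C X \<longleftrightarrow> X \<in> Ob C \<and>
     (\<forall>(J :: ('u, 'u) cat) D L l. filtered_system U C J D \<and> is_colimit C J D L l \<longrightarrow>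
        inj_on (Hom_colim_map C l) (Hom_colim C J D X))"

definition fin_presented :: "'u itself \<Rightarrow> ('o, 'm) cat \<Rightarrow> 'o \<Rightarrow> bool" where
  "fin_presented U C X \<longleftrightarrow> X \<in> Ob C \<and>
     (\<forall>(J :: ('u, 'u) cat) D L l. filtered_system U C J D \<and> is_colimit C J D L l \<longrightarrow>
        bij_betw (Hom_colim_map C l) (Hom_colim C J D X) (Hom C X L))"

definition loc_fin_presented :: "'u itself \<Rightarrow> ('o, 'm) cat \<Rightarrow> bool" where
  "loc_fin_presented U C \<longleftrightarrow> grothendieck U C \<and> generates C {X. fin_presented U C X}"

definition projective :: "('o, 'm) cat \<Rightarrow> 'o \<Rightarrow> bool" where
  "projective C P \<longleftrightarrow> P \<in> Ob C \<and>
     (\<forall>e. epic C e \<longrightarrow> (\<forall>f \<in> Hom C P (Cod C e). \<exists>g \<in> Hom C P (Dom C e). e \<cdot>\<^bsub>C\<^esub> g = f))"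

definition Proj :: "('o, 'm) cat \<Rightarrow> 'o set" where
  "Proj C = {P. projective C P}"

definition fg_proj :: "'u itself \<Rightarrow> ('o, 'm) cat \<Rightarrow> 'o set" where
  "fg_proj U C = {P. projective C P \<and> fin_generated U C P}"

definition enough_projectives :: "('o, 'm) cat \<Rightarrow> bool" where
  "enough_projectives C \<longleftrightarrow> (\<forall>X \<in> Ob C. \<exists>P \<in> Proj C. \<exists>e \<in> Hom C P X. epic C e)"

section \<open>Closure operations on classes of objects\<close>

text \<open>
  These classes are closed under isomorphism. The empty direct sum is allowed, so the first two
  always contain the zero objects.
\<close>

definition Sums :: "'u itself \<Rightarrow> ('o, 'm) cat \<Rightarrow> 'o set \<Rightarrow> 'o set" where
  "Sums U C \<Y> = {S. \<exists>(I :: 'u set) X inc. small U I \<and> (\<forall>i \<in> I. X i \<in> \<Y>) \<and> is_coproduct C I X S inc}"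

definition Add :: "'u itself \<Rightarrow> ('o, 'm) cat \<Rightarrow> 'o set \<Rightarrow> 'o set" where
  "Add U C \<Y> = {X. \<exists>S \<in> Sums U C \<Y>. \<exists>X' inc. is_coproduct C UNIV (\<lambda>b. if b then X else X') S inc}"

definition Filt_colims :: "'u itself \<Rightarrow> ('o, 'm) cat \<Rightarrow> 'o set \<Rightarrow> 'o set" where
  "Filt_colims U C \<Y> = {L. \<exists>(J :: ('u, 'u) cat) D l.
     filtered_system U C J D \<and> (\<forall>j \<in> Ob J. fob D j \<in> \<Y>) \<and> is_colimit C J D L l}"

section \<open>Quivers and their representations\<close>

record ('v, 'e) quiver =
  verts :: "'v set"
  arrs :: "'e set"
  src :: "'e \<Rightarrow> 'v"
  tgt :: "'e \<Rightarrow> 'v"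

definition is_quiver :: "('v, 'e) quiver \<Rightarrow> bool" where
  "is_quiver Q \<longleftrightarrow> (\<forall>a \<in> arrs Q. src Q a \<in> verts Q \<and> tgt Q a \<in> verts Q)"

definition left_rooted :: "('v, 'e) quiver \<Rightarrow> bool" where
  "left_rooted Q \<longleftrightarrow>
     \<not> (\<exists>a :: nat \<Rightarrow> 'e. \<forall>n. a n \<in> arrs Q \<and> tgt Q (a (Suc n)) = src Q (a n))"

fun is_path :: "('v, 'e) quiver \<Rightarrow> 'v \<Rightarrow> 'e list \<Rightarrow> 'v \<Rightarrow> bool" where
  "is_path Q v [] w \<longleftrightarrow> v \<in> verts Q \<and> v = w"
| "is_path Q v (a # p) w \<longleftrightarrow> v \<in> verts Q \<and> a \<in> arrs Q \<and> src Q a = v \<and> is_path Q (tgt Q a) p w"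

text \<open>Paths list their arrows in the order of traversal and carry their end points.\<close>

definition path_cat :: "('v, 'e) quiver \<Rightarrow> ('v, 'v \<times> 'e list \<times> 'v) cat" where
  "path_cat Q = \<lparr> Ob = verts Q,
     Mor = {(v, p, w). is_path Q v p w},
     Dom = (\<lambda>(v, p, w). v),
     Cod = (\<lambda>(v, p, w). w),
     Ide = (\<lambda>v. (v, [], v)),
     Comp = (\<lambda>(w', q, x) (v, p, w). (v, p @ q, x)) \<rparr>"

abbreviation Rep :: "('v, 'e) quiver \<Rightarrow> ('o, 'm) cat \<Rightarrow>
    (('v, 'v \<times> 'e list \<times> 'v, 'o, 'm) func,
     ('v, 'v \<times> 'e list \<times> 'v, 'o, 'm) func \<times> ('v \<Rightarrow> 'm) \<times> ('v, 'v \<times> 'e list \<times> 'v, 'o, 'm) func) cat"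
  where "Rep Q A \<equiv> fun_cat (path_cat Q) A"

definition f_star :: "('v, 'e) quiver \<Rightarrow> ('o, 'm) cat \<Rightarrow> 'o set \<Rightarrow>
    ('v, 'v \<times> 'e list \<times> 'v, 'o, 'm) func set" where
  "f_star Q A \<X> =
     {F. \<exists>v \<in> verts Q. \<exists>X \<in> \<X>. \<exists>u. universal_arrow (Rep Q A) A (eval_at v) X F u}"

text \<open>
  Here \<open>p\<close> is the canonical map to \<open>fob F v\<close> from a direct sum \<open>S\<close>, determined by \<open>F\<close> and \<open>v\<close>
  up to the choice of the direct sum.
\<close>

definition canonical_map :: "('v, 'e) quiver \<Rightarrow> ('o, 'm) cat \<Rightarrow>
    ('v, 'v \<times> 'e list \<times> 'v, 'o, 'm) func \<Rightarrow> 'v \<Rightarrow> 'm \<Rightarrow> bool" where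
  "canonical_map Q A F v p \<longleftrightarrow> (\<exists>S inc.
     is_coproduct A {a \<in> arrs Q. tgt Q a = v} (\<lambda>a. fob F (src Q a)) S inc \<and>
     p \<in> Hom A S (fob F v) \<and>
     (\<forall>a \<in> arrs Q. tgt Q a = v \<longrightarrow> p \<cdot>\<^bsub>A\<^esub> inc a = fmor F (src Q a, [a], v)))"

text \<open>
  Cokernels are determined up to isomorphism only; what is required is that some cokernel object
  lies in \<open>\<X>\<close>.
\<close>

definition Phi :: "('v, 'e) quiver \<Rightarrow> ('o, 'm) cat \<Rightarrow> 'o set \<Rightarrow>
    ('v, 'v \<times> 'e list \<times> 'v, 'o, 'm) func set" where
  "Phi Q A \<X> = {F \<in> Ob (Rep Q A). \<forall>v \<in> verts Q. \<exists>p c.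
     canonical_map Q A F v p \<and> monic A p \<and> is_cokernel A p c \<and> Cod A c \<in> \<X>}"

section \<open>Path categories, functor categories, and the formula for the left adjoint\<close>

lemma is_path_verts: "is_quiver Q \<Longrightarrow> is_path Q v p w \<Longrightarrow> v \<in> verts Q \<and> w \<in> verts Q"
  by (induction p arbitrary: v) auto

lemma is_path_append:
  "is_path Q v p w \<Longrightarrow> is_path Q w q x \<Longrightarrow> is_path Q v (p @ q) x"
  by (induction p arbitrary: v) auto

lemma category_path_cat: "is_quiver Q \<Longrightarrow> category (path_cat Q)"
  by unfold_locales (auto simp: path_cat_def Hom_def is_path_verts is_path_append)

lemma fun_cat_Ob: "F \<in> Ob (fun_cat J C) \<longleftrightarrow>
    is_functor J C F \<and> fob F \<in> extensional (Ob J) \<and> fmor F \<in> extensional (Mor J)"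
  by (simp add: fun_cat_def)

lemma fun_cat_Hom: "h \<in> Hom (fun_cat J C) F G \<longleftrightarrow>
    (\<exists>t. h = (F, t, G) \<and> F \<in> Ob (fun_cat J C) \<and> G \<in> Ob (fun_cat J C) \<and>
       nat_trans J C F G t \<and> t \<in> extensional (Ob J))"
  by (auto simp: fun_cat_def Hom_def)

lemma fun_cat_Comp [simp]:
  "(G', s, H) \<cdot>\<^bsub>fun_cat J C\<^esub> (F, t, G) = (F, (\<lambda>x \<in> Ob J. s x \<cdot>\<^bsub>C\<^esub> t x), H)"
  by (simp add: fun_cat_def)

lemma fun_cat_Ide [simp]: "Ide (fun_cat J C) F = (F, (\<lambda>x \<in> Ob J. Ide C (fob F x)), F)"
  by (simp add: fun_cat_def)

lemma category_fun_cat: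
  assumes J: "category J" and C: "category C"
  shows "category (fun_cat J C)"
proof
  fix F t assume "t \<in> Mor (fun_cat J C)"
  then show "Dom (fun_cat J C) t \<in> Ob (fun_cat J C)" and "Cod (fun_cat J C) t \<in> Ob (fun_cat J C)"
    by (auto simp: fun_cat_def)
next
  fix F assume F: "F \<in> Ob (fun_cat J C)"
  have "nat_trans J C F F (\<lambda>x \<in> Ob J. Ide C (fob F x))"
    unfolding nat_trans_def
  proof (intro conjI ballI allI)
    fix x assume "x \<in> Ob J"
    then show "(\<lambda>x \<in> Ob J. Ide C (fob F x)) x \<in> Hom C (fob F x) (fob F x)"
      using F by (auto simp: fun_cat_Ob is_functor_def intro: category.Ide_Hom[OF C])
  next
    fix x y u assume u: "u \<in> Hom J x y"
    then have "x \<in> Ob J" "y \<in> Ob J"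
      using category.Dom_Ob[OF J] category.Cod_Ob[OF J] by (auto simp: Hom_def)
    moreover have "fmor F u \<in> Hom C (fob F x) (fob F y)"
      using F u by (auto simp: fun_cat_Ob is_functor_def)
    ultimately show "(\<lambda>x \<in> Ob J. Ide C (fob F x)) y \<cdot>\<^bsub>C\<^esub> fmor F u =
        fmor F u \<cdot>\<^bsub>C\<^esub> (\<lambda>x \<in> Ob J. Ide C (fob F x)) x"
      by (simp add: category.Comp_Ide[OF C] category.Ide_Comp[OF C])
  qed
  with F show "Ide (fun_cat J C) F \<in> Hom (fun_cat J C) F F"
    by (simp add: fun_cat_Hom)
next
  fix f g F G H assume f: "f \<in> Hom (fun_cat J C) F G" and g: "g \<in> Hom (fun_cat J C) G H"
  obtain t where t: "f = (F, t, G)" "F \<in> Ob (fun_cat J C)" "G \<in> Ob (fun_cat J C)"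
      "nat_trans J C F G t" using f by (auto simp: fun_cat_Hom)
  obtain s where s: "g = (G, s, H)" "H \<in> Ob (fun_cat J C)" "nat_trans J C G H s"
    using g by (auto simp: fun_cat_Hom)
  have "nat_trans J C F H (\<lambda>x \<in> Ob J. s x \<cdot>\<^bsub>C\<^esub> t x)"
    unfolding nat_trans_def
  proof (intro conjI ballI allI)
    fix x assume "x \<in> Ob J"
    then show "(\<lambda>x \<in> Ob J. s x \<cdot>\<^bsub>C\<^esub> t x) x \<in> Hom C (fob F x) (fob H x)"
      using t s by (auto simp: nat_trans_def intro: category.Comp_Hom[OF C])
  next
    fix x y u assume u: "u \<in> Hom J x y"
    then have xy: "x \<in> Ob J" "y \<in> Ob J"
      using category.Dom_Ob[OF J] category.Cod_Ob[OF J] by (auto simp: Hom_def)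
    have h: "fmor F u \<in> Hom C (fob F x) (fob F y)" "fmor G u \<in> Hom C (fob G x) (fob G y)"
        "fmor H u \<in> Hom C (fob H x) (fob H y)"
      using t s u by (auto simp: fun_cat_Ob is_functor_def)
    have k: "t x \<in> Hom C (fob F x) (fob G x)" "t y \<in> Hom C (fob F y) (fob G y)"
        "s x \<in> Hom C (fob G x) (fob H x)" "s y \<in> Hom C (fob G y) (fob H y)"
      using t s xy by (auto simp: nat_trans_def)
    have n: "t y \<cdot>\<^bsub>C\<^esub> fmor F u = fmor G u \<cdot>\<^bsub>C\<^esub> t x" "s y \<cdot>\<^bsub>C\<^esub> fmor G u = fmor H u \<cdot>\<^bsub>C\<^esub> s x"
      using t s u by (auto simp: nat_trans_def)
    note a = category.Comp_assoc[OF C]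
    have "(s y \<cdot>\<^bsub>C\<^esub> t y) \<cdot>\<^bsub>C\<^esub> fmor F u = (s y \<cdot>\<^bsub>C\<^esub> fmor G u) \<cdot>\<^bsub>C\<^esub> t x"
      by (simp only: a[OF h(1) k(2) k(4)] a[OF k(1) h(2) k(4)] n(1))
    then have "(s y \<cdot>\<^bsub>C\<^esub> t y) \<cdot>\<^bsub>C\<^esub> fmor F u = fmor H u \<cdot>\<^bsub>C\<^esub> (s x \<cdot>\<^bsub>C\<^esub> t x)"
      by (simp only: n(2) a[OF k(1) k(3) h(3)])
    with xy show "(\<lambda>x \<in> Ob J. s x \<cdot>\<^bsub>C\<^esub> t x) y \<cdot>\<^bsub>C\<^esub> fmor F u =
        fmor H u \<cdot>\<^bsub>C\<^esub> (\<lambda>x \<in> Ob J. s x \<cdot>\<^bsub>C\<^esub> t x) x"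
      by simp
  qed
  with t s show "g \<cdot>\<^bsub>fun_cat J C\<^esub> f \<in> Hom (fun_cat J C) F H"
    by (simp add: fun_cat_Hom)
next
  fix f F G assume "f \<in> Hom (fun_cat J C) F G"
  then obtain t where t: "f = (F, t, G)" "nat_trans J C F G t" "t \<in> extensional (Ob J)"
    by (auto simp: fun_cat_Hom)
  then have "(\<lambda>x \<in> Ob J. t x \<cdot>\<^bsub>C\<^esub> (\<lambda>x \<in> Ob J. Ide C (fob F x)) x) = t"
    and "(\<lambda>x \<in> Ob J. (\<lambda>x \<in> Ob J. Ide C (fob G x)) x \<cdot>\<^bsub>C\<^esub> t x) = t"
    by (auto intro!: extensionalityI[of _ "Ob J"] simp: nat_trans_def
        category.Comp_Ide[OF C] category.Ide_Comp[OF C])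
  with t show "f \<cdot>\<^bsub>fun_cat J C\<^esub> Ide (fun_cat J C) F = f"
    and "Ide (fun_cat J C) G \<cdot>\<^bsub>fun_cat J C\<^esub> f = f"
    by simp_all
next
  fix f g h E F G H
  assume "f \<in> Hom (fun_cat J C) E F" "g \<in> Hom (fun_cat J C) F G" "h \<in> Hom (fun_cat J C) G H"
  then obtain t s r where f: "f = (E, t, F)" and g: "g = (F, s, G)" and h: "h = (G, r, H)"
    and t: "nat_trans J C E F t" and s: "nat_trans J C F G s" and r: "nat_trans J C G H r"
    by (auto simp: fun_cat_Hom)
  have "(r x \<cdot>\<^bsub>C\<^esub> s x) \<cdot>\<^bsub>C\<^esub> t x = r x \<cdot>\<^bsub>C\<^esub> (s x \<cdot>\<^bsub>C\<^esub> t x)" if "x \<in> Ob J" for x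
    by (rule category.Comp_assoc[OF C, of _ "fob E x" "fob F x" _ "fob G x" _ "fob H x"])
      (use that t s r in \<open>auto simp: nat_trans_def\<close>)
  then show "(h \<cdot>\<^bsub>fun_cat J C\<^esub> g) \<cdot>\<^bsub>fun_cat J C\<^esub> f = h \<cdot>\<^bsub>fun_cat J C\<^esub> (g \<cdot>\<^bsub>fun_cat J C\<^esub> f)"
    by (auto simp: f g h intro!: restrict_ext)
qed

text \<open>
  For \<open>J = path_cat Q\<close>: an object \<open>F\<close> that is at every \<open>w\<close> a direct sum of copies of \<open>X\<close> over the
  paths from \<open>v\<close> to \<open>w\<close>, with arrows acting by composition of paths, is a value of the left adjoint.
\<close>

lemma universal_arrow_eval_at:
  assumes J: "category J" and C: "category C" and v: "v \<in> Ob J"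
    and F: "F \<in> Ob (fun_cat J C)"
    and cop: "\<And>w. w \<in> Ob J \<Longrightarrow> is_coproduct C (Hom J v w) (\<lambda>_. X) (fob F w) i"
    and act: "\<And>w x p q. p \<in> Hom J v w \<Longrightarrow> q \<in> Hom J w x \<Longrightarrow> fmor F q \<cdot>\<^bsub>C\<^esub> i p = i (q \<cdot>\<^bsub>J\<^esub> p)"
  shows "universal_arrow (fun_cat J C) C (eval_at v) X F (i (Ide J v))"
  unfolding universal_arrow_def
proof (intro conjI ballI)
  note assocC = category.Comp_assoc[OF C]
  have idv: "Ide J v \<in> Hom J v v" using J v by (rule category.Ide_Hom)
  have obJ: "x \<in> Ob J" "y \<in> Ob J" if "u \<in> Hom J x y" for u x y
    using that category.Dom_Ob[OF J] category.Cod_Ob[OF J] by (auto simp: Hom_def)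
  have iH: "i p \<in> Hom C X (fob F w)" if "p \<in> Hom J v w" for p w
    using cop[of w] that obJ[OF that] by (auto simp: is_coproduct_def)
  have Fm: "fmor F q \<in> Hom C (fob F x) (fob F y)" if "q \<in> Hom J x y" for q x y
    using F that by (auto simp: fun_cat_Ob is_functor_def)
  show "F \<in> Ob (fun_cat J C)" by (rule F)
  show "i (Ide J v) \<in> Hom C X (fob (eval_at v) F)" using iH[OF idv] by (simp add: eval_at_def)
  fix G g assume G: "G \<in> Ob (fun_cat J C)" and "g \<in> Hom C X (fob (eval_at v) G)"
  then have g: "g \<in> Hom C X (fob G v)" by (simp add: eval_at_def)
  have Gm: "fmor G q \<in> Hom C (fob G x) (fob G y)" if "q \<in> Hom J x y" for q x y
    using G that by (auto simp: fun_cat_Ob is_functor_def)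
  have Gc: "fmor G (q \<cdot>\<^bsub>J\<^esub> p) = fmor G q \<cdot>\<^bsub>C\<^esub> fmor G p"
    if "p \<in> Hom J x y" "q \<in> Hom J y z" for p q x y z
    using G that by (auto simp: fun_cat_Ob is_functor_def)
  have GO: "fob G w \<in> Ob C" if "w \<in> Ob J" for w
    using G that by (auto simp: fun_cat_Ob is_functor_def)
  have ex1: "\<exists>!h. h \<in> Hom C (fob F w) T \<and> (\<forall>p \<in> Hom J v w. h \<cdot>\<^bsub>C\<^esub> i p = f p)"
    if "w \<in> Ob J" "T \<in> Ob C" "\<And>p. p \<in> Hom J v w \<Longrightarrow> f p \<in> Hom C X T" for w T f
    using cop[OF that(1)] that(2,3) by (auto simp: is_coproduct_def)
  have gp: "fmor G p \<cdot>\<^bsub>C\<^esub> g \<in> Hom C X (fob G w)" if "p \<in> Hom J v w" for p w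
    using category.Comp_Hom[OF C g Gm[OF that]] .
  have "\<exists>h. h \<in> Hom C (fob F w) (fob G w) \<and> (\<forall>p \<in> Hom J v w. h \<cdot>\<^bsub>C\<^esub> i p = fmor G p \<cdot>\<^bsub>C\<^esub> g)"
    if w: "w \<in> Ob J" for w
    using ex1[OF w GO[OF w], of "\<lambda>p. fmor G p \<cdot>\<^bsub>C\<^esub> g"] gp by blast
  then obtain t0 where t0: "\<And>w. w \<in> Ob J \<Longrightarrow> t0 w \<in> Hom C (fob F w) (fob G w) \<and>
      (\<forall>p \<in> Hom J v w. t0 w \<cdot>\<^bsub>C\<^esub> i p = fmor G p \<cdot>\<^bsub>C\<^esub> g)"
    by metis
  define t where "t = restrict t0 (Ob J)"
  have tH: "t w \<in> Hom C (fob F w) (fob G w)" if "w \<in> Ob J" for w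
    using t0 that by (simp add: t_def)
  have ti: "t w \<cdot>\<^bsub>C\<^esub> i p = fmor G p \<cdot>\<^bsub>C\<^esub> g" if "p \<in> Hom J v w" for w p
    using t0 that obJ[OF that] by (simp add: t_def)
  have nat: "nat_trans J C F G t"
    unfolding nat_trans_def
  proof (intro conjI ballI allI)
    show "t x \<in> Hom C (fob F x) (fob G x)" if "x \<in> Ob J" for x using tH that .
    fix x y q assume q: "q \<in> Hom J x y"
    note xy = obJ[OF q]
    let ?f = "\<lambda>p. fmor G q \<cdot>\<^bsub>C\<^esub> (fmor G p \<cdot>\<^bsub>C\<^esub> g)"
    have a: "t y \<cdot>\<^bsub>C\<^esub> fmor F q \<in> Hom C (fob F x) (fob G y)"
      using category.Comp_Hom[OF C Fm[OF q] tH[OF xy(2)]] .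
    have b: "fmor G q \<cdot>\<^bsub>C\<^esub> t x \<in> Hom C (fob F x) (fob G y)"
      using category.Comp_Hom[OF C tH[OF xy(1)] Gm[OF q]] .
    have a': "(t y \<cdot>\<^bsub>C\<^esub> fmor F q) \<cdot>\<^bsub>C\<^esub> i p = ?f p" if p: "p \<in> Hom J v x" for p
    proof -
      have qp: "q \<cdot>\<^bsub>J\<^esub> p \<in> Hom J v y" using category.Comp_Hom[OF J p q] .
      have "(t y \<cdot>\<^bsub>C\<^esub> fmor F q) \<cdot>\<^bsub>C\<^esub> i p = t y \<cdot>\<^bsub>C\<^esub> i (q \<cdot>\<^bsub>J\<^esub> p)"
        by (simp add: assocC[OF iH[OF p] Fm[OF q] tH[OF xy(2)]] act[OF p q])
      also have "\<dots> = ?f p"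
        by (simp add: ti[OF qp] Gc[OF p q] assocC[OF g Gm[OF p] Gm[OF q]])
      finally show ?thesis .
    qed
    have b': "(fmor G q \<cdot>\<^bsub>C\<^esub> t x) \<cdot>\<^bsub>C\<^esub> i p = ?f p" if p: "p \<in> Hom J v x" for p
      by (simp add: assocC[OF iH[OF p] tH[OF xy(1)] Gm[OF q]] ti[OF p])
    have "\<exists>!h. h \<in> Hom C (fob F x) (fob G y) \<and> (\<forall>p \<in> Hom J v x. h \<cdot>\<^bsub>C\<^esub> i p = ?f p)"
      by (rule ex1[OF xy(1) GO[OF xy(2)]]) (rule category.Comp_Hom[OF C gp Gm[OF q]])
    with a b a' b' show "t y \<cdot>\<^bsub>C\<^esub> fmor F q = fmor G q \<cdot>\<^bsub>C\<^esub> t x" by blast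
  qed
  have Gid: "fmor G (Ide J v) \<cdot>\<^bsub>C\<^esub> g = g"
    using G v by (simp add: fun_cat_Ob is_functor_def category.Ide_Comp[OF C g])
  show "\<exists>!h. h \<in> Hom (fun_cat J C) F G \<and> fmor (eval_at v) h \<cdot>\<^bsub>C\<^esub> i (Ide J v) = g"
  proof (rule ex1I[of _ "(F, t, G)"])
    have "t \<in> extensional (Ob J)" by (simp add: t_def)
    then show "(F, t, G) \<in> Hom (fun_cat J C) F G \<and>
        fmor (eval_at v) (F, t, G) \<cdot>\<^bsub>C\<^esub> i (Ide J v) = g"
      using F G nat ti[OF idv] Gid by (simp add: fun_cat_Hom eval_at_def)
  next
    fix h assume h: "h \<in> Hom (fun_cat J C) F G \<and> fmor (eval_at v) h \<cdot>\<^bsub>C\<^esub> i (Ide J v) = g"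
    then obtain s where s: "h = (F, s, G)" "nat_trans J C F G s" "s \<in> extensional (Ob J)"
        "s v \<cdot>\<^bsub>C\<^esub> i (Ide J v) = g"
      by (auto simp: fun_cat_Hom eval_at_def)
    have "s w = t w" if w: "w \<in> Ob J" for w
    proof -
      have sH: "s x \<in> Hom C (fob F x) (fob G x)" if "x \<in> Ob J" for x
        using s(2) that by (simp add: nat_trans_def)
      have "s w \<cdot>\<^bsub>C\<^esub> i p = fmor G p \<cdot>\<^bsub>C\<^esub> g" if p: "p \<in> Hom J v w" for p
      proof -
        have "s w \<cdot>\<^bsub>C\<^esub> i p = s w \<cdot>\<^bsub>C\<^esub> (fmor F p \<cdot>\<^bsub>C\<^esub> i (Ide J v))"
          by (simp add: act[OF idv p] category.Comp_Ide[OF J p])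
        also have "\<dots> = (s w \<cdot>\<^bsub>C\<^esub> fmor F p) \<cdot>\<^bsub>C\<^esub> i (Ide J v)"
          by (simp add: assocC[OF iH[OF idv] Fm[OF p] sH[OF w]])
        also have "\<dots> = (fmor G p \<cdot>\<^bsub>C\<^esub> s v) \<cdot>\<^bsub>C\<^esub> i (Ide J v)"
          using s(2) p by (simp add: nat_trans_def)
        also have "\<dots> = fmor G p \<cdot>\<^bsub>C\<^esub> g"
          by (simp add: assocC[OF iH[OF idv] sH[OF v] Gm[OF p]] s(4))
        finally show ?thesis .
      qed
      with ex1[OF w GO[OF w], of "\<lambda>p. fmor G p \<cdot>\<^bsub>C\<^esub> g"] gp ti sH[OF w] tH[OF w]
      show ?thesis by blast
    qed
    then have "s = t" using s(3) by (auto intro: extensionalityI simp: t_def)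
    then show "h = (F, t, G)" using s(1) by simp
  qed
qed

end

theory Submission
  imports Defs
begin

text \<open>
  Representations of \<open>Q\<close> are functors on its path category. Everything rests on the representations
  \<open>F\<close> that are free on a family of objects \<open>X\<^sub>k\<close> placed at vertices \<open>v\<^sub>k\<close>, that is, on the direct sums of
  the \<open>f\<^sub>v(X)\<close>: maps \<open>F \<rightarrow> G\<close> are the same as families of maps \<open>X\<^sub>k \<rightarrow> G(v\<^sub>k)\<close>, and \<open>F(w)\<close> is the direct
  sum of the \<open>X\<^sub>k\<close> over all \<open>k\<close> and all paths from \<open>v\<^sub>k\<close> to \<open>w\<close>. Sorting these paths by their last arrow
  gives
    \<open>F(w) = (\<Oplus> F(src a) over the arrows a into w) \<oplus> (\<Oplus> X\<^sub>k over all k with v\<^sub>k = w)\<close>,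
  so the canonical map at \<open>w\<close> is a split monomorphism whose cokernel is the sum of the generators at
  \<open>w\<close>. Conversely, a representation that decomposes in this way at every vertex is free: as \<open>Q\<close> is
  left-rooted, the formula over paths follows by well-founded induction over the vertices. Now if the
  canonical map is monic with projective cokernel, then the cokernel splits off. Hence, for a class
  \<open>\<Y>\<close> of projective objects, \<open>\<Phi>(\<Y>)\<close> consists of the representations that are free on a family with
  one object from \<open>\<Y>\<close> at each vertex (\<open>Phi_free\<close>, \<open>free_Phi\<close>).

  (i) is then a matter of regrouping families (\<open>Phi_Sums\<close>, \<open>Sums_Phi\<close>); a zero object in \<open>\<X>\<close> allows to
  view \<open>f\<^sub>v(X)\<close> as generated by one object of \<open>\<X>\<close> at each vertex (\<open>f_star_Phi\<close>).

  (ii) A family of direct summands generates a direct summand, and the canonical map of a retract is a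
  retract of the canonical map (\<open>Phi_Add\<close>). A free representation with one object of \<open>\<X>\<close> at each vertex
  is in \<open>\<Phi>(\<X>)\<close> whichever objects are chosen, and a large sum of such representations has a
  given \<open>f\<^sub>v(X)\<close> as a direct summand (\<open>Add_Phi\<close>).

  (iii) Epimorphisms of representations are the pointwise ones. So free representations on projective
  objects are projective, and a projective \<open>F\<close> is a retract of the free representation on projective
  objects \<open>X\<^sub>w\<close> that map epimorphically to the \<open>F(w)\<close> (\<open>Phi_Proj\<close>).

  (iv) The filtered colimits of finitely generated projective objects are characterised by an
  equational criterion for flatness (\<open>Filt_colims_iff\<close>). For a filtered colimit of finitely generated
  projective representations, the canonical maps are monic with flat cokernels, since maps from finitely
  generated projective objects lift to a stage of the system and relations between them hold at a later
  stage (\<open>Filt_colims_Phi\<close>). For the converse, \<open>F\<close> is written as the colimit of all representations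
  over \<open>F\<close> that are free on finitely many finitely generated projective objects. That this system is
  filtered means that a relation which holds in \<open>F\<close> already holds after a map to another such
  representation over \<open>F\<close> (\<open>kill\<close>). The image of a relation at \<open>w\<close> in the flat cokernel can be removed by
  the equational criterion. What remains lives in the direct sum of the \<open>F(src a)\<close>, because the canonical
  map is monic, and is removed by induction at finitely many of the sources.
\<close>

section \<open>Small sets\<close>

locale universe =
  fixes U :: "'u itself"
  assumes univ: "regular_universe U"
begin

lemma stable_univ: "stable |UNIV :: 'u set|"
proof -
  have inf: "infinite (UNIV :: 'u set)"
  proof
    assume "finite (UNIV :: 'u set)"
    then have "|UNIV :: 'u set| <o natLeq" by (simp add: finite_iff_ordLess_natLeq)
    with univ show False
      unfolding regular_universe_def using not_ordLess_ordLeq ordLess_imp_ordLeq by blast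
  qed
  show ?thesis
    by (rule regularCard_stable[OF card_of_Card_order])
      (use univ inf in \<open>simp_all add: regular_universe_def Field_card_of\<close>)
qed

lemma small_Sigma:
  assumes "small U I" and "\<And>i. i \<in> I \<Longrightarrow> small U (K i)"
  shows "small U (Sigma I K)"
  using assms stable_elim[OF stable_univ] by (auto simp: small_def)

lemma small_Times: "small U I \<Longrightarrow> small U K \<Longrightarrow> small U (I \<times> K)"
  by (rule small_Sigma)

lemma small_inj:
  assumes "small U T" and "inj_on f S" and "f ` S \<subseteq> T"
  shows "small U S"
  using assms card_of_ordLeq[of S T] ordLeq_ordLess_trans unfolding small_def by blast

lemma small_subset: "small U T \<Longrightarrow> S \<subseteq> T \<Longrightarrow> small U S"
  by (rule small_inj[where f = id]) auto

lemma small_image: "small U S \<Longrightarrow> small U (f ` S)"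
  unfolding small_def by (rule ordLeq_ordLess_trans[OF card_of_image])

lemma small_UN:
  assumes "small U I" and "\<And>i. i \<in> I \<Longrightarrow> small U (K i)"
  shows "small U (\<Union>i\<in>I. K i)"
  using assms stable_UNION[OF stable_univ] by (auto simp: small_def)

lemma small_countable_nat: "small U (UNIV :: nat set)"
  using univ ordIso_ordLess_trans[OF card_of_nat] by (auto simp: small_def regular_universe_def)

lemma small_finite: "finite S \<Longrightarrow> small U S"
proof -
  assume "finite S"
  then obtain f :: "'a \<Rightarrow> nat" where "inj_on f S" using finite_imp_inj_to_nat_seg by blast
  then show ?thesis by (rule small_inj[OF small_countable_nat]) auto
qed

lemma small_lists:
  assumes "small U S"
  shows "small U (lists S)"
proof -
  have "small U {xs \<in> lists S. length xs = n}" for n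
  proof (induction n)
    case 0
    then show ?case by (intro small_finite) (auto intro: finite_subset[of _ "{[]}"])
  next
    case (Suc n)
    have "{xs \<in> lists S. length xs = Suc n} \<subseteq> (\<lambda>(x, xs). x # xs) ` (S \<times> {xs \<in> lists S. length xs = n})"
      by (auto simp: length_Suc_conv)
    then show ?case by (rule small_subset[OF small_image[OF small_Times[OF assms Suc]]])
  qed
  then have "small U (\<Union>n. {xs \<in> lists S. length xs = n})"
    by (intro small_UN small_countable_nat)
  then show ?thesis by (rule small_subset) auto
qed

lemma small_Fpow:
  assumes "small U S"
  shows "small U (Fpow S)"
proof -
  have "Fpow S \<subseteq> set ` lists S"
  proof
    fix T assume "T \<in> Fpow S"
    then have T: "finite T" "T \<subseteq> S" by (simp_all add: Fpow_def)
    from T(1) obtain xs where "set xs = T" using finite_list by blast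
    with T(2) have "xs \<in> lists S" "T = set xs" by auto
    then show "T \<in> set ` lists S" by blast
  qed
  then show ?thesis by (rule small_subset[OF small_image[OF small_lists[OF assms]]])
qed

lemma small_embeds:
  assumes "small U S"
  obtains f :: "_ \<Rightarrow> 'u" where "inj_on f S"
  using assms card_of_ordLeq[of S "UNIV :: 'u set"] ordLess_imp_ordLeq unfolding small_def by blast

end

section \<open>Morphisms, coproducts and retracts\<close>

context category
begin

lemma HomD: "f \<in> Hom C X Y \<Longrightarrow> f \<in> Mor C \<and> Dom C f = X \<and> Cod C f = Y"
  by (simp add: Hom_def)

lemma Hom_Ob: "f \<in> Hom C X Y \<Longrightarrow> X \<in> Ob C" "f \<in> Hom C X Y \<Longrightarrow> Y \<in> Ob C"
  by (auto simp: Hom_def Dom_Ob Cod_Ob)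

lemma ide_arr:
  assumes "X \<in> Ob C"
  shows "Ide C X \<in> Mor C" "Dom C (Ide C X) = X" "Cod C (Ide C X) = X"
  using Ide_Hom[OF assms] by (auto simp: Hom_def)

lemma comp_ide:
  "f \<in> Mor C \<Longrightarrow> Dom C f = X \<Longrightarrow> f \<cdot> Ide C X = f"
  "f \<in> Mor C \<Longrightarrow> Cod C f = X \<Longrightarrow> Ide C X \<cdot> f = f"
  using Comp_Ide[of f] Ide_Comp[of f] by (auto simp: Hom_def)

text \<open>For rewriting inside composites, which are kept nested to the right.\<close>

lemma comp_reduce:
  assumes "g \<cdot> f = k" and "f \<in> Hom C X Y" and "g \<in> Hom C Y Z" and "x \<in> Hom C W X"
  shows "g \<cdot> (f \<cdot> x) = k \<cdot> x"
  using assms Comp_assoc by metis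

lemma coprodD:
  assumes "is_coproduct C I X S inc"
  shows "S \<in> Ob C" "i \<in> I \<Longrightarrow> X i \<in> Ob C" "i \<in> I \<Longrightarrow> inc i \<in> Hom C (X i) S"
  using assms by (auto simp: is_coproduct_def)

lemma coprod_ex:
  assumes "is_coproduct C I X S inc" and "T \<in> Ob C" and "\<And>i. i \<in> I \<Longrightarrow> f i \<in> Hom C (X i) T"
  obtains h where "h \<in> Hom C S T" and "\<And>i. i \<in> I \<Longrightarrow> h \<cdot> inc i = f i"
proof -
  have "\<exists>!h. h \<in> Hom C S T \<and> (\<forall>i\<in>I. h \<cdot> inc i = f i)"
    using assms unfolding is_coproduct_def by simp
  then show ?thesis using that by auto
qed

lemma coprod_exB:
  assumes "is_coproduct C I X S inc" and "T \<in> Ob C" and "\<forall>i\<in>I. f i \<in> Hom C (X i) T"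
  shows "\<exists>h \<in> Hom C S T. \<forall>i\<in>I. h \<cdot> inc i = f i"
proof (rule coprod_ex[OF assms(1,2)])
  show "f i \<in> Hom C (X i) T" if "i \<in> I" for i using assms(3) that by simp
qed auto

lemma coprod_eq:
  assumes c: "is_coproduct C I X S inc" and h: "h \<in> Hom C S T" "h' \<in> Hom C S T"
    and e: "\<And>i. i \<in> I \<Longrightarrow> h \<cdot> inc i = h' \<cdot> inc i"
  shows "h = h'"
proof -
  have "\<exists>!k. k \<in> Hom C S T \<and> (\<forall>i\<in>I. k \<cdot> inc i = h' \<cdot> inc i)"
  proof -
    have "\<forall>i\<in>I. h' \<cdot> inc i \<in> Hom C (X i) T" using coprodD(3)[OF c] Comp_Hom[OF _ h(2)] by blast
    with c Hom_Ob(2)[OF h(1)] show ?thesis unfolding is_coproduct_def by simp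
  qed
  with h e show ?thesis by blast
qed

lemma coprodI:
  assumes "S \<in> Ob C" and "\<And>i. i \<in> I \<Longrightarrow> inc i \<in> Hom C (X i) S"
    and "\<And>T f. T \<in> Ob C \<Longrightarrow> (\<And>i. i \<in> I \<Longrightarrow> f i \<in> Hom C (X i) T) \<Longrightarrow>
      \<exists>h. h \<in> Hom C S T \<and> (\<forall>i\<in>I. h \<cdot> inc i = f i)"
    and "\<And>T h h'. h \<in> Hom C S T \<Longrightarrow> h' \<in> Hom C S T \<Longrightarrow> (\<And>i. i \<in> I \<Longrightarrow> h \<cdot> inc i = h' \<cdot> inc i) \<Longrightarrow> h = h'"
  shows "is_coproduct C I X S inc"
  unfolding is_coproduct_def
proof (intro conjI ballI allI impI)
  fix T f assume "T \<in> Ob C" "\<forall>i\<in>I. f i \<in> Hom C (X i) T"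
  then obtain h where "h \<in> Hom C S T \<and> (\<forall>i\<in>I. h \<cdot> inc i = f i)" using assms(3)[of T f] by blast
  then show "\<exists>!h. h \<in> Hom C S T \<and> (\<forall>i\<in>I. h \<cdot> inc i = f i)"
    by (intro ex1I[of _ h]) (auto intro: assms(4))
qed (use assms(1,2) Hom_Ob in blast)+

lemma coprod_Sigma:
  assumes T: "is_coproduct C I S T j"
    and S: "\<And>a. a \<in> I \<Longrightarrow> is_coproduct C (K a) (X a) (S a) (inc a)"
  shows "is_coproduct C (Sigma I K) (\<lambda>(a, i). X a i) T (\<lambda>(a, i). j a \<cdot> inc a i)"
proof (rule coprodI, goal_cases)
  case 1 then show ?case using coprodD[OF T] by blast
next
  case (2 k) then show ?case using coprodD(3)[OF T] coprodD(3)[OF S] by (auto intro: Comp_Hom)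
next
  case (3 M f)
  have "\<exists>h. h \<in> Hom C (S a) M \<and> (\<forall>i\<in>K a. h \<cdot> inc a i = f (a, i))" if a: "a \<in> I" for a
    by (rule coprod_ex[OF S[OF a] 3(1), of "\<lambda>i. f (a, i)"]) (use 3(2) a in auto)
  then obtain h where h: "\<And>a. a \<in> I \<Longrightarrow> h a \<in> Hom C (S a) M"
    "\<And>a i. a \<in> I \<Longrightarrow> i \<in> K a \<Longrightarrow> h a \<cdot> inc a i = f (a, i)" by metis
  obtain g where g: "g \<in> Hom C T M" "\<And>a. a \<in> I \<Longrightarrow> g \<cdot> j a = h a"
    using coprod_ex[OF T 3(1) h(1)] by blast
  have "g \<cdot> (j a \<cdot> inc a i) = f (a, i)" if "a \<in> I" "i \<in> K a" for a i
    using comp_reduce[OF g(2) coprodD(3)[OF T] g(1) coprodD(3)[OF S]] h(2) that by simp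
  with g(1) show ?case by (intro exI[of _ g]) auto
next
  case (4 M h h')
  note j = coprodD(3)[OF T] and i = coprodD(3)[OF S]
  show ?case
  proof (rule coprod_eq[OF T 4(1,2)])
    fix a assume a: "a \<in> I"
    show "h \<cdot> j a = h' \<cdot> j a"
      by (rule coprod_eq[OF S[OF a] Comp_Hom[OF j[OF a] 4(1)] Comp_Hom[OF j[OF a] 4(2)]])
        (use 4(3)[of "(a, _)"] a in
          \<open>auto simp: Comp_assoc[OF i[OF a] j[OF a] 4(1)] Comp_assoc[OF i[OF a] j[OF a] 4(2)]\<close>)
  qed
qed

text \<open>
  A converse to associativity: if the sums over the parts of a partition map to the total sum in the
  evident way, then the total sum is their sum.
\<close>

lemma coprod_group:
  assumes T: "is_coproduct C (Sigma I K) (\<lambda>(a, i). X a i) T e"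
    and S: "\<And>a. a \<in> I \<Longrightarrow> is_coproduct C (K a) (X a) (S a) (inc a)"
    and j: "\<And>a. a \<in> I \<Longrightarrow> j a \<in> Hom C (S a) T"
    and ji: "\<And>a i. a \<in> I \<Longrightarrow> i \<in> K a \<Longrightarrow> j a \<cdot> inc a i = e (a, i)"
  shows "is_coproduct C I S T j"
proof (rule coprodI, goal_cases)
  case 1 then show ?case using coprodD[OF T] by blast
next
  case (2 k) then show ?case by (rule j)
next
  case (3 M f)
  note i = coprodD(3)[OF S]
  have f: "\<And>k. k \<in> Sigma I K \<Longrightarrow> (\<lambda>(a, i). f a \<cdot> inc a i) k \<in> Hom C ((\<lambda>(a, i). X a i) k) M"
    using i 3(2) by (auto intro: Comp_Hom)
  obtain h where h: "h \<in> Hom C T M" "\<And>k. k \<in> Sigma I K \<Longrightarrow> h \<cdot> e k = (\<lambda>(a, i). f a \<cdot> inc a i) k"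
    using coprod_exB[OF T 3(1), of "\<lambda>(a, i). f a \<cdot> inc a i"] f by blast
  have "h \<cdot> j a = f a" if a: "a \<in> I" for a
  proof (rule coprod_eq[OF S[OF a] Comp_Hom[OF j[OF a] h(1)] 3(2)[OF a]])
    fix k assume k: "k \<in> K a"
    show "(h \<cdot> j a) \<cdot> inc a k = f a \<cdot> inc a k"
      using h(2)[of "(a, k)"] a k ji[OF a k] Comp_assoc[OF i[OF a k] j[OF a] h(1)] by simp
  qed
  with h show ?case by blast
next
  case (4 M h h')
  note i = coprodD(3)[OF S]
  show ?case
  proof (rule coprod_eq[OF T 4(1,2)], clarify)
    fix a k assume a: "a \<in> I" and k: "k \<in> K a"
    show "h \<cdot> e (a, k) = h' \<cdot> e (a, k)"
      using 4(3)[OF a] ji[OF a k] Comp_assoc[OF i[OF a k] j[OF a] 4(1)]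
        Comp_assoc[OF i[OF a k] j[OF a] 4(2)] by simp
  qed
qed

lemma coprod_reindex:
  assumes S: "is_coproduct C I X S inc" and b: "bij_betw b I' I"
    and eq: "\<And>i. i \<in> I' \<Longrightarrow> X' i = X (b i)" "\<And>i. i \<in> I' \<Longrightarrow> inc' i = inc (b i)"
  shows "is_coproduct C I' X' S inc'"
proof (rule coprodI, goal_cases)
  case 1 then show ?case using coprodD[OF S] by blast
next
  case (2 k) then show ?case using coprodD(3)[OF S] bij_betwE[OF b] eq by auto
next
  case (3 M f)
  let ?g = "\<lambda>i. f (inv_into I' b i)"
  have m: "inv_into I' b i \<in> I' \<and> b (inv_into I' b i) = i" if "i \<in> I" for i
    using b that by (metis bij_betw_def inv_into_into f_inv_into_f)
  obtain h where h: "h \<in> Hom C S M" "\<And>i. i \<in> I \<Longrightarrow> h \<cdot> inc i = ?g i"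
    by (rule coprod_ex[OF S 3(1), of ?g]) (use 3(2) m eq(1) in force)+
  have "h \<cdot> inc' i = f i" if "i \<in> I'" for i
    using h(2)[of "b i"] that b eq(2) bij_betw_inv_into_left[OF b that] bij_betwE[OF b] by auto
  with h show ?case by blast
next
  case (4 M h h')
  show ?case
    by (rule coprod_eq[OF S 4(1,2)]) (use 4(3) eq(2) b in \<open>metis bij_betw_def imageE\<close>)
qed

lemma coprod_reindex_image:
  assumes S: "is_coproduct C I' X' S inc'" and b: "bij_betw b I' I"
    and eq: "\<And>i. i \<in> I' \<Longrightarrow> X' i = X (b i)" "\<And>i. i \<in> I' \<Longrightarrow> inc' i = inc (b i)"
  shows "is_coproduct C I X S inc"
proof (rule coprod_reindex[OF S bij_betw_inv_into[OF b]])
  fix i assume "i \<in> I"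
  then have "inv_into I' b i \<in> I'" "b (inv_into I' b i) = i"
    using b bij_betw_inv_into_right[OF b] bij_betwE[OF bij_betw_inv_into[OF b]] by auto
  then show "X i = X' (inv_into I' b i)" "inc i = inc' (inv_into I' b i)" using eq by auto
qed

lemma coprod_cong:
  assumes "is_coproduct C I X S inc" and "\<And>i. i \<in> I \<Longrightarrow> X' i = X i" and "\<And>i. i \<in> I \<Longrightarrow> inc' i = inc i"
  shows "is_coproduct C I X' S inc'"
  using coprod_reindex[OF assms(1) bij_betw_id] assms(2,3) by auto

definition inverse_pair where
  "inverse_pair X Y f g \<longleftrightarrow> f \<in> Hom C X Y \<and> g \<in> Hom C Y X \<and> g \<cdot> f = Ide C X \<and> f \<cdot> g = Ide C Y"

lemma inverse_pairD:
  assumes "inverse_pair X Y f g"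
  shows "f \<in> Hom C X Y" "g \<in> Hom C Y X" "x \<in> Hom C W X \<Longrightarrow> g \<cdot> (f \<cdot> x) = x"
    "y \<in> Hom C W Y \<Longrightarrow> f \<cdot> (g \<cdot> y) = y" "x' \<in> Hom C X W \<Longrightarrow> (x' \<cdot> g) \<cdot> f = x'"
    "y' \<in> Hom C Y W \<Longrightarrow> (y' \<cdot> f) \<cdot> g = y'"
  using assms comp_reduce[of g f "Ide C X" X Y X x W] comp_reduce[of f g "Ide C Y" Y X Y y W]
    Comp_assoc[of f X Y g X x' W] Comp_assoc[of g Y X f Y y' W]
  by (auto simp: inverse_pair_def Comp_Ide Ide_Comp)

lemma coprod_iso:
  assumes S: "is_coproduct C I X S inc" and fg: "inverse_pair S S' f g"
  shows "is_coproduct C I X S' (\<lambda>i. f \<cdot> inc i)"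
proof (rule coprodI, goal_cases)
  case 1 then show ?case using Hom_Ob inverse_pairD[OF fg] by blast
next
  case (2 k) then show ?case using coprodD(3)[OF S] inverse_pairD[OF fg] by (auto intro: Comp_Hom)
next
  case (3 M f')
  note fgD = inverse_pairD[OF fg] and i = coprodD(3)[OF S]
  obtain h where h: "h \<in> Hom C S M" "\<And>i. i \<in> I \<Longrightarrow> h \<cdot> inc i = f' i"
    using coprod_ex[OF S 3] by blast
  have "(h \<cdot> g) \<cdot> (f \<cdot> inc a) = f' a" if "a \<in> I" for a
    using h i[OF that] that fgD(3)[OF i[OF that]] Comp_assoc[OF Comp_Hom[OF i[OF that] fgD(1)] fgD(2) h(1)] by simp
  with h fgD show ?case by (auto intro!: exI[of _ "h \<cdot> g"] intro: Comp_Hom)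
next
  case (4 M h h')
  note fgD = inverse_pairD[OF fg] and i = coprodD(3)[OF S]
  have "h \<cdot> f = h' \<cdot> f"
  proof (rule coprod_eq[OF S Comp_Hom[OF fgD(1) 4(1)] Comp_Hom[OF fgD(1) 4(2)]])
    fix a assume a: "a \<in> I"
    show "(h \<cdot> f) \<cdot> inc a = (h' \<cdot> f) \<cdot> inc a"
      using 4(3)[OF a] Comp_assoc[OF i[OF a] fgD(1) 4(1)] Comp_assoc[OF i[OF a] fgD(1) 4(2)] by simp
  qed
  then have "(h \<cdot> f) \<cdot> g = (h' \<cdot> f) \<cdot> g" by (rule arg_cong)
  then show ?case by (simp only: fgD(6)[OF 4(1)] fgD(6)[OF 4(2)])
qed

lemma coprod_unique:
  assumes S: "is_coproduct C I X S inc" and S': "is_coproduct C I X S' inc'"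
  obtains f g where "inverse_pair S S' f g" "\<And>i. i \<in> I \<Longrightarrow> f \<cdot> inc i = inc' i"
proof -
  note i = coprodD(3)[OF S] and i' = coprodD(3)[OF S']
  obtain f where f: "f \<in> Hom C S S'" "\<And>a. a \<in> I \<Longrightarrow> f \<cdot> inc a = inc' a"
    using coprod_ex[OF S coprodD(1)[OF S'] i'] by blast
  obtain g where g: "g \<in> Hom C S' S" "\<And>a. a \<in> I \<Longrightarrow> g \<cdot> inc' a = inc a"
    using coprod_ex[OF S' coprodD(1)[OF S] i] by blast
  have "g \<cdot> f = Ide C S"
    by (rule coprod_eq[OF S Comp_Hom[OF f(1) g(1)] Ide_Hom[OF coprodD(1)[OF S]]])
      (simp add: Comp_assoc[OF i f(1) g(1)] Ide_Comp[OF i] f g)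
  moreover have "f \<cdot> g = Ide C S'"
    by (rule coprod_eq[OF S' Comp_Hom[OF g(1) f(1)] Ide_Hom[OF coprodD(1)[OF S']]])
      (simp add: Comp_assoc[OF i' g(1) f(1)] Ide_Comp[OF i'] f g)
  ultimately show ?thesis using that[of f g] f g by (auto simp: inverse_pair_def)
qed

lemma coprod_singleton:
  assumes "X k \<in> Ob C"
  shows "is_coproduct C {k} X (X k) (\<lambda>_. Ide C (X k))"
  by (rule coprodI) (use assms in \<open>auto simp: Ide_Hom Comp_Ide\<close>)

lemma coprod_Plus_split:
  assumes T: "is_coproduct C (I1 <+> I2) (case_sum X1 X2) T (case_sum i1 i2)"
    and S1: "is_coproduct C I1 X1 S1 inc1" and S2: "is_coproduct C I2 X2 S2 inc2"
    and j1: "j1 \<in> Hom C S1 T" "\<And>i. i \<in> I1 \<Longrightarrow> j1 \<cdot> inc1 i = i1 i"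
    and j2: "j2 \<in> Hom C S2 T" "\<And>i. i \<in> I2 \<Longrightarrow> j2 \<cdot> inc2 i = i2 i"
  shows "is_coproduct C UNIV (\<lambda>b. if b then S1 else S2) T (\<lambda>b. if b then j1 else j2)"
proof (rule coprodI, goal_cases)
  case 1 then show ?case by (rule coprodD(1)[OF T])
next
  case (2 b) then show ?case using j1 j2 by simp
next
  case (3 M f)
  have f: "f True \<in> Hom C S1 M" "f False \<in> Hom C S2 M" using 3(2)[of True] 3(2)[of False] by auto
  have "\<forall>i\<in>I1 <+> I2. (case_sum (\<lambda>i. f True \<cdot> inc1 i) (\<lambda>i. f False \<cdot> inc2 i) i) \<in> Hom C (case_sum X1 X2 i) M"
    using Comp_Hom[OF coprodD(3)[OF S1] f(1)] Comp_Hom[OF coprodD(3)[OF S2] f(2)] by auto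
  from coprod_exB[OF T 3(1) this] obtain h where h: "h \<in> Hom C T M"
    "\<And>i. i \<in> I1 \<Longrightarrow> h \<cdot> i1 i = f True \<cdot> inc1 i" "\<And>i. i \<in> I2 \<Longrightarrow> h \<cdot> i2 i = f False \<cdot> inc2 i"
    by force
  have "h \<cdot> j1 = f True"
    by (rule coprod_eq[OF S1 Comp_Hom[OF j1(1) h(1)] f(1)])
      (simp add: Comp_assoc[OF coprodD(3)[OF S1] j1(1) h(1)] j1(2) h(2))
  moreover have "h \<cdot> j2 = f False"
    by (rule coprod_eq[OF S2 Comp_Hom[OF j2(1) h(1)] f(2)])
      (simp add: Comp_assoc[OF coprodD(3)[OF S2] j2(1) h(1)] j2(2) h(3))
  ultimately show ?case using h(1) by (intro exI[of _ h]) auto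
next
  case (4 M h h')
  have e: "h \<cdot> j1 = h' \<cdot> j1" "h \<cdot> j2 = h' \<cdot> j2" using 4(3)[of True] 4(3)[of False] by auto
  show ?case
  proof (rule coprod_eq[OF T 4(1,2)])
    fix i assume "i \<in> I1 <+> I2"
    then show "h \<cdot> case_sum i1 i2 i = h' \<cdot> case_sum i1 i2 i"
    proof
      fix x assume x: "x \<in> I1" "i = Inl x"
      show ?thesis
        using Comp_assoc[OF coprodD(3)[OF S1 x(1)] j1(1) 4(1)] Comp_assoc[OF coprodD(3)[OF S1 x(1)] j1(1) 4(2)]
          j1(2)[OF x(1)] e(1) x(2) by simp
    next
      fix x assume x: "x \<in> I2" "i = Inr x"
      show ?thesis
        using Comp_assoc[OF coprodD(3)[OF S2 x(1)] j2(1) 4(1)] Comp_assoc[OF coprodD(3)[OF S2 x(1)] j2(1) 4(2)]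
          j2(2)[OF x(1)] e(2) x(2) by simp
    qed
  qed
qed

lemma coprod_Plus_join:
  assumes T: "is_coproduct C UNIV (\<lambda>b. if b then S1 else S2) T (\<lambda>b. if b then j1 else j2)"
    and S1: "is_coproduct C I1 X1 S1 inc1" and S2: "is_coproduct C I2 X2 S2 inc2"
  shows "is_coproduct C (I1 <+> I2) (case_sum X1 X2) T (case_sum (\<lambda>i. j1 \<cdot> inc1 i) (\<lambda>i. j2 \<cdot> inc2 i))"
proof (rule coprodI, goal_cases)
  case 1 then show ?case by (rule coprodD(1)[OF T])
next
  have j: "j1 \<in> Hom C S1 T" "j2 \<in> Hom C S2 T" using coprodD(3)[OF T, of True] coprodD(3)[OF T, of False] by auto
  note i1 = coprodD(3)[OF S1] and i2 = coprodD(3)[OF S2]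
  {
    case (2 i) then show ?case using Comp_Hom[OF i1 j(1)] Comp_Hom[OF i2 j(2)] by auto
  next
    case (3 M f)
    obtain f1 where f1: "f1 \<in> Hom C S1 M" "\<forall>i\<in>I1. f1 \<cdot> inc1 i = f (Inl i)"
      using coprod_exB[OF S1 3(1), of "\<lambda>i. f (Inl i)"] 3(2)[of "Inl _"] by auto
    obtain f2 where f2: "f2 \<in> Hom C S2 M" "\<forall>i\<in>I2. f2 \<cdot> inc2 i = f (Inr i)"
      using coprod_exB[OF S2 3(1), of "\<lambda>i. f (Inr i)"] 3(2)[of "Inr _"] by auto
    have "\<forall>b\<in>UNIV. (if b then f1 else f2) \<in> Hom C (if b then S1 else S2) M" using f1 f2 by simp
    from coprod_exB[OF T 3(1) this] obtain h where hM: "h \<in> Hom C T M" and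
      hb: "\<forall>b. h \<cdot> (if b then j1 else j2) = (if b then f1 else f2)" by auto
    have h: "h \<cdot> j1 = f1" "h \<cdot> j2 = f2" using hb[rule_format, of True] hb[rule_format, of False] by auto
    have "h \<cdot> (j1 \<cdot> inc1 i) = f (Inl i)" if "i \<in> I1" for i
      using Comp_assoc[OF i1[OF that] j(1) hM] h f1(2) that by simp
    moreover have "h \<cdot> (j2 \<cdot> inc2 i) = f (Inr i)" if "i \<in> I2" for i
      using Comp_assoc[OF i2[OF that] j(2) hM] h f2(2) that by simp
    ultimately show ?case using hM by (intro exI[of _ h]) auto
  next
    case (4 M h h')
    have "h \<cdot> j1 = h' \<cdot> j1"
    proof (rule coprod_eq[OF S1 Comp_Hom[OF j(1) 4(1)] Comp_Hom[OF j(1) 4(2)]])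
      fix i assume i: "i \<in> I1"
      show "(h \<cdot> j1) \<cdot> inc1 i = (h' \<cdot> j1) \<cdot> inc1 i"
        using 4(3)[OF InlI[OF i]] Comp_assoc[OF i1[OF i] j(1) 4(1)] Comp_assoc[OF i1[OF i] j(1) 4(2)] by simp
    qed
    moreover have "h \<cdot> j2 = h' \<cdot> j2"
    proof (rule coprod_eq[OF S2 Comp_Hom[OF j(2) 4(1)] Comp_Hom[OF j(2) 4(2)]])
      fix i assume i: "i \<in> I2"
      show "(h \<cdot> j2) \<cdot> inc2 i = (h' \<cdot> j2) \<cdot> inc2 i"
        using 4(3)[OF InrI[OF i]] Comp_assoc[OF i2[OF i] j(2) 4(1)] Comp_assoc[OF i2[OF i] j(2) 4(2)] by simp
    qed
    ultimately show ?case by (intro coprod_eq[OF T 4(1,2)]) auto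
  }
qed

definition retract where
  "retract X Y \<longleftrightarrow> (\<exists>s \<in> Hom C X Y. \<exists>r \<in> Hom C Y X. r \<cdot> s = Ide C X)"

lemma retractE:
  assumes "retract X Y"
  obtains s r where "s \<in> Hom C X Y" "r \<in> Hom C Y X" "r \<cdot> s = Ide C X"
    "\<And>W x. x \<in> Hom C W X \<Longrightarrow> r \<cdot> (s \<cdot> x) = x"
proof -
  obtain s r where s: "s \<in> Hom C X Y" "r \<in> Hom C Y X" "r \<cdot> s = Ide C X"
    using assms unfolding retract_def by blast
  have "r \<cdot> (s \<cdot> x) = x" if x: "x \<in> Hom C W X" for W x
    using comp_reduce[OF s(3,1,2) x] Ide_Comp[OF x] by simp
  with s that show ?thesis by blast
qed

lemma retract_trans:
  assumes "retract X Y" "retract Y Z"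
  shows "retract X Z"
proof -
  obtain s r where s: "s \<in> Hom C X Y" "r \<in> Hom C Y X" "r \<cdot> s = Ide C X" by (rule retractE[OF assms(1)])
  obtain s' r' where s': "s' \<in> Hom C Y Z" "r' \<in> Hom C Z Y" "r' \<cdot> s' = Ide C Y" by (rule retractE[OF assms(2)])
  have "(r \<cdot> r') \<cdot> (s' \<cdot> s) = r \<cdot> (r' \<cdot> (s' \<cdot> s))"
    using Comp_assoc[OF Comp_Hom[OF s(1) s'(1)] s'(2) s(2)] .
  also have "\<dots> = Ide C X" using comp_reduce[OF s'(3,1,2) s(1)] s Ide_Comp[OF s(1)] by simp
  finally show ?thesis using s s' unfolding retract_def by (meson Comp_Hom)
qed

lemma retract_projective:
  assumes "retract X Y" "projective C Y"
  shows "projective C X"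
  unfolding projective_def
proof (intro conjI allI impI ballI)
  obtain s r where s: "s \<in> Hom C X Y" "r \<in> Hom C Y X" "r \<cdot> s = Ide C X" by (rule retractE[OF assms(1)])
  show "X \<in> Ob C" using s Hom_Ob by blast
  fix e f assume e: "epic C e" and f: "f \<in> Hom C X (Cod C e)"
  then have e': "e \<in> Hom C (Dom C e) (Cod C e)" by (simp add: epic_def Hom_def)
  obtain g where g: "g \<in> Hom C Y (Dom C e)" "e \<cdot> g = f \<cdot> r"
    using assms(2) e Comp_Hom[OF s(2) f] unfolding projective_def by blast
  have "e \<cdot> (g \<cdot> s) = f"
    using g s f e' Comp_assoc[OF s(1) g(1) e'] Comp_assoc[OF s(1,2) f] by (simp add: Comp_Ide)
  then show "\<exists>g\<in>Hom C X (Dom C e). e \<cdot> g = f" using Comp_Hom[OF s(1) g(1)] by blast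
qed

lemma coprod_projective:
  assumes S: "is_coproduct C I X S inc" and X: "\<And>i. i \<in> I \<Longrightarrow> projective C (X i)"
  shows "projective C S"
  unfolding projective_def
proof (intro conjI allI impI ballI)
  note i = coprodD(3)[OF S]
  show "S \<in> Ob C" by (rule coprodD[OF S])
  fix e f assume e: "epic C e" and f: "f \<in> Hom C S (Cod C e)"
  then have e': "e \<in> Hom C (Dom C e) (Cod C e)" by (simp add: epic_def Hom_def)
  have "\<exists>g. g \<in> Hom C (X k) (Dom C e) \<and> e \<cdot> g = f \<cdot> inc k" if k: "k \<in> I" for k
    using X[OF k] e Comp_Hom[OF i[OF k] f] unfolding projective_def by blast
  then obtain g where g: "\<And>k. k \<in> I \<Longrightarrow> g k \<in> Hom C (X k) (Dom C e)" "\<And>k. k \<in> I \<Longrightarrow> e \<cdot> g k = f \<cdot> inc k"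
    by metis
  obtain h where h: "h \<in> Hom C S (Dom C e)" "\<And>k. k \<in> I \<Longrightarrow> h \<cdot> inc k = g k"
    using coprod_ex[OF S Hom_Ob(1)[OF e'] g(1)] by blast
  have "e \<cdot> h = f"
    by (rule coprod_eq[OF S Comp_Hom[OF h(1) e'] f]) (use Comp_assoc[OF i h(1) e'] h g in auto)
  then show "\<exists>g\<in>Hom C S (Dom C e). e \<cdot> g = f" using h by blast
qed

lemma epic_Hom: "epic C e \<Longrightarrow> e \<in> Hom C (Dom C e) (Cod C e)"
  by (simp add: epic_def Hom_def)

lemma projectiveD:
  assumes "projective C P" "epic C e" "e \<in> Hom C X Y" "f \<in> Hom C P Y"
  obtains g where "g \<in> Hom C P X" "e \<cdot> g = f"
  using assms unfolding projective_def Hom_def by auto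

lemma projective_retract:
  assumes P: "projective C P" and e: "epic C e" "e \<in> Hom C X P"
  shows "retract P X"
  by (rule projectiveD[OF P e Ide_Hom]) (use P e in \<open>auto simp: projective_def retract_def\<close>)

end

section \<open>Small colimits and finitely generated objects\<close>

lemma functorD:
  assumes "is_functor J C D"
  shows "x \<in> Ob J \<Longrightarrow> fob D x \<in> Ob C"
    and "u \<in> Hom J x y \<Longrightarrow> fmor D u \<in> Hom C (fob D x) (fob D y)"
    and "x \<in> Ob J \<Longrightarrow> fmor D (Ide J x) = Ide C (fob D x)"
    and "u \<in> Hom J x y \<Longrightarrow> v \<in> Hom J y z \<Longrightarrow> fmor D (v \<cdot>\<^bsub>J\<^esub> u) = fmor D v \<cdot>\<^bsub>C\<^esub> fmor D u"
  using assms unfolding is_functor_def by blast+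

lemma coconeD:
  assumes "is_cocone C J D L l"
  shows "L \<in> Ob C" "j \<in> Ob J \<Longrightarrow> l j \<in> Hom C (fob D j) L"
    "u \<in> Hom J i j \<Longrightarrow> l j \<cdot>\<^bsub>C\<^esub> fmor D u = l i"
  using assms unfolding is_cocone_def by blast+

lemma colim_cocone: "is_colimit C J D L l \<Longrightarrow> is_cocone C J D L l"
  unfolding is_colimit_def by blast

lemma colim_ex1:
  assumes "is_colimit C J D L l" and "is_cocone C J D M m"
  shows "\<exists>!h. h \<in> Hom C L M \<and> (\<forall>j\<in>Ob J. h \<cdot>\<^bsub>C\<^esub> l j = m j)"
  using assms unfolding is_colimit_def by blast

context category
begin

lemma cocone_comp:
  assumes J: "category J" and D: "is_functor J C D" and l: "is_cocone C J D L l" and h: "h \<in> Hom C L M"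
  shows "is_cocone C J D M (\<lambda>j. h \<cdot> l j)"
  unfolding is_cocone_def
proof (intro conjI ballI allI)
  show "M \<in> Ob C" using Hom_Ob[OF h] by blast
  show "h \<cdot> l j \<in> Hom C (fob D j) M" if "j \<in> Ob J" for j
    using Comp_Hom[OF coconeD(2)[OF l that] h] .
  fix i j u assume u: "u \<in> Hom J i j"
  then show "(h \<cdot> l j) \<cdot> fmor D u = h \<cdot> l i"
    using Comp_assoc[OF functorD(2)[OF D u] coconeD(2)[OF l category.Hom_Ob(2)[OF J u]] h]
      coconeD(3)[OF l u] by simp
qed

lemma colim_eq:
  assumes J: "category J" and D: "is_functor J C D" and L: "is_colimit C J D L l"
    and h: "h \<in> Hom C L M" "h' \<in> Hom C L M"
    and e: "\<And>j. j \<in> Ob J \<Longrightarrow> h \<cdot> l j = h' \<cdot> l j"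
  shows "h = h'"
  using colim_ex1[OF L cocone_comp[OF J D colim_cocone[OF L] h(2)]] h e by blast

lemma colim_iso:
  assumes J: "category J" and D: "is_functor J C D" and L: "is_colimit C J D L l" and fg: "inverse_pair L M f g"
    and m: "\<And>j. j \<in> Ob J \<Longrightarrow> f \<cdot> l j = m j"
  shows "is_colimit C J D M m"
  unfolding is_colimit_def
proof (intro conjI allI impI)
  note c = coconeD[OF colim_cocone[OF L]] and i = inverse_pairD[OF fg]
  have "is_cocone C J D M (\<lambda>j. f \<cdot> l j)" by (rule cocone_comp[OF J D colim_cocone[OF L] i(1)])
  then show "is_cocone C J D M m" unfolding is_cocone_def using m category.Hom_Ob[OF J] by simp
  fix N n assume n: "is_cocone C J D N n"
  obtain h where h: "h \<in> Hom C L N" "\<And>j. j \<in> Ob J \<Longrightarrow> h \<cdot> l j = n j" using colim_ex1[OF L n] by auto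
  show "\<exists>!h. h \<in> Hom C M N \<and> (\<forall>j\<in>Ob J. h \<cdot> m j = n j)"
  proof (rule ex1I[of _ "h \<cdot> g"], intro conjI ballI)
    show "h \<cdot> g \<in> Hom C M N" by (rule Comp_Hom[OF i(2) h(1)])
    show "(h \<cdot> g) \<cdot> m j = n j" if j: "j \<in> Ob J" for j
      using h(2)[OF j] i(3)[OF c(2)[OF j]] Comp_assoc[OF Comp_Hom[OF c(2)[OF j] i(1)] i(2) h(1)] m[OF j] by simp
    fix k assume k: "k \<in> Hom C M N \<and> (\<forall>j\<in>Ob J. k \<cdot> m j = n j)"
    then have kM: "k \<in> Hom C M N" by blast
    have "k \<cdot> f = h"
    proof (rule colim_eq[OF J D L Comp_Hom[OF i(1) kM] h(1)])
      fix j assume j: "j \<in> Ob J"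
      show "(k \<cdot> f) \<cdot> l j = h \<cdot> l j"
        using Comp_assoc[OF c(2)[OF j] i(1) kM] m[OF j] k h(2)[OF j] j by simp
    qed
    then show "k = h \<cdot> g" using i(6)[OF kM] by simp
  qed
qed

lemma colim_unique:
  assumes J: "category J" and D: "is_functor J C D" and L: "is_colimit C J D L l" and M: "is_colimit C J D M m"
  obtains f g where "inverse_pair L M f g" "\<And>j. j \<in> Ob J \<Longrightarrow> f \<cdot> l j = m j"
proof -
  note c = coconeD[OF colim_cocone[OF L]] and d = coconeD[OF colim_cocone[OF M]]
  obtain f where f: "f \<in> Hom C L M" "\<And>j. j \<in> Ob J \<Longrightarrow> f \<cdot> l j = m j" using colim_ex1[OF L colim_cocone[OF M]] by auto
  obtain g where g: "g \<in> Hom C M L" "\<And>j. j \<in> Ob J \<Longrightarrow> g \<cdot> m j = l j" using colim_ex1[OF M colim_cocone[OF L]] by auto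
  have "g \<cdot> f = Ide C L"
    by (rule colim_eq[OF J D L Comp_Hom[OF f(1) g(1)] Ide_Hom[OF c(1)]])
      (simp add: Comp_assoc[OF c(2) f(1) g(1)] Ide_Comp[OF c(2)] f g)
  moreover have "f \<cdot> g = Ide C M"
    by (rule colim_eq[OF J D M Comp_Hom[OF g(1) f(1)] Ide_Hom[OF d(1)]])
      (simp add: Comp_assoc[OF d(2) g(1) f(1)] Ide_Comp[OF d(2)] f g)
  ultimately show ?thesis using that[of f g] f g by (simp add: inverse_pair_def)
qed

end

text \<open>
  Cocompleteness and finite generation are defined by index categories whose objects and arrows are
  elements of \<open>'u\<close>. Relabelling extends their consequences to all small index categories.
\<close>

locale relabelling = category J for J :: "('a, 'b) cat" (structure) +
  fixes a :: "'a \<Rightarrow> 'u" and b :: "'b \<Rightarrow> 'u"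
  assumes inj_a: "inj_on a (Ob J)" and inj_b: "inj_on b (Mor J)"
begin

definition "a' = inv_into (Ob J) a"
definition "b' = inv_into (Mor J) b"

lemma a'a [simp]: "x \<in> Ob J \<Longrightarrow> a' (a x) = x" by (simp add: a'_def inj_a)
lemma b'b [simp]: "x \<in> Mor J \<Longrightarrow> b' (b x) = x" by (simp add: b'_def inj_b)

definition J' :: "('u, 'u) cat" where
  "J' = \<lparr> Ob = a ` Ob J, Mor = b ` Mor J, Dom = (\<lambda>m. a (Dom J (b' m))), Cod = (\<lambda>m. a (Cod J (b' m))),
     Ide = (\<lambda>x. b (Ide J (a' x))), Comp = (\<lambda>n m. b (Comp J (b' n) (b' m))) \<rparr>"

definition D' where "D' D = \<lparr> fob = (\<lambda>x. fob D (a' x)), fmor = (\<lambda>m. fmor D (b' m)) \<rparr>"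

lemma Hom_J'I: "u \<in> Hom J x y \<Longrightarrow> b u \<in> Hom J' (a x) (a y)"
  by (auto simp: Hom_def J'_def)

lemma Hom_J'E:
  assumes "m \<in> Hom J' x' y'"
  obtains u x y where "x' = a x" "y' = a y" "m = b u" "u \<in> Hom J x y" "x \<in> Ob J" "y \<in> Ob J"
proof -
  from assms obtain u where "u \<in> Mor J" "m = b u" "x' = a (Dom J u)" "y' = a (Cod J u)"
    by (auto simp: Hom_def J'_def)
  then show ?thesis using that[of "Dom J u" "Cod J u" u] Dom_Ob Cod_Ob by (auto simp: Hom_def)
qed

lemma Hom_J'_aE:
  assumes "m \<in> Hom J' (a x) (a y)" "x \<in> Ob J" "y \<in> Ob J"
  obtains u where "m = b u" "u \<in> Hom J x y"
proof -
  obtain u x' y' where u: "a x = a x'" "a y = a y'" "m = b u" "u \<in> Hom J x' y'" "x' \<in> Ob J" "y' \<in> Ob J"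
    by (rule Hom_J'E[OF assms(1)])
  then have "x' = x" "y' = y" using assms(2,3) inj_a by (auto simp: inj_on_def)
  with u that show ?thesis by simp
qed

lemma Comp_J': "u \<in> Mor J \<Longrightarrow> v \<in> Mor J \<Longrightarrow> b v \<cdot>\<^bsub>J'\<^esub> b u = b (v \<cdot> u)"
  by (simp add: J'_def)

lemma Ide_J': "x \<in> Ob J \<Longrightarrow> Ide J' (a x) = b (Ide J x)"
  by (simp add: J'_def)

lemma Ob_J': "Ob J' = a ` Ob J" by (simp add: J'_def)

lemma category_J': "category J'"
proof
  show "f \<in> Mor J' \<Longrightarrow> Dom J' f \<in> Ob J'" for f by (auto simp: J'_def intro: Dom_Ob)
  show "f \<in> Mor J' \<Longrightarrow> Cod J' f \<in> Ob J'" for f by (auto simp: J'_def intro: Cod_Ob)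
  show "X \<in> Ob J' \<Longrightarrow> Ide J' X \<in> Hom J' X X" for X
    by (auto simp: Ob_J' Ide_J' intro!: Hom_J'I Ide_Hom)
next
  fix f g X Y Z assume f: "f \<in> Hom J' X Y" and g: "g \<in> Hom J' Y Z"
  obtain u x y where u: "X = a x" "Y = a y" "f = b u" "u \<in> Hom J x y" "x \<in> Ob J" "y \<in> Ob J"
    by (rule Hom_J'E[OF f])
  obtain v z where v: "Z = a z" "g = b v" "v \<in> Hom J y z"
    by (rule Hom_J'E[OF g]) (use u inj_a in \<open>auto simp: inj_on_def\<close>)
  show "g \<cdot>\<^bsub>J'\<^esub> f \<in> Hom J' X Z"
    using u v Hom_J'I[OF Comp_Hom[OF u(4) v(3)]] Comp_J' HomD by metis
next
  fix f X Y assume f: "f \<in> Hom J' X Y"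
  obtain u x y where u: "X = a x" "Y = a y" "f = b u" "u \<in> Hom J x y" "x \<in> Ob J" "y \<in> Ob J"
    by (rule Hom_J'E[OF f])
  have m: "u \<in> Mor J" "Ide J x \<in> Mor J" "Ide J y \<in> Mor J" using u ide_arr HomD by auto
  show "f \<cdot>\<^bsub>J'\<^esub> Ide J' X = f" "Ide J' Y \<cdot>\<^bsub>J'\<^esub> f = f"
    using u m by (simp_all add: Ide_J' Comp_J' Comp_Ide[OF u(4)] Ide_Comp[OF u(4)])
next
  fix f g h W X Y Z assume f: "f \<in> Hom J' W X" and g: "g \<in> Hom J' X Y" and h: "h \<in> Hom J' Y Z"
  obtain u w x where u: "W = a w" "X = a x" "f = b u" "u \<in> Hom J w x" "w \<in> Ob J" "x \<in> Ob J"
    by (rule Hom_J'E[OF f])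
  obtain v y where v: "Y = a y" "g = b v" "v \<in> Hom J x y" "y \<in> Ob J"
    by (rule Hom_J'E[OF g]) (use u inj_a in \<open>auto simp: inj_on_def\<close>)
  obtain r z where r: "Z = a z" "h = b r" "r \<in> Hom J y z"
    by (rule Hom_J'E[OF h]) (use v inj_a in \<open>auto simp: inj_on_def\<close>)
  have "u \<in> Mor J" "v \<in> Mor J" "r \<in> Mor J" "v \<cdot> u \<in> Mor J" "r \<cdot> v \<in> Mor J"
    using u(4) v(3) r(3) Comp_Hom HomD by blast+
  then show "(h \<cdot>\<^bsub>J'\<^esub> g) \<cdot>\<^bsub>J'\<^esub> f = h \<cdot>\<^bsub>J'\<^esub> (g \<cdot>\<^bsub>J'\<^esub> f)"
    using u v r by (simp add: Comp_J' Comp_assoc[OF u(4) v(3) r(3)])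
qed

lemma filtered_J':
  assumes "filtered J"
  shows "filtered J'"
  unfolding filtered_def
proof (intro conjI ballI allI)
  show "Ob J' \<noteq> {}" using assms by (simp add: filtered_def Ob_J')
next
  fix i' j' assume "i' \<in> Ob J'" "j' \<in> Ob J'"
  then obtain i j where i: "i' = a i" "i \<in> Ob J" and j: "j' = a j" "j \<in> Ob J" by (auto simp: Ob_J')
  then obtain k u v where "u \<in> Hom J i k" "v \<in> Hom J j k"
    using assms unfolding filtered_def by (metis ex_in_conv)
  then have "b u \<in> Hom J' i' (a k)" "b v \<in> Hom J' j' (a k)" using Hom_J'I i j by auto
  then show "\<exists>k. Hom J' i' k \<noteq> {} \<and> Hom J' j' k \<noteq> {}" by blast
next
  fix i' j' u' v' assume u': "u' \<in> Hom J' i' j'" and v': "v' \<in> Hom J' i' j'"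
  obtain u i j where u: "i' = a i" "j' = a j" "u' = b u" "u \<in> Hom J i j" "i \<in> Ob J" "j \<in> Ob J"
    by (rule Hom_J'E[OF u'])
  obtain v where v: "v' = b v" "v \<in> Hom J i j"
    by (rule Hom_J'_aE[of v' i j]) (use u v' in auto)
  obtain k w where w: "w \<in> Hom J j k" "w \<cdot> u = w \<cdot> v"
    using assms u(4) v(2) unfolding filtered_def by metis
  have "b w \<in> Hom J' j' (a k)" "b w \<cdot>\<^bsub>J'\<^esub> u' = b w \<cdot>\<^bsub>J'\<^esub> v'"
    using w u v Hom_J'I by (auto simp: Comp_J' dest!: HomD)
  then show "\<exists>k. \<exists>w\<in>Hom J' j' k. w \<cdot>\<^bsub>J'\<^esub> u' = w \<cdot>\<^bsub>J'\<^esub> v'" by blast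
qed

lemma fob_D' [simp]: "x \<in> Ob J \<Longrightarrow> fob (D' D) (a x) = fob D x"
  and fmor_D' [simp]: "u \<in> Mor J \<Longrightarrow> fmor (D' D) (b u) = fmor D u"
  by (simp_all add: D'_def)

lemma functor_D':
  assumes "is_functor J C D"
  shows "is_functor J' C (D' D)"
  unfolding is_functor_def
proof (intro conjI ballI allI)
  note D = functorD[OF assms]
  show "fob (D' D) x \<in> Ob C" if "x \<in> Ob J'" for x using that D(1) by (auto simp: Ob_J')
  show "fmor (D' D) (Ide J' x) = Ide C (fob (D' D) x)" if "x \<in> Ob J'" for x
    using that D(3) by (auto simp: Ob_J' Ide_J' ide_arr)
  fix X Y f assume f: "f \<in> Hom J' X Y"
  obtain u x y where u: "X = a x" "Y = a y" "f = b u" "u \<in> Hom J x y" "x \<in> Ob J" "y \<in> Ob J"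
    by (rule Hom_J'E[OF f])
  then show "fmor (D' D) f \<in> Hom C (fob (D' D) X) (fob (D' D) Y)" using D(2)[OF u(4)] HomD[OF u(4)] by simp
  fix Z g assume g: "g \<in> Hom J' Y Z"
  obtain v z where v: "Z = a z" "g = b v" "v \<in> Hom J y z"
    by (rule Hom_J'E[OF g]) (use u inj_a in \<open>auto simp: inj_on_def\<close>)
  have "v \<cdot> u \<in> Mor J" using Comp_Hom[OF u(4) v(3)] HomD by blast
  then show "fmor (D' D) (g \<cdot>\<^bsub>J'\<^esub> f) = fmor (D' D) g \<cdot>\<^bsub>C\<^esub> fmor (D' D) f"
    using u v D(4)[OF u(4) v(3)] HomD[OF u(4)] HomD[OF v(3)] by (simp add: Comp_J')
qed

lemma cocone_D': "is_cocone C J' (D' D) M m \<longleftrightarrow> is_cocone C J D M (\<lambda>j. m (a j))"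
proof
  assume c: "is_cocone C J' (D' D) M m"
  show "is_cocone C J D M (\<lambda>j. m (a j))"
    unfolding is_cocone_def
  proof (intro conjI ballI allI)
    show "M \<in> Ob C" by (rule coconeD[OF c])
    show "m (a j) \<in> Hom C (fob D j) M" if "j \<in> Ob J" for j
      using coconeD(2)[OF c, of "a j"] that by (simp add: Ob_J')
    show "m (a j) \<cdot>\<^bsub>C\<^esub> fmor D u = m (a i)" if "u \<in> Hom J i j" for i j u
      using coconeD(3)[OF c Hom_J'I[OF that]] HomD[OF that] by simp
  qed
next
  assume c: "is_cocone C J D M (\<lambda>j. m (a j))"
  show "is_cocone C J' (D' D) M m"
    unfolding is_cocone_def
  proof (intro conjI ballI allI)
    show "M \<in> Ob C" by (rule coconeD[OF c])
    show "m j \<in> Hom C (fob (D' D) j) M" if "j \<in> Ob J'" for j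
      using coconeD(2)[OF c] that by (auto simp: Ob_J')
    fix X Y f assume f: "f \<in> Hom J' X Y"
    obtain u x y where u: "X = a x" "Y = a y" "f = b u" "u \<in> Hom J x y" "x \<in> Ob J" "y \<in> Ob J"
      by (rule Hom_J'E[OF f])
    then show "m Y \<cdot>\<^bsub>C\<^esub> fmor (D' D) f = m X" using coconeD(3)[OF c u(4)] HomD[OF u(4)] by simp
  qed
qed

lemma colimit_D': "is_colimit C J' (D' D) L l \<longleftrightarrow> is_colimit C J D L (\<lambda>j. l (a j))"
proof
  assume L: "is_colimit C J' (D' D) L l"
  show "is_colimit C J D L (\<lambda>j. l (a j))"
    unfolding is_colimit_def
  proof (intro conjI allI impI)
    show "is_cocone C J D L (\<lambda>j. l (a j))" using colim_cocone[OF L] by (simp add: cocone_D')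
    fix M m assume m: "is_cocone C J D M m"
    have "is_cocone C J D M (\<lambda>j. m (a' (a j)))"
      using m unfolding is_cocone_def by (auto simp: Hom_def Dom_Ob Cod_Ob)
    then have "is_cocone C J' (D' D) M (\<lambda>j. m (a' j))" by (simp add: cocone_D')
    from colim_ex1[OF L this] show "\<exists>!h. h \<in> Hom C L M \<and> (\<forall>j\<in>Ob J. h \<cdot>\<^bsub>C\<^esub> l (a j) = m j)"
      by (simp add: Ob_J')
  qed
next
  assume L: "is_colimit C J D L (\<lambda>j. l (a j))"
  show "is_colimit C J' (D' D) L l"
    unfolding is_colimit_def
  proof (intro conjI allI impI)
    show "is_cocone C J' (D' D) L l" using colim_cocone[OF L] by (simp add: cocone_D')
    fix M m assume m: "is_cocone C J' (D' D) M m"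
    from colim_ex1[OF L m[unfolded cocone_D']]
    show "\<exists>!h. h \<in> Hom C L M \<and> (\<forall>j\<in>Ob J'. h \<cdot>\<^bsub>C\<^esub> l j = m j)"
      by (simp add: Ob_J')
  qed
qed

end

definition small_filtered where
  "small_filtered U J \<longleftrightarrow> small_cat U J \<and> filtered J"

lemma small_filteredD:
  assumes "small_filtered U J"
  shows "category J" "small U (Ob J)" "small U (Mor J)" "filtered J"
  using assms by (auto simp: small_filtered_def small_cat_def)

lemma filtered_nonempty: "filtered J \<Longrightarrow> \<exists>j. j \<in> Ob J"
  unfolding filtered_def by blast

lemma filtered_bound:
  assumes "filtered J" "i \<in> Ob J" "j \<in> Ob J"
  obtains k u v where "u \<in> Hom J i k" "v \<in> Hom J j k"
  using assms unfolding filtered_def by blast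

lemma filtered_coequalize:
  assumes "filtered J" "u \<in> Hom J i j" "v \<in> Hom J i j"
  obtains k w where "w \<in> Hom J j k" "w \<cdot>\<^bsub>J\<^esub> u = w \<cdot>\<^bsub>J\<^esub> v"
  using assms unfolding filtered_def by blast

context universe
begin

lemma relabel:
  assumes J: "small_cat U J"
  obtains a :: "'a \<Rightarrow> 'u" and b :: "'b \<Rightarrow> 'u" where "relabelling (J :: ('a, 'b) cat) a b"
    "small_cat U (relabelling.J' J a b)"
proof -
  have J': "category J" "small U (Ob J)" "small U (Mor J)" using J by (auto simp: small_cat_def)
  obtain a :: "'a \<Rightarrow> 'u" where a: "inj_on a (Ob J)" by (rule small_embeds[OF J'(2)])
  obtain b :: "'b \<Rightarrow> 'u" where b: "inj_on b (Mor J)" by (rule small_embeds[OF J'(3)])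
  interpret r: relabelling J a b
    using J'(1) a b by (simp add: relabelling_def relabelling_axioms_def)
  have "small_cat U r.J'"
    using r.category_J' small_image[OF J'(2), of a] small_image[OF J'(3), of b]
    by (simp add: small_cat_def r.J'_def)
  with that[of a b] r.relabelling_axioms show ?thesis by blast
qed

lemma colimit_exists:
  assumes C: "cocomplete U C" and J: "small_cat U J" and D: "is_functor J C D"
  shows "\<exists>L l. is_colimit C J D L l"
proof -
  obtain a b where r: "relabelling J (a :: _ \<Rightarrow> 'u) b" "small_cat U (relabelling.J' J a b)"
    by (rule relabel[OF J])
  interpret r: relabelling J a b by (rule r)
  have "\<exists>L l. is_colimit C r.J' (r.D' D) L l"
    using C r(2) r.functor_D'[OF D] unfolding cocomplete_def by blast
  then show ?thesis unfolding r.colimit_D' by blast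
qed

lemma coproduct_exists:
  assumes C: "cocomplete U C" and I: "small U I" and X: "\<And>i. i \<in> I \<Longrightarrow> X i \<in> Ob C" and "category C"
  shows "\<exists>S inc. is_coproduct C I X S inc"
proof -
  interpret category C by fact
  let ?J = "\<lparr> Ob = I, Mor = I, Dom = id, Cod = id, Ide = id, Comp = (\<lambda>x y. x) \<rparr>"
  let ?D = "\<lparr> fob = X, fmor = (\<lambda>i. Ide C (X i)) \<rparr>"
  have "category ?J" by unfold_locales (auto simp: Hom_def)
  then have "small_cat U ?J" using I by (simp add: small_cat_def)
  moreover have "is_functor ?J C ?D"
    using X by (auto simp: is_functor_def Hom_def[of ?J] Ide_Hom comp_ide ide_arr)
  ultimately obtain S inc where S: "is_colimit C ?J ?D S inc" using colimit_exists[OF C] by blast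
  have c: "is_cocone C ?J ?D T f \<longleftrightarrow> T \<in> Ob C \<and> (\<forall>i\<in>I. f i \<in> Hom C (X i) T)" for T f
    using X by (auto simp: is_cocone_def Hom_def[of ?J] Comp_Ide)
  have "is_coproduct C I X S inc"
    using S X unfolding is_coproduct_def is_colimit_def c by simp
  then show ?thesis by blast
qed

lemma SumsI:
  assumes S: "is_coproduct C I X S inc" and I: "small U I" and X: "\<And>i. i \<in> I \<Longrightarrow> X i \<in> \<Y>"
    and "category C"
  shows "S \<in> Sums U C \<Y>"
proof -
  interpret category C by fact
  obtain a :: "_ \<Rightarrow> 'u" where a: "inj_on a I" by (rule small_embeds[OF I])
  let ?b = "inv_into I a"
  have "bij_betw ?b (a ` I) I" using a by (simp add: bij_betw_inv_into inj_on_imp_bij_betw)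
  then have "is_coproduct C (a ` I) (\<lambda>i. X (?b i)) S (\<lambda>i. inc (?b i))"
    by (rule coprod_reindex[OF S]) auto
  moreover have "small U (a ` I)" by (rule small_image[OF I])
  moreover have "X (?b i) \<in> \<Y>" if "i \<in> a ` I" for i using X that by (simp add: inv_into_into)
  ultimately show ?thesis
    unfolding Sums_def by (intro CollectI exI[of _ "a ` I"] exI[of _ "\<lambda>i. X (?b i)"] exI conjI ballI)
qed

lemma Filt_colimsI:
  assumes J: "small_filtered U J" and D: "is_functor J C D"
    and L: "is_colimit C J D L l" and \<Y>: "\<And>j. j \<in> Ob J \<Longrightarrow> fob D j \<in> \<Y>"
  shows "L \<in> Filt_colims U C \<Y>"
proof -
  have J': "small_cat U J" "filtered J" using J by (auto simp: small_filtered_def)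
  obtain a b where r: "relabelling J (a :: _ \<Rightarrow> 'u) b" "small_cat U (relabelling.J' J a b)"
    by (rule relabel[OF J'(1)])
  interpret r: relabelling J a b by (rule r)
  have "is_cocone C J D M (\<lambda>j. m (r.a' (a j))) \<longleftrightarrow> is_cocone C J D M m" for M m
    unfolding is_cocone_def by (auto simp: Hom_def r.Dom_Ob r.Cod_Ob)
  then have "is_colimit C J D L (\<lambda>j. l (r.a' (a j)))"
    using L unfolding is_colimit_def by simp
  then have "is_colimit C r.J' (r.D' D) L (\<lambda>j. l (r.a' j))" by (simp add: r.colimit_D')
  moreover have "filtered_system U C r.J' (r.D' D)"
    using r(2) r.filtered_J'[OF J'(2)] r.functor_D'[OF D] by (simp add: filtered_system_def)
  moreover have "fob (r.D' D) j \<in> \<Y>" if "j \<in> Ob r.J'" for j using \<Y> that by (auto simp: r.Ob_J')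
  ultimately show ?thesis unfolding Filt_colims_def by blast
qed

end

text \<open>
  The two elements of the colimit of the sets \<open>Hom C X (fob D j)\<close> represented by \<open>x\<close> and \<open>y\<close> agree
  as soon as they do after a transition map; this unfolds the quotient in the definition of
  finitely generated objects.
\<close>

lemma Hom_colim_map_inj_iff:
  assumes C: "category C" and J: "category J" "filtered J" and D: "is_functor J C D"
    and l: "is_cocone C J D L l"
  shows "inj_on (Hom_colim_map C l) (Hom_colim C J D X) \<longleftrightarrow>
    (\<forall>j \<in> Ob J. \<forall>x \<in> Hom C X (fob D j). \<forall>y \<in> Hom C X (fob D j). l j \<cdot>\<^bsub>C\<^esub> x = l j \<cdot>\<^bsub>C\<^esub> y \<longrightarrow>
       (\<exists>k. \<exists>u \<in> Hom J j k. fmor D u \<cdot>\<^bsub>C\<^esub> x = fmor D u \<cdot>\<^bsub>C\<^esub> y))" (is "?inj \<longleftrightarrow> ?INJ")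
proof -
  interpret C: category C by (rule C)
  interpret J: category J by (rule J)
  let ?H = "Hom_union C J D X"
  define R where "R = {((i, f), (j, g)). (i, f) \<in> ?H \<and> (j, g) \<in> ?H \<and>
        (\<exists>k. \<exists>u \<in> Hom J i k. \<exists>v \<in> Hom J j k. fmor D u \<cdot>\<^bsub>C\<^esub> f = fmor D v \<cdot>\<^bsub>C\<^esub> g)}"
  note Dm = functorD(2)[OF D] and Dc = functorD(4)[OF D]
  have H: "(i, f) \<in> ?H \<longleftrightarrow> i \<in> Ob J \<and> f \<in> Hom C X (fob D i)" for i f by (simp add: Hom_union_def)
  have comp: "fmor D (w \<cdot>\<^bsub>J\<^esub> u) \<cdot>\<^bsub>C\<^esub> f = fmor D w \<cdot>\<^bsub>C\<^esub> (fmor D u \<cdot>\<^bsub>C\<^esub> f)"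
    if "f \<in> Hom C X (fob D i)" "u \<in> Hom J i j" "w \<in> Hom J j k" for f u w i j k
    using C.Comp_assoc[OF that(1) Dm[OF that(2)] Dm[OF that(3)]] Dc[OF that(2,3)] by simp
  have R_iff: "((i, f), (j, g)) \<in> R \<longleftrightarrow> (i, f) \<in> ?H \<and> (j, g) \<in> ?H \<and>
      (\<exists>k u v. u \<in> Hom J i k \<and> v \<in> Hom J j k \<and> fmor D u \<cdot>\<^bsub>C\<^esub> f = fmor D v \<cdot>\<^bsub>C\<^esub> g)" for i f j g
    unfolding R_def by auto
  have R_refl: "((i, f), (i, f)) \<in> R" if "(i, f) \<in> ?H" for i f
    using that J.Ide_Hom unfolding R_iff H by blast
  have R_sym: "(y, x) \<in> R" if "(x, y) \<in> R" for x y
  proof -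
    obtain i f j g where "x = (i, f)" "y = (j, g)" by (metis surj_pair)
    then show ?thesis using that unfolding R_iff by (simp add: R_iff) metis
  qed
  have R_trans: "((i, f), (m, h)) \<in> R" if r: "((i, f), (j, g)) \<in> R" "((j, g), (m, h)) \<in> R" for i f j g m h
  proof -
    obtain k u v where 1: "u \<in> Hom J i k" "v \<in> Hom J j k" "fmor D u \<cdot>\<^bsub>C\<^esub> f = fmor D v \<cdot>\<^bsub>C\<^esub> g"
      using r(1) unfolding R_iff by blast
    obtain k' u' v' where 2: "u' \<in> Hom J j k'" "v' \<in> Hom J m k'" "fmor D u' \<cdot>\<^bsub>C\<^esub> g = fmor D v' \<cdot>\<^bsub>C\<^esub> h"
      using r(2) unfolding R_iff by blast
    have h: "f \<in> Hom C X (fob D i)" "g \<in> Hom C X (fob D j)" "h \<in> Hom C X (fob D m)"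
      using r unfolding R_iff H by auto
    obtain n s t where 3: "s \<in> Hom J k n" "t \<in> Hom J k' n"
      by (rule filtered_bound[OF J(2) J.Hom_Ob(2)[OF 1(1)] J.Hom_Ob(2)[OF 2(1)]])
    obtain p w where 4: "w \<in> Hom J n p" "w \<cdot>\<^bsub>J\<^esub> (s \<cdot>\<^bsub>J\<^esub> v) = w \<cdot>\<^bsub>J\<^esub> (t \<cdot>\<^bsub>J\<^esub> u')"
      by (rule filtered_coequalize[OF J(2) J.Comp_Hom[OF 1(2) 3(1)] J.Comp_Hom[OF 2(1) 3(2)]])
    have sv: "s \<cdot>\<^bsub>J\<^esub> u \<in> Hom J i n" "s \<cdot>\<^bsub>J\<^esub> v \<in> Hom J j n" "t \<cdot>\<^bsub>J\<^esub> u' \<in> Hom J j n" "t \<cdot>\<^bsub>J\<^esub> v' \<in> Hom J m n"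
      using 1 2 3 J.Comp_Hom by blast+
    have "fmor D (w \<cdot>\<^bsub>J\<^esub> (s \<cdot>\<^bsub>J\<^esub> u)) \<cdot>\<^bsub>C\<^esub> f = fmor D (w \<cdot>\<^bsub>J\<^esub> (s \<cdot>\<^bsub>J\<^esub> v)) \<cdot>\<^bsub>C\<^esub> g"
      by (simp only: comp[OF h(1) sv(1) 4(1)] comp[OF h(1) 1(1) 3(1)] comp[OF h(2) sv(2) 4(1)]
          comp[OF h(2) 1(2) 3(1)] 1(3))
    also have "\<dots> = fmor D (w \<cdot>\<^bsub>J\<^esub> (t \<cdot>\<^bsub>J\<^esub> v')) \<cdot>\<^bsub>C\<^esub> h"
      by (simp only: 4(2) comp[OF h(2) sv(3) 4(1)] comp[OF h(2) 2(1) 3(2)] comp[OF h(3) sv(4) 4(1)]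
          comp[OF h(3) 2(2) 3(2)] 2(3))
    finally have e: "fmor D (w \<cdot>\<^bsub>J\<^esub> (s \<cdot>\<^bsub>J\<^esub> u)) \<cdot>\<^bsub>C\<^esub> f = fmor D (w \<cdot>\<^bsub>J\<^esub> (t \<cdot>\<^bsub>J\<^esub> v')) \<cdot>\<^bsub>C\<^esub> h" .
    have "w \<cdot>\<^bsub>J\<^esub> (s \<cdot>\<^bsub>J\<^esub> u) \<in> Hom J i p" "w \<cdot>\<^bsub>J\<^esub> (t \<cdot>\<^bsub>J\<^esub> v') \<in> Hom J m p"
      using J.Comp_Hom[OF sv(1) 4(1)] J.Comp_Hom[OF sv(4) 4(1)] by auto
    moreover have "(i, f) \<in> ?H" "(m, h) \<in> ?H" using r unfolding R_iff by auto
    ultimately show ?thesis using e unfolding R_iff by blast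
  qed
  have eqv: "equiv ?H R"
  proof (rule equivI)
    show "R \<subseteq> ?H \<times> ?H" unfolding R_def by auto
    show "refl_on ?H R" using R_refl unfolding refl_on_def by auto
    show "sym R" using R_sym by (rule symI)
    show "trans R" using R_trans by (intro transI) (metis surj_pair)
  qed
  have HC: "Hom_colim C J D X = ?H // R" unfolding Hom_colim_def R_def by simp
  have lR: "l j \<cdot>\<^bsub>C\<^esub> g = l i \<cdot>\<^bsub>C\<^esub> f" if r: "((i, f), (j, g)) \<in> R" for i f j g
  proof -
    obtain k u v where 1: "u \<in> Hom J i k" "v \<in> Hom J j k" "fmor D u \<cdot>\<^bsub>C\<^esub> f = fmor D v \<cdot>\<^bsub>C\<^esub> g"
      using r unfolding R_iff by blast
    have h: "f \<in> Hom C X (fob D i)" "g \<in> Hom C X (fob D j)" using r unfolding R_iff H by auto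
    note lk = coconeD(2)[OF l J.Hom_Ob(2)[OF 1(1)]]
    have "l j \<cdot>\<^bsub>C\<^esub> g = l k \<cdot>\<^bsub>C\<^esub> (fmor D v \<cdot>\<^bsub>C\<^esub> g)"
      using C.Comp_assoc[OF h(2) Dm[OF 1(2)] lk] coconeD(3)[OF l 1(2)] by simp
    also have "\<dots> = l i \<cdot>\<^bsub>C\<^esub> f"
      unfolding 1(3)[symmetric] using C.Comp_assoc[OF h(1) Dm[OF 1(1)] lk] coconeD(3)[OF l 1(1)] by simp
    finally show ?thesis .
  qed
  have val: "Hom_colim_map C l (R `` {(i, f)}) = l i \<cdot>\<^bsub>C\<^esub> f" if "(i, f) \<in> ?H" for i f
  proof -
    have "(\<lambda>(j, g). l j \<cdot>\<^bsub>C\<^esub> g) ` (R `` {(i, f)}) = {l i \<cdot>\<^bsub>C\<^esub> f}"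
    proof (intro equalityI subsetI)
      fix z assume "z \<in> (\<lambda>(j, g). l j \<cdot>\<^bsub>C\<^esub> g) ` (R `` {(i, f)})"
      then show "z \<in> {l i \<cdot>\<^bsub>C\<^esub> f}" using lR by auto
    next
      fix z assume "z \<in> {l i \<cdot>\<^bsub>C\<^esub> f}"
      then show "z \<in> (\<lambda>(j, g). l j \<cdot>\<^bsub>C\<^esub> g) ` (R `` {(i, f)})"
        using R_refl[OF that] by (intro image_eqI[of _ _ "(i, f)"]) auto
    qed
    then show ?thesis by (simp add: Hom_colim_map_def)
  qed
  have "?inj \<longleftrightarrow> (\<forall>x\<in>?H. \<forall>y\<in>?H. Hom_colim_map C l (R `` {x}) = Hom_colim_map C l (R `` {y}) \<longrightarrow>
      (x, y) \<in> R)"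
    unfolding HC inj_on_def quotient_def using eq_equiv_class_iff[OF eqv] by auto
  also have "\<dots> \<longleftrightarrow> (\<forall>i f j g. (i, f) \<in> ?H \<longrightarrow> (j, g) \<in> ?H \<longrightarrow> l i \<cdot>\<^bsub>C\<^esub> f = l j \<cdot>\<^bsub>C\<^esub> g \<longrightarrow>
      ((i, f), (j, g)) \<in> R)"
    using val by auto
  also have "\<dots> \<longleftrightarrow> ?INJ"
  proof
    assume a: "\<forall>i f j g. (i, f) \<in> ?H \<longrightarrow> (j, g) \<in> ?H \<longrightarrow> l i \<cdot>\<^bsub>C\<^esub> f = l j \<cdot>\<^bsub>C\<^esub> g \<longrightarrow> ((i, f), (j, g)) \<in> R"
    show ?INJ
    proof (intro ballI impI)
      fix j x y assume j: "j \<in> Ob J" and x: "x \<in> Hom C X (fob D j)" and y: "y \<in> Hom C X (fob D j)"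
        and e: "l j \<cdot>\<^bsub>C\<^esub> x = l j \<cdot>\<^bsub>C\<^esub> y"
      then have "((j, x), (j, y)) \<in> R" using a H by blast
      then obtain k u v where 1: "u \<in> Hom J j k" "v \<in> Hom J j k" "fmor D u \<cdot>\<^bsub>C\<^esub> x = fmor D v \<cdot>\<^bsub>C\<^esub> y"
        unfolding R_iff by blast
      obtain p w where 2: "w \<in> Hom J k p" "w \<cdot>\<^bsub>J\<^esub> u = w \<cdot>\<^bsub>J\<^esub> v"
        by (rule filtered_coequalize[OF J(2) 1(1,2)])
      have "fmor D (w \<cdot>\<^bsub>J\<^esub> u) \<cdot>\<^bsub>C\<^esub> x = fmor D (w \<cdot>\<^bsub>J\<^esub> v) \<cdot>\<^bsub>C\<^esub> y"
        by (simp only: comp[OF x 1(1) 2(1)] comp[OF y 1(2) 2(1)] 1(3))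
      then have "fmor D (w \<cdot>\<^bsub>J\<^esub> u) \<cdot>\<^bsub>C\<^esub> x = fmor D (w \<cdot>\<^bsub>J\<^esub> u) \<cdot>\<^bsub>C\<^esub> y" by (simp only: 2(2))
      then show "\<exists>k. \<exists>u \<in> Hom J j k. fmor D u \<cdot>\<^bsub>C\<^esub> x = fmor D u \<cdot>\<^bsub>C\<^esub> y"
        using J.Comp_Hom[OF 1(1) 2(1)] by blast
    qed
  next
    assume a: ?INJ
    show "\<forall>i f j g. (i, f) \<in> ?H \<longrightarrow> (j, g) \<in> ?H \<longrightarrow> l i \<cdot>\<^bsub>C\<^esub> f = l j \<cdot>\<^bsub>C\<^esub> g \<longrightarrow> ((i, f), (j, g)) \<in> R"
    proof (intro allI impI)
      fix i f j g assume f: "(i, f) \<in> ?H" and g: "(j, g) \<in> ?H" and e: "l i \<cdot>\<^bsub>C\<^esub> f = l j \<cdot>\<^bsub>C\<^esub> g"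
      have h: "i \<in> Ob J" "j \<in> Ob J" "f \<in> Hom C X (fob D i)" "g \<in> Hom C X (fob D j)" using f g H by auto
      obtain k u v where 1: "u \<in> Hom J i k" "v \<in> Hom J j k" by (rule filtered_bound[OF J(2) h(1,2)])
      note k = J.Hom_Ob(2)[OF 1(1)]
      have x: "fmor D u \<cdot>\<^bsub>C\<^esub> f \<in> Hom C X (fob D k)" and y: "fmor D v \<cdot>\<^bsub>C\<^esub> g \<in> Hom C X (fob D k)"
        using C.Comp_Hom[OF h(3) Dm[OF 1(1)]] C.Comp_Hom[OF h(4) Dm[OF 1(2)]] by auto
      have "l k \<cdot>\<^bsub>C\<^esub> (fmor D u \<cdot>\<^bsub>C\<^esub> f) = l k \<cdot>\<^bsub>C\<^esub> (fmor D v \<cdot>\<^bsub>C\<^esub> g)"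
        using C.Comp_assoc[OF h(3) Dm[OF 1(1)] coconeD(2)[OF l k]] coconeD(3)[OF l 1(1)]
          C.Comp_assoc[OF h(4) Dm[OF 1(2)] coconeD(2)[OF l k]] coconeD(3)[OF l 1(2)] e by simp
      then obtain p w where 2: "w \<in> Hom J k p"
          "fmor D w \<cdot>\<^bsub>C\<^esub> (fmor D u \<cdot>\<^bsub>C\<^esub> f) = fmor D w \<cdot>\<^bsub>C\<^esub> (fmor D v \<cdot>\<^bsub>C\<^esub> g)"
        using a k x y by blast
      then have "fmor D (w \<cdot>\<^bsub>J\<^esub> u) \<cdot>\<^bsub>C\<^esub> f = fmor D (w \<cdot>\<^bsub>J\<^esub> v) \<cdot>\<^bsub>C\<^esub> g"
        by (simp only: comp[OF h(3) 1(1) 2(1)] comp[OF h(4) 1(2) 2(1)])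
      then show "((i, f), (j, g)) \<in> R"
        using f g J.Comp_Hom[OF 1(1) 2(1)] J.Comp_Hom[OF 1(2) 2(1)] unfolding R_iff by blast
    qed
  qed
  finally show ?thesis .
qed

context universe
begin

lemma fin_generatedI:
  assumes C: "category C" and X: "X \<in> Ob C"
    and INJ: "\<And>(J :: ('u, 'u) cat) D L l j x y. small_filtered U J \<Longrightarrow> is_functor J C D \<Longrightarrow>
      is_colimit C J D L l \<Longrightarrow> j \<in> Ob J \<Longrightarrow> x \<in> Hom C X (fob D j) \<Longrightarrow> y \<in> Hom C X (fob D j) \<Longrightarrow>
      l j \<cdot>\<^bsub>C\<^esub> x = l j \<cdot>\<^bsub>C\<^esub> y \<Longrightarrow> \<exists>k. \<exists>u \<in> Hom J j k. fmor D u \<cdot>\<^bsub>C\<^esub> x = fmor D u \<cdot>\<^bsub>C\<^esub> y"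
  shows "fin_generated U C X"
  unfolding fin_generated_def
proof (intro conjI allI impI)
  fix J :: "('u, 'u) cat" and D L l
  assume a: "filtered_system U C J D \<and> is_colimit C J D L l"
  then have J: "small_filtered U J" and D: "is_functor J C D" and L: "is_colimit C J D L l"
    by (auto simp: filtered_system_def small_filtered_def)
  show "inj_on (Hom_colim_map C l) (Hom_colim C J D X)"
    unfolding Hom_colim_map_inj_iff[OF C small_filteredD(1,4)[OF J] D colim_cocone[OF L]]
    using INJ[OF J D L] by blast
qed (rule X)

lemma fin_generatedD:
  assumes X: "fin_generated U C X" and C: "category C"
    and J: "small_filtered U J" and D: "is_functor J C D" and L: "is_colimit C J D L l"
    and j: "j \<in> Ob J" and x: "x \<in> Hom C X (fob D j)" and y: "y \<in> Hom C X (fob D j)"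
    and e: "l j \<cdot>\<^bsub>C\<^esub> x = l j \<cdot>\<^bsub>C\<^esub> y"
  shows "\<exists>k. \<exists>u \<in> Hom J j k. fmor D u \<cdot>\<^bsub>C\<^esub> x = fmor D u \<cdot>\<^bsub>C\<^esub> y"
proof -
  have J': "small_cat U J" "filtered J" using J by (auto simp: small_filtered_def)
  obtain a b where r: "relabelling J (a :: _ \<Rightarrow> 'u) b" "small_cat U (relabelling.J' J a b)"
    by (rule relabel[OF J'(1)])
  interpret r: relabelling J a b by (rule r)
  define l' where "l' = (\<lambda>j. l (r.a' j))"
  have "is_cocone C J D M (\<lambda>j. m (r.a' (a j))) \<longleftrightarrow> is_cocone C J D M m" for M m
    unfolding is_cocone_def by (auto simp: Hom_def r.Dom_Ob r.Cod_Ob)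
  then have "is_colimit C J D L (\<lambda>j. l (r.a' (a j)))"
    using L unfolding is_colimit_def by simp
  then have L': "is_colimit C r.J' (r.D' D) L l'" by (simp add: r.colimit_D' l'_def)
  have fs: "filtered_system U C r.J' (r.D' D)"
    using r(2) r.filtered_J'[OF J'(2)] r.functor_D'[OF D] by (simp add: filtered_system_def)
  have "inj_on (Hom_colim_map C l') (Hom_colim C r.J' (r.D' D) X)"
    using X fs L' unfolding fin_generated_def by blast
  then have "\<exists>k. \<exists>u \<in> Hom r.J' (a j) k. fmor (r.D' D) u \<cdot>\<^bsub>C\<^esub> x = fmor (r.D' D) u \<cdot>\<^bsub>C\<^esub> y"
    unfolding Hom_colim_map_inj_iff[OF C r.category_J' r.filtered_J'[OF J'(2)] r.functor_D'[OF D] colim_cocone[OF L']]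
    using j x y e by (simp add: r.Ob_J' l'_def)
  then obtain k u' where u': "u' \<in> Hom r.J' (a j) k" "fmor (r.D' D) u' \<cdot>\<^bsub>C\<^esub> x = fmor (r.D' D) u' \<cdot>\<^bsub>C\<^esub> y"
    by blast
  obtain u i m where u: "a j = a i" "k = a m" "u' = b u" "u \<in> Hom J i m" "i \<in> Ob J" "m \<in> Ob J"
    by (rule r.Hom_J'E[OF u'(1)])
  have "i = j" using u(1,5) j r.inj_a by (auto simp: inj_on_def)
  then show ?thesis using u u'(2) r.HomD[OF u(4)] by auto
qed

end

section \<open>Abelian categories\<close>

locale abelian_cat = category A for A :: "('o, 'm) cat" (structure) +
  fixes pl :: "'m \<Rightarrow> 'm \<Rightarrow> 'm"  (infixl "\<oplus>" 65)
  assumes preadd: "preadditive A pl" and abel: "abelian A"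
begin

text \<open>
  A preadditive structure provides the neutral element of each \<open>Hom A X Y\<close> only up to existence; as it is
  unique, the choice is immaterial.
\<close>

definition zr :: "'o \<Rightarrow> 'o \<Rightarrow> 'm" where
  "zr X Y = (SOME z. comm_group \<lparr> carrier = Hom A X Y, mult = pl, one = z \<rparr>)"

abbreviation grp :: "'o \<Rightarrow> 'o \<Rightarrow> 'm monoid" where
  "grp X Y \<equiv> \<lparr> carrier = Hom A X Y, mult = pl, one = zr X Y \<rparr>"

definition mi :: "'m \<Rightarrow> 'm \<Rightarrow> 'm" (infixl "\<ominus>" 65) where
  "f \<ominus> g = f \<oplus> m_inv (grp (Dom A g) (Cod A g)) g"

lemma grp: "X \<in> Ob A \<Longrightarrow> Y \<in> Ob A \<Longrightarrow> comm_group (grp X Y)"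
  using preadd unfolding preadditive_def zr_def by (metis (mono_tags, lifting) someI_ex)

lemma zr_Hom: "X \<in> Ob A \<Longrightarrow> Y \<in> Ob A \<Longrightarrow> zr X Y \<in> Hom A X Y"
  using monoid.one_closed[OF group.is_monoid[OF comm_group.axioms(2)[OF grp]], of X Y] by simp

context
  fixes f X Y assumes f: "f \<in> Hom A X Y"
begin

lemma grpH: "comm_group (grp X Y)"
  using grp Hom_Ob[OF f] by blast

interpretation G: comm_group "grp X Y" by (rule grpH)

lemma pl_Hom: "g \<in> Hom A X Y \<Longrightarrow> f \<oplus> g \<in> Hom A X Y"
  using G.m_closed[of f g] f by simp

lemma pl_comm: "g \<in> Hom A X Y \<Longrightarrow> f \<oplus> g = g \<oplus> f"
  using G.m_comm[of f g] f by simp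

lemma pl_zr: "f \<oplus> zr X Y = f" "zr X Y \<oplus> f = f"
  using G.r_one[of f] G.l_one[of f] f by simp_all

lemma inv_Hom: "g \<in> Hom A X Y \<Longrightarrow> m_inv (grp X Y) g \<in> Hom A X Y"
  using G.inv_closed[of g] by simp

lemma mi_alt: "g \<in> Hom A X Y \<Longrightarrow> f \<ominus> g = f \<oplus> m_inv (grp X Y) g"
  by (simp add: mi_def Hom_def)

lemma mi_Hom: "g \<in> Hom A X Y \<Longrightarrow> f \<ominus> g \<in> Hom A X Y"
  by (simp add: mi_alt pl_Hom inv_Hom)

lemma mi_self: "f \<ominus> f = zr X Y"
  using G.r_inv[of f] f by (simp add: mi_alt)

lemma mi_pl: "g \<in> Hom A X Y \<Longrightarrow> (f \<ominus> g) \<oplus> g = f"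
  using G.m_assoc[of f "m_inv (grp X Y) g" g] G.l_inv[of g] G.r_one[of f] f inv_Hom[of g]
  by (simp add: mi_alt)

lemma pl_mi: "g \<in> Hom A X Y \<Longrightarrow> (f \<oplus> g) \<ominus> g = f"
  using G.m_assoc[of f g "m_inv (grp X Y) g"] G.r_inv[of g] G.r_one[of f] f inv_Hom[of g] pl_Hom[of g]
  by (simp add: mi_def Hom_def)

lemma pl_cancel: "g \<in> Hom A X Y \<Longrightarrow> h \<in> Hom A X Y \<Longrightarrow> f \<oplus> g = h \<oplus> g \<longleftrightarrow> f = h"
  using G.right_cancel[of g f h] f by simp

lemma mi_eq_zr: "g \<in> Hom A X Y \<Longrightarrow> f \<ominus> g = zr X Y \<longleftrightarrow> f = g"
  using mi_pl[of g] mi_self G.l_one[of g] by auto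

end

lemma mi_zr: "f \<in> Hom A X Y \<Longrightarrow> f \<ominus> zr X Y = f"
  using mi_pl[of f X Y "zr X Y"] pl_zr[of "f \<ominus> zr X Y" X Y] zr_Hom Hom_Ob mi_Hom by metis

lemma comp_pl:
  assumes "f \<in> Hom A X Y" "f' \<in> Hom A X Y" "g \<in> Hom A Y Z"
  shows "g \<cdot> (f \<oplus> f') = (g \<cdot> f) \<oplus> (g \<cdot> f')"
  using preadd assms unfolding preadditive_def by blast

lemma pl_comp:
  assumes "f \<in> Hom A X Y" "g \<in> Hom A Y Z" "g' \<in> Hom A Y Z"
  shows "(g \<oplus> g') \<cdot> f = (g \<cdot> f) \<oplus> (g' \<cdot> f)"
  using preadd assms unfolding preadditive_def by blast

lemma comp_zr:
  assumes g: "g \<in> Hom A Y Z" and X: "X \<in> Ob A"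
  shows "g \<cdot> zr X Y = zr X Z"
proof -
  have z: "zr X Y \<in> Hom A X Y" using zr_Hom X Hom_Ob[OF g] by blast
  have gz: "g \<cdot> zr X Y \<in> Hom A X Z" using Comp_Hom[OF z g] .
  have "(g \<cdot> zr X Y) \<oplus> (g \<cdot> zr X Y) = zr X Z \<oplus> (g \<cdot> zr X Y)"
    using comp_pl[OF z z g] pl_zr[OF z] pl_zr[OF gz] by simp
  then show ?thesis using pl_cancel[OF gz gz zr_Hom[OF X Hom_Ob(2)[OF g]]] by simp
qed

lemma zr_comp:
  assumes f: "f \<in> Hom A X Y" and Z: "Z \<in> Ob A"
  shows "zr Y Z \<cdot> f = zr X Z"
proof -
  have z: "zr Y Z \<in> Hom A Y Z" using zr_Hom Z Hom_Ob[OF f] by blast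
  have gz: "zr Y Z \<cdot> f \<in> Hom A X Z" using Comp_Hom[OF f z] .
  have "(zr Y Z \<cdot> f) \<oplus> (zr Y Z \<cdot> f) = zr X Z \<oplus> (zr Y Z \<cdot> f)"
    using pl_comp[OF f z z] pl_zr[OF z] pl_zr[OF gz] by simp
  then show ?thesis using pl_cancel[OF gz gz zr_Hom[OF Hom_Ob(1)[OF f] Z]] by simp
qed

lemma comp_mi:
  assumes f: "f \<in> Hom A X Y" "f' \<in> Hom A X Y" and g: "g \<in> Hom A Y Z"
  shows "g \<cdot> (f \<ominus> f') = (g \<cdot> f) \<ominus> (g \<cdot> f')"
proof -
  note m = mi_Hom[OF f]
  have "(g \<cdot> (f \<ominus> f')) \<oplus> (g \<cdot> f') = g \<cdot> f"
    using comp_pl[OF m f(2) g] mi_pl[OF f] by simp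
  then show ?thesis using pl_mi[OF Comp_Hom[OF m g] Comp_Hom[OF f(2) g]] by simp
qed

lemma mi_comp:
  assumes f: "f \<in> Hom A X Y" and g: "g \<in> Hom A Y Z" "g' \<in> Hom A Y Z"
  shows "(g \<ominus> g') \<cdot> f = (g \<cdot> f) \<ominus> (g' \<cdot> f)"
proof -
  note m = mi_Hom[OF g]
  have "((g \<ominus> g') \<cdot> f) \<oplus> (g' \<cdot> f) = g \<cdot> f"
    using pl_comp[OF f m g(2)] mi_pl[OF g] by simp
  then show ?thesis using pl_mi[OF Comp_Hom[OF f m] Comp_Hom[OF f g(2)]] by simp
qed

lemma zero_ob_exists: "\<exists>Z. zero_ob A Z"
  using abel by (simp add: abelian_def)

lemma zero_ob_Hom:
  assumes Z: "zero_ob A Z"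
  shows "f \<in> Hom A X Z \<Longrightarrow> f = zr X Z" "f \<in> Hom A Z X \<Longrightarrow> f = zr Z X"
  using Z Hom_Ob zr_Hom[of X Z] zr_Hom[of Z X] unfolding zero_ob_def by blast+

lemma zero_mor_iff:
  assumes f: "f \<in> Hom A X Y"
  shows "zero_mor A f \<longleftrightarrow> f = zr X Y"
proof
  assume "zero_mor A f"
  then obtain Z g h where Z: "zero_ob A Z" and g: "g \<in> Hom A X Z" and h: "h \<in> Hom A Z Y" and e: "f = h \<cdot> g"
    using f by (auto simp: zero_mor_def Hom_def)
  then show "f = zr X Y" using zero_ob_Hom(1)[OF Z g] comp_zr[OF h Hom_Ob(1)[OF f]] by simp
next
  assume e: "f = zr X Y"
  obtain Z where Z: "zero_ob A Z" using zero_ob_exists by blast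
  then have o: "X \<in> Ob A" "Y \<in> Ob A" "Z \<in> Ob A" using Hom_Ob[OF f] by (auto simp: zero_ob_def)
  then have "zr X Z \<in> Hom A X Z" "zr Z Y \<in> Hom A Z Y" "f = zr Z Y \<cdot> zr X Z"
    using zr_Hom comp_zr[OF zr_Hom[of Z Y]] e by auto
  then show "zero_mor A f" using Z HomD[OF f] unfolding zero_mor_def
    by (intro conjI exI[of _ Z] bexI[of _ "zr X Z"] bexI[of _ "zr Z Y"]) simp_all
qed

lemma monicI:
  assumes f: "f \<in> Hom A X Y" and "\<And>W g. g \<in> Hom A W X \<Longrightarrow> f \<cdot> g = zr W Y \<Longrightarrow> g = zr W X"
  shows "monic A f"
proof -
  have "g = h" if g: "g \<in> Hom A W X" and h: "h \<in> Hom A W X" and e: "f \<cdot> g = f \<cdot> h" for W g h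
  proof -
    have "f \<cdot> (g \<ominus> h) = zr W Y"
      using comp_mi[OF g h f] mi_self[OF Comp_Hom[OF g f]] e by simp
    then show ?thesis using assms(2)[OF mi_Hom[OF g h]] mi_eq_zr[OF g h] by simp
  qed
  then show ?thesis using HomD[OF f] unfolding monic_def by auto
qed

lemma monicD:
  assumes "monic A f" "f \<in> Hom A X Y" "g \<in> Hom A W X" "h \<in> Hom A W X" "f \<cdot> g = f \<cdot> h"
  shows "g = h"
  using assms HomD[OF assms(2)] unfolding monic_def by blast

lemma monic_zrD:
  assumes "monic A f" "f \<in> Hom A X Y" "g \<in> Hom A W X" "f \<cdot> g = zr W Y"
  shows "g = zr W X"
  using monicD[OF assms(1-3) zr_Hom] assms comp_zr[OF assms(2)] Hom_Ob[OF assms(2)] Hom_Ob[OF assms(3)] by simp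

lemma epicI:
  assumes f: "f \<in> Hom A X Y" and "\<And>Z g. g \<in> Hom A Y Z \<Longrightarrow> g \<cdot> f = zr X Z \<Longrightarrow> g = zr Y Z"
  shows "epic A f"
proof -
  have "g = h" if g: "g \<in> Hom A Y Z" and h: "h \<in> Hom A Y Z" and e: "g \<cdot> f = h \<cdot> f" for Z g h
  proof -
    have "(g \<ominus> h) \<cdot> f = zr X Z"
      using mi_comp[OF f g h] mi_self[OF Comp_Hom[OF f g]] e by simp
    then show ?thesis using assms(2)[OF mi_Hom[OF g h]] mi_eq_zr[OF g h] by simp
  qed
  then show ?thesis using HomD[OF f] unfolding epic_def by auto
qed

lemma epicD:
  assumes "epic A f" "f \<in> Hom A X Y" "g \<in> Hom A Y Z" "h \<in> Hom A Y Z" "g \<cdot> f = h \<cdot> f"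
  shows "g = h"
  using assms HomD[OF assms(2)] unfolding epic_def by blast

lemma kernel_exists:
  assumes f: "f \<in> Hom A X Y"
  obtains K k where "k \<in> Hom A K X" "is_kernel A f k"
proof -
  have "f \<in> Mor A" using f HomD by blast
  then obtain k where k: "is_kernel A f k" using abel unfolding abelian_def by blast
  then have "k \<in> Hom A (Dom A k) X" using HomD[OF f] by (auto simp: is_kernel_def Hom_def)
  with k that show ?thesis by blast
qed

lemma kernelD:
  assumes k: "is_kernel A f k" and f: "f \<in> Hom A X Y" and kH: "k \<in> Hom A K X"
  shows "f \<cdot> k = zr K Y" "monic A k"
    "g \<in> Hom A W X \<Longrightarrow> f \<cdot> g = zr W Y \<Longrightarrow> \<exists>h \<in> Hom A W K. k \<cdot> h = g"
proof -
  note fH = HomD[OF f] and kH' = HomD[OF kH]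
  show z: "f \<cdot> k = zr K Y" using k zero_mor_iff[OF Comp_Hom[OF kH f]] by (simp add: is_kernel_def)
  have ex1: "\<exists>!h. h \<in> Hom A W K \<and> k \<cdot> h = g" if g: "g \<in> Hom A W X" and "f \<cdot> g = zr W Y" for W g
    using k zero_mor_iff[OF Comp_Hom[OF g f]] that fH kH' unfolding is_kernel_def by blast
  show "g \<in> Hom A W X \<Longrightarrow> f \<cdot> g = zr W Y \<Longrightarrow> \<exists>h \<in> Hom A W K. k \<cdot> h = g" using ex1[of g W] by blast
  show "monic A k"
  proof (rule monicI[OF kH])
    fix W g assume g: "g \<in> Hom A W K" and e: "k \<cdot> g = zr W X"
    have W: "W \<in> Ob A" and K: "K \<in> Ob A" using Hom_Ob[OF g] by auto
    have "f \<cdot> (k \<cdot> g) = zr W Y" using e comp_zr[OF f W] by simp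
    from ex1[OF Comp_Hom[OF g kH] this] show "g = zr W K"
      using g e zr_Hom[OF W K] comp_zr[OF kH W] by metis
  qed
qed

lemma cokernel_exists:
  assumes f: "f \<in> Hom A X Y"
  obtains Z c where "c \<in> Hom A Y Z" "is_cokernel A f c"
proof -
  have "f \<in> Mor A" using f HomD by blast
  then obtain c where c: "is_cokernel A f c" using abel unfolding abelian_def by blast
  then have "c \<in> Hom A Y (Cod A c)" using HomD[OF f] by (auto simp: is_cokernel_def Hom_def)
  with c that show ?thesis by blast
qed

lemma cokernelD:
  assumes c: "is_cokernel A f c" and f: "f \<in> Hom A X Y" and cH: "c \<in> Hom A Y Z"
  shows "c \<cdot> f = zr X Z" "epic A c"
    "g \<in> Hom A Y W \<Longrightarrow> g \<cdot> f = zr X W \<Longrightarrow> \<exists>h \<in> Hom A Z W. h \<cdot> c = g"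
proof -
  note fH = HomD[OF f] and cH' = HomD[OF cH]
  show z: "c \<cdot> f = zr X Z" using c zero_mor_iff[OF Comp_Hom[OF f cH]] by (simp add: is_cokernel_def)
  have ex1: "\<exists>!h. h \<in> Hom A Z W \<and> h \<cdot> c = g" if g: "g \<in> Hom A Y W" and "g \<cdot> f = zr X W" for W g
    using c zero_mor_iff[OF Comp_Hom[OF f g]] that fH cH' unfolding is_cokernel_def by blast
  show "g \<in> Hom A Y W \<Longrightarrow> g \<cdot> f = zr X W \<Longrightarrow> \<exists>h \<in> Hom A Z W. h \<cdot> c = g" using ex1[of g W] by blast
  show "epic A c"
  proof (rule epicI[OF cH])
    fix W g assume g: "g \<in> Hom A Z W" and e: "g \<cdot> c = zr Y W"
    have W: "W \<in> Ob A" and Z: "Z \<in> Ob A" using Hom_Ob[OF g] by auto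
    have "(g \<cdot> c) \<cdot> f = zr X W" using e zr_comp[OF f W] by simp
    from ex1[OF Comp_Hom[OF cH g] this] show "g = zr Z W"
      using g e zr_Hom[OF Z W] zr_comp[OF cH W] by metis
  qed
qed

lemma cokernelI:
  assumes f: "f \<in> Hom A X Y" and c: "c \<in> Hom A Y Z" and z: "c \<cdot> f = zr X Z" and e: "epic A c"
    and ex: "\<And>W g. g \<in> Hom A Y W \<Longrightarrow> g \<cdot> f = zr X W \<Longrightarrow> \<exists>h \<in> Hom A Z W. h \<cdot> c = g"
  shows "is_cokernel A f c"
  unfolding is_cokernel_def
proof (intro conjI allI ballI impI)
  show "f \<in> Mor A" "c \<in> Mor A" "Dom A c = Cod A f" using HomD[OF f] HomD[OF c] by auto
  show "zero_mor A (c \<cdot> f)" using z zero_mor_iff[OF Comp_Hom[OF f c]] by simp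
  fix W g assume "g \<in> Hom A (Cod A f) W" and gz: "zero_mor A (g \<cdot> f)"
  then have g: "g \<in> Hom A Y W" using HomD[OF f] by simp
  obtain h where h: "h \<in> Hom A Z W" "h \<cdot> c = g"
    using ex[OF g] gz zero_mor_iff[OF Comp_Hom[OF f g]] by blast
  have Z: "Cod A c = Z" using HomD[OF c] by blast
  show "\<exists>!h. h \<in> Hom A (Cod A c) W \<and> h \<cdot> c = g"
    unfolding Z
  proof (rule ex1I[of _ h])
    fix h' assume h': "h' \<in> Hom A Z W \<and> h' \<cdot> c = g"
    show "h' = h" by (rule epicD[OF e c]) (use h h' in simp_all)
  qed (use h in simp)
qed

text \<open>A monomorphism is the kernel of its cokernel, an epimorphism the cokernel of its kernel.\<close>

lemma monic_kernel:
  assumes f: "monic A f" "f \<in> Hom A X Y" and c: "is_cokernel A f c" "c \<in> Hom A Y Z"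
    and g: "g \<in> Hom A W Y" "c \<cdot> g = zr W Z"
  shows "\<exists>h \<in> Hom A W X. f \<cdot> h = g"
proof -
  obtain d where d: "is_kernel A d f" using abel f(1) unfolding abelian_def by blast
  then have dH: "d \<in> Hom A Y (Cod A d)" using HomD[OF f(2)] by (auto simp: is_kernel_def Hom_def)
  obtain d' where d': "d' \<in> Hom A Z (Cod A d)" "d' \<cdot> c = d"
    using cokernelD(3)[OF c(1) f(2) c(2) dH] kernelD(1)[OF d dH f(2)] by blast
  have "d \<cdot> g = d' \<cdot> (c \<cdot> g)" using Comp_assoc[OF g(1) c(2) d'(1)] d'(2) by simp
  then have "d \<cdot> g = zr W (Cod A d)" using g(2) comp_zr[OF d'(1) Hom_Ob(1)[OF g(1)]] by simp
  then show ?thesis using kernelD(3)[OF d dH f(2) g(1)] by blast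
qed

lemma epic_cokernel:
  assumes f: "epic A f" "f \<in> Hom A X Y" and k: "is_kernel A f k" "k \<in> Hom A K X"
    and g: "g \<in> Hom A X W" "g \<cdot> k = zr K W"
  shows "\<exists>h \<in> Hom A Y W. h \<cdot> f = g"
proof -
  obtain d where d: "is_cokernel A d f" using abel f(1) unfolding abelian_def by blast
  then have dH: "d \<in> Hom A (Dom A d) X" using HomD[OF f(2)] by (auto simp: is_cokernel_def Hom_def)
  obtain d' where d': "d' \<in> Hom A (Dom A d) K" "k \<cdot> d' = d"
    using kernelD(3)[OF k(1) f(2) k(2) dH] cokernelD(1)[OF d dH f(2)] by blast
  have "g \<cdot> d = (g \<cdot> k) \<cdot> d'" using Comp_assoc[OF d'(1) k(2) g(1)] d'(2) by simp
  then have "g \<cdot> d = zr (Dom A d) W" using g(2) zr_comp[OF d'(1) Hom_Ob(2)[OF g(1)]] by simp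
  then show ?thesis using cokernelD(3)[OF d dH f(2) g(1)] by blast
qed

lemma coprod_proj:
  assumes S: "is_coproduct A I X S inc" and i: "i \<in> I"
  obtains p where "p \<in> Hom A S (X i)" "p \<cdot> inc i = Ide A (X i)"
    "\<And>j. j \<in> I \<Longrightarrow> j \<noteq> i \<Longrightarrow> p \<cdot> inc j = zr (X j) (X i)"
proof -
  have "\<forall>j\<in>I. (if j = i then Ide A (X i) else zr (X j) (X i)) \<in> Hom A (X j) (X i)"
    using coprodD(2)[OF S] Ide_Hom zr_Hom i by auto
  from coprod_exB[OF S coprodD(2)[OF S i] this] obtain p where p: "p \<in> Hom A S (X i)"
    "\<forall>j\<in>I. p \<cdot> inc j = (if j = i then Ide A (X i) else zr (X j) (X i))" by blast
  show ?thesis by (rule that[OF p(1)]) (use p(2) i in simp_all)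
qed

lemma coprod_retract: "is_coproduct A I X S inc \<Longrightarrow> i \<in> I \<Longrightarrow> retract (X i) S"
proof -
  assume S: "is_coproduct A I X S inc" and i: "i \<in> I"
  obtain p where "p \<in> Hom A S (X i)" "p \<cdot> inc i = Ide A (X i)" by (rule coprod_proj[OF S i])
  with coprodD(3)[OF S i] show ?thesis unfolding retract_def by blast
qed

text \<open>The direct sum of two objects, in the form used by \<^const>\<open>Add\<close>.\<close>

abbreviation sum2 where
  "sum2 X Z Y f s \<equiv> is_coproduct A UNIV (\<lambda>b. if b then X else Z) Y (\<lambda>b. if b then f else s)"

lemma sum2_Hom:
  assumes "sum2 X Z Y f s"
  shows "f \<in> Hom A X Y" "s \<in> Hom A Z Y"
  using coprodD(3)[OF assms, of True] coprodD(3)[OF assms, of False] by simp_all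

lemma biproduct_sum2:
  assumes i: "i \<in> Hom A X Y" and j: "j \<in> Hom A Z Y" and p: "p \<in> Hom A Y X" and q: "q \<in> Hom A Y Z"
    and e: "p \<cdot> i = Ide A X" "q \<cdot> j = Ide A Z" "p \<cdot> j = zr Z X" "q \<cdot> i = zr X Z"
      "(i \<cdot> p) \<oplus> (j \<cdot> q) = Ide A Y"
  shows "sum2 X Z Y i j"
proof (rule coprodI, goal_cases)
  case 1 then show ?case using Hom_Ob[OF i] by blast
next
  case (2 b) then show ?case using i j by simp
next
  case (3 T f)
  have f: "f True \<in> Hom A X T" "f False \<in> Hom A Z T" using 3(2)[of True] 3(2)[of False] by auto
  note a = Comp_Hom[OF p f(1)] and b = Comp_Hom[OF q f(2)]
  let ?h = "(f True \<cdot> p) \<oplus> (f False \<cdot> q)"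
  have "?h \<in> Hom A Y T" by (rule pl_Hom[OF a b])
  moreover have "?h \<cdot> i = f True"
    using pl_comp[OF i a b] Comp_assoc[OF i p f(1)] Comp_assoc[OF i q f(2)] e
      comp_zr[OF f(2) Hom_Ob(1)[OF i]] Comp_Ide[OF f(1)] pl_zr[OF f(1)] by simp
  moreover have "?h \<cdot> j = f False"
    using pl_comp[OF j a b] Comp_assoc[OF j p f(1)] Comp_assoc[OF j q f(2)] e
      comp_zr[OF f(1) Hom_Ob(1)[OF j]] Comp_Ide[OF f(2)] pl_zr[OF f(2)] by simp
  ultimately show ?case by (intro exI[of _ ?h]) auto
next
  case (4 T h h')
  have x: "k = ((k \<cdot> i) \<cdot> p) \<oplus> ((k \<cdot> j) \<cdot> q)" if k: "k \<in> Hom A Y T" for k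
    using comp_pl[OF Comp_Hom[OF p i] Comp_Hom[OF q j] k] e(5) Comp_Ide[OF k]
      Comp_assoc[OF p i k] Comp_assoc[OF q j k] by simp
  have "h \<cdot> i = h' \<cdot> i" "h \<cdot> j = h' \<cdot> j" using 4(3)[of True] 4(3)[of False] by auto
  then show ?case using x[OF 4(1)] x[OF 4(2)] by simp
qed

text \<open>
  The projection to \<open>X\<close> is obtained by factoring \<open>id - s c\<close> through the kernel \<open>f\<close> of \<open>c\<close>.
\<close>

lemma split_mono_sum2:
  assumes f: "monic A f" "f \<in> Hom A X Y" and c: "is_cokernel A f c" "c \<in> Hom A Y Z"
    and s: "s \<in> Hom A Z Y" "c \<cdot> s = Ide A Z"
  shows "sum2 X Z Y f s"
proof -
  have o: "X \<in> Ob A" "Y \<in> Ob A" "Z \<in> Ob A" using Hom_Ob[OF f(2)] Hom_Ob[OF c(2)] by auto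
  note sc = Comp_Hom[OF c(2) s(1)] and I = Ide_Hom[OF o(2)]
  note d = mi_Hom[OF I sc]
  have "c \<cdot> (Ide A Y \<ominus> (s \<cdot> c)) = zr Y Z"
    using comp_mi[OF I sc c(2)] Comp_assoc[OF c(2) s(1) c(2)] s(2) Comp_Ide[OF c(2)] Ide_Comp[OF c(2)]
      mi_self[OF c(2)] by simp
  then obtain p where p: "p \<in> Hom A Y X" "f \<cdot> p = Ide A Y \<ominus> (s \<cdot> c)"
    using monic_kernel[OF f c d] by blast
  have "f \<cdot> (p \<cdot> f) = f \<cdot> Ide A X"
    using Comp_assoc[OF f(2) p(1) f(2)] p(2) mi_comp[OF f(2) I sc] Comp_assoc[OF f(2) c(2) s(1)]
      cokernelD(1)[OF c(1) f(2) c(2)] comp_zr[OF s(1) o(1)] Ide_Comp[OF f(2)] Comp_Ide[OF f(2)]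
      mi_zr[OF f(2)] by simp
  then have pf: "p \<cdot> f = Ide A X" using monicD[OF f Comp_Hom[OF f(2) p(1)] Ide_Hom[OF o(1)]] by blast
  have "f \<cdot> (p \<cdot> s) = zr Z Y"
    using Comp_assoc[OF s(1) p(1) f(2)] p(2) mi_comp[OF s(1) I sc] Comp_assoc[OF s(1) c(2) s(1)] s(2)
      Ide_Comp[OF s(1)] Comp_Ide[OF s(1)] mi_self[OF s(1)] by simp
  then have ps: "p \<cdot> s = zr Z X" using monic_zrD[OF f Comp_Hom[OF s(1) p(1)]] by blast
  show ?thesis
    by (rule biproduct_sum2[OF f(2) s(1) p(1) c(2) pf s(2) ps cokernelD(1)[OF c(1) f(2) c(2)]])
      (simp add: p(2) mi_pl[OF I sc])
qed

text \<open>
  The complement is the kernel of the retraction.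
\<close>

lemma retract_sum2:
  assumes "retract X Y"
  obtains Z f s where "sum2 X Z Y f s"
proof -
  obtain s r where s: "s \<in> Hom A X Y" "r \<in> Hom A Y X" "r \<cdot> s = Ide A X" by (rule retractE[OF assms])
  obtain K k where k: "k \<in> Hom A K Y" "is_kernel A r k" by (rule kernel_exists[OF s(2)])
  note kD = kernelD[OF k(2) s(2) k(1)]
  have o: "X \<in> Ob A" "Y \<in> Ob A" "K \<in> Ob A" using Hom_Ob[OF s(1)] Hom_Ob[OF k(1)] by auto
  note sr = Comp_Hom[OF s(2) s(1)] and I = Ide_Hom[OF o(2)]
  have "r \<cdot> (Ide A Y \<ominus> (s \<cdot> r)) = zr Y X"
    using comp_mi[OF I sr s(2)] Comp_assoc[OF s(2) s(1) s(2)] s(3) Comp_Ide[OF s(2)] Ide_Comp[OF s(2)]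
      mi_self[OF s(2)] by simp
  then obtain q where q: "q \<in> Hom A Y K" "k \<cdot> q = Ide A Y \<ominus> (s \<cdot> r)"
    using kD(3)[OF mi_Hom[OF I sr]] by blast
  have "k \<cdot> (q \<cdot> k) = k \<cdot> Ide A K"
    using Comp_assoc[OF k(1) q(1) k(1)] q(2) mi_comp[OF k(1) I sr] Comp_assoc[OF k(1) s(2) s(1)]
      kD(1) comp_zr[OF s(1) o(3)] Ide_Comp[OF k(1)] Comp_Ide[OF k(1)] mi_zr[OF k(1)] by simp
  then have qk: "q \<cdot> k = Ide A K" using monicD[OF kD(2) k(1) Comp_Hom[OF k(1) q(1)] Ide_Hom[OF o(3)]] by blast
  have "k \<cdot> (q \<cdot> s) = zr X Y"
    using Comp_assoc[OF s(1) q(1) k(1)] q(2) mi_comp[OF s(1) I sr] Comp_assoc[OF s(1) s(2) s(1)] s(3)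
      Ide_Comp[OF s(1)] Comp_Ide[OF s(1)] mi_self[OF s(1)] by simp
  then have qs: "q \<cdot> s = zr X K" using monic_zrD[OF kD(2) k(1) Comp_Hom[OF s(1) q(1)]] by blast
  have "(s \<cdot> r) \<oplus> (k \<cdot> q) = Ide A Y"
    using mi_pl[OF I sr] q(2) pl_comm[OF sr mi_Hom[OF I sr]] by simp
  then show ?thesis using that biproduct_sum2[OF s(1) k(1) s(2) q(1) s(3) qk kD(1) qs] by blast
qed

lemma sum2_cokernel:
  assumes S: "sum2 X Z Y f s"
  obtains c where "monic A f" "is_cokernel A f c" "c \<in> Hom A Y Z" "c \<cdot> s = Ide A Z"
proof -
  note h = sum2_Hom[OF S]
  have o: "X \<in> Ob A" "Z \<in> Ob A" using Hom_Ob h by auto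
  obtain c where c: "c \<in> Hom A Y Z" "c \<cdot> s = Ide A Z" "c \<cdot> f = zr X Z"
  proof -
    obtain c where "c \<in> Hom A Y (if False then X else Z)"
      "c \<cdot> (if False then f else s) = Ide A (if False then X else Z)"
      "\<And>j. j \<in> UNIV \<Longrightarrow> j \<noteq> False \<Longrightarrow>
        c \<cdot> (if j then f else s) = zr (if j then X else Z) (if False then X else Z)"
      using coprod_proj[OF S, of False] by blast
    then show ?thesis using that[of c] by (metis (full_types) UNIV_I)
  qed
  obtain p where p: "p \<in> Hom A Y X" "p \<cdot> f = Ide A X"
  proof -
    obtain p where "p \<in> Hom A Y (if True then X else Z)"
      "p \<cdot> (if True then f else s) = Ide A (if True then X else Z)"
      using coprod_proj[OF S, of True] by blast
    then show ?thesis using that[of p] by simp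
  qed
  have m: "monic A f"
  proof (rule monicI[OF h(1)])
    fix W g assume g: "g \<in> Hom A W X" "f \<cdot> g = zr W Y"
    then show "g = zr W X"
      using comp_reduce[OF p(2) h(1) p(1) g(1)] comp_zr[OF p(1) Hom_Ob(1)[OF g(1)]] Ide_Comp[OF g(1)] by simp
  qed
  have ep: "epic A c"
  proof (rule epicI[OF c(1)])
    fix T g assume g: "g \<in> Hom A Z T" "g \<cdot> c = zr Y T"
    show "g = zr Z T"
      using Comp_assoc[OF h(2) c(1) g(1)] g(2) c(2) Comp_Ide[OF g(1)] zr_comp[OF h(2) Hom_Ob(2)[OF g(1)]]
      by simp
  qed
  have "is_cokernel A f c"
  proof (rule cokernelI[OF h(1) c(1,3) ep])
    fix T g assume g: "g \<in> Hom A Y T" "g \<cdot> f = zr X T"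
    note gs = Comp_Hom[OF h(2) g(1)]
    have "(g \<cdot> s) \<cdot> c = g"
    proof (rule coprod_eq[OF S Comp_Hom[OF c(1) gs] g(1)])
      fix b :: bool
      show "((g \<cdot> s) \<cdot> c) \<cdot> (if b then f else s) = g \<cdot> (if b then f else s)"
        using Comp_assoc[OF h(1) c(1) gs] Comp_assoc[OF h(2) c(1) gs] c g(2) comp_zr[OF gs o(1)]
          Comp_Ide[OF gs] by simp
    qed
    then show "\<exists>h\<in>Hom A Z T. h \<cdot> c = g" using gs by blast
  qed
  with m c that show ?thesis by blast
qed

end

section \<open>Categories of functors into an abelian category\<close>

locale functors = abelian_cat A pl + J: category J + universe U
  for A :: "('o, 'm) cat" (structure) and pl and J :: "('v, 'p) cat" and U :: "'u itself" +
  assumes cocomp: "cocomplete U A"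
    and small_Hom: "\<And>v w. small U (Hom J v w)"
begin

abbreviation R where "R \<equiv> fun_cat J A"

sublocale R: category R
  by (rule category_fun_cat[OF J.category_axioms category_axioms])

definition cmp :: "('v, 'p, 'o, 'm) func \<times> ('v \<Rightarrow> 'm) \<times> ('v, 'p, 'o, 'm) func \<Rightarrow> 'v \<Rightarrow> 'm" where
  "cmp h v = fst (snd h) v"

lemma R_Ob:
  assumes "F \<in> Ob R"
  shows "is_functor J A F" "v \<in> Ob J \<Longrightarrow> fob F v \<in> Ob A"
    "p \<in> Hom J v w \<Longrightarrow> fmor F p \<in> Hom A (fob F v) (fob F w)"
    "v \<in> Ob J \<Longrightarrow> fmor F (Ide J v) = Ide A (fob F v)"
    "p \<in> Hom J v w \<Longrightarrow> q \<in> Hom J w x \<Longrightarrow> fmor F (q \<cdot>\<^bsub>J\<^esub> p) = fmor F q \<cdot> fmor F p"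
proof -
  show f: "is_functor J A F" using assms by (simp add: fun_cat_Ob)
  show "v \<in> Ob J \<Longrightarrow> fob F v \<in> Ob A" "p \<in> Hom J v w \<Longrightarrow> fmor F p \<in> Hom A (fob F v) (fob F w)"
    "v \<in> Ob J \<Longrightarrow> fmor F (Ide J v) = Ide A (fob F v)"
    "p \<in> Hom J v w \<Longrightarrow> q \<in> Hom J w x \<Longrightarrow> fmor F (q \<cdot>\<^bsub>J\<^esub> p) = fmor F q \<cdot> fmor F p"
    by (fact functorD[OF f])+
qed

lemma cmp_Hom: "h \<in> Hom R F G \<Longrightarrow> v \<in> Ob J \<Longrightarrow> cmp h v \<in> Hom A (fob F v) (fob G v)"
  by (auto simp: fun_cat_Hom nat_trans_def cmp_def)

lemma cmp_nat: "h \<in> Hom R F G \<Longrightarrow> p \<in> Hom J v w \<Longrightarrow> cmp h w \<cdot> fmor F p = fmor G p \<cdot> cmp h v"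
  by (auto simp: fun_cat_Hom nat_trans_def cmp_def)

lemma cmp_comp:
  "h \<in> Hom R F G \<Longrightarrow> k \<in> Hom R G H \<Longrightarrow> v \<in> Ob J \<Longrightarrow> cmp (k \<cdot>\<^bsub>R\<^esub> h) v = cmp k v \<cdot> cmp h v"
  by (auto simp: fun_cat_Hom cmp_def)

lemma cmp_ide: "v \<in> Ob J \<Longrightarrow> cmp (Ide R F) v = Ide A (fob F v)"
  by (simp add: cmp_def)

lemma R_ext:
  assumes "h \<in> Hom R F G" "h' \<in> Hom R F G" "\<And>v. v \<in> Ob J \<Longrightarrow> cmp h v = cmp h' v"
  shows "h = h'"
proof -
  obtain t t' where t: "h = (F, t, G)" "t \<in> extensional (Ob J)" "h' = (F, t', G)" "t' \<in> extensional (Ob J)"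
    using assms(1,2) by (auto simp: fun_cat_Hom)
  then have "t = t'" using assms(3) by (intro extensionalityI[of t "Ob J" t']) (auto simp: cmp_def)
  then show ?thesis using t by simp
qed

lemma R_homI:
  assumes F: "F \<in> Ob R" and G: "G \<in> Ob R"
    and t: "\<And>v. v \<in> Ob J \<Longrightarrow> t v \<in> Hom A (fob F v) (fob G v)"
    and n: "\<And>v w p. p \<in> Hom J v w \<Longrightarrow> t w \<cdot> fmor F p = fmor G p \<cdot> t v"
  obtains h where "h \<in> Hom R F G" "\<And>v. v \<in> Ob J \<Longrightarrow> cmp h v = t v"
proof -
  have "nat_trans J A F G (restrict t (Ob J))"
    unfolding nat_trans_def using t n J.Hom_Ob by simp
  then have "(F, restrict t (Ob J), G) \<in> Hom R F G" using F G by (simp add: fun_cat_Hom)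
  then show ?thesis using that[of "(F, restrict t (Ob J), G)"] by (simp add: cmp_def)
qed

lemma R_obI:
  assumes X: "\<And>v. v \<in> Ob J \<Longrightarrow> X v \<in> Ob A"
    and m: "\<And>v w p. p \<in> Hom J v w \<Longrightarrow> m p \<in> Hom A (X v) (X w)"
    and i: "\<And>v. v \<in> Ob J \<Longrightarrow> m (Ide J v) = Ide A (X v)"
    and c: "\<And>v w x p q. p \<in> Hom J v w \<Longrightarrow> q \<in> Hom J w x \<Longrightarrow> m (q \<cdot>\<^bsub>J\<^esub> p) = m q \<cdot> m p"
  obtains F where "F \<in> Ob R" "\<And>v. v \<in> Ob J \<Longrightarrow> fob F v = X v"
    "\<And>v w p. p \<in> Hom J v w \<Longrightarrow> fmor F p = m p"
proof -
  let ?F = "\<lparr> fob = restrict X (Ob J), fmor = restrict m (Mor J) \<rparr>"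
  have "is_functor J A ?F"
    unfolding is_functor_def
  proof (intro conjI ballI allI)
    show "fob ?F v \<in> Ob A" if "v \<in> Ob J" for v using X that by simp
    show "fmor ?F (Ide J v) = Ide A (fob ?F v)" if "v \<in> Ob J" for v using i that J.ide_arr by simp
    fix v w p assume p: "p \<in> Hom J v w"
    note P = J.HomD[OF p] J.Hom_Ob[OF p]
    show "fmor ?F p \<in> Hom A (fob ?F v) (fob ?F w)" using m[OF p] P by simp
    fix x q assume q: "q \<in> Hom J w x"
    show "fmor ?F (q \<cdot>\<^bsub>J\<^esub> p) = fmor ?F q \<cdot> fmor ?F p"
      using c[OF p q] P J.HomD[OF q] J.HomD[OF J.Comp_Hom[OF p q]] by simp
  qed
  then have "?F \<in> Ob R" by (simp add: fun_cat_Ob)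
  then show ?thesis using that[of ?F] by (auto simp: Hom_def)
qed

lemma inverse_pair_cmp:
  assumes "R.inverse_pair F G f g" "v \<in> Ob J"
  shows "inverse_pair (fob F v) (fob G v) (cmp f v) (cmp g v)"
proof -
  have f: "f \<in> Hom R F G" and g: "g \<in> Hom R G F" and e: "g \<cdot>\<^bsub>R\<^esub> f = Ide R F" "f \<cdot>\<^bsub>R\<^esub> g = Ide R G"
    using assms(1) by (auto simp only: R.inverse_pair_def)
  have "cmp g v \<cdot> cmp f v = Ide A (fob F v)" "cmp f v \<cdot> cmp g v = Ide A (fob G v)"
    using cmp_comp[OF f g assms(2)] cmp_comp[OF g f assms(2)] e cmp_ide[OF assms(2)] by simp_all
  then show ?thesis using cmp_Hom[OF f assms(2)] cmp_Hom[OF g assms(2)] by (simp add: inverse_pair_def)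
qed

text \<open>
  The pointwise cokernels of \<open>h\<close> form a functor. The transformation to it agrees with the zero
  transformation after composition with \<open>h\<close>, so it vanishes if \<open>h\<close> is epic.
\<close>

lemma epic_cmp:
  assumes e: "epic R h" and h: "h \<in> Hom R F G" and v: "v \<in> Ob J"
  shows "epic A (cmp h v)"
proof -
  have F: "F \<in> Ob R" and G: "G \<in> Ob R" using R.Hom_Ob[OF h] by auto
  note Fm = R_Ob[OF F] and Gm = R_Ob[OF G] and hH = cmp_Hom[OF h] and hn = cmp_nat[OF h]
  have "\<exists>Z c. c \<in> Hom A (fob G w) Z \<and> is_cokernel A (cmp h w) c" if w: "w \<in> Ob J" for w
    by (rule cokernel_exists[OF hH[OF w]]) blast
  then obtain Z c where c: "\<And>w. w \<in> Ob J \<Longrightarrow> c w \<in> Hom A (fob G w) (Z w)"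
    "\<And>w. w \<in> Ob J \<Longrightarrow> is_cokernel A (cmp h w) (c w)" by metis
  note cD = cokernelD[OF c(2) hH c(1)]
  have "\<forall>p \<in> Mor J. \<exists>m. m \<in> Hom A (Z (Dom J p)) (Z (Cod J p)) \<and> m \<cdot> c (Dom J p) = c (Cod J p) \<cdot> fmor G p"
  proof
    fix p assume "p \<in> Mor J"
    then have p: "p \<in> Hom J (Dom J p) (Cod J p)" by (simp add: Hom_def)
    note o = J.Hom_Ob[OF p]
    have "(c (Cod J p) \<cdot> fmor G p) \<cdot> cmp h (Dom J p) = zr (fob F (Dom J p)) (Z (Cod J p))"
      using Comp_assoc[OF hH[OF o(1)] Gm(3)[OF p] c(1)[OF o(2)]] hn[OF p]
        Comp_assoc[OF Fm(3)[OF p] hH[OF o(2)] c(1)[OF o(2)]] cD(1)[OF o(2) o(2) o(2)]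
        zr_comp[OF Fm(3)[OF p] Hom_Ob(2)[OF c(1)[OF o(2)]]] by simp
    from cD(3)[OF o(1) o(1) o(1) Comp_Hom[OF Gm(3)[OF p] c(1)[OF o(2)]] this]
    show "\<exists>m. m \<in> Hom A (Z (Dom J p)) (Z (Cod J p)) \<and> m \<cdot> c (Dom J p) = c (Cod J p) \<cdot> fmor G p" by blast
  qed
  then obtain m where "\<forall>p \<in> Mor J. m p \<in> Hom A (Z (Dom J p)) (Z (Cod J p)) \<and>
      m p \<cdot> c (Dom J p) = c (Cod J p) \<cdot> fmor G p" by (rule bchoice[THEN exE])
  then have m: "\<And>p x y. p \<in> Hom J x y \<Longrightarrow> m p \<in> Hom A (Z x) (Z y)"
    "\<And>p x y. p \<in> Hom J x y \<Longrightarrow> m p \<cdot> c x = c y \<cdot> fmor G p"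
    by (auto simp: Hom_def[of J])
  have ZO: "Z w \<in> Ob A" if "w \<in> Ob J" for w using Hom_Ob(2)[OF c(1)[OF that]] .
  obtain H where H: "H \<in> Ob R" "\<And>w. w \<in> Ob J \<Longrightarrow> fob H w = Z w"
    "\<And>x y p. p \<in> Hom J x y \<Longrightarrow> fmor H p = m p"
  proof (rule R_obI[of Z m])
    fix x assume x: "x \<in> Ob J"
    show "m (Ide J x) = Ide A (Z x)"
    proof (rule epicD[OF cD(2)[OF x x x] c(1)[OF x] m(1)[OF J.Ide_Hom[OF x]] Ide_Hom[OF ZO[OF x]]])
      show "m (Ide J x) \<cdot> c x = Ide A (Z x) \<cdot> c x"
        using m(2)[OF J.Ide_Hom[OF x]] Gm(4)[OF x] Comp_Ide[OF c(1)[OF x]] Ide_Comp[OF c(1)[OF x]] by simp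
    qed
  next
    fix x y z p q assume p: "p \<in> Hom J x y" and q: "q \<in> Hom J y z"
    note x = J.Hom_Ob[OF p] and z = J.Hom_Ob(2)[OF q] and qp = J.Comp_Hom[OF p q]
    show "m (q \<cdot>\<^bsub>J\<^esub> p) = m q \<cdot> m p"
    proof (rule epicD[OF cD(2)[OF x(1) x(1) x(1)] c(1)[OF x(1)] m(1)[OF qp] Comp_Hom[OF m(1)[OF p] m(1)[OF q]]])
      have "(m q \<cdot> m p) \<cdot> c x = m q \<cdot> (c y \<cdot> fmor G p)"
        using Comp_assoc[OF c(1)[OF x(1)] m(1)[OF p] m(1)[OF q]] m(2)[OF p] by simp
      also have "\<dots> = c z \<cdot> (fmor G q \<cdot> fmor G p)"
        using Comp_assoc[OF Gm(3)[OF p] c(1)[OF x(2)] m(1)[OF q]] m(2)[OF q]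
          Comp_assoc[OF Gm(3)[OF p] Gm(3)[OF q] c(1)[OF z]] by simp
      finally show "m (q \<cdot>\<^bsub>J\<^esub> p) \<cdot> c x = (m q \<cdot> m p) \<cdot> c x" using m(2)[OF qp] Gm(5)[OF p q] by simp
    qed
  qed (use ZO m(1) in auto)
  have n1: "c y \<cdot> fmor G p = fmor H p \<cdot> c x" if "p \<in> Hom J x y" for p x y
    using m(2)[OF that] H(3)[OF that] by simp
  obtain c' where c': "c' \<in> Hom R G H" "\<And>w. w \<in> Ob J \<Longrightarrow> cmp c' w = c w"
    by (rule R_homI[OF G H(1), of c]) (use c H n1 in auto)
  have n2: "zr (fob G y) (Z y) \<cdot> fmor G p = fmor H p \<cdot> zr (fob G x) (Z x)" if p: "p \<in> Hom J x y" for p x y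
    using zr_comp[OF Gm(3)[OF p] ZO[OF J.Hom_Ob(2)[OF p]]] H(3)[OF p]
      comp_zr[OF m(1)[OF p] Gm(2)[OF J.Hom_Ob(1)[OF p]]] by simp
  have z0: "zr (fob G w) (Z w) \<in> Hom A (fob G w) (fob H w)" if "w \<in> Ob J" for w
    using zr_Hom[OF Gm(2)[OF that] ZO[OF that]] H(2)[OF that] by simp
  obtain z' where z': "z' \<in> Hom R G H" "\<And>w. w \<in> Ob J \<Longrightarrow> cmp z' w = zr (fob G w) (Z w)"
    by (rule R_homI[OF G H(1), of "\<lambda>w. zr (fob G w) (Z w)"]) (use z0 n2 in auto)
  have "c' \<cdot>\<^bsub>R\<^esub> h = z' \<cdot>\<^bsub>R\<^esub> h"
  proof (rule R_ext[OF R.Comp_Hom[OF h c'(1)] R.Comp_Hom[OF h z'(1)]])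
    fix w assume w: "w \<in> Ob J"
    show "cmp (c' \<cdot>\<^bsub>R\<^esub> h) w = cmp (z' \<cdot>\<^bsub>R\<^esub> h) w"
      using cmp_comp[OF h c'(1) w] cmp_comp[OF h z'(1) w] c'(2)[OF w] z'(2)[OF w] cD(1)[OF w w w]
        zr_comp[OF hH[OF w] ZO[OF w]] by simp
  qed
  then have "c' = z'" using e R.HomD[OF h] c'(1) z'(1) unfolding epic_def by blast
  then have cz: "c v = zr (fob G v) (Z v)" using c'(2)[OF v] z'(2)[OF v] by simp
  show ?thesis
  proof (rule epicI[OF hH[OF v]])
    fix W g assume g: "g \<in> Hom A (fob G v) W" "g \<cdot> cmp h v = zr (fob F v) W"
    obtain k where k: "k \<in> Hom A (Z v) W" "k \<cdot> c v = g" using cD(3)[OF v v v g] by blast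
    then show "g = zr (fob G v) W" using cz comp_zr[OF k(1) Gm(2)[OF v]] by simp
  qed
qed

lemma epic_pointwise:
  assumes h: "h \<in> Hom R F G" and e: "\<And>v. v \<in> Ob J \<Longrightarrow> epic A (cmp h v)"
  shows "epic R h"
  unfolding epic_def
proof (intro conjI allI ballI impI)
  show "h \<in> Mor R" using R.HomD[OF h] by blast
  fix H g g' assume g: "g \<in> Hom R (Cod R h) H" "g' \<in> Hom R (Cod R h) H" and eq: "g \<cdot>\<^bsub>R\<^esub> h = g' \<cdot>\<^bsub>R\<^esub> h"
  have g': "g \<in> Hom R G H" "g' \<in> Hom R G H" using g R.HomD[OF h] by auto
  show "g = g'"
  proof (rule R_ext[OF g'])
    fix v assume v: "v \<in> Ob J"
    show "cmp g v = cmp g' v"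
      by (rule epicD[OF e[OF v] cmp_Hom[OF h v] cmp_Hom[OF g'(1) v] cmp_Hom[OF g'(2) v]])
        (use cmp_comp[OF h g'(1) v] cmp_comp[OF h g'(2) v] eq in simp)
  qed
qed

text \<open>Colimits are computed pointwise.\<close>

definition ev where
  "ev D v = \<lparr> fob = (\<lambda>k. fob (fob D k) v), fmor = (\<lambda>u. cmp (fmor D u) v) \<rparr>"

lemma ev_simps [simp]: "fob (ev D v) k = fob (fob D k) v" "fmor (ev D v) u = cmp (fmor D u) v"
  by (simp_all add: ev_def)

lemma functor_ev:
  assumes D: "is_functor K R D" and v: "v \<in> Ob J"
  shows "is_functor K A (ev D v)"
  unfolding is_functor_def
proof (intro conjI ballI allI)
  note d = functorD[OF D]
  show "fob (ev D v) k \<in> Ob A" if "k \<in> Ob K" for k using R_Ob(2)[OF d(1)[OF that] v] by simp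
  show "fmor (ev D v) (Ide K k) = Ide A (fob (ev D v) k)" if "k \<in> Ob K" for k
    using d(3)[OF that] cmp_ide[OF v] by simp
  fix x y u assume u: "u \<in> Hom K x y"
  show "fmor (ev D v) u \<in> Hom A (fob (ev D v) x) (fob (ev D v) y)" using cmp_Hom[OF d(2)[OF u] v] by simp
  show "fmor (ev D v) (w \<cdot>\<^bsub>K\<^esub> u) = fmor (ev D v) w \<cdot> fmor (ev D v) u" if w: "w \<in> Hom K y z" for w z
    using d(4)[OF u w] cmp_comp[OF d(2)[OF u] d(2)[OF w] v] by simp
qed

lemma cocone_ev:
  assumes D: "is_functor K R D" and l: "is_cocone R K D L l" and v: "v \<in> Ob J"
    and K: "category K"
  shows "is_cocone A K (ev D v) (fob L v) (\<lambda>k. cmp (l k) v)"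
  unfolding is_cocone_def
proof (intro conjI ballI allI)
  note d = functorD[OF D] and c = coconeD[OF l]
  show "fob L v \<in> Ob A" by (rule R_Ob(2)[OF c(1) v])
  show "cmp (l k) v \<in> Hom A (fob (ev D v) k) (fob L v)" if "k \<in> Ob K" for k
    using cmp_Hom[OF c(2)[OF that] v] by simp
  fix i j u assume u: "u \<in> Hom K i j"
  show "cmp (l j) v \<cdot> fmor (ev D v) u = cmp (l i) v"
    using cmp_comp[OF d(2)[OF u] c(2)[OF category.Hom_Ob(2)[OF K u]] v] c(3)[OF u] by simp
qed

lemma colimit_pointwise_ob:
  assumes K: "small_cat U K" and D: "is_functor K R D"
  obtains P t where "is_colimit R K D P t"
    "\<And>v. v \<in> Ob J \<Longrightarrow> is_colimit A K (ev D v) (fob P v) (\<lambda>k. cmp (t k) v)"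
proof -
  have Kc: "category K" using K by (simp add: small_cat_def)
  interpret K: category K by (rule Kc)
  note d = functorD[OF D] and De = functor_ev[OF D]
  have "\<exists>L l. is_colimit A K (ev D v) L l" if "v \<in> Ob J" for v
    by (rule colimit_exists[OF cocomp K De[OF that]])
  then obtain L l where L: "\<And>v. v \<in> Ob J \<Longrightarrow> is_colimit A K (ev D v) (L v) (l v)" by metis
  note c = coconeD[OF colim_cocone[OF L], simplified]
  note leq = colim_eq[OF Kc De L]
  have LO: "L v \<in> Ob A" if "v \<in> Ob J" for v by (rule c(1)[OF that])
  have cc: "is_cocone A K (ev D x) (L y) (\<lambda>k. l y k \<cdot> fmor (fob D k) p)" if p: "p \<in> Hom J x y" for p x y
    unfolding is_cocone_def
  proof (intro conjI ballI allI)
    note o = J.Hom_Ob[OF p]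
    show "L y \<in> Ob A" by (rule LO[OF o(2)])
    show "l y k \<cdot> fmor (fob D k) p \<in> Hom A (fob (ev D x) k) (L y)" if k: "k \<in> Ob K" for k
      using Comp_Hom[OF R_Ob(3)[OF d(1)[OF k] p] c(2)[OF o(2) k]] by simp
    fix i j u assume u: "u \<in> Hom K i j"
    note ij = K.Hom_Ob[OF u]
    have "(l y j \<cdot> fmor (fob D j) p) \<cdot> cmp (fmor D u) x = l y j \<cdot> (cmp (fmor D u) y \<cdot> fmor (fob D i) p)"
      using Comp_assoc[OF cmp_Hom[OF d(2)[OF u] o(1)] R_Ob(3)[OF d(1)[OF ij(2)] p] c(2)[OF o(2) ij(2)]]
        cmp_nat[OF d(2)[OF u] p] by simp
    also have "\<dots> = l y i \<cdot> fmor (fob D i) p"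
      using Comp_assoc[OF R_Ob(3)[OF d(1)[OF ij(1)] p] cmp_Hom[OF d(2)[OF u] o(2)] c(2)[OF o(2) ij(2)]]
        c(3)[OF o(2) u] by simp
    finally show "(l y j \<cdot> fmor (fob D j) p) \<cdot> fmor (ev D x) u = l y i \<cdot> fmor (fob D i) p" by simp
  qed
  have "\<forall>p \<in> Mor J. \<exists>m. m \<in> Hom A (L (Dom J p)) (L (Cod J p)) \<and>
      (\<forall>k\<in>Ob K. m \<cdot> l (Dom J p) k = l (Cod J p) k \<cdot> fmor (fob D k) p)"
  proof
    fix p assume "p \<in> Mor J"
    then have p: "p \<in> Hom J (Dom J p) (Cod J p)" by (simp add: Hom_def)
    show "\<exists>m. m \<in> Hom A (L (Dom J p)) (L (Cod J p)) \<and>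
      (\<forall>k\<in>Ob K. m \<cdot> l (Dom J p) k = l (Cod J p) k \<cdot> fmor (fob D k) p)"
      using colim_ex1[OF L[OF J.Hom_Ob(1)[OF p]] cc[OF p]] by (rule ex1_implies_ex)
  qed
  then obtain m where "\<forall>p \<in> Mor J. m p \<in> Hom A (L (Dom J p)) (L (Cod J p)) \<and>
      (\<forall>k\<in>Ob K. m p \<cdot> l (Dom J p) k = l (Cod J p) k \<cdot> fmor (fob D k) p)" by (rule bchoice[THEN exE])
  then have m: "\<And>p x y. p \<in> Hom J x y \<Longrightarrow> m p \<in> Hom A (L x) (L y)"
    "\<And>p x y k. p \<in> Hom J x y \<Longrightarrow> k \<in> Ob K \<Longrightarrow> m p \<cdot> l x k = l y k \<cdot> fmor (fob D k) p"
    by (auto simp: Hom_def[of J])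
  obtain P where P: "P \<in> Ob R" "\<And>w. w \<in> Ob J \<Longrightarrow> fob P w = L w"
    "\<And>x y p. p \<in> Hom J x y \<Longrightarrow> fmor P p = m p"
  proof (rule R_obI[of L m])
    fix x assume x: "x \<in> Ob J"
    show "m (Ide J x) = Ide A (L x)"
    proof (rule leq[OF x x m(1)[OF J.Ide_Hom[OF x]] Ide_Hom[OF LO[OF x]]])
      fix k assume k: "k \<in> Ob K"
      show "m (Ide J x) \<cdot> l x k = Ide A (L x) \<cdot> l x k"
        using m(2)[OF J.Ide_Hom[OF x] k] R_Ob(4)[OF d(1)[OF k] x] Comp_Ide[OF c(2)[OF x k]]
          Ide_Comp[OF c(2)[OF x k]] by simp
    qed
  next
    fix x y z p q assume p: "p \<in> Hom J x y" and q: "q \<in> Hom J y z"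
    note x = J.Hom_Ob[OF p] and z = J.Hom_Ob(2)[OF q] and qp = J.Comp_Hom[OF p q]
    show "m (q \<cdot>\<^bsub>J\<^esub> p) = m q \<cdot> m p"
    proof (rule leq[OF x(1) x(1) m(1)[OF qp] Comp_Hom[OF m(1)[OF p] m(1)[OF q]]])
      fix k assume k: "k \<in> Ob K"
      note Dk = R_Ob[OF d(1)[OF k]]
      have "(m q \<cdot> m p) \<cdot> l x k = m q \<cdot> (l y k \<cdot> fmor (fob D k) p)"
        using Comp_assoc[OF c(2)[OF x(1) k] m(1)[OF p] m(1)[OF q]] m(2)[OF p k] by simp
      also have "\<dots> = l z k \<cdot> (fmor (fob D k) q \<cdot> fmor (fob D k) p)"
        using Comp_assoc[OF Dk(3)[OF p] c(2)[OF x(2) k] m(1)[OF q]] m(2)[OF q k]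
          Comp_assoc[OF Dk(3)[OF p] Dk(3)[OF q] c(2)[OF z k]] by simp
      finally show "m (q \<cdot>\<^bsub>J\<^esub> p) \<cdot> l x k = (m q \<cdot> m p) \<cdot> l x k" using m(2)[OF qp k] Dk(5)[OF p q] by simp
    qed
  qed (use LO m(1) in auto)
  have "\<exists>t. t \<in> Hom R (fob D k) P \<and> (\<forall>v\<in>Ob J. cmp t v = l v k)" if k: "k \<in> Ob K" for k
  proof -
    have n: "l y k \<cdot> fmor (fob D k) p = fmor P p \<cdot> l x k" if p: "p \<in> Hom J x y" for p x y
      using m(2)[OF p k] P(3)[OF p] by simp
    obtain t where "t \<in> Hom R (fob D k) P" "\<And>v. v \<in> Ob J \<Longrightarrow> cmp t v = l v k"
      by (rule R_homI[OF d(1)[OF k] P(1), of "\<lambda>v. l v k"]) (use c(2)[OF _ k] P(2) n in auto)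
    then show ?thesis by blast
  qed
  then obtain t where t: "\<And>k. k \<in> Ob K \<Longrightarrow> t k \<in> Hom R (fob D k) P"
    "\<And>k v. k \<in> Ob K \<Longrightarrow> v \<in> Ob J \<Longrightarrow> cmp (t k) v = l v k" by metis
  have Pv: "is_colimit A K (ev D v) (fob P v) (\<lambda>k. cmp (t k) v)" if v: "v \<in> Ob J" for v
    by (rule colim_iso[OF Kc De[OF v] L[OF v], of _ "Ide A (L v)" "Ide A (L v)"])
      (use P(2)[OF v] t(2)[OF _ v] LO[OF v] Ide_Comp[OF c(2)[OF v]] Ide_Comp[OF Ide_Hom[OF LO[OF v]]]
        in \<open>simp_all add: inverse_pair_def Ide_Hom\<close>)
  have tc: "is_cocone R K D P t"
    unfolding is_cocone_def
  proof (intro conjI ballI allI)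
    show "P \<in> Ob R" by (rule P)
    show "t k \<in> Hom R (fob D k) P" if "k \<in> Ob K" for k by (rule t(1)[OF that])
    fix i j u assume u: "u \<in> Hom K i j"
    note ij = K.Hom_Ob[OF u]
    show "t j \<cdot>\<^bsub>R\<^esub> fmor D u = t i"
    proof (rule R_ext[OF R.Comp_Hom[OF d(2)[OF u] t(1)[OF ij(2)]] t(1)[OF ij(1)]])
      fix v assume v: "v \<in> Ob J"
      show "cmp (t j \<cdot>\<^bsub>R\<^esub> fmor D u) v = cmp (t i) v"
        using cmp_comp[OF d(2)[OF u] t(1)[OF ij(2)] v] t(2)[OF ij(1) v] t(2)[OF ij(2) v] c(3)[OF v u] by simp
    qed
  qed
  have "is_colimit R K D P t"
    unfolding is_colimit_def
  proof (intro conjI allI impI)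
    show "is_cocone R K D P t" by (rule tc)
    fix M n assume n: "is_cocone R K D M n"
    note nD = coconeD[OF n]
    have "\<exists>h. h \<in> Hom A (fob P v) (fob M v) \<and> (\<forall>k\<in>Ob K. h \<cdot> cmp (t k) v = cmp (n k) v)" if v: "v \<in> Ob J" for v
      using colim_ex1[OF Pv[OF v] cocone_ev[OF D n v Kc]] by (rule ex1_implies_ex)
    then obtain h where h: "\<And>v. v \<in> Ob J \<Longrightarrow> h v \<in> Hom A (fob P v) (fob M v)"
      "\<And>v k. v \<in> Ob J \<Longrightarrow> k \<in> Ob K \<Longrightarrow> h v \<cdot> cmp (t k) v = cmp (n k) v" by metis
    have hn: "h y \<cdot> fmor P p = fmor M p \<cdot> h x" if p: "p \<in> Hom J x y" for p x y
    proof -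
      note o = J.Hom_Ob[OF p]
      show ?thesis
      proof (rule colim_eq[OF Kc De[OF o(1)] Pv[OF o(1)] Comp_Hom[OF R_Ob(3)[OF P(1) p] h(1)[OF o(2)]]
            Comp_Hom[OF h(1)[OF o(1)] R_Ob(3)[OF nD(1) p]]])
        fix k assume k: "k \<in> Ob K"
        note tk = cmp_Hom[OF t(1)[OF k]]
        have "(h y \<cdot> fmor P p) \<cdot> cmp (t k) x = h y \<cdot> (cmp (t k) y \<cdot> fmor (fob D k) p)"
          using Comp_assoc[OF tk[OF o(1)] R_Ob(3)[OF P(1) p] h(1)[OF o(2)]] cmp_nat[OF t(1)[OF k] p] by simp
        also have "\<dots> = fmor M p \<cdot> cmp (n k) x"
          using Comp_assoc[OF R_Ob(3)[OF d(1)[OF k] p] tk[OF o(2)] h(1)[OF o(2)]] h(2)[OF o(2) k]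
            cmp_nat[OF nD(2)[OF k] p] by simp
        also have "\<dots> = (fmor M p \<cdot> h x) \<cdot> cmp (t k) x"
          using Comp_assoc[OF tk[OF o(1)] h(1)[OF o(1)] R_Ob(3)[OF nD(1) p]] h(2)[OF o(1) k] by simp
        finally show "(h y \<cdot> fmor P p) \<cdot> cmp (t k) x = (fmor M p \<cdot> h x) \<cdot> cmp (t k) x" .
      qed
    qed
    obtain h' where h': "h' \<in> Hom R P M" "\<And>v. v \<in> Ob J \<Longrightarrow> cmp h' v = h v"
      using R_homI[OF P(1) nD(1) h(1) hn] by blast
    show "\<exists>!h. h \<in> Hom R P M \<and> (\<forall>k\<in>Ob K. h \<cdot>\<^bsub>R\<^esub> t k = n k)"
    proof (rule ex1I[of _ h'], intro conjI ballI)
      show "h' \<in> Hom R P M" by (rule h')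
      show "h' \<cdot>\<^bsub>R\<^esub> t k = n k" if k: "k \<in> Ob K" for k
      proof (rule R_ext[OF R.Comp_Hom[OF t(1)[OF k] h'(1)] nD(2)[OF k]])
        fix v assume v: "v \<in> Ob J"
        show "cmp (h' \<cdot>\<^bsub>R\<^esub> t k) v = cmp (n k) v"
          using cmp_comp[OF t(1)[OF k] h'(1) v] h'(2)[OF v] h(2)[OF v k] by simp
      qed
      fix g assume g: "g \<in> Hom R P M \<and> (\<forall>k\<in>Ob K. g \<cdot>\<^bsub>R\<^esub> t k = n k)"
      then have gM: "g \<in> Hom R P M" by blast
      show "g = h'"
      proof (rule R_ext[OF gM h'(1)])
        fix v assume v: "v \<in> Ob J"
        show "cmp g v = cmp h' v"
        proof (rule colim_eq[OF Kc De[OF v] Pv[OF v] cmp_Hom[OF gM v] cmp_Hom[OF h'(1) v]])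
          fix k assume k: "k \<in> Ob K"
          show "cmp g v \<cdot> cmp (t k) v = cmp h' v \<cdot> cmp (t k) v"
            using cmp_comp[OF t(1)[OF k] gM v] g k h'(2)[OF v] h(2)[OF v k] by simp
        qed
      qed
    qed
  qed
  with Pv that show ?thesis by blast
qed

lemma colimit_cmp:
  assumes K: "small_cat U K" and D: "is_functor K R D" and L: "is_colimit R K D L l" and v: "v \<in> Ob J"
  shows "is_colimit A K (ev D v) (fob L v) (\<lambda>k. cmp (l k) v)"
proof -
  have Kc: "category K" using K by (simp add: small_cat_def)
  obtain P t where P: "is_colimit R K D P t"
    "\<And>v. v \<in> Ob J \<Longrightarrow> is_colimit A K (ev D v) (fob P v) (\<lambda>k. cmp (t k) v)"
    by (rule colimit_pointwise_ob[OF K D]) blast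
  obtain f g where fg: "R.inverse_pair P L f g" "\<And>k. k \<in> Ob K \<Longrightarrow> f \<cdot>\<^bsub>R\<^esub> t k = l k"
    by (rule R.colim_unique[OF Kc D P(1) L]) blast
  have f: "f \<in> Hom R P L" by (rule R.inverse_pairD(1)[OF fg(1)])
  show ?thesis
  proof (rule colim_iso[OF Kc functor_ev[OF D v] P(2)[OF v] inverse_pair_cmp[OF fg(1) v]])
    fix k assume k: "k \<in> Ob K"
    show "cmp f v \<cdot> cmp (t k) v = cmp (l k) v"
      using cmp_comp[OF coconeD(2)[OF colim_cocone[OF P(1)] k] f v] fg(2)[OF k] by simp
  qed
qed

section \<open>Free functors on families of objects\<close>

text \<open>
  The functor \<open>F\<close>, with the units \<open>u\<close>, represents the families of maps \<open>X k \<rightarrow> G(v k)\<close>. For functors on a path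
  category it is the direct sum of the \<open>f\<^sub>v(X)\<close> for \<open>v = v k\<close> and \<open>X = X k\<close>; working with the universal property
  for whole families avoids any choice of left adjoints.
\<close>

definition free_on where
  "free_on K v X F u \<longleftrightarrow> F \<in> Ob R \<and> (\<forall>k\<in>K. v k \<in> Ob J \<and> u k \<in> Hom A (X k) (fob F (v k))) \<and>
     (\<forall>G\<in>Ob R. \<forall>g. (\<forall>k\<in>K. g k \<in> Hom A (X k) (fob G (v k))) \<longrightarrow>
        (\<exists>!h. h \<in> Hom R F G \<and> (\<forall>k\<in>K. cmp h (v k) \<cdot> u k = g k)))"

text \<open>
  The same functor by its values: \<open>u k\<close> followed by the paths out of \<open>v k\<close> are the injections of a direct sum.
\<close>

definition pointwise_free where
  "pointwise_free K v X F u \<longleftrightarrow> F \<in> Ob R \<and> (\<forall>k\<in>K. v k \<in> Ob J \<and> u k \<in> Hom A (X k) (fob F (v k))) \<and>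
     (\<forall>w\<in>Ob J. is_coproduct A {(k, p). k \<in> K \<and> p \<in> Hom J (v k) w} (\<lambda>(k, p). X k) (fob F w)
        (\<lambda>(k, p). fmor F p \<cdot> u k))"

lemma freeD:
  assumes "free_on K v X F u"
  shows "F \<in> Ob R" "k \<in> K \<Longrightarrow> v k \<in> Ob J" "k \<in> K \<Longrightarrow> u k \<in> Hom A (X k) (fob F (v k))"
    "k \<in> K \<Longrightarrow> X k \<in> Ob A"
  using assms Hom_Ob unfolding free_on_def by blast+

lemma free_ex1:
  assumes "free_on K v X F u" "G \<in> Ob R" "\<forall>k\<in>K. g k \<in> Hom A (X k) (fob G (v k))"
  shows "\<exists>!h. h \<in> Hom R F G \<and> (\<forall>k\<in>K. cmp h (v k) \<cdot> u k = g k)"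
  using assms unfolding free_on_def by simp

lemma free_ex:
  assumes "free_on K v X F u" "G \<in> Ob R" "\<forall>k\<in>K. g k \<in> Hom A (X k) (fob G (v k))"
  shows "\<exists>h \<in> Hom R F G. \<forall>k\<in>K. cmp h (v k) \<cdot> u k = g k"
  using ex1_implies_ex[OF free_ex1[OF assms]] by blast

lemma free_eq:
  assumes F: "free_on K v X F u" and h: "h \<in> Hom R F G" "h' \<in> Hom R F G"
    and e: "\<And>k. k \<in> K \<Longrightarrow> cmp h (v k) \<cdot> u k = cmp h' (v k) \<cdot> u k"
  shows "h = h'"
proof -
  have "\<forall>k\<in>K. cmp h' (v k) \<cdot> u k \<in> Hom A (X k) (fob G (v k))"
    using Comp_Hom[OF freeD(3)[OF F] cmp_Hom[OF h(2) freeD(2)[OF F]]] by blast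
  from free_ex1[OF F R.Hom_Ob(2)[OF h(1)] this] h e show ?thesis by blast
qed

lemma free_onI:
  assumes "F \<in> Ob R" and "\<And>k. k \<in> K \<Longrightarrow> v k \<in> Ob J" and "\<And>k. k \<in> K \<Longrightarrow> u k \<in> Hom A (X k) (fob F (v k))"
    and ex: "\<And>G g. G \<in> Ob R \<Longrightarrow> (\<And>k. k \<in> K \<Longrightarrow> g k \<in> Hom A (X k) (fob G (v k))) \<Longrightarrow>
      \<exists>h \<in> Hom R F G. \<forall>k\<in>K. cmp h (v k) \<cdot> u k = g k"
    and eq: "\<And>G h h'. h \<in> Hom R F G \<Longrightarrow> h' \<in> Hom R F G \<Longrightarrow>
      (\<And>k. k \<in> K \<Longrightarrow> cmp h (v k) \<cdot> u k = cmp h' (v k) \<cdot> u k) \<Longrightarrow> h = h'"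
  shows "free_on K v X F u"
  unfolding free_on_def
proof (intro conjI ballI allI impI)
  fix G g assume "G \<in> Ob R" "\<forall>k\<in>K. g k \<in> Hom A (X k) (fob G (v k))"
  then obtain h where "h \<in> Hom R F G" "\<forall>k\<in>K. cmp h (v k) \<cdot> u k = g k" using ex[of G g] by blast
  then show "\<exists>!h. h \<in> Hom R F G \<and> (\<forall>k\<in>K. cmp h (v k) \<cdot> u k = g k)"
    by (intro ex1I[of _ h]) (auto intro: eq)
qed (use assms(1-3) in auto)

lemma free_cong:
  assumes "free_on K v X F u" "\<And>k. k \<in> K \<Longrightarrow> v' k = v k" "\<And>k. k \<in> K \<Longrightarrow> X' k = X k" "\<And>k. k \<in> K \<Longrightarrow> u' k = u k"
  shows "free_on K v' X' F u'"
  using assms unfolding free_on_def by simp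

lemma pointwise_freeD:
  assumes "pointwise_free K v X F u"
  shows "F \<in> Ob R" "k \<in> K \<Longrightarrow> v k \<in> Ob J" "k \<in> K \<Longrightarrow> u k \<in> Hom A (X k) (fob F (v k))"
    "w \<in> Ob J \<Longrightarrow> is_coproduct A {(k, p). k \<in> K \<and> p \<in> Hom J (v k) w} (\<lambda>(k, p). X k) (fob F w)
        (\<lambda>(k, p). fmor F p \<cdot> u k)"
  using assms unfolding pointwise_free_def by blast+

text \<open>
  Naturality forces the values of a map out of \<open>F\<close> on all summands from those on the generators. For a
  single generator this is \<open>universal_arrow_eval_at\<close>.
\<close>

lemma pointwise_free_free:
  assumes P: "pointwise_free K v X F u"
  shows "free_on K v X F u"
proof (rule free_onI)
  note D = pointwise_freeD[OF P]
  note Fm = R_Ob[OF D(1)]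
  show "F \<in> Ob R" "\<And>k. k \<in> K \<Longrightarrow> v k \<in> Ob J" "\<And>k. k \<in> K \<Longrightarrow> u k \<in> Hom A (X k) (fob F (v k))" by (fact D)+
  have ide: "fmor F (Ide J (v k)) \<cdot> u k = u k" if "k \<in> K" for k
    using Fm(4)[OF D(2)[OF that]] Ide_Comp[OF D(3)[OF that]] by simp
  show "h = h'" if h: "h \<in> Hom R F G" "h' \<in> Hom R F G"
    and e: "\<And>k. k \<in> K \<Longrightarrow> cmp h (v k) \<cdot> u k = cmp h' (v k) \<cdot> u k" for G h h'
  proof (rule R_ext[OF h])
    fix w assume w: "w \<in> Ob J"
    show "cmp h w = cmp h' w"
    proof (rule coprod_eq[OF D(4)[OF w] cmp_Hom[OF h(1) w] cmp_Hom[OF h(2) w]], clarify)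
      fix k p assume k: "k \<in> K" and p: "p \<in> Hom J (v k) w"
      note uk = D(3)[OF k] and o = J.Hom_Ob[OF p] and G = R_Ob(3)[OF R.Hom_Ob(2)[OF h(1)] p]
      have *: "cmp h w \<cdot> (fmor F p \<cdot> u k) = fmor G p \<cdot> (cmp h (v k) \<cdot> u k)" if h: "h \<in> Hom R F G" for h
        using Comp_assoc[OF uk Fm(3)[OF p] cmp_Hom[OF h w]] cmp_nat[OF h p]
          Comp_assoc[OF uk cmp_Hom[OF h o(1)] G] by simp
      show "cmp h w \<cdot> (fmor F p \<cdot> u k) = cmp h' w \<cdot> (fmor F p \<cdot> u k)"
        using *[OF h(1)] *[OF h(2)] e[OF k] by simp
    qed
  qed
  show "\<exists>h \<in> Hom R F G. \<forall>k\<in>K. cmp h (v k) \<cdot> u k = g k"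
    if G: "G \<in> Ob R" and g: "\<And>k. k \<in> K \<Longrightarrow> g k \<in> Hom A (X k) (fob G (v k))" for G g
  proof -
    note Gm = R_Ob[OF G]
    have gp: "fmor G p \<cdot> g k \<in> Hom A (X k) (fob G w)" if "k \<in> K" "p \<in> Hom J (v k) w" for k p w
      by (rule Comp_Hom[OF g[OF that(1)] Gm(3)[OF that(2)]])
    have "\<exists>h. h \<in> Hom A (fob F w) (fob G w) \<and>
        (\<forall>k p. k \<in> K \<longrightarrow> p \<in> Hom J (v k) w \<longrightarrow> h \<cdot> (fmor F p \<cdot> u k) = fmor G p \<cdot> g k)" if w: "w \<in> Ob J" for w
      using coprod_exB[OF D(4)[OF w] Gm(2)[OF w], of "\<lambda>(k, p). fmor G p \<cdot> g k"] gp by auto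
    then obtain h where h: "\<And>w. w \<in> Ob J \<Longrightarrow> h w \<in> Hom A (fob F w) (fob G w)"
      "\<And>w k p. w \<in> Ob J \<Longrightarrow> k \<in> K \<Longrightarrow> p \<in> Hom J (v k) w \<Longrightarrow> h w \<cdot> (fmor F p \<cdot> u k) = fmor G p \<cdot> g k"
      by metis
    have n: "h y \<cdot> fmor F q = fmor G q \<cdot> h x" if q: "q \<in> Hom J x y" for q x y
    proof -
      note o = J.Hom_Ob[OF q]
      show ?thesis
      proof (rule coprod_eq[OF D(4)[OF o(1)] Comp_Hom[OF Fm(3)[OF q] h(1)[OF o(2)]]
            Comp_Hom[OF h(1)[OF o(1)] Gm(3)[OF q]]], clarify)
        fix k p assume k: "k \<in> K" and p: "p \<in> Hom J (v k) x"
        note uk = D(3)[OF k] and pu = Comp_Hom[OF D(3)[OF k] Fm(3)[OF p]]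
        have "(h y \<cdot> fmor F q) \<cdot> (fmor F p \<cdot> u k) = h y \<cdot> (fmor F (q \<cdot>\<^bsub>J\<^esub> p) \<cdot> u k)"
          using Comp_assoc[OF pu Fm(3)[OF q] h(1)[OF o(2)]] Comp_assoc[OF uk Fm(3)[OF p] Fm(3)[OF q]]
            Fm(5)[OF p q] by simp
        also have "\<dots> = fmor G q \<cdot> (fmor G p \<cdot> g k)"
          using h(2)[OF o(2) k J.Comp_Hom[OF p q]] Gm(5)[OF p q]
            Comp_assoc[OF g[OF k] Gm(3)[OF p] Gm(3)[OF q]] by simp
        also have "\<dots> = (fmor G q \<cdot> h x) \<cdot> (fmor F p \<cdot> u k)"
          using Comp_assoc[OF pu h(1)[OF o(1)] Gm(3)[OF q]] h(2)[OF o(1) k p] by simp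
        finally show "(h y \<cdot> fmor F q) \<cdot> (fmor F p \<cdot> u k) = (fmor G q \<cdot> h x) \<cdot> (fmor F p \<cdot> u k)" .
      qed
    qed
    obtain h' where h': "h' \<in> Hom R F G" "\<And>w. w \<in> Ob J \<Longrightarrow> cmp h' w = h w"
      by (rule R_homI[OF D(1) G, of h]) (use h n in auto)
    have "cmp h' (v k) \<cdot> u k = g k" if k: "k \<in> K" for k
      using h(2)[OF D(2)[OF k] k J.Ide_Hom[OF D(2)[OF k]]] ide[OF k] h'(2)[OF D(2)[OF k]]
        Gm(4)[OF D(2)[OF k]] Ide_Comp[OF g[OF k]] by simp
    then show ?thesis using h' by blast
  qed
qed

lemma small_paths: "small U K \<Longrightarrow> small U {(k, p). k \<in> K \<and> p \<in> Hom J (v k) w}"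
proof -
  assume "small U K"
  then have "small U (Sigma K (\<lambda>k. Hom J (v k) w))" by (rule small_Sigma) (rule small_Hom)
  moreover have "{(k, p). k \<in> K \<and> p \<in> Hom J (v k) w} = Sigma K (\<lambda>k. Hom J (v k) w)" by auto
  ultimately show ?thesis by simp
qed

lemma pointwise_free_exists:
  assumes K: "small U K" and v: "\<And>k. k \<in> K \<Longrightarrow> v k \<in> Ob J" and X: "\<And>k. k \<in> K \<Longrightarrow> X k \<in> Ob A"
  obtains F u where "pointwise_free K v X F u"
proof -
  let ?I = "\<lambda>w. {(k, p). k \<in> K \<and> p \<in> Hom J (v k) w}" and ?X = "\<lambda>(k, p). X k"
  have "\<exists>S inc. is_coproduct A (?I w) ?X S inc" for w
    by (rule coproduct_exists[OF cocomp small_paths[OF K] _ category_axioms]) (use X in auto)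
  then have "\<forall>w. \<exists>T. is_coproduct A (?I w) ?X (fst T) (snd T)" by simp
  then obtain T where T: "\<forall>w. is_coproduct A (?I w) ?X (fst (T w)) (snd (T w))" by (rule choice[THEN exE])
  define S inc where "S w = fst (T w)" and "inc w = snd (T w)" for w
  have S: "is_coproduct A (?I w) ?X (S w) (inc w)" for w using T by (simp add: S_def inc_def)
  have SO: "S w \<in> Ob A" for w by (rule coprodD(1)[OF S])
  have i: "inc w (k, p) \<in> Hom A (X k) (S w)" if "k \<in> K" "p \<in> Hom J (v k) w" for k p w
    using coprodD(3)[OF S[of w], of "(k, p)"] that by simp
  have "\<forall>q\<in>Mor J. \<exists>m. m \<in> Hom A (S (Dom J q)) (S (Cod J q)) \<and>
      (\<forall>k p. k \<in> K \<longrightarrow> p \<in> Hom J (v k) (Dom J q) \<longrightarrow> m \<cdot> inc (Dom J q) (k, p) = inc (Cod J q) (k, q \<cdot>\<^bsub>J\<^esub> p))"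
  proof
    fix q assume "q \<in> Mor J"
    then have q: "q \<in> Hom J (Dom J q) (Cod J q)" by (simp add: Hom_def)
    have "\<forall>kp\<in>?I (Dom J q). (\<lambda>(k, p). inc (Cod J q) (k, q \<cdot>\<^bsub>J\<^esub> p)) kp \<in> Hom A (?X kp) (S (Cod J q))"
      using i J.Comp_Hom[OF _ q] by auto
    from coprod_exB[OF S SO this]
    show "\<exists>m. m \<in> Hom A (S (Dom J q)) (S (Cod J q)) \<and>
      (\<forall>k p. k \<in> K \<longrightarrow> p \<in> Hom J (v k) (Dom J q) \<longrightarrow> m \<cdot> inc (Dom J q) (k, p) = inc (Cod J q) (k, q \<cdot>\<^bsub>J\<^esub> p))"
      by auto
  qed
  then obtain m where "\<forall>q\<in>Mor J. m q \<in> Hom A (S (Dom J q)) (S (Cod J q)) \<and>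
      (\<forall>k p. k \<in> K \<longrightarrow> p \<in> Hom J (v k) (Dom J q) \<longrightarrow> m q \<cdot> inc (Dom J q) (k, p) = inc (Cod J q) (k, q \<cdot>\<^bsub>J\<^esub> p))"
    by (rule bchoice[THEN exE])
  then have m: "\<And>q x y. q \<in> Hom J x y \<Longrightarrow> m q \<in> Hom A (S x) (S y)"
    "\<And>q x y k p. q \<in> Hom J x y \<Longrightarrow> k \<in> K \<Longrightarrow> p \<in> Hom J (v k) x \<Longrightarrow> m q \<cdot> inc x (k, p) = inc y (k, q \<cdot>\<^bsub>J\<^esub> p)"
    by (auto simp: Hom_def[of J])
  obtain F where F: "F \<in> Ob R" "\<And>w. w \<in> Ob J \<Longrightarrow> fob F w = S w"
    "\<And>x y p. p \<in> Hom J x y \<Longrightarrow> fmor F p = m p"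
  proof (rule R_obI[of S m])
    fix x assume x: "x \<in> Ob J"
    show "m (Ide J x) = Ide A (S x)"
    proof (rule coprod_eq[OF S m(1)[OF J.Ide_Hom[OF x]] Ide_Hom[OF SO]], clarify)
      fix k p assume k: "k \<in> K" and p: "p \<in> Hom J (v k) x"
      show "m (Ide J x) \<cdot> inc x (k, p) = Ide A (S x) \<cdot> inc x (k, p)"
        using m(2)[OF J.Ide_Hom[OF x] k p] Ide_Comp[OF i[OF k p]] J.Ide_Comp[OF p] by simp
    qed
  next
    fix x y z p q assume p: "p \<in> Hom J x y" and q: "q \<in> Hom J y z"
    show "m (q \<cdot>\<^bsub>J\<^esub> p) = m q \<cdot> m p"
    proof (rule coprod_eq[OF S m(1)[OF J.Comp_Hom[OF p q]] Comp_Hom[OF m(1)[OF p] m(1)[OF q]]], clarify)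
      fix k r assume k: "k \<in> K" and r: "r \<in> Hom J (v k) x"
      show "m (q \<cdot>\<^bsub>J\<^esub> p) \<cdot> inc x (k, r) = (m q \<cdot> m p) \<cdot> inc x (k, r)"
        using m(2)[OF J.Comp_Hom[OF p q] k r] Comp_assoc[OF i[OF k r] m(1)[OF p] m(1)[OF q]]
          m(2)[OF p k r] m(2)[OF q k J.Comp_Hom[OF r p]] J.Comp_assoc[OF r p q] by simp
    qed
  qed (use SO m(1) in auto)
  define u where "u k = inc (v k) (k, Ide J (v k))" for k
  have "pointwise_free K v X F u"
    unfolding pointwise_free_def
  proof (intro conjI ballI)
    show "F \<in> Ob R" by (rule F)
    show "v k \<in> Ob J" if "k \<in> K" for k by (rule v[OF that])
    show "u k \<in> Hom A (X k) (fob F (v k))" if "k \<in> K" for k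
      using i[OF that J.Ide_Hom[OF v[OF that]]] F(2)[OF v[OF that]] by (simp add: u_def)
    fix w assume w: "w \<in> Ob J"
    have "fmor F p \<cdot> u k = inc w (k, p)" if "k \<in> K" "p \<in> Hom J (v k) w" for k p
      using m(2)[OF that(2,1) J.Ide_Hom[OF v[OF that(1)]]] F(3)[OF that(2)] J.Comp_Ide[OF that(2)]
      by (simp add: u_def)
    then show "is_coproduct A (?I w) ?X (fob F w) (\<lambda>(k, p). fmor F p \<cdot> u k)"
      unfolding F(2)[OF w] by (intro coprod_cong[OF S[of w]]) auto
  qed
  then show ?thesis by (rule that)
qed

lemma free_exists:
  assumes K: "small U K" and v: "\<And>k. k \<in> K \<Longrightarrow> v k \<in> Ob J" and X: "\<And>k. k \<in> K \<Longrightarrow> X k \<in> Ob A"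
  obtains F u where "free_on K v X F u"
proof -
  obtain F u where "pointwise_free K v X F u" by (rule pointwise_free_exists[OF K v X])
  then show ?thesis using that pointwise_free_free by blast
qed

lemma free_unique:
  assumes F: "free_on K v X F u" and F': "free_on K v X F' u'"
  obtains f g where "R.inverse_pair F F' f g" "\<And>k. k \<in> K \<Longrightarrow> cmp f (v k) \<cdot> u k = u' k"
proof -
  note D = freeD[OF F] and D' = freeD[OF F']
  have 1: "\<forall>k\<in>K. u' k \<in> Hom A (X k) (fob F' (v k))" and 2: "\<forall>k\<in>K. u k \<in> Hom A (X k) (fob F (v k))"
    using D(3) D'(3) by auto
  obtain f where f: "f \<in> Hom R F F'" "\<forall>k\<in>K. cmp f (v k) \<cdot> u k = u' k" using free_ex[OF F D'(1) 1] by blast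
  obtain g where g: "g \<in> Hom R F' F" "\<forall>k\<in>K. cmp g (v k) \<cdot> u' k = u k" using free_ex[OF F' D(1) 2] by blast
  have "g \<cdot>\<^bsub>R\<^esub> f = Ide R F"
  proof (rule free_eq[OF F R.Comp_Hom[OF f(1) g(1)] R.Ide_Hom[OF D(1)]])
    fix k assume k: "k \<in> K"
    note vk = D(2)[OF k] and uk = D(3)[OF k]
    show "cmp (g \<cdot>\<^bsub>R\<^esub> f) (v k) \<cdot> u k = cmp (Ide R F) (v k) \<cdot> u k"
      using cmp_comp[OF f(1) g(1) vk] cmp_ide[OF vk] Comp_assoc[OF uk cmp_Hom[OF f(1) vk] cmp_Hom[OF g(1) vk]]
        f(2) g(2) k Ide_Comp[OF uk] by simp
  qed
  moreover have "f \<cdot>\<^bsub>R\<^esub> g = Ide R F'"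
  proof (rule free_eq[OF F' R.Comp_Hom[OF g(1) f(1)] R.Ide_Hom[OF D'(1)]])
    fix k assume k: "k \<in> K"
    note vk = D(2)[OF k] and uk = D'(3)[OF k]
    show "cmp (f \<cdot>\<^bsub>R\<^esub> g) (v k) \<cdot> u' k = cmp (Ide R F') (v k) \<cdot> u' k"
      using cmp_comp[OF g(1) f(1) vk] cmp_ide[OF vk] Comp_assoc[OF uk cmp_Hom[OF g(1) vk] cmp_Hom[OF f(1) vk]]
        f(2) g(2) k Ide_Comp[OF uk] by simp
  qed
  ultimately have "R.inverse_pair F F' f g" unfolding R.inverse_pair_def using f(1) g(1) by blast
  with f(2) that show ?thesis by blast
qed

text \<open>
  Free functors are unique up to isomorphism, and one of them is known to be pointwise free.
\<close>

lemma free_pointwise: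
  assumes F: "free_on K v X F u" and K: "small U K"
  shows "pointwise_free K v X F u"
proof -
  note D = freeD[OF F]
  obtain P t where P: "pointwise_free K v X P t" by (rule pointwise_free_exists[OF K D(2,4)])
  note Pt = pointwise_freeD[OF P]
  obtain f g where fg: "R.inverse_pair P F f g" "\<And>k. k \<in> K \<Longrightarrow> cmp f (v k) \<cdot> t k = u k"
    by (rule free_unique[OF pointwise_free_free[OF P] F]) blast
  have f: "f \<in> Hom R P F" by (rule R.inverse_pairD(1)[OF fg(1)])
  show ?thesis
    unfolding pointwise_free_def
  proof (intro conjI ballI)
    fix w assume w: "w \<in> Ob J"
    show "is_coproduct A {(k, p). k \<in> K \<and> p \<in> Hom J (v k) w} (\<lambda>(k, p). X k) (fob F w) (\<lambda>(k, p). fmor F p \<cdot> u k)"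
    proof (rule coprod_cong[OF coprod_iso[OF Pt(4)[OF w] inverse_pair_cmp[OF fg(1) w]]], goal_cases)
      case (2 kp)
      then obtain k p where k: "kp = (k, p)" "k \<in> K" and p: "p \<in> Hom J (v k) w" by auto
      have "cmp f w \<cdot> (fmor P p \<cdot> t k) = fmor F p \<cdot> u k"
        using Comp_assoc[OF Pt(3)[OF k(2)] R_Ob(3)[OF Pt(1) p] cmp_Hom[OF f w]] cmp_nat[OF f p]
          Comp_assoc[OF Pt(3)[OF k(2)] cmp_Hom[OF f Pt(2)[OF k(2)]] R_Ob(3)[OF D(1) p]] fg(2)[OF k(2)] by simp
      then show ?case using k by simp
    qed simp
  qed (use D in auto)
qed

lemma free_reindex:
  assumes F: "free_on K v X F u" and b: "bij_betw b K' K"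
  shows "free_on K' (\<lambda>k. v (b k)) (\<lambda>k. X (b k)) F (\<lambda>k. u (b k))"
proof (rule free_onI)
  note D = freeD[OF F] and bK = bij_betwE[OF b]
  have m: "inv_into K' b i \<in> K' \<and> b (inv_into K' b i) = i" if "i \<in> K" for i
    using b that by (metis bij_betw_def inv_into_into f_inv_into_f)
  show "F \<in> Ob R" "\<And>k. k \<in> K' \<Longrightarrow> v (b k) \<in> Ob J" "\<And>k. k \<in> K' \<Longrightarrow> u (b k) \<in> Hom A (X (b k)) (fob F (v (b k)))"
    using D bK by auto
  show "\<exists>h \<in> Hom R F G. \<forall>k\<in>K'. cmp h (v (b k)) \<cdot> u (b k) = g k"
    if G: "G \<in> Ob R" and g: "\<And>k. k \<in> K' \<Longrightarrow> g k \<in> Hom A (X (b k)) (fob G (v (b k)))" for G g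
  proof -
    have "\<forall>k\<in>K. g (inv_into K' b k) \<in> Hom A (X k) (fob G (v k))" using g m by force
    from free_ex[OF F G this] obtain h where h: "h \<in> Hom R F G"
      "\<forall>k\<in>K. cmp h (v k) \<cdot> u k = g (inv_into K' b k)" by blast
    have "cmp h (v (b k)) \<cdot> u (b k) = g k" if k: "k \<in> K'" for k
      using h(2) bK k bij_betw_inv_into_left[OF b k] by simp
    with h(1) show ?thesis by blast
  qed
  show "h = h'" if h: "h \<in> Hom R F G" "h' \<in> Hom R F G"
    and e: "\<And>k. k \<in> K' \<Longrightarrow> cmp h (v (b k)) \<cdot> u (b k) = cmp h' (v (b k)) \<cdot> u (b k)" for G h h'
  proof (rule free_eq[OF F h])
    fix k assume "k \<in> K"
    then show "cmp h (v k) \<cdot> u k = cmp h' (v k) \<cdot> u k" using e[of "inv_into K' b k"] m by simp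
  qed
qed

lemma free_transport:
  assumes F: "free_on K v X F u" and ab: "\<And>k. k \<in> K \<Longrightarrow> inverse_pair (X k) (X' k) (a k) (b k)"
  shows "free_on K v X' F (\<lambda>k. u k \<cdot> b k)"
proof (rule free_onI)
  note D = freeD[OF F] and ip = inverse_pairD[OF ab]
  show "F \<in> Ob R" "\<And>k. k \<in> K \<Longrightarrow> v k \<in> Ob J" using D by auto
  show "\<And>k. k \<in> K \<Longrightarrow> u k \<cdot> b k \<in> Hom A (X' k) (fob F (v k))" using Comp_Hom[OF ip(2) D(3)] by blast
  show "\<exists>h \<in> Hom R F H. \<forall>k\<in>K. cmp h (v k) \<cdot> (u k \<cdot> b k) = g k"
    if H: "H \<in> Ob R" and g: "\<And>k. k \<in> K \<Longrightarrow> g k \<in> Hom A (X' k) (fob H (v k))" for H g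
  proof -
    have "\<forall>k\<in>K. g k \<cdot> a k \<in> Hom A (X k) (fob H (v k))" using Comp_Hom[OF ip(1) g] by blast
    from free_ex[OF F H this] obtain h where h: "h \<in> Hom R F H" "\<forall>k\<in>K. cmp h (v k) \<cdot> u k = g k \<cdot> a k" by blast
    have "cmp h (v k) \<cdot> (u k \<cdot> b k) = g k" if k: "k \<in> K" for k
      using Comp_assoc[OF ip(2)[OF k] D(3)[OF k] cmp_Hom[OF h(1) D(2)[OF k]]] h(2) k ip(6)[OF k g[OF k]] by simp
    with h(1) show ?thesis by blast
  qed
  show "h = h'" if h: "h \<in> Hom R F H" "h' \<in> Hom R F H"
    and e: "\<And>k. k \<in> K \<Longrightarrow> cmp h (v k) \<cdot> (u k \<cdot> b k) = cmp h' (v k) \<cdot> (u k \<cdot> b k)" for H h h'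
  proof (rule free_eq[OF F h])
    fix k assume k: "k \<in> K"
    have *: "cmp h (v k) \<cdot> u k = (cmp h (v k) \<cdot> (u k \<cdot> b k)) \<cdot> a k" if h: "h \<in> Hom R F H" for h
      using Comp_assoc[OF ip(2)[OF k] D(3)[OF k] cmp_Hom[OF h D(2)[OF k]]]
        ip(5)[OF k Comp_Hom[OF D(3)[OF k] cmp_Hom[OF h D(2)[OF k]]]] by simp
    show "cmp h (v k) \<cdot> u k = cmp h' (v k) \<cdot> u k" using *[OF h(1)] *[OF h(2)] e[OF k] by simp
  qed
qed

text \<open>
  The next four lemmas compare families indexed by pairs with families of families. They are
  formal consequences of the universal property.
\<close>

lemma free_refine:
  assumes F: "free_on K v S F u" and S: "\<And>k. k \<in> K \<Longrightarrow> is_coproduct A (I k) (X k) (S k) (inc k)"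
  shows "free_on (Sigma K I) (\<lambda>(k, i). v k) (\<lambda>(k, i). X k i) F (\<lambda>(k, i). u k \<cdot> inc k i)"
proof (rule free_onI)
  note D = freeD[OF F] and i = coprodD(3)[OF S]
  show "F \<in> Ob R" by (rule D)
  show "\<And>k. k \<in> Sigma K I \<Longrightarrow> (case k of (k, i) \<Rightarrow> v k) \<in> Ob J" using D by auto
  show "\<And>k. k \<in> Sigma K I \<Longrightarrow> (case k of (k, i) \<Rightarrow> u k \<cdot> inc k i) \<in>
      Hom A (case k of (k, i) \<Rightarrow> X k i) (fob F (case k of (k, i) \<Rightarrow> v k))"
    using Comp_Hom[OF i D(3)] by auto
  show "\<exists>h\<in>Hom R F G. \<forall>k\<in>Sigma K I. cmp h (case k of (k, i) \<Rightarrow> v k) \<cdot> (case k of (k, i) \<Rightarrow> u k \<cdot> inc k i) = g k"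
    if G: "G \<in> Ob R" and g: "\<And>k. k \<in> Sigma K I \<Longrightarrow>
      g k \<in> Hom A (case k of (k, i) \<Rightarrow> X k i) (fob G (case k of (k, i) \<Rightarrow> v k))" for G g
  proof -
    have "\<exists>h. h \<in> Hom A (S k) (fob G (v k)) \<and> (\<forall>i\<in>I k. h \<cdot> inc k i = g (k, i))" if k: "k \<in> K" for k
    proof -
      have "\<forall>i\<in>I k. g (k, i) \<in> Hom A (X k i) (fob G (v k))" using g[of "(k, _)"] k by simp
      from coprod_exB[OF S[OF k] R_Ob(2)[OF G D(2)[OF k]] this] show ?thesis by blast
    qed
    then obtain g' where g': "\<And>k. k \<in> K \<Longrightarrow> g' k \<in> Hom A (S k) (fob G (v k))"
      "\<And>k i. k \<in> K \<Longrightarrow> i \<in> I k \<Longrightarrow> g' k \<cdot> inc k i = g (k, i)" by metis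
    have "\<forall>k\<in>K. g' k \<in> Hom A (S k) (fob G (v k))" using g' by blast
    from free_ex[OF F G this] obtain h where h: "h \<in> Hom R F G" "\<forall>k\<in>K. cmp h (v k) \<cdot> u k = g' k" by blast
    have "cmp h (v k) \<cdot> (u k \<cdot> inc k j) = g (k, j)" if "k \<in> K" "j \<in> I k" for k j
      using Comp_assoc[OF i[OF that] D(3)[OF that(1)] cmp_Hom[OF h(1) D(2)[OF that(1)]]] h(2) g'(2)[OF that]
        that by simp
    with h(1) show ?thesis by auto
  qed
  show "h = h'" if h: "h \<in> Hom R F G" "h' \<in> Hom R F G"
    and e: "\<And>k. k \<in> Sigma K I \<Longrightarrow> cmp h (case k of (k, i) \<Rightarrow> v k) \<cdot> (case k of (k, i) \<Rightarrow> u k \<cdot> inc k i) =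
      cmp h' (case k of (k, i) \<Rightarrow> v k) \<cdot> (case k of (k, i) \<Rightarrow> u k \<cdot> inc k i)" for G h h'
  proof (rule free_eq[OF F h])
    fix k assume k: "k \<in> K"
    note hk = cmp_Hom[OF h(1) D(2)[OF k]] cmp_Hom[OF h(2) D(2)[OF k]]
    show "cmp h (v k) \<cdot> u k = cmp h' (v k) \<cdot> u k"
    proof (rule coprod_eq[OF S[OF k] Comp_Hom[OF D(3)[OF k] hk(1)] Comp_Hom[OF D(3)[OF k] hk(2)]])
      fix j assume j: "j \<in> I k"
      show "(cmp h (v k) \<cdot> u k) \<cdot> inc k j = (cmp h' (v k) \<cdot> u k) \<cdot> inc k j"
        using e[of "(k, j)"] k j Comp_assoc[OF i[OF k j] D(3)[OF k] hk(1)]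
          Comp_assoc[OF i[OF k j] D(3)[OF k] hk(2)] by simp
    qed
  qed
qed

lemma free_coarsen:
  assumes F: "free_on (Sigma K I) (\<lambda>(k, i). v k) (\<lambda>(k, i). X k i) F e" and v: "\<And>k. k \<in> K \<Longrightarrow> v k \<in> Ob J"
    and S: "\<And>k. k \<in> K \<Longrightarrow> is_coproduct A (I k) (X k) (S k) (inc k)"
  obtains u where "free_on K v S F u"
proof -
  note D = freeD[OF F] and i = coprodD(3)[OF S]
  have "\<exists>u. u \<in> Hom A (S k) (fob F (v k)) \<and> (\<forall>i\<in>I k. u \<cdot> inc k i = e (k, i))" if k: "k \<in> K" for k
  proof -
    have "\<forall>i\<in>I k. e (k, i) \<in> Hom A (X k i) (fob F (v k))" using D(3)[of "(k, _)"] k by simp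
    from coprod_exB[OF S[OF k] R_Ob(2)[OF D(1) v[OF k]] this] show ?thesis by blast
  qed
  then obtain u where u: "\<And>k. k \<in> K \<Longrightarrow> u k \<in> Hom A (S k) (fob F (v k))"
    "\<And>k i. k \<in> K \<Longrightarrow> i \<in> I k \<Longrightarrow> u k \<cdot> inc k i = e (k, i)" by metis
  have "free_on K v S F u"
  proof (rule free_onI[OF D(1) v u(1)])
    show "\<exists>h \<in> Hom R F G. \<forall>k\<in>K. cmp h (v k) \<cdot> u k = g k"
      if G: "G \<in> Ob R" and g: "\<And>k. k \<in> K \<Longrightarrow> g k \<in> Hom A (S k) (fob G (v k))" for G g
    proof -
      have "\<forall>k\<in>Sigma K I. (\<lambda>(k, i). g k \<cdot> inc k i) k \<in>
          Hom A ((\<lambda>(k, i). X k i) k) (fob G ((\<lambda>(k, i). v k) k))"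
        using Comp_Hom[OF i g] by auto
      from free_ex[OF F G this] obtain h where h: "h \<in> Hom R F G"
        "\<forall>(k, i)\<in>Sigma K I. cmp h (v k) \<cdot> e (k, i) = g k \<cdot> inc k i" by (auto simp: split_def)
      have "cmp h (v k) \<cdot> u k = g k" if k: "k \<in> K" for k
      proof (rule coprod_eq[OF S[OF k] Comp_Hom[OF u(1)[OF k] cmp_Hom[OF h(1) v[OF k]]] g[OF k]])
        fix j assume j: "j \<in> I k"
        show "(cmp h (v k) \<cdot> u k) \<cdot> inc k j = g k \<cdot> inc k j"
          using Comp_assoc[OF i[OF k j] u(1)[OF k] cmp_Hom[OF h(1) v[OF k]]] u(2)[OF k j] h(2) k j by auto
      qed
      with h(1) show ?thesis by blast
    qed
    show "h = h'" if h: "h \<in> Hom R F G" "h' \<in> Hom R F G"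
      and eq: "\<And>k. k \<in> K \<Longrightarrow> cmp h (v k) \<cdot> u k = cmp h' (v k) \<cdot> u k" for G h h'
    proof (rule free_eq[OF F h], clarify)
      fix k j assume k: "k \<in> K" and j: "j \<in> I k"
      show "cmp h (v k) \<cdot> e (k, j) = cmp h' (v k) \<cdot> e (k, j)"
        using Comp_assoc[OF i[OF k j] u(1)[OF k] cmp_Hom[OF h(1) v[OF k]]] u(2)[OF k j]
          Comp_assoc[OF i[OF k j] u(1)[OF k] cmp_Hom[OF h(2) v[OF k]]] eq[OF k] by simp
    qed
  qed
  then show ?thesis by (rule that)
qed

lemma free_coproduct:
  assumes H: "free_on (Sigma M K) (\<lambda>(m, k). v m k) (\<lambda>(m, k). X m k) H e"
    and F: "\<And>m. m \<in> M \<Longrightarrow> free_on (K m) (v m) (X m) (F m) (u m)"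
  obtains j where "is_coproduct R M F H j"
proof -
  note D = freeD[OF H] and Dm = freeD[OF F]
  have eH: "e (m, k) \<in> Hom A (X m k) (fob H (v m k))" if "m \<in> M" "k \<in> K m" for m k
    using D(3)[of "(m, k)"] that by simp
  have "\<exists>j. j \<in> Hom R (F m) H \<and> (\<forall>k\<in>K m. cmp j (v m k) \<cdot> u m k = e (m, k))" if m: "m \<in> M" for m
    using free_ex[OF F[OF m] D(1), of "\<lambda>k. e (m, k)"] eH[OF m] by blast
  then obtain j where j: "\<And>m. m \<in> M \<Longrightarrow> j m \<in> Hom R (F m) H"
    "\<And>m k. m \<in> M \<Longrightarrow> k \<in> K m \<Longrightarrow> cmp (j m) (v m k) \<cdot> u m k = e (m, k)" by metis
  have cj: "cmp (h \<cdot>\<^bsub>R\<^esub> j m) (v m k) \<cdot> u m k = cmp h (v m k) \<cdot> e (m, k)"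
    if h: "h \<in> Hom R H G" and m: "m \<in> M" and k: "k \<in> K m" for h G m k
    using cmp_comp[OF j(1)[OF m] h Dm(2)[OF m k]] j(2)[OF m k]
      Comp_assoc[OF Dm(3)[OF m k] cmp_Hom[OF j(1)[OF m] Dm(2)[OF m k]] cmp_Hom[OF h Dm(2)[OF m k]]] by simp
  have "is_coproduct R M F H j"
  proof (rule R.coprodI[OF D(1) j(1)])
    show "\<exists>h. h \<in> Hom R H G \<and> (\<forall>m\<in>M. h \<cdot>\<^bsub>R\<^esub> j m = f m)"
      if G: "G \<in> Ob R" and f: "\<And>m. m \<in> M \<Longrightarrow> f m \<in> Hom R (F m) G" for G f
    proof -
      have "\<forall>mk\<in>Sigma M K. (\<lambda>(m, k). cmp (f m) (v m k) \<cdot> u m k) mk \<in>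
          Hom A ((\<lambda>(m, k). X m k) mk) (fob G ((\<lambda>(m, k). v m k) mk))"
        using Comp_Hom[OF Dm(3) cmp_Hom[OF f Dm(2)]] by auto
      from free_ex[OF H G this] obtain h where h: "h \<in> Hom R H G"
        "\<forall>(m, k)\<in>Sigma M K. cmp h (v m k) \<cdot> e (m, k) = cmp (f m) (v m k) \<cdot> u m k" by (auto simp: split_def)
      have "h \<cdot>\<^bsub>R\<^esub> j m = f m" if m: "m \<in> M" for m
        by (rule free_eq[OF F[OF m] R.Comp_Hom[OF j(1)[OF m] h(1)] f[OF m]])
          (use cj[OF h(1) m] h(2) m in auto)
      with h(1) show ?thesis by blast
    qed
    show "h = h'" if h: "h \<in> Hom R H G" "h' \<in> Hom R H G" and eq: "\<And>m. m \<in> M \<Longrightarrow> h \<cdot>\<^bsub>R\<^esub> j m = h' \<cdot>\<^bsub>R\<^esub> j m"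
      for G h h'
    proof (rule free_eq[OF H h], clarify)
      fix m k assume m: "m \<in> M" and k: "k \<in> K m"
      show "cmp h (v m k) \<cdot> e (m, k) = cmp h' (v m k) \<cdot> e (m, k)"
        using cj[OF h(1) m k] cj[OF h(2) m k] eq[OF m] by simp
    qed
  qed
  then show ?thesis by (rule that)
qed

lemma coproduct_free:
  assumes H: "is_coproduct R M F H j"
    and F: "\<And>m. m \<in> M \<Longrightarrow> free_on (K m) (v m) (X m) (F m) (u m)"
  shows "free_on (Sigma M K) (\<lambda>(m, k). v m k) (\<lambda>(m, k). X m k) H (\<lambda>(m, k). cmp (j m) (v m k) \<cdot> u m k)"
proof (rule free_onI)
  note Dm = freeD[OF F] and j = R.coprodD(3)[OF H]
  show "H \<in> Ob R" by (rule R.coprodD[OF H])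
  show "\<And>k. k \<in> Sigma M K \<Longrightarrow> (case k of (m, k) \<Rightarrow> v m k) \<in> Ob J" using Dm by auto
  show "\<And>k. k \<in> Sigma M K \<Longrightarrow> (case k of (m, k) \<Rightarrow> cmp (j m) (v m k) \<cdot> u m k) \<in>
      Hom A (case k of (m, k) \<Rightarrow> X m k) (fob H (case k of (m, k) \<Rightarrow> v m k))"
    using Comp_Hom[OF Dm(3) cmp_Hom[OF j Dm(2)]] by auto
  have cj: "cmp (h \<cdot>\<^bsub>R\<^esub> j m) (v m k) \<cdot> u m k = cmp h (v m k) \<cdot> (cmp (j m) (v m k) \<cdot> u m k)"
    if h: "h \<in> Hom R H G" and m: "m \<in> M" and k: "k \<in> K m" for h G m k
    using cmp_comp[OF j[OF m] h Dm(2)[OF m k]]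
      Comp_assoc[OF Dm(3)[OF m k] cmp_Hom[OF j[OF m] Dm(2)[OF m k]] cmp_Hom[OF h Dm(2)[OF m k]]] by simp
  show "\<exists>h\<in>Hom R H G. \<forall>k\<in>Sigma M K. cmp h (case k of (m, k) \<Rightarrow> v m k) \<cdot>
      (case k of (m, k) \<Rightarrow> cmp (j m) (v m k) \<cdot> u m k) = g k"
    if G: "G \<in> Ob R" and g: "\<And>k. k \<in> Sigma M K \<Longrightarrow>
      g k \<in> Hom A (case k of (m, k) \<Rightarrow> X m k) (fob G (case k of (m, k) \<Rightarrow> v m k))" for G g
  proof -
    have "\<exists>f. f \<in> Hom R (F m) G \<and> (\<forall>k\<in>K m. cmp f (v m k) \<cdot> u m k = g (m, k))" if m: "m \<in> M" for m
      using free_ex[OF F[OF m] G, of "\<lambda>k. g (m, k)"] g[of "(m, _)"] m by auto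
    then obtain f where f: "\<And>m. m \<in> M \<Longrightarrow> f m \<in> Hom R (F m) G"
      "\<And>m k. m \<in> M \<Longrightarrow> k \<in> K m \<Longrightarrow> cmp (f m) (v m k) \<cdot> u m k = g (m, k)" by metis
    have "\<forall>m\<in>M. f m \<in> Hom R (F m) G" using f by blast
    from R.coprod_exB[OF H G this] obtain h where h: "h \<in> Hom R H G" "\<forall>m\<in>M. h \<cdot>\<^bsub>R\<^esub> j m = f m" by blast
    show ?thesis using h(1) cj[OF h(1)] h(2) f(2) by (intro bexI[of _ h]) auto
  qed
  show "h = h'" if h: "h \<in> Hom R H G" "h' \<in> Hom R H G"
    and e: "\<And>k. k \<in> Sigma M K \<Longrightarrow> cmp h (case k of (m, k) \<Rightarrow> v m k) \<cdot>
      (case k of (m, k) \<Rightarrow> cmp (j m) (v m k) \<cdot> u m k) = cmp h' (case k of (m, k) \<Rightarrow> v m k) \<cdot>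
      (case k of (m, k) \<Rightarrow> cmp (j m) (v m k) \<cdot> u m k)" for G h h'
  proof (rule R.coprod_eq[OF H h])
    fix m assume m: "m \<in> M"
    show "h \<cdot>\<^bsub>R\<^esub> j m = h' \<cdot>\<^bsub>R\<^esub> j m"
      by (rule free_eq[OF F[OF m] R.Comp_Hom[OF j[OF m] h(1)] R.Comp_Hom[OF j[OF m] h(2)]])
        (use e[of "(m, _)"] m cj[OF h(1) m] cj[OF h(2) m] in auto)
  qed
qed

text \<open>
  \<open>f\<^sub>v(X)\<close> is free on the family that consists of \<open>X\<close> alone.
\<close>

lemma universal_arrow_iff:
  assumes v: "v \<in> Ob J"
  shows "universal_arrow R A (eval_at v) X F u \<longleftrightarrow> free_on {()} (\<lambda>_. v) (\<lambda>_. X) F (\<lambda>_. u)"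
proof -
  have "fmor (eval_at v) h = cmp h v" for h :: "('v, 'p, 'o, 'm) func \<times> ('v \<Rightarrow> 'm) \<times> ('v, 'p, 'o, 'm) func"
    by (simp add: eval_at_def cmp_def split_def)
  moreover have "fob (eval_at v) F = fob F v" for F :: "('v, 'p, 'o, 'm) func"
    by (simp add: eval_at_def)
  moreover have all_unit: "(\<forall>g :: unit \<Rightarrow> 'm. P (g ())) \<longleftrightarrow> (\<forall>g. P g)" for P
  proof
    assume a: "\<forall>g :: unit \<Rightarrow> 'm. P (g ())"
    show "\<forall>g. P g" using a by (auto dest: spec[of _ "\<lambda>_. _"])
  qed simp
  ultimately show ?thesis
    unfolding universal_arrow_def free_on_def
    using v all_unit[of "\<lambda>g. g \<in> Hom A X (fob G v) \<longrightarrow> (\<exists>!h. h \<in> Hom R F G \<and> cmp h v \<cdot> u = g)" for G]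
    by (simp add: Ball_def)
qed

end

section \<open>Representations of left-rooted quivers\<close>

locale quiver_reps = abelian_cat A pl + universe U
  for A :: "('o, 'm) cat" (structure) and pl and U :: "'u itself" +
  fixes Q :: "('v, 'e) quiver"
  assumes cocomplete: "cocomplete U A" and quiver: "is_quiver Q"
    and small_verts: "small U (verts Q)" and small_arrs: "small U (arrs Q)" and rooted: "left_rooted Q"
begin

lemma path_Hom: "p \<in> Hom (path_cat Q) v w \<longleftrightarrow> (\<exists>q. p = (v, q, w) \<and> is_path Q v q w)"
  by (auto simp: Hom_def path_cat_def)

lemma path_arrs: "is_path Q v p w \<Longrightarrow> p \<in> lists (arrs Q)"
  by (induction p arbitrary: v) auto

lemma path_snoc: "is_path Q v (p @ [a]) w \<longleftrightarrow> is_path Q v p (src Q a) \<and> a \<in> arrs Q \<and> tgt Q a = w"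
  using quiver by (induction p arbitrary: v) (auto simp: is_quiver_def)

sublocale functors A pl "path_cat Q" U
proof (rule functors.intro)
  show "abelian_cat A pl" "universe U" by unfold_locales
  show "category (path_cat Q)" by (rule category_path_cat[OF quiver])
  show "functors_axioms A (path_cat Q) U"
  proof
    show "cocomplete U A" by (rule cocomplete)
    fix v w
    have "Hom (path_cat Q) v w \<subseteq> (\<lambda>p. (v, p, w)) ` lists (arrs Q)" using path_arrs by (auto simp: path_Hom)
    then show "small U (Hom (path_cat Q) v w)" by (rule small_subset[OF small_image[OF small_lists[OF small_arrs]]])
  qed
qed

lemma Ob_path [simp]: "Ob (path_cat Q) = verts Q" by (simp add: path_cat_def)
lemma Ide_path [simp]: "Ide (path_cat Q) v = (v, [], v)" by (simp add: path_cat_def)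
lemma Comp_path [simp]: "(w', q, x) \<cdot>\<^bsub>path_cat Q\<^esub> (v, p, w) = (v, p @ q, x)" by (simp add: path_cat_def)

definition into :: "'v \<Rightarrow> 'e set" where
  "into w = {a \<in> arrs Q. tgt Q a = w}"

definition act where
  "act F a = fmor F (src Q a, [a], tgt Q a)"

lemma intoD: "a \<in> into w \<Longrightarrow> a \<in> arrs Q" "a \<in> into w \<Longrightarrow> tgt Q a = w" "a \<in> into w \<Longrightarrow> src Q a \<in> verts Q"
  using quiver by (auto simp: into_def is_quiver_def)

lemma arrow_Hom: "a \<in> into w \<Longrightarrow> (src Q a, [a], w) \<in> Hom (path_cat Q) (src Q a) w"
  using quiver by (auto simp: path_Hom into_def is_quiver_def)

lemma act_Hom: "F \<in> Ob R \<Longrightarrow> a \<in> into w \<Longrightarrow> act F a \<in> Hom A (fob F (src Q a)) (fob F w)"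
  using R_Ob(3)[OF _ arrow_Hom] by (simp add: act_def intoD)

lemma act_nat:
  "h \<in> Hom R F G \<Longrightarrow> a \<in> into w \<Longrightarrow> cmp h w \<cdot> act F a = act G a \<cdot> cmp h (src Q a)"
  using cmp_nat[OF _ arrow_Hom] by (simp add: act_def intoD)

lemma small_into: "small U (into w)"
  by (rule small_subset[OF small_arrs]) (auto simp: into_def)

lemma wf_arrows: "wf {(src Q a, tgt Q a) |a. a \<in> arrs Q}"
  unfolding wf_iff_no_infinite_down_chain
proof
  assume "\<exists>f. \<forall>i. (f (Suc i), f i) \<in> {(src Q a, tgt Q a) |a. a \<in> arrs Q}"
  then obtain f where f: "\<forall>i. (f (Suc i), f i) \<in> {(src Q a, tgt Q a) |a. a \<in> arrs Q}" by blast
  have "\<forall>i. \<exists>a. a \<in> arrs Q \<and> src Q a = f (Suc i) \<and> tgt Q a = f i"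
  proof
    fix i show "\<exists>a. a \<in> arrs Q \<and> src Q a = f (Suc i) \<and> tgt Q a = f i" using f[rule_format, of i] by auto
  qed
  then obtain a where "\<forall>i. a i \<in> arrs Q \<and> src Q (a i) = f (Suc i) \<and> tgt Q (a i) = f i" by metis
  then have "\<forall>n. a n \<in> arrs Q \<and> tgt Q (a (Suc n)) = src Q (a n)" by simp
  with rooted show False unfolding left_rooted_def by blast
qed

text \<open>
  Left-rootedness enters through this induction from the sources of the arrows into a vertex to the
  vertex.
\<close>

lemma vertex_induct:
  assumes "\<And>w. (\<And>a. a \<in> into w \<Longrightarrow> P (src Q a)) \<Longrightarrow> P w"
  shows "P w"
  using wf_arrows
proof (induction w)
  case (less w)
  show ?case by (rule assms) (use less in \<open>auto simp: into_def\<close>)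
qed

text \<open>
  Sorting the paths ending at \<open>w\<close> by their last arrow: a functor is free exactly if, at each
  vertex, it is the direct sum of its values at the sources of the incoming arrows and of the
  generators sitting at that vertex. Left-rootedness makes the recursion from the sources to
  \<open>w\<close> well founded.
\<close>

definition layered where
  "layered K v X F u \<longleftrightarrow> F \<in> Ob R \<and> (\<forall>k\<in>K. v k \<in> verts Q \<and> u k \<in> Hom A (X k) (fob F (v k))) \<and>
     (\<forall>w\<in>verts Q. is_coproduct A (into w <+> {k \<in> K. v k = w}) (case_sum (\<lambda>a. fob F (src Q a)) X) (fob F w)
        (case_sum (act F) u))"

definition paths_to where
  "paths_to K v w = {(k, p). k \<in> K \<and> p \<in> Hom (path_cat Q) (v k) w}"

text \<open>
  The part of \<open>paths_to K v w\<close> that belongs to one summand of the decomposition by last arrows: the paths to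
  the source of an arrow \<open>a\<close>, still to be continued by \<open>a\<close>, or the trivial path at a generator.
\<close>

definition last_layer where
  "last_layer K v w c = (case c of Inl a \<Rightarrow> paths_to K v (src Q a) | Inr k \<Rightarrow> {(k, (w, [], w))})"

definition extend :: "'v \<Rightarrow> ('e + 'k) \<times> 'k \<times> 'v \<times> 'e list \<times> 'v \<Rightarrow> 'k \<times> 'v \<times> 'e list \<times> 'v" where
  "extend w = (\<lambda>(c, (k, (x, p, y))). case c of Inl a \<Rightarrow> (k, (x, p @ [a], w)) | Inr _ \<Rightarrow> (k, (x, p, y)))"

lemma last_layerE:
  assumes s: "s \<in> Sigma (into w <+> {k \<in> K. v k = w}) (last_layer K v w)"
  obtains (arrow) a k p where "s = (Inl a, (k, (v k, p, src Q a)))" "a \<in> into w" "k \<in> K"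
      "is_path Q (v k) p (src Q a)"
    | (generator) k where "s = (Inr k, (k, (w, [], w)))" "k \<in> K" "v k = w"
proof -
  obtain c i where s': "s = (c, i)" by (cases s)
  have "c \<in> into w <+> {k \<in> K. v k = w} \<and> i \<in> last_layer K v w c"
    using s by (simp only: s' mem_Sigma_iff)
  with s' have c: "s = (c, i)" "c \<in> into w <+> {k \<in> K. v k = w}" "i \<in> last_layer K v w c" by blast+
  from c(2) show ?thesis
  proof
    fix a assume a: "a \<in> into w" "c = Inl a"
    then obtain k p where "i = (k, p)" "k \<in> K" "p \<in> Hom (path_cat Q) (v k) (src Q a)"
      using c(3) by (auto simp: last_layer_def paths_to_def)
    then show ?thesis using arrow a c(1) by (auto simp: path_Hom)
  next
    fix k assume "k \<in> {k \<in> K. v k = w}" "c = Inr k"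
    then show ?thesis using generator c by (simp add: last_layer_def)
  qed
qed

lemma bij_extend:
  assumes w: "w \<in> verts Q"
  shows "bij_betw (extend w) (Sigma (into w <+> {k \<in> K. v k = w}) (last_layer K v w)) (paths_to K v w)"
proof (rule bij_betw_imageI)
  show "inj_on (extend w) (Sigma (into w <+> {k \<in> K. v k = w}) (last_layer K v w))"
  proof (rule inj_onI)
    fix s s' assume s: "s \<in> Sigma (into w <+> {k \<in> K. v k = w}) (last_layer K v w)"
      and s': "s' \<in> Sigma (into w <+> {k \<in> K. v k = w}) (last_layer K v w)" and e: "extend w s = extend w s'"
    show "s = s'"
      by (rule last_layerE[OF s]; rule last_layerE[OF s']) (use e in \<open>simp_all add: extend_def\<close>)
  qed
  show "extend w ` Sigma (into w <+> {k \<in> K. v k = w}) (last_layer K v w) = paths_to K v w"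
  proof (intro equalityI subsetI)
    fix z assume "z \<in> extend w ` Sigma (into w <+> {k \<in> K. v k = w}) (last_layer K v w)"
    then obtain s where s: "s \<in> Sigma (into w <+> {k \<in> K. v k = w}) (last_layer K v w)" "z = extend w s"
      by blast
    show "z \<in> paths_to K v w"
      by (rule last_layerE[OF s(1)])
        (use w s(2) in \<open>simp_all add: extend_def paths_to_def path_Hom path_snoc into_def\<close>)
  next
    fix z assume "z \<in> paths_to K v w"
    then obtain k p where z: "z = (k, (v k, p, w))" "k \<in> K" "is_path Q (v k) p w"
      by (auto simp: paths_to_def path_Hom)
    show "z \<in> extend w ` Sigma (into w <+> {k \<in> K. v k = w}) (last_layer K v w)"
    proof (cases p rule: rev_cases)
      case Nil
      then have "z = extend w (Inr k, (k, (w, [], w)))" "v k = w" using z by (auto simp: extend_def)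
      then show ?thesis using z(2) by (intro image_eqI[of _ _ "(Inr k, (k, (w, [], w)))"]) (auto simp: last_layer_def)
    next
      case (snoc q a)
      then have "z = extend w (Inl a, (k, (v k, q, src Q a)))" "is_path Q (v k) q (src Q a)" "a \<in> into w"
        using z path_snoc by (auto simp: extend_def into_def)
      then show ?thesis using z(2)
        by (intro image_eqI[of _ _ "(Inl a, (k, (v k, q, src Q a)))"])
          (auto simp: last_layer_def paths_to_def path_Hom)
    qed
  qed
qed

lemma act_path:
  assumes F: "F \<in> Ob R" and a: "a \<in> into w" and p: "is_path Q x p (src Q a)" and g: "g \<in> Hom A Y (fob F x)"
  shows "fmor F (x, p @ [a], w) \<cdot> g = act F a \<cdot> (fmor F (x, p, src Q a) \<cdot> g)"
proof -
  have P: "(x, p, src Q a) \<in> Hom (path_cat Q) x (src Q a)" using p by (simp add: path_Hom)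
  have "fmor F (x, p @ [a], w) = act F a \<cdot> fmor F (x, p, src Q a)"
    using R_Ob(5)[OF F P arrow_Hom[OF a]] a by (simp add: act_def intoD)
  then show ?thesis using Comp_assoc[OF g R_Ob(3)[OF F P] act_Hom[OF F a]] by simp
qed

lemma layer_values:
  assumes F: "F \<in> Ob R" and u: "\<And>k. k \<in> K \<Longrightarrow> u k \<in> Hom A (X k) (fob F (v k))"
    and s: "s \<in> Sigma (into w <+> {k \<in> K. v k = w}) (last_layer K v w)" and w: "w \<in> verts Q"
  shows "(\<lambda>(k, p). X k) (extend w s) = (\<lambda>(c, k, p). X k) s"
    and "(\<lambda>(k, p). fmor F p \<cdot> u k) (extend w s) = (\<lambda>(c, i). case_sum (act F) u c \<cdot>
        case_sum (\<lambda>a (k, p). fmor F p \<cdot> u k) (\<lambda>k _. Ide A (X k)) c i) s"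
proof -
  have id: "fmor F (v k, [], v k) \<cdot> u k = u k \<cdot> Ide A (X k)" if "k \<in> K" "v k = w" for k
    using R_Ob(4)[OF F, of w] w that Ide_Comp[OF u[OF that(1)]] Comp_Ide[OF u[OF that(1)]] by simp
  show "(\<lambda>(k, p). X k) (extend w s) = (\<lambda>(c, k, p). X k) s"
    by (rule last_layerE[OF s]) (simp_all add: extend_def)
  show "(\<lambda>(k, p). fmor F p \<cdot> u k) (extend w s) = (\<lambda>(c, i). case_sum (act F) u c \<cdot>
        case_sum (\<lambda>a (k, p). fmor F p \<cdot> u k) (\<lambda>k _. Ide A (X k)) c i) s"
    by (rule last_layerE[OF s]) (use id in \<open>simp_all add: extend_def act_path[OF F _ _ u]\<close>)
qed

text \<open>
  The sum over all paths is the sum of its parts with a common last arrow.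
\<close>

lemma pointwise_layered:
  assumes P: "pointwise_free K v X F u"
  shows "layered K v X F u"
  unfolding layered_def
proof (intro conjI ballI)
  note D = pointwise_freeD[OF P]
  show "F \<in> Ob R" "\<And>k. k \<in> K \<Longrightarrow> v k \<in> verts Q" "\<And>k. k \<in> K \<Longrightarrow> u k \<in> Hom A (X k) (fob F (v k))"
    using D(1-3) by auto
  fix w assume w: "w \<in> verts Q"
  let ?L = "into w <+> {k \<in> K. v k = w}"
  let ?inc = "case_sum (\<lambda>a (k, p). fmor F p \<cdot> u k) (\<lambda>k _. Ide A (X k))"
  have T: "is_coproduct A (Sigma ?L (last_layer K v w)) (\<lambda>(c, k, p). X k) (fob F w)
      (\<lambda>(c, i). case_sum (act F) u c \<cdot> ?inc c i)"
  proof (rule coprod_reindex[OF D(4)[folded paths_to_def] bij_extend[OF w]])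
    show "w \<in> Ob (path_cat Q)" using w by simp
  qed (rule layer_values[symmetric, OF D(1,3) _ w]; assumption)+
  show "is_coproduct A ?L (case_sum (\<lambda>a. fob F (src Q a)) X) (fob F w) (case_sum (act F) u)"
  proof (rule coprod_group[where X = "\<lambda>c (k, p). X k" and inc = ?inc, OF T])
    fix c assume c: "c \<in> ?L"
    show "case_sum (act F) u c \<in> Hom A (case_sum (\<lambda>a. fob F (src Q a)) X c) (fob F w)"
      using c act_Hom[OF D(1)] D(3) by auto
    show "is_coproduct A (last_layer K v w c) ((\<lambda>c (k, p). X k) c) (case_sum (\<lambda>a. fob F (src Q a)) X c) (?inc c)"
    proof (cases c)
      case (Inl a)
      then show ?thesis using c D(4)[of "src Q a"] intoD(3) by (auto simp: last_layer_def paths_to_def)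
    next
      case (Inr k)
      then have "X k \<in> Ob A" using c Hom_Ob(1)[OF D(3)] by auto
      then show ?thesis
        using Inr coprod_singleton[of "\<lambda>(k, p). X k" "(k, (w, [], w))"] by (simp add: last_layer_def)
    qed
  qed simp
qed

text \<open>
  By induction each \<open>F(src a)\<close> is a sum over paths, so \<open>F(w)\<close> is one by associativity of direct sums.
\<close>

lemma layered_pointwise:
  assumes L: "layered K v X F u"
  shows "pointwise_free K v X F u"
proof -
  have F: "F \<in> Ob R" and v: "\<And>k. k \<in> K \<Longrightarrow> v k \<in> verts Q"
    and u: "\<And>k. k \<in> K \<Longrightarrow> u k \<in> Hom A (X k) (fob F (v k))"
    and T: "\<And>w. w \<in> verts Q \<Longrightarrow> is_coproduct A (into w <+> {k \<in> K. v k = w})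
      (case_sum (\<lambda>a. fob F (src Q a)) X) (fob F w) (case_sum (act F) u)"
    using L by (auto simp: layered_def)
  have "w \<in> verts Q \<longrightarrow> is_coproduct A (paths_to K v w) (\<lambda>(k, p). X k) (fob F w) (\<lambda>(k, p). fmor F p \<cdot> u k)" for w
  proof (induction w rule: vertex_induct)
    case (1 w)
    show ?case
    proof
      assume w: "w \<in> verts Q"
      let ?L = "into w <+> {k \<in> K. v k = w}"
      let ?inc = "case_sum (\<lambda>a (k, p). fmor F p \<cdot> u k) (\<lambda>k _. Ide A (X k))"
      have "is_coproduct A (Sigma ?L (last_layer K v w)) (\<lambda>(c, i). (\<lambda>c (k, p). X k) c i) (fob F w)
          (\<lambda>(c, i). case_sum (act F) u c \<cdot> ?inc c i)"
      proof (rule coprod_Sigma[OF T[OF w]])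
        fix c assume c: "c \<in> ?L"
        show "is_coproduct A (last_layer K v w c) ((\<lambda>c (k, p). X k) c) (case_sum (\<lambda>a. fob F (src Q a)) X c) (?inc c)"
        proof (cases c)
          case (Inl a)
          then show ?thesis using c 1 intoD(3) by (auto simp: last_layer_def)
        next
          case (Inr k)
          then have "X k \<in> Ob A" using c Hom_Ob(1)[OF u] by auto
          then show ?thesis
            using Inr coprod_singleton[of "\<lambda>(k, p). X k" "(k, (w, [], w))"] by (simp add: last_layer_def)
        qed
      qed
      then show "is_coproduct A (paths_to K v w) (\<lambda>(k, p). X k) (fob F w) (\<lambda>(k, p). fmor F p \<cdot> u k)"
        by (rule coprod_reindex_image[OF _ bij_extend[OF w]])
          (rule layer_values[symmetric, OF F u _ w]; assumption)+
    qed
  qed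
  then show ?thesis unfolding pointwise_free_def using F u v by (simp add: paths_to_def)
qed

lemma free_layered: "free_on K v X F u \<Longrightarrow> small U K \<Longrightarrow> layered K v X F u"
  by (rule pointwise_layered[OF free_pointwise])

lemma layered_free: "layered K v X F u \<Longrightarrow> free_on K v X F u"
  by (rule pointwise_free_free[OF layered_pointwise])

text \<open>The canonical map, with its source, in terms of \<^const>\<open>into\<close> and \<^const>\<open>act\<close>.\<close>

definition canonical where
  "canonical F w S inc p \<longleftrightarrow> is_coproduct A (into w) (\<lambda>a. fob F (src Q a)) S inc \<and>
     p \<in> Hom A S (fob F w) \<and> (\<forall>a\<in>into w. p \<cdot> inc a = act F a)"

lemma canonical_map_iff: "canonical_map Q A F w p \<longleftrightarrow> (\<exists>S inc. canonical F w S inc p)"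
  by (auto simp: canonical_map_def canonical_def into_def act_def)

lemma canonical_exists:
  assumes F: "F \<in> Ob R" and w: "w \<in> verts Q"
  obtains S inc p where "canonical F w S inc p"
proof -
  have "\<exists>S inc. is_coproduct A (into w) (\<lambda>a. fob F (src Q a)) S inc"
    by (rule coproduct_exists[OF cocomplete small_into _ category_axioms]) (use R_Ob(2)[OF F] intoD(3) in simp)
  then obtain S inc where S: "is_coproduct A (into w) (\<lambda>a. fob F (src Q a)) S inc" by blast
  have "\<forall>a\<in>into w. act F a \<in> Hom A (fob F (src Q a)) (fob F w)" using act_Hom[OF F] by blast
  from coprod_exB[OF S R_Ob(2)[OF F] this] w S that show ?thesis unfolding canonical_def by auto
qed

lemma canonicalD:
  assumes "canonical F w S inc p"
  shows "is_coproduct A (into w) (\<lambda>a. fob F (src Q a)) S inc" "p \<in> Hom A S (fob F w)"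
    "a \<in> into w \<Longrightarrow> p \<cdot> inc a = act F a"
  using assms by (auto simp: canonical_def)

text \<open>
  Functoriality of the source of the canonical map and naturality of the latter.
\<close>

lemma canonical_nat:
  assumes p: "canonical F w S inc p" and q: "canonical H w S' inc' q" and h: "h \<in> Hom R F H" and w: "w \<in> verts Q"
  obtains g where "g \<in> Hom A S S'" "\<forall>a\<in>into w. g \<cdot> inc a = inc' a \<cdot> cmp h (src Q a)" "q \<cdot> g = cmp h w \<cdot> p"
proof -
  note pD = canonicalD[OF p] and qD = canonicalD[OF q] and hH = cmp_Hom[OF h, simplified]
  note i = coprodD(3)[OF pD(1)] and i' = coprodD(3)[OF qD(1)]
  have "\<forall>a\<in>into w. inc' a \<cdot> cmp h (src Q a) \<in> Hom A (fob F (src Q a)) S'"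
    using Comp_Hom[OF hH i'] intoD(3) by blast
  from coprod_exB[OF pD(1) coprodD(1)[OF qD(1)] this] obtain g where g: "g \<in> Hom A S S'"
    "\<forall>a\<in>into w. g \<cdot> inc a = inc' a \<cdot> cmp h (src Q a)" by blast
  have "q \<cdot> g = cmp h w \<cdot> p"
  proof (rule coprod_eq[OF pD(1) Comp_Hom[OF g(1) qD(2)] Comp_Hom[OF pD(2) hH[OF w]]])
    fix a assume a: "a \<in> into w"
    show "(q \<cdot> g) \<cdot> inc a = (cmp h w \<cdot> p) \<cdot> inc a"
      using Comp_assoc[OF i[OF a] g(1) qD(2)] g(2) a Comp_assoc[OF hH[OF intoD(3)[OF a]] i'[OF a] qD(2)]
        qD(3)[OF a] Comp_assoc[OF i[OF a] pD(2) hH[OF w]] pD(3)[OF a] act_nat[OF h a] by simp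
  qed
  with g show ?thesis by (rule that)
qed

lemma layered_sum2:
  assumes L: "layered K v X F u" and w: "w \<in> verts Q" and p: "canonical F w S inc p"
    and T: "is_coproduct A {k \<in> K. v k = w} X T incT" and s: "s \<in> Hom A T (fob F w)"
      "\<And>k. k \<in> K \<Longrightarrow> v k = w \<Longrightarrow> s \<cdot> incT k = u k"
  shows "sum2 S T (fob F w) p s"
  by (rule coprod_Plus_split[OF _ canonicalD(1)[OF p] T canonicalD(2,3)[OF p] s(1)])
    (use L w s(2) in \<open>auto simp: layered_def\<close>)

lemma free_canonical:
  assumes F: "free_on (verts Q) (\<lambda>w. w) X F u" and w: "w \<in> verts Q"
  obtains S inc p where "canonical F w S inc p" "sum2 S (X w) (fob F w) p (u w)"
proof -
  note D = freeD[OF F]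
  obtain S inc p where p: "canonical F w S inc p" by (rule canonical_exists[OF D(1) w])
  have e: "{k \<in> verts Q. k = w} = {w}" using w by auto
  have "sum2 S (X w) (fob F w) p (u w)"
    by (rule layered_sum2[OF free_layered[OF F small_verts] w p, of "X w" "\<lambda>_. Ide A (X w)"])
      (use D(3,4)[OF w] coprod_singleton[of X w] Comp_Ide[OF D(3)[OF w]] in \<open>auto simp: e\<close>)
  with p that show ?thesis by blast
qed

lemma Phi_free:
  assumes F: "free_on (verts Q) (\<lambda>w. w) X F u" and X: "\<And>w. w \<in> verts Q \<Longrightarrow> X w \<in> \<Y>"
  shows "F \<in> Phi Q A \<Y>"
  unfolding Phi_def
proof (intro CollectI conjI ballI)
  show "F \<in> Ob R" by (rule freeD[OF F])
  fix w assume w: "w \<in> verts Q"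
  obtain S inc p where p: "canonical F w S inc p" "sum2 S (X w) (fob F w) p (u w)" by (rule free_canonical[OF F w])
  obtain c where c: "monic A p" "is_cokernel A p c" "c \<in> Hom A (fob F w) (X w)" by (rule sum2_cokernel[OF p(2)])
  show "\<exists>p c. canonical_map Q A F w p \<and> monic A p \<and> is_cokernel A p c \<and> Cod A c \<in> \<Y>"
    unfolding canonical_map_iff
    by (intro exI[of _ p] exI[of _ c] conjI exI[of _ S] exI[of _ inc]) (use p(1) c X[OF w] HomD[OF c(3)] in auto)
qed

lemma PhiD:
  assumes F: "F \<in> Phi Q A \<Y>" and w: "w \<in> verts Q"
  obtains S inc p Z c where "canonical F w S inc p" "monic A p" "is_cokernel A p c" "c \<in> Hom A (fob F w) Z" "Z \<in> \<Y>"
proof -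
  obtain p c where p: "canonical_map Q A F w p" "monic A p" "is_cokernel A p c" "Cod A c \<in> \<Y>"
    using F w unfolding Phi_def by blast
  obtain S inc where S: "canonical F w S inc p" using p(1) unfolding canonical_map_iff by blast
  have "c \<in> Hom A (fob F w) (Cod A c)"
    using p(3) HomD[OF canonicalD(2)[OF S]] by (auto simp: is_cokernel_def Hom_def)
  with S p that show ?thesis by blast
qed

lemma Phi_Ob: "F \<in> Phi Q A \<Y> \<Longrightarrow> F \<in> Ob R"
  by (simp add: Phi_def)

text \<open>
  If the cokernels are projective then they split off, so the summands in \<^const>\<open>layered\<close> can be
  taken to be lifts of the cokernels.
\<close>

lemma free_Phi:
  assumes F: "F \<in> Phi Q A \<Y>" and \<Y>: "\<Y> \<subseteq> Proj A"
  obtains X u where "\<forall>w\<in>verts Q. X w \<in> \<Y>" "free_on (verts Q) (\<lambda>w. w) X F u"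
proof -
  have "\<exists>Z s. Z \<in> \<Y> \<and> s \<in> Hom A Z (fob F w) \<and>
      is_coproduct A (into w <+> {w}) (case_sum (\<lambda>a. fob F (src Q a)) (\<lambda>_. Z)) (fob F w) (case_sum (act F) (\<lambda>_. s))"
    if w: "w \<in> verts Q" for w
  proof -
    obtain S inc p Z c where p: "canonical F w S inc p" "monic A p" and c: "is_cokernel A p c"
      "c \<in> Hom A (fob F w) Z" "Z \<in> \<Y>" by (rule PhiD[OF F w])
    note pD = canonicalD[OF p(1)]
    have Z: "projective A Z" using c(3) \<Y> by (auto simp: Proj_def)
    have ZO: "Z \<in> Ob A" using Hom_Ob[OF c(2)] by blast
    obtain s where s: "s \<in> Hom A Z (fob F w)" "c \<cdot> s = Ide A Z"
      by (rule projectiveD[OF Z cokernelD(2)[OF c(1) pD(2) c(2)] c(2) Ide_Hom[OF ZO]])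
    have "is_coproduct A (into w <+> {w}) (case_sum (\<lambda>a. fob F (src Q a)) (\<lambda>_. Z)) (fob F w)
        (case_sum (\<lambda>a. p \<cdot> inc a) (\<lambda>_. s \<cdot> Ide A Z))"
      by (rule coprod_Plus_join[OF split_mono_sum2[OF p(2) pD(2) c(1,2) s] pD(1)
            coprod_singleton[of "\<lambda>_. Z", OF ZO]])
    then have "is_coproduct A (into w <+> {w}) (case_sum (\<lambda>a. fob F (src Q a)) (\<lambda>_. Z)) (fob F w)
        (case_sum (act F) (\<lambda>_. s))"
      by (rule coprod_cong) (use pD(3) Comp_Ide[OF s(1)] in auto)
    with c(3) s(1) show ?thesis by blast
  qed
  then obtain X u where X: "\<And>w. w \<in> verts Q \<Longrightarrow> X w \<in> \<Y>" "\<And>w. w \<in> verts Q \<Longrightarrow> u w \<in> Hom A (X w) (fob F w)"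
    and T: "\<And>w. w \<in> verts Q \<Longrightarrow> is_coproduct A (into w <+> {w}) (case_sum (\<lambda>a. fob F (src Q a)) (\<lambda>_. X w))
      (fob F w) (case_sum (act F) (\<lambda>_. u w))" by metis
  have "layered (verts Q) (\<lambda>w. w) X F u"
    unfolding layered_def
  proof (intro conjI ballI)
    fix w assume w: "w \<in> verts Q"
    have e: "{k \<in> verts Q. k = w} = {w}" using w by auto
    show "is_coproduct A (into w <+> {k \<in> verts Q. k = w}) (case_sum (\<lambda>a. fob F (src Q a)) X) (fob F w)
        (case_sum (act F) u)"
      unfolding e by (rule coprod_cong[OF T[OF w]]) auto
  qed (use X(2) Phi_Ob[OF F] in auto)
  then show ?thesis using that X(1) layered_free by blast
qed

lemma f_star_iff: "F \<in> f_star Q A \<X> \<longleftrightarrow> (\<exists>v X u. X \<in> \<X> \<and> free_on {()} (\<lambda>_. v) (\<lambda>_. X) F (\<lambda>_. u))"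
proof -
  have "universal_arrow R A (eval_at v) X F u \<and> v \<in> verts Q \<longleftrightarrow> free_on {()} (\<lambda>_. v) (\<lambda>_. X) F (\<lambda>_. u)" for v X u
    using universal_arrow_iff[of v X F u] freeD(2)[of "{()}" "\<lambda>_. v" "\<lambda>_. X" F "\<lambda>_. u" "()"] by auto
  then show ?thesis unfolding f_star_def by blast
qed

lemma Sums_f_starI:
  assumes F: "free_on K v X F u" and K: "small U K" and X: "\<And>k. k \<in> K \<Longrightarrow> X k \<in> \<X>"
  shows "F \<in> Sums U R (f_star Q A \<X>)"
proof -
  note D = freeD[OF F]
  have "\<forall>k\<in>K. \<exists>P. free_on {()} (\<lambda>_. v k) (\<lambda>_. X k) (fst P) (snd P)"
  proof
    fix k assume k: "k \<in> K"
    obtain G t where "free_on {()} (\<lambda>_. v k) (\<lambda>_. X k) G t"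
      by (rule free_exists[of "{()}" "\<lambda>_. v k" "\<lambda>_. X k"]) (use small_finite[of "{()}"] D(2,4)[OF k] in auto)
    then show "\<exists>P. free_on {()} (\<lambda>_. v k) (\<lambda>_. X k) (fst P) (snd P)" by (intro exI[of _ "(G, t)"]) simp
  qed
  then obtain P where P: "\<forall>k\<in>K. free_on {()} (\<lambda>_. v k) (\<lambda>_. X k) (fst (P k)) (snd (P k))"
    by (rule bchoice[THEN exE])
  define G t where "G k = fst (P k)" and "t k = snd (P k)" for k
  have G: "\<And>k. k \<in> K \<Longrightarrow> free_on {()} (\<lambda>_. v k) (\<lambda>_. X k) (G k) (t k)"
    using P by (simp add: G_def t_def)
  have b: "bij_betw fst (Sigma K (\<lambda>_. {()})) K" by (rule bij_betwI[of _ _ _ "\<lambda>k. (k, ())"]) auto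
  have FS: "free_on (Sigma K (\<lambda>_. {()})) (\<lambda>(k, _). v k) (\<lambda>(k, _). X k) F (\<lambda>k. u (fst k))"
    by (rule free_cong[OF free_reindex[OF F b]]) auto
  obtain j where j: "is_coproduct R K G F j"
    by (rule free_coproduct[where M = K and K = "\<lambda>_. {()}" and v = "\<lambda>k _. v k" and X = "\<lambda>k _. X k"
          and F = G and u = t and H = F, OF FS]) (use G in auto)
  show ?thesis
  proof (rule SumsI[OF j K _ R.category_axioms])
    fix k assume k: "k \<in> K"
    have "free_on {()} (\<lambda>_. v k) (\<lambda>_. X k) (G k) (\<lambda>_. t k ())" by (rule free_cong[OF G[OF k]]) auto
    then show "G k \<in> f_star Q A \<X>" unfolding f_star_iff using X[OF k] by blast
  qed
qed

lemma Sums_f_starE: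
  assumes "F \<in> Sums U R (f_star Q A \<X>)"
  obtains K :: "'u set" and v X u where "small U K" "\<forall>k\<in>K. X k \<in> \<X>" "free_on K v X F u"
proof -
  obtain K :: "'u set" and G j where K: "small U K" and G: "\<forall>k\<in>K. G k \<in> f_star Q A \<X>" and j: "is_coproduct R K G F j"
    using assms unfolding Sums_def by blast
  have "\<forall>k\<in>K. \<exists>v X u. X \<in> \<X> \<and> free_on {()} (\<lambda>_. v) (\<lambda>_. X) (G k) (\<lambda>_. u)"
    using G unfolding f_star_iff by blast
  then obtain v X u where X: "\<And>k. k \<in> K \<Longrightarrow> X k \<in> \<X>"
    and G': "\<And>k. k \<in> K \<Longrightarrow> free_on {()} (\<lambda>_. v k) (\<lambda>_. X k) (G k) (\<lambda>_. u k)" by metis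
  have F: "free_on (Sigma K (\<lambda>_. {()})) (\<lambda>(k, _). v k) (\<lambda>(k, _). X k) F (\<lambda>(k, _). cmp (j k) (v k) \<cdot> u k)"
    by (rule coproduct_free[OF j G'])
  have "bij_betw (\<lambda>k. (k, ())) K (Sigma K (\<lambda>_. {()}))" by (rule bij_betwI[of _ _ _ fst]) auto
  from free_reindex[OF F this] have "free_on K v X F (\<lambda>k. cmp (j k) (v k) \<cdot> u k)" by simp
  with K X that show ?thesis by blast
qed

end

section \<open>Direct sums, direct summands and projective representations\<close>

lemma Sums_mono: "\<Y> \<subseteq> \<Z> \<Longrightarrow> Sums U C \<Y> \<subseteq> Sums U C \<Z>"
  unfolding Sums_def by blast

lemma Add_mono: "Sums U C \<Y> \<subseteq> Sums U C \<Z> \<Longrightarrow> Add U C \<Y> \<subseteq> Add U C \<Z>"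
  unfolding Add_def by blast

lemma SumsE:
  assumes "S \<in> Sums U C \<Y>"
  obtains I :: "'u set" and X inc where "small (U :: 'u itself) I" "\<forall>i\<in>I. X i \<in> \<Y>" "is_coproduct C I X S inc"
  using assms unfolding Sums_def by blast

context universe
begin

lemma Sums_incl: "category C \<Longrightarrow> \<Y> \<subseteq> Ob C \<Longrightarrow> \<Y> \<subseteq> Sums U C \<Y>"
proof
  fix X assume C: "category C" and Y: "\<Y> \<subseteq> Ob C" and X: "X \<in> \<Y>"
  have "is_coproduct C {()} (\<lambda>_. X) X (\<lambda>_. Ide C X)"
    using category.coprod_singleton[OF C, of "\<lambda>_. X" "()"] X Y by blast
  then show "X \<in> Sums U C \<Y>" by (rule SumsI[OF _ small_finite _ C]) (use X in auto)
qed

lemma Sums_Sums: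
  assumes C: "category C"
  shows "Sums U C (Sums U C \<Y>) \<subseteq> Sums U C \<Y>"
proof
  fix S assume "S \<in> Sums U C (Sums U C \<Y>)"
  then obtain I :: "'u set" and T j where I: "small U I" and T: "\<forall>i\<in>I. T i \<in> Sums U C \<Y>"
    and S: "is_coproduct C I T S j" by (rule SumsE)
  have "\<forall>i\<in>I. \<exists>K X inc. small U (K :: 'u set) \<and> (\<forall>k\<in>K. X k \<in> \<Y>) \<and> is_coproduct C K X (T i) inc"
    using T unfolding Sums_def by blast
  then obtain K X inc where K: "\<And>i. i \<in> I \<Longrightarrow> small U (K i :: 'u set)" "\<And>i k. i \<in> I \<Longrightarrow> k \<in> K i \<Longrightarrow> X i k \<in> \<Y>"
    "\<And>i. i \<in> I \<Longrightarrow> is_coproduct C (K i) (X i) (T i) (inc i)" by metis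
  show "S \<in> Sums U C \<Y>"
    by (rule SumsI[OF category.coprod_Sigma[OF C S K(3)] small_Sigma[OF I K(1)] _ C]) (use K(2) in auto)
qed

end

context abelian_cat
begin

lemma Sums_Proj:
  fixes U :: "'u itself"
  assumes "\<X> \<subseteq> Proj A"
  shows "Sums U A \<X> \<subseteq> Proj A"
proof
  fix S assume "S \<in> Sums U A \<X>"
  then obtain I :: "'u set" and X inc where "small U I" and X: "\<forall>i\<in>I. X i \<in> \<X>" and S: "is_coproduct A I X S inc" by (rule SumsE)
  have "projective A S" by (rule coprod_projective[OF S]) (use X assms in \<open>auto simp: Proj_def\<close>)
  then show "S \<in> Proj A" by (simp add: Proj_def)
qed

lemma Add_iff: "X \<in> Add U A \<Y> \<longleftrightarrow> (\<exists>S \<in> Sums U A \<Y>. retract X S)"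
proof
  assume "X \<in> Add U A \<Y>"
  then obtain S X' inc where S: "S \<in> Sums U A \<Y>" "is_coproduct A UNIV (\<lambda>b. if b then X else X') S inc"
    unfolding Add_def by blast
  from coprod_retract[OF S(2), of True] S(1) show "\<exists>S \<in> Sums U A \<Y>. retract X S" by auto
next
  assume "\<exists>S \<in> Sums U A \<Y>. retract X S"
  then obtain S where S: "S \<in> Sums U A \<Y>" "retract X S" by blast
  obtain Z f s where "sum2 X Z S f s" by (rule retract_sum2[OF S(2)])
  then show "X \<in> Add U A \<Y>" unfolding Add_def using S(1) by blast
qed

lemma Add_Proj: "\<X> \<subseteq> Proj A \<Longrightarrow> Add U A \<X> \<subseteq> Proj A"
proof
  fix X assume X: "\<X> \<subseteq> Proj A" and "X \<in> Add U A \<X>"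
  then obtain S where S: "S \<in> Sums U A \<X>" "retract X S" unfolding Add_iff by blast
  have "projective A S" using Sums_Proj[OF X] S(1) by (auto simp: Proj_def)
  from retract_projective[OF S(2) this] show "X \<in> Proj A" by (simp add: Proj_def)
qed

lemma coprod_inj_retract:
  assumes S: "is_coproduct A I X S inc" and S': "is_coproduct A I' X' S' inc'"
    and b: "inj_on b I" "b ` I \<subseteq> I'" and eq: "\<And>i. i \<in> I \<Longrightarrow> X' (b i) = X i"
  shows "retract S S'"
proof -
  have SO: "S \<in> Ob A" "S' \<in> Ob A" using coprodD(1)[OF S] coprodD(1)[OF S'] .
  note i = coprodD(3)[OF S] and i' = coprodD(3)[OF S']
  have ib: "inc' (b j) \<in> Hom A (X j) S'" if "j \<in> I" for j using i'[of "b j"] b(2) eq[OF that] that by auto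
  then obtain s where s: "s \<in> Hom A S S'" "\<forall>j\<in>I. s \<cdot> inc j = inc' (b j)" using coprod_exB[OF S SO(2), of "\<lambda>j. inc' (b j)"] by blast
  have "\<forall>j\<in>I'. (if j \<in> b ` I then inc (inv_into I b j) else zr (X' j) S) \<in> Hom A (X' j) S"
    using i zr_Hom[OF coprodD(2)[OF S'] SO(1)] b(1) eq by auto
  from coprod_exB[OF S' SO(1) this] obtain r where r: "r \<in> Hom A S' S"
    "\<forall>j\<in>I'. r \<cdot> inc' j = (if j \<in> b ` I then inc (inv_into I b j) else zr (X' j) S)" by blast
  have "r \<cdot> s = Ide A S"
  proof (rule coprod_eq[OF S Comp_Hom[OF s(1) r(1)] Ide_Hom[OF SO(1)]])
    fix j assume j: "j \<in> I"
    show "(r \<cdot> s) \<cdot> inc j = Ide A S \<cdot> inc j"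
      using Comp_assoc[OF i[OF j] s(1) r(1)] s(2) r(2) j b Ide_Comp[OF i[OF j]] by auto
  qed
  with s(1) r(1) show ?thesis unfolding retract_def by blast
qed

end

context functors
begin

lemma R_zero:
  assumes "F \<in> Ob R" "G \<in> Ob R"
  shows "\<exists>z. z \<in> Hom R F G"
proof -
  have n: "zr (fob F w) (fob G w) \<cdot> fmor F p = fmor G p \<cdot> zr (fob F v) (fob G v)" if p: "p \<in> Hom J v w" for v w p
    using zr_comp[OF R_Ob(3)[OF assms(1) p]] comp_zr[OF R_Ob(3)[OF assms(2) p]]
      R_Ob(2)[OF assms(1) J.Hom_Ob(1)[OF p]] R_Ob(2)[OF assms(2) J.Hom_Ob(2)[OF p]] by simp
  obtain h where "h \<in> Hom R F G"
    by (rule R_homI[OF assms, of "\<lambda>v. zr (fob F v) (fob G v)"])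
      (use n zr_Hom[OF R_Ob(2)[OF assms(1)] R_Ob(2)[OF assms(2)]] in auto)
  then show ?thesis by blast
qed

lemma R_sum2_retract:
  assumes S: "is_coproduct R UNIV (\<lambda>b. if b then F else F') S inc"
  shows "R.retract F S"
proof -
  have F: "F \<in> Ob R" "F' \<in> Ob R" using R.coprodD(2)[OF S, of True] R.coprodD(2)[OF S, of False] by auto
  obtain z where z: "z \<in> Hom R F' F" using R_zero[OF F(2,1)] by blast
  have "\<forall>b\<in>UNIV. (if b then Ide R F else z) \<in> Hom R (if b then F else F') F" using z R.Ide_Hom[OF F(1)] by auto
  from R.coprod_exB[OF S F(1) this] obtain r where r: "r \<in> Hom R S F"
    "\<forall>b. r \<cdot>\<^bsub>R\<^esub> inc b = (if b then Ide R F else z)" by blast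
  then have "r \<cdot>\<^bsub>R\<^esub> inc True = Ide R F" by (simp del: fun_cat_Ide)
  moreover have "inc True \<in> Hom R F S" using R.coprodD(3)[OF S, of True] by simp
  ultimately show ?thesis unfolding R.retract_def using r(1) by blast
qed

text \<open>
  Maps out of \<open>F\<close> are lifted generator by generator, along epimorphisms that are pointwise epic.
\<close>

lemma free_projective:
  assumes F: "free_on K v X F u" and X: "\<And>k. k \<in> K \<Longrightarrow> projective A (X k)"
  shows "projective R F"
  unfolding projective_def
proof (intro conjI allI impI ballI)
  note D = freeD[OF F]
  show "F \<in> Ob R" by (rule D)
  fix e f assume e: "epic R e" and f: "f \<in> Hom R F (Cod R e)"
  have eH: "e \<in> Hom R (Dom R e) (Cod R e)" by (rule R.epic_Hom[OF e])
  have "\<forall>k\<in>K. \<exists>g. g \<in> Hom A (X k) (fob (Dom R e) (v k)) \<and> cmp e (v k) \<cdot> g = cmp f (v k) \<cdot> u k"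
  proof
    fix k assume k: "k \<in> K"
    show "\<exists>g. g \<in> Hom A (X k) (fob (Dom R e) (v k)) \<and> cmp e (v k) \<cdot> g = cmp f (v k) \<cdot> u k"
      by (rule projectiveD[OF X[OF k] epic_cmp[OF e eH D(2)[OF k]] cmp_Hom[OF eH D(2)[OF k]]
            Comp_Hom[OF D(3)[OF k] cmp_Hom[OF f D(2)[OF k]]]]) blast
  qed
  then obtain g where g: "\<forall>k\<in>K. g k \<in> Hom A (X k) (fob (Dom R e) (v k)) \<and>
      cmp e (v k) \<cdot> g k = cmp f (v k) \<cdot> u k" by (rule bchoice[THEN exE])
  then have "\<forall>k\<in>K. g k \<in> Hom A (X k) (fob (Dom R e) (v k))" by blast
  from free_ex[OF F R.Hom_Ob(1)[OF eH] this] obtain h where h: "h \<in> Hom R F (Dom R e)"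
    "\<forall>k\<in>K. cmp h (v k) \<cdot> u k = g k" by blast
  have "e \<cdot>\<^bsub>R\<^esub> h = f"
  proof (rule free_eq[OF F R.Comp_Hom[OF h(1) eH] f])
    fix k assume k: "k \<in> K"
    show "cmp (e \<cdot>\<^bsub>R\<^esub> h) (v k) \<cdot> u k = cmp f (v k) \<cdot> u k"
      using cmp_comp[OF h(1) eH D(2)[OF k]] g h(2) k
        Comp_assoc[OF D(3)[OF k] cmp_Hom[OF h(1) D(2)[OF k]] cmp_Hom[OF eH D(2)[OF k]]] by simp
  qed
  with h(1) show "\<exists>g\<in>Hom R F (Dom R e). e \<cdot>\<^bsub>R\<^esub> g = f" by blast
qed

text \<open>Generators that are zero objects impose no condition on the maps out of \<open>F\<close>.\<close>

lemma free_add_zeros: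
  assumes F: "free_on K v X F u" and K: "K \<subseteq> K'" and v: "\<And>k. k \<in> K' \<Longrightarrow> v k \<in> Ob J"
    and X: "\<And>k. k \<in> K' - K \<Longrightarrow> zero_ob A (X k)"
  shows "free_on K' v X F (\<lambda>k. if k \<in> K then u k else zr (X k) (fob F (v k)))" (is "free_on K' v X F ?u")
proof (rule free_onI)
  note D = freeD[OF F]
  show "F \<in> Ob R" by (rule D)
  show "\<And>k. k \<in> K' \<Longrightarrow> v k \<in> Ob J" by (rule v)
  show uH: "?u k \<in> Hom A (X k) (fob F (v k))" if "k \<in> K'" for k
    using D(3) zr_Hom[OF _ R_Ob(2)[OF D(1) v[OF that]]] X that by (auto simp: zero_ob_def)
  show "h = h'" if h: "h \<in> Hom R F G" "h' \<in> Hom R F G"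
    and e: "\<And>k. k \<in> K' \<Longrightarrow> cmp h (v k) \<cdot> ?u k = cmp h' (v k) \<cdot> ?u k" for G h h'
    by (rule free_eq[OF F h]) (use e K in force)
  show "\<exists>h \<in> Hom R F G. \<forall>k\<in>K'. cmp h (v k) \<cdot> ?u k = g k"
    if G: "G \<in> Ob R" and g: "\<And>k. k \<in> K' \<Longrightarrow> g k \<in> Hom A (X k) (fob G (v k))" for G g
  proof -
    have "\<forall>k\<in>K. g k \<in> Hom A (X k) (fob G (v k))" using g K by blast
    from free_ex[OF F G this] obtain h where h: "h \<in> Hom R F G" "\<forall>k\<in>K. cmp h (v k) \<cdot> u k = g k" by blast
    have "cmp h (v k) \<cdot> ?u k = g k" if k: "k \<in> K'" for k
    proof (cases "k \<in> K")
      case False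
      then have "zero_ob A (X k)" using X k by blast
      then show ?thesis
        using zero_ob_Hom(2)[OF _ g[OF k]] zero_ob_Hom(2)[OF _ Comp_Hom[OF uH[OF k] cmp_Hom[OF h(1) v[OF k]]]] by simp
    qed (use h in simp)
    with h(1) show ?thesis by blast
  qed
qed

text \<open>
  The complement is free on the complements of the \<open>X k\<close>.
\<close>

lemma free_summand:
  assumes F: "free_on K v X F u" and H: "free_on K v V H e" and r: "\<And>k. k \<in> K \<Longrightarrow> retract (X k) (V k)"
    and K: "small U K"
  obtains F' j where "is_coproduct R UNIV (\<lambda>b. if b then F else F') H j"
proof -
  note D = freeD[OF F]
  have "\<forall>k\<in>K. \<exists>Z inc. is_coproduct A UNIV (\<lambda>b. if b then X k else Z) (V k) inc"
  proof
    fix k assume k: "k \<in> K"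
    show "\<exists>Z inc. is_coproduct A UNIV (\<lambda>b. if b then X k else Z) (V k) inc"
      by (rule retract_sum2[OF r[OF k]]) blast
  qed
  then obtain Z inc where Z: "\<And>k. k \<in> K \<Longrightarrow> is_coproduct A UNIV (\<lambda>b. if b then X k else Z k) (V k) (inc k)"
    by metis
  have ZO: "Z k \<in> Ob A" if "k \<in> K" for k using coprodD(2)[OF Z[OF that], of False] by simp
  obtain F' u' where F': "free_on K v Z F' u'" by (rule free_exists[of K v Z]) (use K D(2) ZO in auto)
  have 1: "free_on (Sigma K (\<lambda>_. UNIV)) (\<lambda>(k, b). v k) (\<lambda>(k, b). if b then X k else Z k) H (\<lambda>(k, b). e k \<cdot> inc k b)"
    by (rule free_refine[OF H Z])
  have b: "bij_betw (\<lambda>(b, k). (k, b)) (Sigma UNIV (\<lambda>_. K)) (Sigma K (\<lambda>_. UNIV))"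
    by (rule bij_betwI[of _ _ _ "\<lambda>(k, b). (b, k)"]) auto
  have 2: "free_on (Sigma (UNIV :: bool set) (\<lambda>_. K)) (\<lambda>(b, k). v k) (\<lambda>(b, k). if b then X k else Z k) H
      (\<lambda>(b, k). e k \<cdot> inc k b)"
    by (rule free_cong[OF free_reindex[OF 1 b]]) auto
  obtain j where "is_coproduct R UNIV (\<lambda>b. if b then F else F') H j"
    by (rule free_coproduct[where M = UNIV and K = "\<lambda>_. K" and v = "\<lambda>_. v" and F = "\<lambda>b. if b then F else F'"
          and X = "\<lambda>b k. if b then X k else Z k" and u = "\<lambda>b. if b then u else u'", OF 2])
      (use F F' in auto)
  with that show ?thesis by blast
qed

end

context quiver_reps
begin

text \<open>
  On both sides are the representations that are free on a family of objects of \<open>\<X>\<close>; on the left the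
  generators at each vertex are summed up.
\<close>

lemma Phi_Sums:
  assumes X: "\<X> \<subseteq> Proj A"
  shows "Phi Q A (Sums U A \<X>) = Sums U R (f_star Q A \<X>)"
proof (intro equalityI subsetI)
  fix F assume "F \<in> Phi Q A (Sums U A \<X>)"
  then obtain S u where S: "\<forall>w\<in>verts Q. S w \<in> Sums U A \<X>" and F: "free_on (verts Q) (\<lambda>w. w) S F u"
    using Sums_Proj[OF X] by (rule free_Phi)
  have "\<forall>w\<in>verts Q. \<exists>K X inc. small U (K :: 'u set) \<and> (\<forall>k\<in>K. X k \<in> \<X>) \<and> is_coproduct A K X (S w) inc"
    using S unfolding Sums_def by blast
  then obtain K Y inc where K: "\<And>w. w \<in> verts Q \<Longrightarrow> small U (K w :: 'u set)"
    "\<And>w k. w \<in> verts Q \<Longrightarrow> k \<in> K w \<Longrightarrow> Y w k \<in> \<X>"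
    "\<And>w. w \<in> verts Q \<Longrightarrow> is_coproduct A (K w) (Y w) (S w) (inc w)" by metis
  show "F \<in> Sums U R (f_star Q A \<X>)"
    by (rule Sums_f_starI[OF free_refine[OF F K(3)] small_Sigma[OF small_verts K(1)]]) (use K(2) in auto)
next
  fix F assume "F \<in> Sums U R (f_star Q A \<X>)"
  then obtain K :: "'u set" and v Y u where K: "small U K" "\<forall>k\<in>K. Y k \<in> \<X>" and F: "free_on K v Y F u"
    by (rule Sums_f_starE)
  note D = freeD[OF F]
  let ?I = "\<lambda>w. {k \<in> K. v k = w}"
  have sI: "small U (?I w)" for w by (rule small_subset[OF K(1)]) auto
  have "\<exists>S inc. is_coproduct A (?I w) Y S inc" for w
    by (rule coproduct_exists[OF cocomplete sI _ category_axioms]) (use D(4) in auto)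
  then obtain S inc where S: "\<And>w. is_coproduct A (?I w) Y (S w) (inc w)" by metis
  have SX: "S w \<in> Sums U A \<X>" for w by (rule SumsI[OF S sI _ category_axioms]) (use K(2) in auto)
  have b: "bij_betw snd (Sigma (verts Q) ?I) K"
    by (rule bij_betwI[of _ _ _ "\<lambda>k. (v k, k)"]) (use D(2) in auto)
  have "free_on (Sigma (verts Q) ?I) (\<lambda>(w, k). w) (\<lambda>(w, k). (\<lambda>_. Y) w k) F (\<lambda>k. u (snd k))"
    by (rule free_cong[OF free_reindex[OF F b]]) auto
  then obtain u' where "free_on (verts Q) (\<lambda>w. w) S F u'"
    by (rule free_coarsen[where K = "verts Q" and v = "\<lambda>w. w" and I = ?I and X = "\<lambda>_. Y" and S = S and inc = inc])
      (use S in auto)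
  then show "F \<in> Phi Q A (Sums U A \<X>)" by (rule Phi_free) (rule SX)
qed

lemma Phi_mono: "\<Y> \<subseteq> \<Z> \<Longrightarrow> Phi Q A \<Y> \<subseteq> Phi Q A \<Z>"
  unfolding Phi_def by blast

lemma Proj_Ob: "\<X> \<subseteq> Proj A \<Longrightarrow> \<X> \<subseteq> Ob A"
  by (auto simp: Proj_def projective_def)

lemma Phi_Sums_f_star:
  assumes X: "\<X> \<subseteq> Proj A"
  shows "Phi Q A \<X> \<subseteq> Sums U R (f_star Q A \<X>)"
  using Phi_mono[OF Sums_incl[OF category_axioms Proj_Ob[OF X]]] Phi_Sums[OF X] by simp

lemma Sums_Phi:
  assumes X: "\<X> \<subseteq> Proj A"
  shows "Sums U R (Phi Q A \<X>) \<subseteq> Sums U R (f_star Q A \<X>)"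
  using Sums_mono[OF Phi_Sums_f_star[OF X]] Sums_Sums[OF R.category_axioms] by blast

text \<open>
  The zero object serves as the generator at all vertices but one.
\<close>

lemma f_star_Phi:
  assumes Z: "Z \<in> \<X>" "zero_ob A Z"
  shows "f_star Q A \<X> \<subseteq> Phi Q A \<X>"
proof
  fix F assume "F \<in> f_star Q A \<X>"
  then obtain v X u where X: "X \<in> \<X>" and F: "free_on {()} (\<lambda>_. v) (\<lambda>_. X) F (\<lambda>_. u)"
    unfolding f_star_iff by blast
  have v: "v \<in> verts Q" using freeD(2)[OF F, of "()"] by simp
  have b: "bij_betw (\<lambda>_. ()) {v} {()}" by (simp add: bij_betw_def)
  let ?X = "\<lambda>w. if w = v then X else Z"
  have "free_on {v} (\<lambda>w. w) ?X F (\<lambda>_. u)" by (rule free_cong[OF free_reindex[OF F b]]) auto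
  then have "free_on (verts Q) (\<lambda>w. w) ?X F (\<lambda>k. if k \<in> {v} then u else zr (?X k) (fob F k))"
    by (rule free_add_zeros) (use v Z in auto)
  then show "F \<in> Phi Q A \<X>" by (rule Phi_free) (use X Z in auto)
qed

text \<open>The canonical map of a retract is a retract of the canonical map.\<close>

lemma Phi_retract:
  assumes G: "G \<in> Phi Q A \<Y>" and r: "R.retract F G" and \<Z>: "\<And>X Y. Y \<in> \<Y> \<Longrightarrow> retract X Y \<Longrightarrow> X \<in> \<Z>"
  shows "F \<in> Phi Q A \<Z>"
  unfolding Phi_def
proof (intro CollectI conjI ballI)
  obtain s e where s: "s \<in> Hom R F G" "e \<in> Hom R G F" "e \<cdot>\<^bsub>R\<^esub> s = Ide R F" by (rule R.retractE[OF r])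
  show F: "F \<in> Ob R" using R.Hom_Ob[OF s(1)] by blast
  fix w assume w: "w \<in> verts Q"
  have w': "w \<in> Ob (path_cat Q)" using w by simp
  have es: "cmp e x \<cdot> cmp s x = Ide A (fob F x)" if "x \<in> verts Q" for x
    using cmp_comp[OF s(1,2)] cmp_ide[of x F] s(3) that by simp
  note sH = cmp_Hom[OF s(1), simplified] and eH = cmp_Hom[OF s(2), simplified]
  obtain T incT p Z c where p: "canonical G w T incT p" "monic A p" "is_cokernel A p c"
    "c \<in> Hom A (fob G w) Z" "Z \<in> \<Y>" by (rule PhiD[OF G w])
  note pD = canonicalD[OF p(1)] and iT = coprodD(3)[OF canonicalD(1)[OF p(1)]]
  obtain S inc q where q: "canonical F w S inc q" by (rule canonical_exists[OF F w])
  note qD = canonicalD[OF q] and i = coprodD(3)[OF canonicalD(1)[OF q]]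
  have SO: "S \<in> Ob A" "T \<in> Ob A" using coprodD(1)[OF qD(1)] coprodD(1)[OF pD(1)] .
  obtain s' where s': "s' \<in> Hom A S T" "\<forall>a\<in>into w. s' \<cdot> inc a = incT a \<cdot> cmp s (src Q a)"
    and ps: "p \<cdot> s' = cmp s w \<cdot> q" by (rule canonical_nat[OF q p(1) s(1) w])
  obtain e' where e': "e' \<in> Hom A T S" "\<forall>a\<in>into w. e' \<cdot> incT a = inc a \<cdot> cmp e (src Q a)"
    and qe: "q \<cdot> e' = cmp e w \<cdot> p" by (rule canonical_nat[OF p(1) q s(2) w])
  have es': "e' \<cdot> s' = Ide A S"
  proof (rule coprod_eq[OF qD(1) Comp_Hom[OF s'(1) e'(1)] Ide_Hom[OF SO(1)]])
    fix a assume a: "a \<in> into w"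
    note x = intoD(3)[OF a]
    have "(e' \<cdot> s') \<cdot> inc a = inc a \<cdot> (cmp e (src Q a) \<cdot> cmp s (src Q a))"
      using Comp_assoc[OF i[OF a] s'(1) e'(1)] s'(2) a Comp_assoc[OF sH[OF x] iT[OF a] e'(1)] e'(2)
        Comp_assoc[OF sH[OF x] eH[OF x] i[OF a]] by simp
    then show "(e' \<cdot> s') \<cdot> inc a = Ide A S \<cdot> inc a"
      using es[OF x] Comp_Ide[OF i[OF a]] Ide_Comp[OF i[OF a]] by simp
  qed
  have mq: "monic A q"
  proof (rule monicI[OF qD(2)])
    fix W g assume g: "g \<in> Hom A W S" "q \<cdot> g = zr W (fob F w)"
    note W = Hom_Ob(1)[OF g(1)]
    have "p \<cdot> (s' \<cdot> g) = zr W (fob G w)"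
      using Comp_assoc[OF g(1) s'(1) pD(2)] ps Comp_assoc[OF g(1) qD(2) sH[OF w]] g(2) comp_zr[OF sH[OF w] W] by simp
    then have "s' \<cdot> g = zr W T" by (rule monic_zrD[OF p(2) pD(2) Comp_Hom[OF g(1) s'(1)]])
    then show "g = zr W S"
      using comp_reduce[OF es' s'(1) e'(1) g(1)] Ide_Comp[OF g(1)] comp_zr[OF e'(1) W] by simp
  qed
  obtain Y d where d: "d \<in> Hom A (fob F w) Y" "is_cokernel A q d" by (rule cokernel_exists[OF qD(2)])
  note dD = cokernelD[OF d(2) qD(2) d(1)] and cD = cokernelD[OF p(3) pD(2) p(4)]
  have YO: "Y \<in> Ob A" "Z \<in> Ob A" using Hom_Ob d(1) p(4) by auto
  have "(c \<cdot> cmp s w) \<cdot> q = zr S Z"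
    using Comp_assoc[OF qD(2) sH[OF w] p(4)] ps Comp_assoc[OF s'(1) pD(2) p(4)] cD(1) zr_comp[OF s'(1) YO(2)] by simp
  from dD(3)[OF Comp_Hom[OF sH[OF w] p(4)] this] obtain t where t: "t \<in> Hom A Y Z" "t \<cdot> d = c \<cdot> cmp s w" by blast
  have "(d \<cdot> cmp e w) \<cdot> p = zr T Y"
    using Comp_assoc[OF pD(2) eH[OF w] d(1)] qe Comp_assoc[OF e'(1) qD(2) d(1)] dD(1) zr_comp[OF e'(1) YO(1)] by simp
  from cD(3)[OF Comp_Hom[OF eH[OF w] d(1)] this] obtain t' where t': "t' \<in> Hom A Z Y" "t' \<cdot> c = d \<cdot> cmp e w" by blast
  have "(t' \<cdot> t) \<cdot> d = Ide A Y \<cdot> d"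
    using Comp_assoc[OF d(1) t(1) t'(1)] t(2) Comp_assoc[OF sH[OF w] p(4) t'(1)] t'(2)
      Comp_assoc[OF sH[OF w] eH[OF w] d(1)] es[OF w] Comp_Ide[OF d(1)] Ide_Comp[OF d(1)] by simp
  then have "t' \<cdot> t = Ide A Y" by (rule epicD[OF dD(2) d(1) Comp_Hom[OF t(1) t'(1)] Ide_Hom[OF YO(1)]])
  then have "retract Y Z" using t(1) t'(1) unfolding retract_def by blast
  then have "Y \<in> \<Z>" by (rule \<Z>[OF p(5)])
  then show "\<exists>p c. canonical_map Q A F w p \<and> monic A p \<and> is_cokernel A p c \<and> Cod A c \<in> \<Z>"
    unfolding canonical_map_iff using q mq d HomD[OF d(1)] by blast
qed

lemma Phi_Add:
  assumes X: "\<X> \<subseteq> Proj A"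
  shows "Phi Q A (Add U A \<X>) = Add U R (f_star Q A \<X>)"
proof (intro equalityI subsetI)
  fix F assume "F \<in> Phi Q A (Add U A \<X>)"
  then obtain Y u where Y: "\<forall>w\<in>verts Q. Y w \<in> Add U A \<X>" and F: "free_on (verts Q) (\<lambda>w. w) Y F u"
    using Add_Proj[OF X] by (rule free_Phi)
  obtain S where S: "\<And>w. w \<in> verts Q \<Longrightarrow> S w \<in> Sums U A \<X>" "\<And>w. w \<in> verts Q \<Longrightarrow> retract (Y w) (S w)"
    using Y unfolding Add_iff by metis
  have SO: "S w \<in> Ob A" if "w \<in> verts Q" for w
    using Proj_Ob[OF Sums_Proj[OF X]] S(1)[OF that] by blast
  obtain H e where H: "free_on (verts Q) (\<lambda>w. w) S H e"
    by (rule free_exists[of "verts Q" "\<lambda>w. w" S]) (use small_verts SO in auto)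
  obtain F' j where "is_coproduct R UNIV (\<lambda>b. if b then F else F') H j"
    by (rule free_summand[OF F H S(2) small_verts])
  moreover have "H \<in> Sums U R (f_star Q A \<X>)" using Phi_free[OF H S(1)] Phi_Sums[OF X] by simp
  ultimately show "F \<in> Add U R (f_star Q A \<X>)" unfolding Add_def by blast
next
  fix F assume "F \<in> Add U R (f_star Q A \<X>)"
  then obtain S F' j where S: "S \<in> Sums U R (f_star Q A \<X>)" and j: "is_coproduct R UNIV (\<lambda>b. if b then F else F') S j"
    unfolding Add_def by blast
  have S': "S \<in> Phi Q A (Sums U A \<X>)" using S Phi_Sums[OF X] by simp
  show "F \<in> Phi Q A (Add U A \<X>)"
    by (rule Phi_retract[OF S' R_sum2_retract[OF j]]) (use Add_iff in blast)
qed

text \<open>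
  For the inclusion of \<open>f\<^sub>*(\<X>)\<close> into \<open>Add \<Phi>(\<X>)\<close> the generators are enlarged: the free functor with
  one generator for each vertex \<open>w\<close>, chosen in \<open>\<X>\<close>, lies in \<open>\<Phi>(\<X>)\<close> whatever the choice, and the sum
  of sufficiently many such functors has any given family of direct summands of sums of objects
  of \<open>\<X>\<close> as part of its generators.
\<close>

lemma Add_Phi:
  assumes X: "\<X> \<subseteq> Proj A"
  shows "Add U R (f_star Q A \<X>) = Add U R (Phi Q A \<X>)"
proof
  show "Add U R (Phi Q A \<X>) \<subseteq> Add U R (f_star Q A \<X>)" by (rule Add_mono[OF Sums_Phi[OF X]])
  show "Add U R (f_star Q A \<X>) \<subseteq> Add U R (Phi Q A \<X>)"
  proof
    fix F assume "F \<in> Add U R (f_star Q A \<X>)"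
    then have "F \<in> Phi Q A (Add U A \<X>)" using Phi_Add[OF X] by simp
    then obtain Y u where Y: "\<forall>w\<in>verts Q. Y w \<in> Add U A \<X>" and F: "free_on (verts Q) (\<lambda>w. w) Y F u"
      using Add_Proj[OF X] by (rule free_Phi)
    obtain S where S: "\<And>w. w \<in> verts Q \<Longrightarrow> S w \<in> Sums U A \<X>" "\<And>w. w \<in> verts Q \<Longrightarrow> retract (Y w) (S w)"
      using Y unfolding Add_iff by metis
    have "\<forall>w\<in>verts Q. \<exists>K X inc. small U (K :: 'u set) \<and> (\<forall>k\<in>K. X k \<in> \<X>) \<and> is_coproduct A K X (S w) inc"
      using S(1) unfolding Sums_def by blast
    then obtain K Z inc where K: "\<And>w. w \<in> verts Q \<Longrightarrow> small U (K w :: 'u set)"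
      "\<And>w k. w \<in> verts Q \<Longrightarrow> k \<in> K w \<Longrightarrow> Z w k \<in> \<X>"
      "\<And>w. w \<in> verts Q \<Longrightarrow> is_coproduct A (K w) (Z w) (S w) (inc w)" by metis
    define N where "N = Sigma (verts Q) K"
    have sN: "small U N" unfolding N_def by (rule small_Sigma[OF small_verts K(1)])
    \<comment> \<open>At vertices other than the one of \<open>n\<close> any object of \<open>\<X>\<close> will do; there is one as soon as \<open>N\<close> has an element.\<close>
    define B where "B n w = (if w = fst n then Z w (snd n) else (SOME X. X \<in> \<X>))" for n w
    have BX: "B n w \<in> \<X>" if "n \<in> N" "w \<in> verts Q" for n w
      using that K(2) someI[of "\<lambda>X. X \<in> \<X>"] by (auto simp: N_def B_def)
    then have BO: "B n w \<in> Ob A" if "n \<in> N" "w \<in> verts Q" for n w using that Proj_Ob[OF X] by blast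
    have "\<forall>w\<in>verts Q. \<exists>V i. is_coproduct A N (\<lambda>n. B n w) V i"
    proof
      fix w assume w: "w \<in> verts Q"
      show "\<exists>V i. is_coproduct A N (\<lambda>n. B n w) V i"
        by (rule coproduct_exists[OF cocomplete sN _ category_axioms]) (rule BO[OF _ w])
    qed
    then obtain V i where V: "\<And>w. w \<in> verts Q \<Longrightarrow> is_coproduct A N (\<lambda>n. B n w) (V w) (i w)" by metis
    obtain H e where H: "free_on (verts Q) (\<lambda>w. w) V H e"
      by (rule free_exists[of "verts Q" "\<lambda>w. w" V]) (use small_verts coprodD(1)[OF V] in auto)
    have r: "retract (Y w) (V w)" if w: "w \<in> verts Q" for w
    proof -
      have "retract (S w) (V w)"
        by (rule coprod_inj_retract[OF K(3)[OF w] V[OF w], of "\<lambda>k. (w, k)"])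
          (use w in \<open>auto simp: N_def B_def inj_on_def\<close>)
      then show ?thesis by (rule retract_trans[OF S(2)[OF w]])
    qed
    obtain F' j where FF: "is_coproduct R UNIV (\<lambda>b. if b then F else F') H j"
      by (rule free_summand[OF F H r small_verts])
    have "\<forall>n\<in>N. \<exists>G. G \<in> Phi Q A \<X> \<and> (\<exists>t. free_on (verts Q) (\<lambda>w. w) (B n) G t)"
    proof
      fix n assume n: "n \<in> N"
      obtain G t where G: "free_on (verts Q) (\<lambda>w. w) (B n) G t"
        by (rule free_exists[of "verts Q" "\<lambda>w. w" "B n"]) (use small_verts BO[OF n] in auto)
      then show "\<exists>G. G \<in> Phi Q A \<X> \<and> (\<exists>t. free_on (verts Q) (\<lambda>w. w) (B n) G t)"
        using Phi_free[OF G BX[OF n]] by blast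
    qed
    then obtain G t where G: "\<And>n. n \<in> N \<Longrightarrow> G n \<in> Phi Q A \<X>"
      "\<And>n. n \<in> N \<Longrightarrow> free_on (verts Q) (\<lambda>w. w) (B n) (G n) (t n)" by metis
    have b: "bij_betw (\<lambda>(n, w). (w, n)) (Sigma N (\<lambda>_. verts Q)) (Sigma (verts Q) (\<lambda>_. N))"
      by (rule bij_betwI[of _ _ _ "\<lambda>(k, b). (b, k)"]) auto
    have HN: "free_on (Sigma N (\<lambda>_. verts Q)) (\<lambda>(n, w). w) (\<lambda>(n, w). B n w) H (\<lambda>(n, w). e w \<cdot> i w n)"
      by (rule free_cong[OF free_reindex[OF free_refine[OF H V] b]]) auto
    obtain j' where j': "is_coproduct R N G H j'"
      by (rule free_coproduct[where M = N and K = "\<lambda>_. verts Q" and v = "\<lambda>_ w. w" and X = B and F = G and u = t, OF HN])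
        (use G(2) in auto)
    have "H \<in> Sums U R (Phi Q A \<X>)" by (rule SumsI[OF j' sN G(1) R.category_axioms])
    with FF show "F \<in> Add U R (Phi Q A \<X>)" unfolding Add_def by blast
  qed
qed

text \<open>
  A projective \<open>F\<close> is a retract of a free representation that is generated by projective objects mapping
  onto the \<open>F(w)\<close>, and \<open>\<Phi>(Proj)\<close> is closed under retracts.
\<close>

lemma Phi_Proj:
  assumes en: "enough_projectives A"
  shows "Phi Q A (Proj A) = Proj R"
proof (intro equalityI subsetI)
  fix F assume "F \<in> Phi Q A (Proj A)"
  then obtain X u where "\<forall>w\<in>verts Q. X w \<in> Proj A" "free_on (verts Q) (\<lambda>w. w) X F u"
    using order_refl by (rule free_Phi)
  then show "F \<in> Proj R" using free_projective[of "verts Q" "\<lambda>w. w" X F u] by (simp add: Proj_def)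
next
  fix F assume "F \<in> Proj R"
  then have P: "projective R F" by (simp add: Proj_def)
  then have F: "F \<in> Ob R" by (simp add: projective_def)
  have "\<forall>w\<in>verts Q. \<exists>X e. X \<in> Proj A \<and> e \<in> Hom A X (fob F w) \<and> epic A e"
    using en R_Ob(2)[OF F] unfolding enough_projectives_def by force
  then obtain X e where X: "\<And>w. w \<in> verts Q \<Longrightarrow> X w \<in> Proj A" and e: "\<And>w. w \<in> verts Q \<Longrightarrow> e w \<in> Hom A (X w) (fob F w)"
    "\<And>w. w \<in> verts Q \<Longrightarrow> epic A (e w)" by metis
  obtain H u where H: "free_on (verts Q) (\<lambda>w. w) X H u"
    by (rule free_exists[of "verts Q" "\<lambda>w. w" X]) (use small_verts Hom_Ob(1)[OF e(1)] in auto)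
  note D = freeD[OF H]
  have "\<forall>w\<in>verts Q. e w \<in> Hom A (X w) (fob F w)" using e by blast
  from free_ex[OF H F this] obtain h where h: "h \<in> Hom R H F" "\<forall>w\<in>verts Q. cmp h w \<cdot> u w = e w" by blast
  have "epic R h"
  proof (rule epic_pointwise[OF h(1)])
    fix w assume "w \<in> Ob (path_cat Q)"
    then have w: "w \<in> verts Q" by simp
    note hw = cmp_Hom[OF h(1), simplified, OF w]
    show "epic A (cmp h w)"
    proof (rule epicI[OF hw])
      fix Z g assume g: "g \<in> Hom A (fob F w) Z" "g \<cdot> cmp h w = zr (fob H w) Z"
      note Z = Hom_Ob(2)[OF g(1)]
      have "g \<cdot> e w = zr (X w) Z"
        using Comp_assoc[OF D(3)[OF w] hw g(1)] h(2) w g(2) zr_comp[OF D(3)[OF w] Z] by simp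
      also have "\<dots> = zr (fob F w) Z \<cdot> e w" using zr_comp[OF e(1)[OF w] Z] by simp
      finally show "g = zr (fob F w) Z"
        by (rule epicD[OF e(2)[OF w] e(1)[OF w] g(1) zr_Hom[OF Hom_Ob(1)[OF g(1)] Z]])
    qed
  qed
  then have r: "R.retract F H" by (rule R.projective_retract[OF P _ h(1)])
  show "F \<in> Phi Q A (Proj A)"
    by (rule Phi_retract[OF Phi_free[OF H X] r]) (use retract_projective in \<open>auto simp: Proj_def\<close>)
qed

end

section \<open>Finitely generated projective objects\<close>

text \<open>
  Two witnesses for different conditions are continued to a common target and then equalized there; both
  conditions survive, as they are preserved by composition.
\<close>

lemma filtered_finite:
  assumes K: "category K" "filtered K" and j: "j \<in> Ob K" and T: "finite T"
    and ex: "\<And>i. i \<in> T \<Longrightarrow> \<exists>k. \<exists>u \<in> Hom K j k. E i u"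
    and stable: "\<And>i u k w k'. i \<in> T \<Longrightarrow> u \<in> Hom K j k \<Longrightarrow> E i u \<Longrightarrow> w \<in> Hom K k k' \<Longrightarrow> E i (w \<cdot>\<^bsub>K\<^esub> u)"
  shows "\<exists>k. \<exists>u \<in> Hom K j k. \<forall>i\<in>T. E i u"
  using T ex stable
proof (induction T)
  case empty
  then show ?case using category.Ide_Hom[OF K(1) j] by blast
next
  case (insert i T)
  interpret K: category K by (rule K)
  obtain k u where u: "u \<in> Hom K j k" "\<forall>i\<in>T. E i u" using insert.IH insert.prems by blast
  obtain k' v where v: "v \<in> Hom K j k'" "E i v" using insert.prems(1) by blast
  obtain m s t where s: "s \<in> Hom K k m" and t: "t \<in> Hom K k' m"
    by (rule filtered_bound[OF K(2) K.Hom_Ob(2)[OF u(1)] K.Hom_Ob(2)[OF v(1)]])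
  obtain n w where w: "w \<in> Hom K m n" "w \<cdot>\<^bsub>K\<^esub> (s \<cdot>\<^bsub>K\<^esub> u) = w \<cdot>\<^bsub>K\<^esub> (t \<cdot>\<^bsub>K\<^esub> v)"
    by (rule filtered_coequalize[OF K(2) K.Comp_Hom[OF u(1) s] K.Comp_Hom[OF v(1) t]])
  have su: "s \<cdot>\<^bsub>K\<^esub> u \<in> Hom K j m" and tv: "t \<cdot>\<^bsub>K\<^esub> v \<in> Hom K j m"
    using K.Comp_Hom[OF u(1) s] K.Comp_Hom[OF v(1) t] .
  have "E x (w \<cdot>\<^bsub>K\<^esub> (s \<cdot>\<^bsub>K\<^esub> u))" if "x \<in> T" for x
  proof -
    have "E x (s \<cdot>\<^bsub>K\<^esub> u)" by (rule insert.prems(2)[OF _ u(1) _ s]) (use that u(2) in auto)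
    from insert.prems(2)[OF _ su this w(1)] that show ?thesis by auto
  qed
  moreover have "E i (w \<cdot>\<^bsub>K\<^esub> (s \<cdot>\<^bsub>K\<^esub> u))"
  proof -
    have "E i (t \<cdot>\<^bsub>K\<^esub> v)" by (rule insert.prems(2)[OF _ v t]) auto
    from insert.prems(2)[OF _ tv this w(1)] w(2) show ?thesis by auto
  qed
  ultimately show ?case using K.Comp_Hom[OF su w(1)] by blast
qed

locale cocomplete_abelian = abelian_cat A pl + universe U
  for A :: "('o, 'm) cat" (structure) and pl (infixl "\<oplus>" 65) and U :: "'u itself" +
  assumes cocomp: "cocomplete U A"
begin

lemma A_cat: "category A" by (rule category_axioms)

lemma coproducts: "small U I \<Longrightarrow> (\<And>i. i \<in> I \<Longrightarrow> X i \<in> Ob A) \<Longrightarrow> \<exists>S inc. is_coproduct A I X S inc"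
  by (rule coproduct_exists[OF cocomp _ _ A_cat])

lemma fg_projD:
  assumes "P \<in> fg_proj U A"
  shows "projective A P" "fin_generated U A P" "P \<in> Ob A"
  using assms by (auto simp: fg_proj_def projective_def)

text \<open>
  The partial sums over the complements of the finite sets of indices form a filtered system with
  colimit zero. As \<open>P\<close> is finitely generated, \<open>x\<close> becomes zero in one of them.
\<close>

lemma finite_support:
  assumes P: "fin_generated U A P" and S: "is_coproduct A I X S inc" and I: "small U I" and x: "x \<in> Hom A P S"
  shows "\<exists>T. finite T \<and> T \<subseteq> I \<and> (\<forall>M t. t \<in> Hom A S M \<longrightarrow> (\<forall>i\<in>T. t \<cdot> inc i = zr (X i) M) \<longrightarrow> t \<cdot> x = zr P M)"
proof -
  note XO = coprodD(2)[OF S] and i = coprodD(3)[OF S] and PO = Hom_Ob(1)[OF x]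
  have "\<forall>T\<in>Fpow I. \<exists>Y. is_coproduct A (I - T) X (fst Y) (snd Y)"
  proof
    fix T assume "T \<in> Fpow I"
    obtain Y e where "is_coproduct A (I - T) X Y e"
      using coproducts[OF small_subset[OF I], of "I - T" X] XO by auto
    then show "\<exists>Y. is_coproduct A (I - T) X (fst Y) (snd Y)" by (intro exI[of _ "(Y, e)"]) simp
  qed
  then obtain Z where Z: "\<forall>T\<in>Fpow I. is_coproduct A (I - T) X (fst (Z T)) (snd (Z T))"
    by (rule bchoice[THEN exE])
  define Y e where "Y T = fst (Z T)" and "e T = snd (Z T)" for T
  have Y: "is_coproduct A (I - T) X (Y T) (e T)" if "T \<in> Fpow I" for T
    using Z that by (simp add: Y_def e_def)
  note YO = coprodD(1)[OF Y] and eH = coprodD(3)[OF Y]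
  have "\<forall>TT\<in>Fpow I \<times> Fpow I. \<exists>d. d \<in> Hom A (Y (fst TT)) (Y (snd TT)) \<and>
      (\<forall>k\<in>I - fst TT. d \<cdot> e (fst TT) k = (if k \<in> snd TT then zr (X k) (Y (snd TT)) else e (snd TT) k))"
  proof
    fix TT assume "TT \<in> Fpow I \<times> Fpow I"
    then have T: "fst TT \<in> Fpow I" "snd TT \<in> Fpow I" by auto
    have "\<forall>k\<in>I - fst TT. (if k \<in> snd TT then zr (X k) (Y (snd TT)) else e (snd TT) k) \<in> Hom A (X k) (Y (snd TT))"
      using eH[OF T(2)] zr_Hom[OF XO YO[OF T(2)]] by auto
    from coprod_exB[OF Y[OF T(1)] YO[OF T(2)] this]
    show "\<exists>d. d \<in> Hom A (Y (fst TT)) (Y (snd TT)) \<and>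
      (\<forall>k\<in>I - fst TT. d \<cdot> e (fst TT) k = (if k \<in> snd TT then zr (X k) (Y (snd TT)) else e (snd TT) k))" by blast
  qed
  then obtain d where "\<forall>TT\<in>Fpow I \<times> Fpow I. d TT \<in> Hom A (Y (fst TT)) (Y (snd TT)) \<and>
      (\<forall>k\<in>I - fst TT. d TT \<cdot> e (fst TT) k = (if k \<in> snd TT then zr (X k) (Y (snd TT)) else e (snd TT) k))"
    by (rule bchoice[THEN exE])
  then have d: "\<And>T T'. T \<in> Fpow I \<Longrightarrow> T' \<in> Fpow I \<Longrightarrow> d (T, T') \<in> Hom A (Y T) (Y T')"
    "\<And>T T' k. T \<in> Fpow I \<Longrightarrow> T' \<in> Fpow I \<Longrightarrow> k \<in> I \<Longrightarrow> k \<notin> T \<Longrightarrow>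
      d (T, T') \<cdot> e T k = (if k \<in> T' then zr (X k) (Y T') else e T' k)"
    by auto
  \<comment> \<open>\<open>d (T, T')\<close> forgets the components in \<open>T'\<close>.\<close>
  let ?K = "\<lparr> Ob = Fpow I, Mor = {(T, T'). T \<in> Fpow I \<and> T' \<in> Fpow I \<and> T \<subseteq> T'}, Dom = fst, Cod = snd,
    Ide = (\<lambda>T. (T, T)), Comp = (\<lambda>q p. (fst p, snd q)) \<rparr>"
  let ?D = "\<lparr> fob = Y, fmor = d \<rparr>"
  have HomK: "p \<in> Hom ?K T T' \<longleftrightarrow> p = (T, T') \<and> T \<in> Fpow I \<and> T' \<in> Fpow I \<and> T \<subseteq> T'" for p T T'
    by (cases p) (auto simp: Hom_def)
  have K: "category ?K" by unfold_locales (auto simp: HomK)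
  have un: "T \<union> T' \<in> Fpow I" if "T \<in> Fpow I" "T' \<in> Fpow I" for T T' using that by (auto simp: Fpow_def)
  have fK: "filtered ?K"
    unfolding filtered_def
  proof (intro conjI ballI allI)
    show "Ob ?K \<noteq> {}" by (auto simp: Fpow_def)
    show "\<exists>k. Hom ?K T k \<noteq> {} \<and> Hom ?K T' k \<noteq> {}" if "T \<in> Ob ?K" "T' \<in> Ob ?K" for T T'
      using that un by (intro exI[of _ "T \<union> T'"]) (auto simp: HomK ex_in_conv[symmetric])
    show "\<exists>k. \<exists>w\<in>Hom ?K T' k. w \<cdot>\<^bsub>?K\<^esub> u = w \<cdot>\<^bsub>?K\<^esub> v" if "u \<in> Hom ?K T T'" "v \<in> Hom ?K T T'" for u v T T'
      using that by (intro exI[of _ T'] bexI[of _ "(T', T')"]) (auto simp: HomK)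
  qed
  have "Mor ?K \<subseteq> Fpow I \<times> Fpow I" by auto
  then have "small U (Mor ?K)" by (rule small_subset[OF small_Times[OF small_Fpow[OF I] small_Fpow[OF I]]])
  then have sfK: "small_filtered U ?K" using K fK small_Fpow[OF I] by (simp add: small_filtered_def small_cat_def)
  have D: "is_functor ?K A ?D"
    unfolding is_functor_def
  proof (intro conjI ballI allI)
    show "fob ?D T \<in> Ob A" if "T \<in> Ob ?K" for T using YO that by simp
    show "fmor ?D (Ide ?K T) = Ide A (fob ?D T)" if "T \<in> Ob ?K" for T
    proof -
      have T: "T \<in> Fpow I" using that by simp
      have "d (T, T) = Ide A (Y T)"
        by (rule coprod_eq[OF Y[OF T] d(1)[OF T T] Ide_Hom[OF YO[OF T]]])
          (use d(2)[OF T T] Ide_Comp[OF eH[OF T]] in auto)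
      then show ?thesis by simp
    qed
    fix T T' p assume p: "p \<in> Hom ?K T T'"
    then show "fmor ?D p \<in> Hom A (fob ?D T) (fob ?D T')" using d(1) by (simp add: HomK)
    fix T'' q assume q: "q \<in> Hom ?K T' T''"
    have T: "T \<in> Fpow I" "T' \<in> Fpow I" "T'' \<in> Fpow I" "T \<subseteq> T'" "T' \<subseteq> T''" using p q by (simp_all add: HomK)
    have "d (T, T'') = d (T', T'') \<cdot> d (T, T')"
    proof (rule coprod_eq[OF Y[OF T(1)] d(1)[OF T(1,3)] Comp_Hom[OF d(1)[OF T(1,2)] d(1)[OF T(2,3)]]])
      fix k assume k: "k \<in> I - T"
      have "(d (T', T'') \<cdot> d (T, T')) \<cdot> e T k = d (T', T'') \<cdot> (d (T, T') \<cdot> e T k)"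
        using Comp_assoc[OF eH[OF T(1) k] d(1)[OF T(1,2)] d(1)[OF T(2,3)]] .
      also have "\<dots> = d (T, T'') \<cdot> e T k"
        using k d(2)[OF T(1,2)] d(2)[OF T(2,3)] d(2)[OF T(1,3)] comp_zr[OF d(1)[OF T(2,3)] XO] T(5) by auto
      finally show "d (T, T'') \<cdot> e T k = (d (T', T'') \<cdot> d (T, T')) \<cdot> e T k" by simp
    qed
    then show "fmor ?D (q \<cdot>\<^bsub>?K\<^esub> p) = fmor ?D q \<cdot> fmor ?D p" using p q by (simp add: HomK)
  qed
  obtain N0 where N0: "zero_ob A N0" using zero_ob_exists by blast
  then have NO: "N0 \<in> Ob A" by (simp add: zero_ob_def)
  have L: "is_colimit A ?K ?D N0 (\<lambda>T. zr (Y T) N0)"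
    unfolding is_colimit_def
  proof (intro conjI allI impI)
    show "is_cocone A ?K ?D N0 (\<lambda>T. zr (Y T) N0)"
      unfolding is_cocone_def using NO zr_Hom[OF YO NO] zr_comp[OF d(1) NO] by (auto simp: HomK)
    fix M m assume m: "is_cocone A ?K ?D M m"
    note mD = coconeD[OF m, simplified]
    have mz: "m T = zr (Y T) M" if T: "T \<in> Fpow I" for T
    proof (rule coprod_eq[OF Y[OF T] mD(2)[OF T] zr_Hom[OF YO[OF T] mD(1)]])
      fix k assume k: "k \<in> I - T"
      have T': "insert k T \<in> Fpow I" using T k by (auto simp: Fpow_def)
      have "m T = m (insert k T) \<cdot> d (T, insert k T)"
        using coconeD(3)[OF m, of "(T, insert k T)" T "insert k T"] T T' by (simp add: HomK subset_insertI)
      then have "m T \<cdot> e T k = m (insert k T) \<cdot> (d (T, insert k T) \<cdot> e T k)"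
        using Comp_assoc[OF eH[OF T k] d(1)[OF T T'] mD(2)[OF T']] by simp
      also have "\<dots> = zr (Y T) M \<cdot> e T k"
        using d(2)[OF T T'] k comp_zr[OF mD(2)[OF T'] XO] zr_comp[OF eH[OF T k] mD(1)] by simp
      finally show "m T \<cdot> e T k = zr (Y T) M \<cdot> e T k" .
    qed
    show "\<exists>!h. h \<in> Hom A N0 M \<and> (\<forall>T\<in>Ob ?K. h \<cdot> zr (Y T) N0 = m T)"
    proof (rule ex1I[of _ "zr N0 M"])
      show "zr N0 M \<in> Hom A N0 M \<and> (\<forall>T\<in>Ob ?K. zr N0 M \<cdot> zr (Y T) N0 = m T)"
        using zr_Hom[OF NO mD(1)] comp_zr[OF zr_Hom[OF NO mD(1)] YO] mz by simp
    qed (use zero_ob_Hom(2)[OF N0] in blast)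
  qed
  have E: "{} \<in> Fpow I" by (simp add: Fpow_def)
  have "\<forall>k\<in>I. e {} k \<in> Hom A (X k) (Y {})" using eH[OF E] by simp
  from coprod_exB[OF S YO[OF E] this] obtain q where q: "q \<in> Hom A S (Y {})" "\<And>k. k \<in> I \<Longrightarrow> q \<cdot> inc k = e {} k"
    by blast
  have qx: "q \<cdot> x \<in> Hom A P (Y {})" by (rule Comp_Hom[OF x q(1)])
  have "zr (Y {}) N0 \<cdot> (q \<cdot> x) = zr (Y {}) N0 \<cdot> zr P (Y {})"
    using zr_comp[OF qx NO] comp_zr[OF zr_Hom[OF YO[OF E] NO] PO] by simp
  then have "\<exists>T. \<exists>u\<in>Hom ?K {} T. fmor ?D u \<cdot> (q \<cdot> x) = fmor ?D u \<cdot> zr P (Y {})"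
    using fin_generatedD[OF P A_cat sfK D L, of "{}" "q \<cdot> x" "zr P (Y {})"] E qx zr_Hom[OF PO YO[OF E]] by simp
  then obtain T where T: "T \<in> Fpow I" and dz: "d ({}, T) \<cdot> (q \<cdot> x) = d ({}, T) \<cdot> zr P (Y {})"
    by (auto simp: HomK)
  note dH = d(1)[OF E T]
  have rx: "(d ({}, T) \<cdot> q) \<cdot> x = zr P (Y T)"
    using Comp_assoc[OF x q(1) dH] dz comp_zr[OF dH PO] by simp
  note rH = Comp_Hom[OF q(1) dH]
  have ri: "(d ({}, T) \<cdot> q) \<cdot> inc k = (if k \<in> T then zr (X k) (Y T) else e T k)" if "k \<in> I" for k
    using Comp_assoc[OF i[OF that] q(1) dH] q(2)[OF that] d(2)[OF E T that] by simp
  have "t \<cdot> x = zr P M" if t: "t \<in> Hom A S M" and tz: "\<forall>k\<in>T. t \<cdot> inc k = zr (X k) M" for M t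
  proof -
    note M = Hom_Ob(2)[OF t]
    have "\<forall>k\<in>I - T. t \<cdot> inc k \<in> Hom A (X k) M" using Comp_Hom[OF i t] by blast
    from coprod_exB[OF Y[OF T] M this] obtain t' where t': "t' \<in> Hom A (Y T) M" "\<forall>k\<in>I - T. t' \<cdot> e T k = t \<cdot> inc k"
      by blast
    have "t' \<cdot> (d ({}, T) \<cdot> q) = t"
    proof (rule coprod_eq[OF S Comp_Hom[OF rH t'(1)] t])
      fix k assume k: "k \<in> I"
      show "(t' \<cdot> (d ({}, T) \<cdot> q)) \<cdot> inc k = t \<cdot> inc k"
        using Comp_assoc[OF i[OF k] rH t'(1)] ri[OF k] t'(2) tz k comp_zr[OF t'(1) XO[OF k]] by simp
    qed
    then show ?thesis using Comp_assoc[OF x rH t'(1)] rx comp_zr[OF t'(1) PO] by simp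
  qed
  moreover have "finite T \<and> T \<subseteq> I" using T by (auto simp: Fpow_def)
  ultimately show ?thesis by blast
qed

text \<open>
  Peeling off one component at a time turns the previous lemma into an induction principle for maps
  into a direct sum.
\<close>

lemma finite_support_induct:
  assumes P: "fin_generated U A P" and S: "is_coproduct A I X S inc" and I: "small U I" and x: "x \<in> Hom A P S"
    and zero: "\<Phi> (zr P S)"
    and step: "\<And>x' i y. x' \<in> Hom A P S \<Longrightarrow> \<Phi> x' \<Longrightarrow> i \<in> I \<Longrightarrow> y \<in> Hom A P (X i) \<Longrightarrow> \<Phi> (x' \<oplus> (inc i \<cdot> y))"
  shows "\<Phi> x"
proof -
  note SO = coprodD(1)[OF S] and i = coprodD(3)[OF S] and PO = Hom_Ob(1)[OF x]
  have main: "\<Phi> x" if "finite T" "T \<subseteq> I" "x \<in> Hom A P S"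
    "\<And>M t. t \<in> Hom A S M \<Longrightarrow> \<forall>i\<in>T. t \<cdot> inc i = zr (X i) M \<Longrightarrow> t \<cdot> x = zr P M" for T x
    using that
  proof (induction T arbitrary: x)
    case empty
    have "x = zr P S" using empty(3)[OF Ide_Hom[OF SO]] Ide_Comp[OF empty(2)] by simp
    then show ?case using zero by simp
  next
    case (insert k T)
    have k: "k \<in> I" using insert.prems by simp
    note xH = insert.prems(2)
    obtain p where p: "p \<in> Hom A S (X k)" "p \<cdot> inc k = Ide A (X k)"
      and p0: "\<And>j. j \<in> I \<Longrightarrow> j \<noteq> k \<Longrightarrow> p \<cdot> inc j = zr (X j) (X k)"
      using coprod_proj[OF S k] by metis
    note px = Comp_Hom[OF xH p(1)] and ip = Comp_Hom[OF p(1) i[OF k]]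
    note ipx = Comp_Hom[OF px i[OF k]]
    let ?x = "x \<ominus> (inc k \<cdot> (p \<cdot> x))"
    have "\<Phi> ?x"
    proof (rule insert.IH)
      show "T \<subseteq> I" using insert.prems by simp
      show "?x \<in> Hom A P S" by (rule mi_Hom[OF xH ipx])
      fix M t assume t: "t \<in> Hom A S M" and tz: "\<forall>i\<in>T. t \<cdot> inc i = zr (X i) M"
      let ?t = "t \<ominus> (t \<cdot> (inc k \<cdot> p))"
      note tip = Comp_Hom[OF ip t] and tk = Comp_Hom[OF i[OF k] t]
      have "?t \<cdot> inc j = zr (X j) M" if j: "j \<in> insert k T" for j
      proof -
        have jI: "j \<in> I" using j insert.prems(1) by blast
        have 1: "?t \<cdot> inc j = (t \<cdot> inc j) \<ominus> (t \<cdot> (inc k \<cdot> (p \<cdot> inc j)))"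
          using mi_comp[OF i[OF jI] t tip] Comp_assoc[OF i[OF jI] ip t] Comp_assoc[OF i[OF jI] p(1) i[OF k]] by simp
        show ?thesis
        proof (cases "j = k")
          case True
          then show ?thesis using 1 p(2) Comp_Ide[OF i[OF k]] mi_self[OF tk] by simp
        next
          case False
          then have "t \<cdot> inc j = zr (X j) M" using tz j by blast
          moreover have "t \<cdot> (inc k \<cdot> (p \<cdot> inc j)) = zr (X j) M"
            using p0[OF jI False] comp_zr[OF i[OF k] coprodD(2)[OF S jI]] comp_zr[OF t coprodD(2)[OF S jI]] by simp
          ultimately show ?thesis
            using 1 mi_self[OF zr_Hom[OF coprodD(2)[OF S jI] Hom_Ob(2)[OF t]]] by simp
        qed
      qed
      then have "?t \<cdot> x = zr P M" using insert.prems(3)[OF mi_Hom[OF t tip]] by blast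
      then show "t \<cdot> ?x = zr P M"
        using comp_mi[OF xH ipx t] mi_comp[OF xH t tip] Comp_assoc[OF xH ip t] Comp_assoc[OF xH p(1) i[OF k]] by simp
    qed
    from step[OF mi_Hom[OF xH ipx] this k px] show ?case using mi_pl[OF xH ipx] by simp
  qed
  obtain T where "finite T" "T \<subseteq> I" "\<forall>M t. t \<in> Hom A S M \<longrightarrow> (\<forall>i\<in>T. t \<cdot> inc i = zr (X i) M) \<longrightarrow> t \<cdot> x = zr P M"
    using finite_support[OF P S I x] by blast
  then show ?thesis using main[of T x] x by blast
qed

text \<open>
  The direct sum over a finite support will do.
\<close>

lemma finite_factor:
  assumes P: "fin_generated U A P" and S: "is_coproduct A I X S inc" and I: "small U I" and x: "x \<in> Hom A P S"
  obtains T S' inc' a b where "finite T" "T \<subseteq> I" "is_coproduct A T X S' inc'" "a \<in> Hom A S' S" "b \<in> Hom A S S'"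
    "a \<cdot> (b \<cdot> x) = x"
proof -
  note SO = coprodD(1)[OF S] and i = coprodD(3)[OF S] and PO = Hom_Ob(1)[OF x] and XO = coprodD(2)[OF S]
  obtain T where T: "finite T" "T \<subseteq> I"
    "\<forall>M t. t \<in> Hom A S M \<longrightarrow> (\<forall>i\<in>T. t \<cdot> inc i = zr (X i) M) \<longrightarrow> t \<cdot> x = zr P M"
    using finite_support[OF P S I x] by blast
  obtain S' inc' where S': "is_coproduct A T X S' inc'"
    using coproducts[OF small_finite[OF T(1)], of X] XO T(2) by blast
  note S'N0 = coprodD(1)[OF S'] and i' = coprodD(3)[OF S']
  have "\<forall>k\<in>T. inc k \<in> Hom A (X k) S" using i T(2) by blast
  from coprod_exB[OF S' SO this] obtain a where a: "a \<in> Hom A S' S" "\<forall>k\<in>T. a \<cdot> inc' k = inc k" by blast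
  have "\<forall>k\<in>I. (if k \<in> T then inc' k else zr (X k) S') \<in> Hom A (X k) S'"
    using i' zr_Hom[OF XO S'N0] by simp
  from coprod_exB[OF S S'N0 this] obtain b where b: "b \<in> Hom A S S'"
    "\<forall>k\<in>I. b \<cdot> inc k = (if k \<in> T then inc' k else zr (X k) S')" by blast
  note ab = Comp_Hom[OF b(1) a(1)]
  have "(Ide A S \<ominus> (a \<cdot> b)) \<cdot> inc k = zr (X k) S" if k: "k \<in> T" for k
  proof -
    have kI: "k \<in> I" using k T(2) by blast
    show ?thesis
      using mi_comp[OF i[OF kI] Ide_Hom[OF SO] ab] Ide_Comp[OF i[OF kI]] Comp_assoc[OF i[OF kI] b(1) a(1)]
        a(2) b(2) k kI mi_self[OF i[OF kI]] by simp
  qed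
  then have "(Ide A S \<ominus> (a \<cdot> b)) \<cdot> x = zr P S" using T(3) mi_Hom[OF Ide_Hom[OF SO] ab] by blast
  then have "x \<ominus> (a \<cdot> (b \<cdot> x)) = zr P S"
    using mi_comp[OF x Ide_Hom[OF SO] ab] Ide_Comp[OF x] Comp_assoc[OF x b(1) a(1)] by simp
  then have "a \<cdot> (b \<cdot> x) = x" using mi_eq_zr[OF x Comp_Hom[OF Comp_Hom[OF x b(1)] a(1)]] by simp
  with T S' a b that show ?thesis by blast
qed

text \<open>
  For a finite set \<open>T\<close> that supports \<open>x\<close>, the sum of the endomorphisms \<open>inc i \<cdot> p i\<close> for \<open>i \<in> T\<close>, here
  constructed by induction on \<open>T\<close>, fixes \<open>x\<close>. Hence \<open>x\<close> is killed together with its components in \<open>T\<close>.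
\<close>

lemma component_support:
  assumes P: "fin_generated U A P" and S: "is_coproduct A I X S inc" and I: "small U I" and x: "x \<in> Hom A P S"
    and p: "\<And>i. i \<in> I \<Longrightarrow> p i \<in> Hom A S (X i)" "\<And>i. i \<in> I \<Longrightarrow> p i \<cdot> inc i = Ide A (X i)"
      "\<And>i j. i \<in> I \<Longrightarrow> j \<in> I \<Longrightarrow> i \<noteq> j \<Longrightarrow> p i \<cdot> inc j = zr (X j) (X i)"
  shows "\<exists>T. finite T \<and> T \<subseteq> I \<and>
    (\<forall>M g. g \<in> Hom A S M \<longrightarrow> (\<forall>i\<in>T. g \<cdot> (inc i \<cdot> (p i \<cdot> x)) = zr P M) \<longrightarrow> g \<cdot> x = zr P M)"
proof -
  note SO = coprodD(1)[OF S] and XO = coprodD(2)[OF S] and i = coprodD(3)[OF S] and PO = Hom_Ob(1)[OF x]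
  have main: "\<exists>e \<in> Hom A S S. (\<forall>i\<in>T. e \<cdot> inc i = inc i) \<and> (\<forall>i\<in>I - T. e \<cdot> inc i = zr (X i) S) \<and>
      (\<forall>M g. g \<in> Hom A S M \<longrightarrow> (\<forall>i\<in>T. g \<cdot> (inc i \<cdot> (p i \<cdot> x)) = zr P M) \<longrightarrow> g \<cdot> (e \<cdot> x) = zr P M)"
    if "finite T" "T \<subseteq> I" for T
    using that
  proof (induction T)
    case empty
    have "zr S S \<cdot> inc k = zr (X k) S" if "k \<in> I" for k using zr_comp[OF i[OF that] SO] .
    moreover have "g \<cdot> (zr S S \<cdot> x) = zr P M" if "g \<in> Hom A S M" for M g
      using zr_comp[OF x SO] comp_zr[OF that PO] by simp
    ultimately show ?case using zr_Hom[OF SO SO] by (intro bexI[of _ "zr S S"]) auto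
  next
    case (insert k T)
    then have k: "k \<in> I" and kT: "k \<notin> T" by auto
    obtain e where e: "e \<in> Hom A S S" "\<forall>i\<in>T. e \<cdot> inc i = inc i" "\<forall>i\<in>I - T. e \<cdot> inc i = zr (X i) S"
      "\<forall>M g. g \<in> Hom A S M \<longrightarrow> (\<forall>i\<in>T. g \<cdot> (inc i \<cdot> (p i \<cdot> x)) = zr P M) \<longrightarrow> g \<cdot> (e \<cdot> x) = zr P M"
      using insert.IH insert.prems by blast
    note ip = Comp_Hom[OF p(1)[OF k] i[OF k]]
    let ?e = "e \<oplus> (inc k \<cdot> p k)"
    have pi: "(inc k \<cdot> p k) \<cdot> inc j = (if j = k then inc k else zr (X j) S)" if j: "j \<in> I" for j
      using Comp_assoc[OF i[OF j] p(1)[OF k] i[OF k]] p(2)[OF k] p(3)[OF k j] Comp_Ide[OF i[OF k]]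
        comp_zr[OF i[OF k] XO[OF j]] by auto
    have ei: "?e \<cdot> inc j = (if j \<in> insert k T then inc j else zr (X j) S)" if j: "j \<in> I" for j
    proof -
      have "?e \<cdot> inc j = (e \<cdot> inc j) \<oplus> ((inc k \<cdot> p k) \<cdot> inc j)" by (rule pl_comp[OF i[OF j] e(1) ip])
      moreover have "e \<cdot> inc j = (if j \<in> T then inc j else zr (X j) S)" using e(2,3) j by simp
      ultimately show ?thesis
        using pi[OF j] kT pl_zr[OF i[OF j]] pl_zr[OF zr_Hom[OF XO[OF j] SO]] by auto
    qed
    have "g \<cdot> (?e \<cdot> x) = zr P M" if g: "g \<in> Hom A S M" and gz: "\<forall>i\<in>insert k T. g \<cdot> (inc i \<cdot> (p i \<cdot> x)) = zr P M" for M g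
    proof -
      have "g \<cdot> (e \<cdot> x) = zr P M" using e(4) g gz by blast
      then show ?thesis
        using pl_comp[OF x e(1) ip] comp_pl[OF Comp_Hom[OF x e(1)] Comp_Hom[OF x ip] g]
          Comp_assoc[OF x p(1)[OF k] i[OF k]] gz pl_zr[OF zr_Hom[OF PO Hom_Ob(2)[OF g]]] by simp
    qed
    then show ?case using ei insert.prems pl_Hom[OF e(1) ip] by (intro bexI[of _ ?e]) auto
  qed
  obtain T where T: "finite T" "T \<subseteq> I"
    "\<forall>M t. t \<in> Hom A S M \<longrightarrow> (\<forall>i\<in>T. t \<cdot> inc i = zr (X i) M) \<longrightarrow> t \<cdot> x = zr P M"
    using finite_support[OF P S I x] by blast
  obtain e where e: "e \<in> Hom A S S" "\<forall>i\<in>T. e \<cdot> inc i = inc i"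
      "\<forall>M g. g \<in> Hom A S M \<longrightarrow> (\<forall>i\<in>T. g \<cdot> (inc i \<cdot> (p i \<cdot> x)) = zr P M) \<longrightarrow> g \<cdot> (e \<cdot> x) = zr P M"
    using main[OF T(1,2)] by blast
  have "g \<cdot> x = zr P M" if g: "g \<in> Hom A S M" and gz: "\<forall>i\<in>T. g \<cdot> (inc i \<cdot> (p i \<cdot> x)) = zr P M" for M g
  proof -
    note ge = Comp_Hom[OF e(1) g]
    have "(g \<ominus> (g \<cdot> e)) \<cdot> inc k = zr (X k) M" if k: "k \<in> T" for k
    proof -
      have kI: "k \<in> I" using k T(2) by blast
      show ?thesis
        using mi_comp[OF i[OF kI] g ge] Comp_assoc[OF i[OF kI] e(1) g] e(2) k mi_self[OF Comp_Hom[OF i[OF kI] g]] by simp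
    qed
    then have "(g \<ominus> (g \<cdot> e)) \<cdot> x = zr P M" using T(3) mi_Hom[OF g ge] by blast
    then have "g \<cdot> x = g \<cdot> (e \<cdot> x)"
      using mi_comp[OF x g ge] Comp_assoc[OF x e(1) g] mi_eq_zr[OF Comp_Hom[OF x g] Comp_Hom[OF Comp_Hom[OF x e(1)] g]] by simp
    then show ?thesis using e(3) g gz by simp
  qed
  with T(1,2) show ?thesis by blast
qed

text \<open>
  The colimit is a quotient of the direct sum of all stages, to which \<open>f\<close> lifts. The lift has finitely many
  components, and these are added up at a common later stage.
\<close>

lemma fg_proj_factor:
  assumes P: "P \<in> fg_proj U A" and K: "small_filtered U K" and D: "is_functor K A D" and L: "is_colimit A K D L l"
    and f: "f \<in> Hom A P L"
  shows "\<exists>j y. j \<in> Ob K \<and> y \<in> Hom A P (fob D j) \<and> l j \<cdot> y = f"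
proof -
  note P' = fg_projD[OF P] and K' = small_filteredD[OF K] and c = coconeD[OF colim_cocone[OF L]] and d = functorD[OF D]
  interpret K: category K by (rule K'(1))
  obtain E inc where E: "is_coproduct A (Ob K) (fob D) E inc" using coproducts[OF K'(2), of "fob D"] d(1) by blast
  note i = coprodD(3)[OF E]
  have "\<forall>j\<in>Ob K. l j \<in> Hom A (fob D j) L" using c(2) by blast
  from coprod_exB[OF E c(1) this] obtain e where e: "e \<in> Hom A E L" "\<forall>j\<in>Ob K. e \<cdot> inc j = l j" by blast
  have ep: "epic A e"
  proof (rule epicI[OF e(1)])
    fix M g assume g: "g \<in> Hom A L M" "g \<cdot> e = zr E M"
    note M = Hom_Ob(2)[OF g(1)]
    show "g = zr L M"
    proof (rule colim_eq[OF K'(1) D L g(1) zr_Hom[OF c(1) M]])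
      fix j assume j: "j \<in> Ob K"
      show "g \<cdot> l j = zr L M \<cdot> l j"
        using Comp_assoc[OF i[OF j] e(1) g(1)] e(2) j g(2) zr_comp[OF i[OF j] M] zr_comp[OF c(2)[OF j] M] by simp
    qed
  qed
  obtain x where x: "x \<in> Hom A P E" "e \<cdot> x = f" by (rule projectiveD[OF P'(1) ep e(1) f])
  have "\<exists>j y. j \<in> Ob K \<and> y \<in> Hom A P (fob D j) \<and> l j \<cdot> y = e \<cdot> x"
  proof (rule finite_support_induct[OF P'(2) E K'(2) x(1)])
    obtain j where j: "j \<in> Ob K" using filtered_nonempty[OF K'(4)] by blast
    show "\<exists>j y. j \<in> Ob K \<and> y \<in> Hom A P (fob D j) \<and> l j \<cdot> y = e \<cdot> zr P E"
      using j zr_Hom[OF P'(3) d(1)[OF j]] comp_zr[OF c(2)[OF j] P'(3)] comp_zr[OF e(1) P'(3)]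
      by (intro exI[of _ j] exI[of _ "zr P (fob D j)"]) simp
  next
    fix x' k z assume x': "x' \<in> Hom A P E" and IH: "\<exists>j y. j \<in> Ob K \<and> y \<in> Hom A P (fob D j) \<and> l j \<cdot> y = e \<cdot> x'"
      and k: "k \<in> Ob K" and z: "z \<in> Hom A P (fob D k)"
    obtain j y where y: "j \<in> Ob K" "y \<in> Hom A P (fob D j)" "l j \<cdot> y = e \<cdot> x'" using IH by blast
    obtain m u v where u: "u \<in> Hom K j m" and v: "v \<in> Hom K k m" by (rule filtered_bound[OF K'(4) y(1) k])
    have m: "m \<in> Ob K" using K.Hom_Ob[OF u] by blast
    note Du = Comp_Hom[OF y(2) d(2)[OF u]] and Dv = Comp_Hom[OF z d(2)[OF v]]
    have "l m \<cdot> ((fmor D u \<cdot> y) \<oplus> (fmor D v \<cdot> z)) = (e \<cdot> x') \<oplus> (e \<cdot> (inc k \<cdot> z))"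
      using comp_pl[OF Du Dv c(2)[OF m]] Comp_assoc[OF y(2) d(2)[OF u] c(2)[OF m]] c(3)[OF u] y(3)
        Comp_assoc[OF z d(2)[OF v] c(2)[OF m]] c(3)[OF v] Comp_assoc[OF z i[OF k] e(1)] e(2) k by simp
    also have "\<dots> = e \<cdot> (x' \<oplus> (inc k \<cdot> z))" using comp_pl[OF x' Comp_Hom[OF z i[OF k]] e(1)] by simp
    finally show "\<exists>j y. j \<in> Ob K \<and> y \<in> Hom A P (fob D j) \<and> l j \<cdot> y = e \<cdot> (x' \<oplus> (inc k \<cdot> z))"
      using m pl_Hom[OF Du Dv] by blast
  qed
  then show ?thesis using x(2) by simp
qed

text \<open>
  Equality of two maps is tested on the finitely many summands, and finitely many tests are passed at a
  common stage.
\<close>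

lemma fg_proj_coprod:
  assumes S: "is_coproduct A I X S inc" and I: "finite I" and X: "\<And>i. i \<in> I \<Longrightarrow> X i \<in> fg_proj U A"
  shows "S \<in> fg_proj U A"
proof -
  note i = coprodD(3)[OF S]
  have "fin_generated U A S"
  proof (rule fin_generatedI[OF A_cat coprodD(1)[OF S]])
    fix K :: "('u, 'u) cat" and D L l j x y
    assume K: "small_filtered U K" and D: "is_functor K A D" and L: "is_colimit A K D L l" and j: "j \<in> Ob K"
      and x: "x \<in> Hom A S (fob D j)" and y: "y \<in> Hom A S (fob D j)" and e: "l j \<cdot> x = l j \<cdot> y"
    note K' = small_filteredD[OF K] and lj = coconeD(2)[OF colim_cocone[OF L] j]
    have "\<exists>k. \<exists>u\<in>Hom K j k. \<forall>n\<in>I. fmor D u \<cdot> (x \<cdot> inc n) = fmor D u \<cdot> (y \<cdot> inc n)"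
    proof (rule filtered_finite[OF K'(1,4) j I])
      fix n assume n: "n \<in> I"
      have "l j \<cdot> (x \<cdot> inc n) = l j \<cdot> (y \<cdot> inc n)" using Comp_assoc[OF i[OF n] x lj] Comp_assoc[OF i[OF n] y lj] e by simp
      then show "\<exists>k. \<exists>u\<in>Hom K j k. fmor D u \<cdot> (x \<cdot> inc n) = fmor D u \<cdot> (y \<cdot> inc n)"
        using fin_generatedD[OF fg_projD(2)[OF X[OF n]] A_cat K D L j Comp_Hom[OF i[OF n] x] Comp_Hom[OF i[OF n] y]] by blast
      fix u k w k' assume u: "u \<in> Hom K j k" "fmor D u \<cdot> (x \<cdot> inc n) = fmor D u \<cdot> (y \<cdot> inc n)" and w: "w \<in> Hom K k k'"
      note Du = functorD(2)[OF D u(1)] functorD(2)[OF D w]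
      show "fmor D (w \<cdot>\<^bsub>K\<^esub> u) \<cdot> (x \<cdot> inc n) = fmor D (w \<cdot>\<^bsub>K\<^esub> u) \<cdot> (y \<cdot> inc n)"
        using functorD(4)[OF D u(1) w] Comp_assoc[OF Comp_Hom[OF i[OF n] x] Du] Comp_assoc[OF Comp_Hom[OF i[OF n] y] Du]
          u(2) by simp
    qed
    then obtain k u where u: "u \<in> Hom K j k" "\<forall>n\<in>I. fmor D u \<cdot> (x \<cdot> inc n) = fmor D u \<cdot> (y \<cdot> inc n)" by blast
    note Du = functorD(2)[OF D u(1)]
    have "fmor D u \<cdot> x = fmor D u \<cdot> y"
      by (rule coprod_eq[OF S Comp_Hom[OF x Du] Comp_Hom[OF y Du]])
        (simp add: Comp_assoc[OF i x Du] Comp_assoc[OF i y Du] u(2))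
    then show "\<exists>k. \<exists>u\<in>Hom K j k. fmor D u \<cdot> x = fmor D u \<cdot> y" using u(1) by blast
  qed
  moreover have "projective A S" by (rule coprod_projective[OF S fg_projD(1)[OF X]])
  ultimately show ?thesis by (simp add: fg_proj_def)
qed

text \<open>
  For modules this is the equational criterion for flatness: a relation that holds in \<open>X\<close> already holds
  in a finitely generated projective object over \<open>X\<close>.
\<close>

definition flat where
  "flat X \<longleftrightarrow> X \<in> Ob A \<and> (\<forall>P\<in>fg_proj U A. \<forall>P'\<in>fg_proj U A. \<forall>f\<in>Hom A P X. \<forall>g\<in>Hom A P' P. f \<cdot> g = zr P' X \<longrightarrow>
     (\<exists>P''\<in>fg_proj U A. \<exists>h\<in>Hom A P P''. \<exists>y\<in>Hom A P'' X. y \<cdot> h = f \<and> h \<cdot> g = zr P' P''))"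

lemma Filt_colims_flat:
  assumes "X \<in> Filt_colims U A (fg_proj U A)"
  shows "flat X"
proof -
  obtain K :: "('u, 'u) cat" and D l where fs: "filtered_system U A K D" and DP: "\<forall>j\<in>Ob K. fob D j \<in> fg_proj U A"
    and L: "is_colimit A K D X l" using assms unfolding Filt_colims_def by blast
  have K: "small_filtered U K" and D: "is_functor K A D"
    using fs by (auto simp: filtered_system_def small_filtered_def)
  note K' = small_filteredD[OF K] and c = coconeD[OF colim_cocone[OF L]] and d = functorD[OF D]
  interpret K: category K by (rule K'(1))
  show ?thesis
    unfolding flat_def
  proof (intro conjI ballI impI)
    show "X \<in> Ob A" by (rule c)
    fix P P' f g assume P: "P \<in> fg_proj U A" and P': "P' \<in> fg_proj U A" and f: "f \<in> Hom A P X" and g: "g \<in> Hom A P' P"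
      and z: "f \<cdot> g = zr P' X"
    obtain j y where j: "j \<in> Ob K" and y: "y \<in> Hom A P (fob D j)" "l j \<cdot> y = f"
      using fg_proj_factor[OF P K D L f] by blast
    note PO = fg_projD(3)[OF P']
    have "l j \<cdot> (y \<cdot> g) = l j \<cdot> zr P' (fob D j)"
      using Comp_assoc[OF g y(1) c(2)[OF j]] y(2) z comp_zr[OF c(2)[OF j] PO] by simp
    then obtain k u where u: "u \<in> Hom K j k" "fmor D u \<cdot> (y \<cdot> g) = fmor D u \<cdot> zr P' (fob D j)"
      using fin_generatedD[OF fg_projD(2)[OF P'] A_cat K D L j Comp_Hom[OF g y(1)] zr_Hom[OF PO d(1)[OF j]]] by blast
    have k: "k \<in> Ob K" using K.Hom_Ob[OF u(1)] by blast
    note Du = d(2)[OF u(1)]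
    have "l k \<cdot> (fmor D u \<cdot> y) = f" using Comp_assoc[OF y(1) Du c(2)[OF k]] c(3)[OF u(1)] y(2) by simp
    moreover have "(fmor D u \<cdot> y) \<cdot> g = zr P' (fob D k)"
      using Comp_assoc[OF g y(1) Du] u(2) comp_zr[OF Du PO] by simp
    ultimately show "\<exists>P''\<in>fg_proj U A. \<exists>h\<in>Hom A P P''. \<exists>y\<in>Hom A P'' X. y \<cdot> h = f \<and> h \<cdot> g = zr P' P''"
      using DP k Comp_Hom[OF y(1) Du] c(2)[OF k] by blast
  qed
qed

end

section \<open>Objects as canonical filtered colimits\<close>

text \<open>
  The arrows from \<open>\<G>\<close> to \<open>X\<close> are the objects of the comma category \<open>\<G>/X\<close>. The hypotheses say that
  it is filtered and that \<open>X\<close> is the colimit of the canonical diagram over it; passing to a small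
  skeleton \<open>\<G>\<^sub>0\<close> makes the diagram small.
\<close>

lemma (in universe) canonical_filtered_colimit:
  assumes "category C" and X: "X \<in> Ob C" and \<G>: "\<G> \<subseteq> Ob C"
    and \<G>\<^sub>0: "\<G>\<^sub>0 \<subseteq> \<G>" "small U \<G>\<^sub>0" "\<And>G Y. G \<in> \<G>\<^sub>0 \<Longrightarrow> Y \<in> Ob C \<Longrightarrow> small U (Hom C G Y)"
      "\<And>G. G \<in> \<G> \<Longrightarrow> \<exists>G' \<in> \<G>\<^sub>0. \<exists>f g. category.inverse_pair C G G' f g"
    and nonempty: "\<exists>G \<in> \<G>. Hom C G X \<noteq> {}"
    and bound: "\<And>G G' x x'. G \<in> \<G> \<Longrightarrow> G' \<in> \<G> \<Longrightarrow> x \<in> Hom C G X \<Longrightarrow> x' \<in> Hom C G' X \<Longrightarrow>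
      \<exists>H \<in> \<G>. \<exists>z \<in> Hom C H X. \<exists>i \<in> Hom C G H. \<exists>j \<in> Hom C G' H. z \<cdot>\<^bsub>C\<^esub> i = x \<and> z \<cdot>\<^bsub>C\<^esub> j = x'"
    and coequalize: "\<And>G G' x u v. G \<in> \<G> \<Longrightarrow> G' \<in> \<G> \<Longrightarrow> x \<in> Hom C G' X \<Longrightarrow> u \<in> Hom C G G' \<Longrightarrow>
      v \<in> Hom C G G' \<Longrightarrow> x \<cdot>\<^bsub>C\<^esub> u = x \<cdot>\<^bsub>C\<^esub> v \<Longrightarrow>
      \<exists>H \<in> \<G>. \<exists>w \<in> Hom C G' H. \<exists>z \<in> Hom C H X. z \<cdot>\<^bsub>C\<^esub> w = x \<and> w \<cdot>\<^bsub>C\<^esub> u = w \<cdot>\<^bsub>C\<^esub> v"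
    and dense: "\<And>M m. M \<in> Ob C \<Longrightarrow> (\<And>G x. G \<in> \<G> \<Longrightarrow> x \<in> Hom C G X \<Longrightarrow> m x \<in> Hom C G M) \<Longrightarrow>
      (\<And>G G' g x. G \<in> \<G> \<Longrightarrow> G' \<in> \<G> \<Longrightarrow> g \<in> Hom C G' G \<Longrightarrow> x \<in> Hom C G X \<Longrightarrow> m (x \<cdot>\<^bsub>C\<^esub> g) = m x \<cdot>\<^bsub>C\<^esub> g) \<Longrightarrow>
      \<exists>!h. h \<in> Hom C X M \<and> (\<forall>G \<in> \<G>. \<forall>x \<in> Hom C G X. h \<cdot>\<^bsub>C\<^esub> x = m x)"
  shows "X \<in> Filt_colims U C \<G>"
proof -
  interpret category C by fact
  have iso: "\<exists>G' f g. G' \<in> \<G>\<^sub>0 \<and> inverse_pair G G' f g" if "G \<in> \<G>" for G using \<G>\<^sub>0(4)[OF that] by blast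
  define I where "I = {x \<in> Mor C. Dom C x \<in> \<G>\<^sub>0 \<and> Cod C x = X}"
  have I: "x \<in> I \<longleftrightarrow> Dom C x \<in> \<G>\<^sub>0 \<and> x \<in> Hom C (Dom C x) X" for x by (auto simp: I_def Hom_def)
  have II: "x \<in> I" if "x \<in> Hom C G X" "G \<in> \<G>\<^sub>0" for x G using that by (auto simp: I_def Hom_def)
  define K where "K = \<lparr> Ob = I, Mor = {(x, h, x'). x \<in> I \<and> x' \<in> I \<and> h \<in> Hom C (Dom C x) (Dom C x') \<and> x' \<cdot>\<^bsub>C\<^esub> h = x},
    Dom = (\<lambda>(x, h, x'). x), Cod = (\<lambda>(x, h, x'). x'), Ide = (\<lambda>x. (x, Ide C (Dom C x), x)),
    Comp = (\<lambda>(_, k, x'') (x, h, _). (x, k \<cdot>\<^bsub>C\<^esub> h, x'')) \<rparr>"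
  have K_simps [simp]: "Ob K = I"
    "Mor K = {(x, h, x'). x \<in> I \<and> x' \<in> I \<and> h \<in> Hom C (Dom C x) (Dom C x') \<and> x' \<cdot>\<^bsub>C\<^esub> h = x}"
    "Dom K = (\<lambda>(x, h, x'). x)" "Cod K = (\<lambda>(x, h, x'). x')" "Ide K = (\<lambda>x. (x, Ide C (Dom C x), x))"
    "Comp K = (\<lambda>(_, k, x'') (x, h, _). (x, k \<cdot>\<^bsub>C\<^esub> h, x''))"
    by (simp_all add: K_def)
  let ?D = "\<lparr> fob = Dom C, fmor = (\<lambda>(x, h, x'). h) \<rparr>"
  have HomK: "p \<in> Hom K x x' \<longleftrightarrow> (\<exists>h. p = (x, h, x') \<and> x \<in> I \<and> x' \<in> I \<and> h \<in> Hom C (Dom C x) (Dom C x') \<and> x' \<cdot>\<^bsub>C\<^esub> h = x)"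
    for p x x' unfolding Hom_def[of K] by (cases p) auto
  have IH: "x \<in> Hom C (Dom C x) X" if "x \<in> I" for x using that I by blast
  have IO: "Dom C x \<in> Ob C" if "x \<in> I" for x using Hom_Ob(1)[OF IH[OF that]] .
  have catK: "category K"
  proof
    show "f \<in> Mor K \<Longrightarrow> Dom K f \<in> Ob K" "f \<in> Mor K \<Longrightarrow> Cod K f \<in> Ob K" for f by auto
    show "Ide K x \<in> Hom K x x" if "x \<in> Ob K" for x
      using that Ide_Hom[OF IO] Comp_Ide[OF IH] by (simp add: HomK)
  next
    fix f g x y z assume "f \<in> Hom K x y" "g \<in> Hom K y z"
    then obtain h k where h: "f = (x, h, y)" "x \<in> I" "y \<in> I" "h \<in> Hom C (Dom C x) (Dom C y)" "y \<cdot>\<^bsub>C\<^esub> h = x"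
      and k: "g = (y, k, z)" "z \<in> I" "k \<in> Hom C (Dom C y) (Dom C z)" "z \<cdot>\<^bsub>C\<^esub> k = y" by (auto simp: HomK)
    then show "g \<cdot>\<^bsub>K\<^esub> f \<in> Hom K x z"
      using Comp_Hom[OF h(4) k(3)] Comp_assoc[OF h(4) k(3) IH[OF k(2)]] by (simp add: HomK)
  next
    fix f x y assume "f \<in> Hom K x y"
    then obtain h where "f = (x, h, y)" "h \<in> Hom C (Dom C x) (Dom C y)" by (auto simp: HomK)
    then show "f \<cdot>\<^bsub>K\<^esub> Ide K x = f" "Ide K y \<cdot>\<^bsub>K\<^esub> f = f" by (simp_all add: Comp_Ide Ide_Comp)
  next
    fix f g h w x y z assume "f \<in> Hom K w x" "g \<in> Hom K x y" "h \<in> Hom K y z"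
    then obtain f' g' h' where f: "f = (w, f', x)" "f' \<in> Hom C (Dom C w) (Dom C x)"
      and g: "g = (x, g', y)" "g' \<in> Hom C (Dom C x) (Dom C y)"
      and h: "h = (y, h', z)" "h' \<in> Hom C (Dom C y) (Dom C z)" by (auto simp: HomK)
    show "(h \<cdot>\<^bsub>K\<^esub> g) \<cdot>\<^bsub>K\<^esub> f = h \<cdot>\<^bsub>K\<^esub> (g \<cdot>\<^bsub>K\<^esub> f)"
      using f(1) g(1) h(1) Comp_assoc[OF f(2) g(2) h(2)] by simp
  qed
  have sI: "small U I"
  proof (rule small_subset[OF small_UN[OF \<G>\<^sub>0(2)]])
    show "I \<subseteq> (\<Union>G\<in>\<G>\<^sub>0. Hom C G X)" using I by blast
    show "small U (Hom C G X)" if "G \<in> \<G>\<^sub>0" for G by (rule \<G>\<^sub>0(3)[OF that X])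
  qed
  have "Mor K \<subseteq> (\<Union>x\<in>I. \<Union>x'\<in>I. (\<lambda>h. (x, h, x')) ` Hom C (Dom C x) (Dom C x'))" by auto
  moreover have "small U (\<Union>x\<in>I. \<Union>x'\<in>I. (\<lambda>h. (x, h, x')) ` Hom C (Dom C x) (Dom C x'))"
    by (intro small_UN sI small_image \<G>\<^sub>0(3)) (use I IO in auto)
  ultimately have sM: "small U (Mor K)" by (meson small_subset)
  \<comment> \<open>Any object of \<open>\<G>/X\<close> maps to one of the small skeleton.\<close>
  have replace: "\<exists>x' g. x' \<in> I \<and> g \<in> Hom C G (Dom C x') \<and> x' \<cdot>\<^bsub>C\<^esub> g = x" if G: "G \<in> \<G>" and x: "x \<in> Hom C G X" for G x
  proof -
    obtain G' f g where G': "G' \<in> \<G>\<^sub>0" and fg: "inverse_pair G G' f g" using iso[OF G] by blast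
    note i = inverse_pairD[OF fg]
    have "x \<cdot>\<^bsub>C\<^esub> g \<in> Hom C G' X" by (rule Comp_Hom[OF i(2) x])
    moreover have "(x \<cdot>\<^bsub>C\<^esub> g) \<cdot>\<^bsub>C\<^esub> f = x" by (rule i(5)[OF x])
    ultimately show ?thesis using II[OF _ G'] i(1) HomD by (intro exI[of _ "x \<cdot>\<^bsub>C\<^esub> g"] exI[of _ f]) auto
  qed
  have fK: "filtered K"
    unfolding filtered_def
  proof (intro conjI ballI allI)
    obtain G x where "G \<in> \<G>" "x \<in> Hom C G X" using nonempty by blast
    from replace[OF this] show "Ob K \<noteq> {}" by auto
  next
    fix x y assume "x \<in> Ob K" "y \<in> Ob K"
    then have x: "x \<in> I" and y: "y \<in> I" by auto
    then obtain H z i j where H: "H \<in> \<G>" "z \<in> Hom C H X" and i: "i \<in> Hom C (Dom C x) H" "z \<cdot>\<^bsub>C\<^esub> i = x"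
      and j: "j \<in> Hom C (Dom C y) H" "z \<cdot>\<^bsub>C\<^esub> j = y"
      using bound[OF _ _ IH[OF x] IH[OF y]] I \<G>\<^sub>0(1) by blast
    obtain z' g where z': "z' \<in> I" "g \<in> Hom C H (Dom C z')" "z' \<cdot>\<^bsub>C\<^esub> g = z" using replace[OF H] by blast
    have "(x, g \<cdot>\<^bsub>C\<^esub> i, z') \<in> Hom K x z'" "(y, g \<cdot>\<^bsub>C\<^esub> j, z') \<in> Hom K y z'"
      using x y z'(1) Comp_Hom[OF i(1) z'(2)] Comp_Hom[OF j(1) z'(2)] Comp_assoc[OF i(1) z'(2) IH[OF z'(1)]]
        Comp_assoc[OF j(1) z'(2) IH[OF z'(1)]] z'(3) i(2) j(2) by (simp_all add: HomK)
    then show "\<exists>k. Hom K x k \<noteq> {} \<and> Hom K y k \<noteq> {}" by blast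
  next
    fix x y p q assume "p \<in> Hom K x y" "q \<in> Hom K x y"
    then obtain u v where p: "p = (x, u, y)" and q: "q = (x, v, y)" and x: "x \<in> I" and y: "y \<in> I"
      and u: "u \<in> Hom C (Dom C x) (Dom C y)" "y \<cdot>\<^bsub>C\<^esub> u = x" and v: "v \<in> Hom C (Dom C x) (Dom C y)" "y \<cdot>\<^bsub>C\<^esub> v = x"
      by (auto simp: HomK)
    have xy: "Dom C x \<in> \<G>" "Dom C y \<in> \<G>" using x y I \<G>\<^sub>0(1) by auto
    have e: "y \<cdot>\<^bsub>C\<^esub> u = y \<cdot>\<^bsub>C\<^esub> v" by (simp only: u(2) v(2))
    obtain H w z where H: "H \<in> \<G>" "z \<in> Hom C H X" and w: "w \<in> Hom C (Dom C y) H" "z \<cdot>\<^bsub>C\<^esub> w = y" "w \<cdot>\<^bsub>C\<^esub> u = w \<cdot>\<^bsub>C\<^esub> v"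
      using coequalize[OF xy IH[OF y] u(1) v(1) e] by blast
    obtain z' g where z': "z' \<in> I" "g \<in> Hom C H (Dom C z')" "z' \<cdot>\<^bsub>C\<^esub> g = z" using replace[OF H] by blast
    have "(y, g \<cdot>\<^bsub>C\<^esub> w, z') \<in> Hom K y z'"
      using y z'(1) Comp_Hom[OF w(1) z'(2)] Comp_assoc[OF w(1) z'(2) IH[OF z'(1)]] z'(3) w(2) by (simp add: HomK)
    moreover have "(y, g \<cdot>\<^bsub>C\<^esub> w, z') \<cdot>\<^bsub>K\<^esub> p = (y, g \<cdot>\<^bsub>C\<^esub> w, z') \<cdot>\<^bsub>K\<^esub> q"
      using p q Comp_assoc[OF u(1) w(1) z'(2)] Comp_assoc[OF v(1) w(1) z'(2)] w(3) by simp
    ultimately show "\<exists>k. \<exists>w\<in>Hom K y k. w \<cdot>\<^bsub>K\<^esub> p = w \<cdot>\<^bsub>K\<^esub> q" by blast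
  qed
  have sf: "small_filtered U K" using catK fK sI sM by (simp add: small_filtered_def small_cat_def)
  have D: "is_functor K C ?D"
    unfolding is_functor_def
  proof (intro conjI ballI allI)
    show "fob ?D x \<in> Ob C" if "x \<in> Ob K" for x using IO that by simp
    show "fmor ?D (Ide K x) = Ide C (fob ?D x)" if "x \<in> Ob K" for x by simp
    fix x y p assume "p \<in> Hom K x y"
    then obtain h where h: "p = (x, h, y)" "h \<in> Hom C (Dom C x) (Dom C y)" unfolding HomK by blast
    then show "fmor ?D p \<in> Hom C (fob ?D x) (fob ?D y)" by simp
    fix z q assume "q \<in> Hom K y z"
    then obtain k where "q = (y, k, z)" unfolding HomK by blast
    with h show "fmor ?D (q \<cdot>\<^bsub>K\<^esub> p) = fmor ?D q \<cdot>\<^bsub>C\<^esub> fmor ?D p" by simp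
  qed
  have "is_colimit C K ?D X (\<lambda>x. x)"
    unfolding is_colimit_def
  proof (intro conjI allI impI)
    show "is_cocone C K ?D X (\<lambda>x. x)" 
      unfolding is_cocone_def
    proof (intro conjI ballI allI)
      show "l \<in> Hom C (fob ?D l) X" if "l \<in> Ob K" for l using IH that by simp
      fix x y p assume "p \<in> Hom K x y"
      then obtain h where "p = (x, h, y)" "y \<cdot>\<^bsub>C\<^esub> h = x" unfolding HomK by blast
      then show "y \<cdot>\<^bsub>C\<^esub> fmor ?D p = x" by simp
    qed (rule X)
    fix M m assume m: "is_cocone C K ?D M m"
    note mD = coconeD[OF m, simplified]
    have mn: "m y \<cdot>\<^bsub>C\<^esub> h = m x" if "x \<in> I" "y \<in> I" "h \<in> Hom C (Dom C x) (Dom C y)" "y \<cdot>\<^bsub>C\<^esub> h = x" for x y h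
      using coconeD(3)[OF m, of "(x, h, y)" x y] that by (simp add: HomK)
    have "\<forall>G. G \<in> \<G> \<longrightarrow> (\<exists>t. fst t \<in> \<G>\<^sub>0 \<and> inverse_pair G (fst t) (fst (snd t)) (snd (snd t)))"
      using iso by (metis fst_conv snd_conv)
    then obtain t where t: "\<And>G. G \<in> \<G> \<Longrightarrow> fst (t G) \<in> \<G>\<^sub>0 \<and> inverse_pair G (fst (t G)) (fst (snd (t G))) (snd (snd (t G)))"
      by metis
    define r a b where "r G = fst (t G)" and "a G = fst (snd (t G))" and "b G = snd (snd (t G))" for G
    have r: "r G \<in> \<G>\<^sub>0" "inverse_pair G (r G) (a G) (b G)" if "G \<in> \<G>" for G
      using t[OF that] by (auto simp: r_def a_def b_def)
    note ip = inverse_pairD[OF r(2)]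
    define n where "n x = m (x \<cdot>\<^bsub>C\<^esub> b (Dom C x)) \<cdot>\<^bsub>C\<^esub> a (Dom C x)" for x
    have xb: "x \<cdot>\<^bsub>C\<^esub> b G \<in> I" "Dom C (x \<cdot>\<^bsub>C\<^esub> b G) = r G" if "G \<in> \<G>" "x \<in> Hom C G X" for G x
      using II[OF Comp_Hom[OF ip(2)[OF that(1)] that(2)] r(1)[OF that(1)]] Comp_Hom[OF ip(2)[OF that(1)] that(2)] HomD by auto
    have nH: "n x \<in> Hom C G M" if "G \<in> \<G>" "x \<in> Hom C G X" for G x
      using Comp_Hom[OF ip(1)[OF that(1)], of "m (x \<cdot>\<^bsub>C\<^esub> b G)" M] mD(2)[OF xb(1)[OF that]] xb(2)[OF that] HomD[OF that(2)]
      by (simp add: n_def)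
    have nn: "n (x \<cdot>\<^bsub>C\<^esub> g) = n x \<cdot>\<^bsub>C\<^esub> g" if G: "G \<in> \<G>" "G' \<in> \<G>" and g: "g \<in> Hom C G' G" and x: "x \<in> Hom C G X" for G G' g x
    proof -
      note xg = Comp_Hom[OF g x]
      note ga = Comp_Hom[OF Comp_Hom[OF ip(2)[OF G(2)] g] ip(1)[OF G(1)]]
      have mxb: "m (x \<cdot>\<^bsub>C\<^esub> b G) \<in> Hom C (r G) M" using mD(2)[OF xb(1)[OF G(1) x]] xb(2)[OF G(1) x] by simp
      have "(x \<cdot>\<^bsub>C\<^esub> b G) \<cdot>\<^bsub>C\<^esub> (a G \<cdot>\<^bsub>C\<^esub> (g \<cdot>\<^bsub>C\<^esub> b G')) = (x \<cdot>\<^bsub>C\<^esub> g) \<cdot>\<^bsub>C\<^esub> b G'"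
        using Comp_assoc[OF Comp_Hom[OF Comp_Hom[OF ip(2)[OF G(2)] g] ip(1)[OF G(1)]] ip(2)[OF G(1)] x]
          ip(3)[OF G(1) Comp_Hom[OF ip(2)[OF G(2)] g]] Comp_assoc[OF ip(2)[OF G(2)] g x] by simp
      then have "m (x \<cdot>\<^bsub>C\<^esub> b G) \<cdot>\<^bsub>C\<^esub> (a G \<cdot>\<^bsub>C\<^esub> (g \<cdot>\<^bsub>C\<^esub> b G')) = m ((x \<cdot>\<^bsub>C\<^esub> g) \<cdot>\<^bsub>C\<^esub> b G')"
        using mn[OF xb(1)[OF G(2) xg] xb(1)[OF G(1) x]] xb(2)[OF G(2) xg] xb(2)[OF G(1) x] ga by simp
      then have "n (x \<cdot>\<^bsub>C\<^esub> g) = (m (x \<cdot>\<^bsub>C\<^esub> b G) \<cdot>\<^bsub>C\<^esub> (a G \<cdot>\<^bsub>C\<^esub> (g \<cdot>\<^bsub>C\<^esub> b G'))) \<cdot>\<^bsub>C\<^esub> a G'"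
        using HomD[OF xg] by (simp add: n_def)
      also have "\<dots> = m (x \<cdot>\<^bsub>C\<^esub> b G) \<cdot>\<^bsub>C\<^esub> (a G \<cdot>\<^bsub>C\<^esub> g)"
        using Comp_assoc[OF ip(1)[OF G(2)] ga mxb]
          Comp_assoc[OF ip(1)[OF G(2)] Comp_Hom[OF ip(2)[OF G(2)] g] ip(1)[OF G(1)]] ip(5)[OF G(2) g] by simp
      also have "\<dots> = n x \<cdot>\<^bsub>C\<^esub> g"
        using Comp_assoc[OF g ip(1)[OF G(1)] mxb] HomD[OF x] by (simp add: n_def)
      finally show ?thesis .
    qed
    have nm: "n x = m x" if x: "x \<in> I" for x
    proof -
      have G: "Dom C x \<in> \<G>" "x \<in> Hom C (Dom C x) X" using x I \<G>\<^sub>0(1) by auto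
      show ?thesis
        unfolding n_def
        by (rule mn[OF x xb(1)[OF G]]) (use ip(1)[OF G(1)] ip(5)[OF G] xb(2)[OF G] in auto)
    qed
    obtain h where h: "h \<in> Hom C X M" "\<forall>G \<in> \<G>. \<forall>x \<in> Hom C G X. h \<cdot>\<^bsub>C\<^esub> x = n x"
      and hu: "\<And>h'. h' \<in> Hom C X M \<Longrightarrow> \<forall>G \<in> \<G>. \<forall>x \<in> Hom C G X. h' \<cdot>\<^bsub>C\<^esub> x = n x \<Longrightarrow> h' = h"
    proof -
      have "\<exists>!h. h \<in> Hom C X M \<and> (\<forall>G \<in> \<G>. \<forall>x \<in> Hom C G X. h \<cdot>\<^bsub>C\<^esub> x = n x)"
        by (rule dense[OF mD(1)]) (rule nH, assumption+, rule nn, assumption+)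
      then show ?thesis using that by blast
    qed
    show "\<exists>!h. h \<in> Hom C X M \<and> (\<forall>x\<in>Ob K. h \<cdot>\<^bsub>C\<^esub> x = m x)"
    proof (rule ex1I[of _ h], intro conjI ballI)
      show "h \<in> Hom C X M" by (rule h)
      show "h \<cdot>\<^bsub>C\<^esub> x = m x" if x: "x \<in> Ob K" for x
      proof -
        have xI: "x \<in> I" using x by simp
        then have "Dom C x \<in> \<G>" using I \<G>\<^sub>0(1) by auto
        from h(2)[rule_format, OF this IH[OF xI]] show ?thesis using nm[OF xI] by simp
      qed
      fix h' assume h': "h' \<in> Hom C X M \<and> (\<forall>x\<in>Ob K. h' \<cdot>\<^bsub>C\<^esub> x = m x)"
      then have h'M: "h' \<in> Hom C X M" and h'm: "\<And>x. x \<in> I \<Longrightarrow> h' \<cdot>\<^bsub>C\<^esub> x = m x" by auto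
      show "h' = h"
      proof (rule hu[OF h'M], intro ballI)
        fix G x assume G: "G \<in> \<G>" and x: "x \<in> Hom C G X"
        have "h' \<cdot>\<^bsub>C\<^esub> x = (h' \<cdot>\<^bsub>C\<^esub> (x \<cdot>\<^bsub>C\<^esub> b G)) \<cdot>\<^bsub>C\<^esub> a G"
          using Comp_assoc[OF ip(1)[OF G] Comp_Hom[OF ip(2)[OF G] x] h'M] ip(5)[OF G x] by simp
        then show "h' \<cdot>\<^bsub>C\<^esub> x = n x" using h'm[OF xb(1)[OF G x]] HomD[OF x] by (simp add: n_def)
      qed
    qed
  qed
  then show ?thesis by (rule Filt_colimsI[OF sf D]) (use I \<G>\<^sub>0(1) in auto)
qed

section \<open>Categories generated by finitely generated projective objects\<close>

text \<open>
  The finitely generated projective objects generate, but a priori there is a proper class of them. The single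
  generator \<open>G\<close> is there to bound their number and the size of the sets of maps.
\<close>

locale fg_generated = cocomplete_abelian A pl U
  for A :: "('o, 'm) cat" (structure) and pl (infixl "\<oplus>" 65) and U :: "'u itself" +
  fixes G :: 'o
  assumes G: "G \<in> Ob A" "generates A {G}" "\<And>X. X \<in> Ob A \<Longrightarrow> small U (Hom A G X)"
    and gen: "generates A (fg_proj U A)"
begin

lemma gen_zero:
  assumes f: "f \<in> Hom A X Y" and z: "\<And>P g. P \<in> fg_proj U A \<Longrightarrow> g \<in> Hom A P X \<Longrightarrow> f \<cdot> g = zr P Y"
  shows "f = zr X Y"
proof -
  have "zero_mor A (f \<cdot> g)" if "P \<in> fg_proj U A" "g \<in> Hom A P X" for P g
    using zero_mor_iff[OF Comp_Hom[OF that(2) f]] z[OF that] by simp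
  then have "zero_mor A f" using gen HomD[OF f] unfolding generates_def by blast
  then show ?thesis using zero_mor_iff[OF f] by simp
qed

lemma gen_eq:
  assumes f: "f \<in> Hom A X Y" "f' \<in> Hom A X Y"
    and e: "\<And>P g. P \<in> fg_proj U A \<Longrightarrow> g \<in> Hom A P X \<Longrightarrow> f \<cdot> g = f' \<cdot> g"
  shows "f = f'"
proof -
  have "f \<ominus> f' = zr X Y"
  proof (rule gen_zero[OF mi_Hom[OF f]])
    fix P g assume P: "P \<in> fg_proj U A" and g: "g \<in> Hom A P X"
    show "(f \<ominus> f') \<cdot> g = zr P Y" using mi_comp[OF g f] e[OF P g] mi_self[OF Comp_Hom[OF g f(2)]] by simp
  qed
  then show ?thesis using mi_eq_zr[OF f] by simp
qed

text \<open>
  Finitely many of the copies of \<open>G\<close> that cover \<open>P\<close> suffice. So the finitely generated projective objects are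
  the images of idempotents of finite powers of \<open>G\<close>, and there are few of those.
\<close>

lemma retract_power:
  assumes P: "P \<in> fg_proj U A"
  shows "\<exists>n S inc. is_coproduct A {..<n::nat} (\<lambda>_. G) S inc \<and> retract P S"
proof -
  note P' = fg_projD[OF P]
  let ?I = "Hom A G P"
  obtain E inc where E: "is_coproduct A ?I (\<lambda>_. G) E inc" using coproducts[OF G(3)[OF P'(3)], of "\<lambda>_. G"] G(1) by blast
  note i = coprodD(3)[OF E]
  have "\<forall>g\<in>?I. g \<in> Hom A G P" by blast
  from coprod_exB[OF E P'(3) this] obtain e where e: "e \<in> Hom A E P" "\<forall>g\<in>?I. e \<cdot> inc g = g" by blast
  have "epic A e"
  proof (rule epicI[OF e(1)])
    fix M g assume g: "g \<in> Hom A P M" "g \<cdot> e = zr E M"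
    note M = Hom_Ob(2)[OF g(1)]
    have "zero_mor A (g \<cdot> x)" if x: "x \<in> Hom A G P" for x
      using Comp_assoc[OF i[OF x] e(1) g(1)] e(2) x g(2) zr_comp[OF i[OF x] M] zero_mor_iff[OF Comp_Hom[OF x g(1)]] by simp
    then have "zero_mor A g" using G(2) HomD[OF g(1)] unfolding generates_def by blast
    then show "g = zr P M" using zero_mor_iff[OF g(1)] by simp
  qed
  then have "retract P E" by (rule projective_retract[OF P'(1) _ e(1)])
  then obtain s r where s: "s \<in> Hom A P E" "r \<in> Hom A E P" "r \<cdot> s = Ide A P" by (rule retractE)
  obtain T S inc' a b where T: "finite T" and "T \<subseteq> ?I" and S: "is_coproduct A T (\<lambda>_. G) S inc'"
    and ab: "a \<in> Hom A S E" "b \<in> Hom A E S" "a \<cdot> (b \<cdot> s) = s" by (rule finite_factor[OF P'(2) E G(3)[OF P'(3)] s(1)])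
  have "(r \<cdot> a) \<cdot> (b \<cdot> s) = Ide A P"
    using Comp_assoc[OF Comp_Hom[OF s(1) ab(2)] ab(1) s(2)] ab(3) s(3) by simp
  then have r: "retract P S" unfolding retract_def using Comp_Hom[OF s(1) ab(2)] Comp_Hom[OF ab(1) s(2)] by blast
  obtain h where "bij_betw h {..<card T} T" using ex_bij_betw_nat_finite[OF T] by (auto simp: atLeast0LessThan)
  from coprod_reindex[OF S this] have "is_coproduct A {..<card T} (\<lambda>_. G) S (\<lambda>i. inc' (h i))" by simp
  with r show ?thesis by blast
qed

lemma small_Hom_power:
  assumes S: "is_coproduct A {..<n::nat} (\<lambda>_. G) S inc" and X: "X \<in> Ob A"
  shows "small U (Hom A S X)"
proof (rule small_inj[OF small_lists[OF G(3)[OF X]]])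
  note i = coprodD(3)[OF S]
  show "inj_on (\<lambda>h. map (\<lambda>k. h \<cdot> inc k) [0..<n]) (Hom A S X)"
    by (rule inj_onI, rule coprod_eq[OF S]) auto
  show "(\<lambda>h. map (\<lambda>k. h \<cdot> inc k) [0..<n]) ` Hom A S X \<subseteq> lists (Hom A G X)"
    using Comp_Hom[OF i] by auto
qed

lemma small_Hom_fg_proj:
  assumes P: "P \<in> fg_proj U A" and X: "X \<in> Ob A"
  shows "small U (Hom A P X)"
proof -
  obtain n :: nat and S inc where S: "is_coproduct A {..<n} (\<lambda>_. G) S inc" "retract P S" using retract_power[OF P] by blast
  obtain s r where s: "s \<in> Hom A P S" "r \<in> Hom A S P" "r \<cdot> s = Ide A P" by (rule retractE[OF S(2)])
  have x: "x = (x \<cdot> r) \<cdot> s" if "x \<in> Hom A P X" for x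
    using Comp_assoc[OF s(1,2) that] s(3) Comp_Ide[OF that] by simp
  show ?thesis
  proof (rule small_inj[OF small_Hom_power[OF S(1) X]])
    show "inj_on (\<lambda>x. x \<cdot> r) (Hom A P X)" by (rule inj_onI) (use x in metis)
    show "(\<lambda>x. x \<cdot> r) ` Hom A P X \<subseteq> Hom A S X" using Comp_Hom[OF s(2)] by auto
  qed
qed

lemma skeleton:
  obtains \<P> where "\<P> \<subseteq> fg_proj U A" "small U \<P>" "\<And>P. P \<in> fg_proj U A \<Longrightarrow> \<exists>P'\<in>\<P>. \<exists>f g. inverse_pair P P' f g"
proof -
  have "\<forall>n. \<exists>S. is_coproduct A {..<n::nat} (\<lambda>_. G) (fst S) (snd S)"
  proof
    fix n :: nat
    obtain S inc where "is_coproduct A {..<n} (\<lambda>_. G) S inc"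
      using coproducts[OF small_finite, of "{..<n}" "\<lambda>_. G"] G(1) by auto
    then show "\<exists>S. is_coproduct A {..<n} (\<lambda>_. G) (fst S) (snd S)" by (intro exI[of _ "(S, inc)"]) simp
  qed
  then obtain Z where Z: "\<forall>n. is_coproduct A {..<n::nat} (\<lambda>_. G) (fst (Z n)) (snd (Z n))" by (rule choice[THEN exE])
  define W where "W n = fst (Z n)" for n
  have W: "is_coproduct A {..<n} (\<lambda>_. G) (W n) (snd (Z n))" for n using Z by (simp add: W_def)
  have "\<forall>P\<in>fg_proj U A. \<exists>c. fst (snd c) \<in> Hom A P (W (fst c)) \<and> snd (snd c) \<in> Hom A (W (fst c)) P \<and>
      snd (snd c) \<cdot> fst (snd c) = Ide A P"
  proof
    fix P assume "P \<in> fg_proj U A"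
    then obtain n :: nat and S inc where S: "is_coproduct A {..<n} (\<lambda>_. G) S inc" "retract P S" using retract_power by blast
    obtain f g where fg: "inverse_pair S (W n) f g" by (rule coprod_unique[OF S(1) W])
    then have "retract S (W n)" unfolding retract_def inverse_pair_def by blast
    from retract_trans[OF S(2) this] obtain s r where s: "s \<in> Hom A P (W n)" "r \<in> Hom A (W n) P" "r \<cdot> s = Ide A P"
      by (rule retractE)
    then show "\<exists>c. fst (snd c) \<in> Hom A P (W (fst c)) \<and> snd (snd c) \<in> Hom A (W (fst c)) P \<and>
      snd (snd c) \<cdot> fst (snd c) = Ide A P" by (intro exI[of _ "(n, s, r)"]) simp
  qed
  then obtain c where c: "\<forall>P\<in>fg_proj U A. fst (snd (c P)) \<in> Hom A P (W (fst (c P))) \<and>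
      snd (snd (c P)) \<in> Hom A (W (fst (c P))) P \<and> snd (snd (c P)) \<cdot> fst (snd (c P)) = Ide A P"
    by (rule bchoice[THEN exE])
  define n s r where "n P = fst (c P)" and "s P = fst (snd (c P))" and "r P = snd (snd (c P))" for P
  have s: "s P \<in> Hom A P (W (n P))" "r P \<in> Hom A (W (n P)) P" "r P \<cdot> s P = Ide A P" if "P \<in> fg_proj U A" for P
    using c that by (auto simp: n_def s_def r_def)
  \<comment> \<open>An object is determined up to isomorphism by the idempotent of which it is the image.\<close>
  define code where "code P = (n P, s P \<cdot> r P)" for P
  have "code ` fg_proj U A \<subseteq> (SIGMA n:UNIV. Hom A (W n) (W n))" using Comp_Hom[OF s(2,1)] by (auto simp: code_def)
  then have sc: "small U (code ` fg_proj U A)"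
    by (rule small_subset[OF small_Sigma[OF small_countable_nat small_Hom_power[OF W coprodD(1)[OF W]]]])
  define rep where "rep k = (SOME P. P \<in> fg_proj U A \<and> code P = k)" for k
  have rep: "rep (code P) \<in> fg_proj U A" "code (rep (code P)) = code P" if "P \<in> fg_proj U A" for P
    using someI[of "\<lambda>P'. P' \<in> fg_proj U A \<and> code P' = code P" P] that by (auto simp: rep_def)
  show ?thesis
  proof (rule that[of "rep ` code ` fg_proj U A"])
    show "rep ` code ` fg_proj U A \<subseteq> fg_proj U A" using rep(1) by blast
    show "small U (rep ` code ` fg_proj U A)" by (rule small_image[OF sc])
    fix P assume P: "P \<in> fg_proj U A"
    define P' where "P' = rep (code P)"
    have P': "P' \<in> fg_proj U A" "code P' = code P" using rep[OF P] by (auto simp: P'_def)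
    then have n: "n P' = n P" and e: "s P' \<cdot> r P' = s P \<cdot> r P" by (auto simp: code_def)
    note sP = s[OF P] and sP' = s[OF P'(1), unfolded n]
    have 1: "(r P \<cdot> s P') \<cdot> (r P' \<cdot> s P) = Ide A P"
    proof -
      have "(r P \<cdot> s P') \<cdot> (r P' \<cdot> s P) = r P \<cdot> ((s P' \<cdot> r P') \<cdot> s P)"
        using Comp_assoc[OF Comp_Hom[OF sP(1) sP'(2)] sP'(1) sP(2)] Comp_assoc[OF sP(1) sP'(2,1)] by simp
      also have "\<dots> = r P \<cdot> (s P \<cdot> (r P \<cdot> s P))" using e Comp_assoc[OF sP(1,2,1)] by simp
      also have "\<dots> = Ide A P" using sP(3) Comp_Ide[OF sP(1)] by simp
      finally show ?thesis .
    qed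
    have 2: "(r P' \<cdot> s P) \<cdot> (r P \<cdot> s P') = Ide A P'"
    proof -
      have "(r P' \<cdot> s P) \<cdot> (r P \<cdot> s P') = r P' \<cdot> ((s P \<cdot> r P) \<cdot> s P')"
        using Comp_assoc[OF Comp_Hom[OF sP'(1) sP(2)] sP(1) sP'(2)] Comp_assoc[OF sP'(1) sP(2,1)] by simp
      also have "\<dots> = r P' \<cdot> (s P' \<cdot> (r P' \<cdot> s P'))" using e Comp_assoc[OF sP'(1,2,1)] by simp
      also have "\<dots> = Ide A P'" using sP'(3) Comp_Ide[OF sP'(1)] by simp
      finally show ?thesis .
    qed
    have "inverse_pair P P' (r P' \<cdot> s P) (r P \<cdot> s P')"
      unfolding inverse_pair_def using 1 2 Comp_Hom[OF sP(1) sP'(2)] Comp_Hom[OF sP'(1) sP(2)] by blast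
    moreover have "P' \<in> rep ` code ` fg_proj U A" using P by (simp add: P'_def)
    ultimately show "\<exists>P'\<in>rep ` code ` fg_proj U A. \<exists>f g. inverse_pair P P' f g" by blast
  qed
qed

text \<open>
  The epimorphism onto \<open>X\<close> from the sum of the sources of all maps \<open>P \<rightarrow> X\<close>, for \<open>P\<close> in a small skeleton of the
  finitely generated projective objects. The last clause says that the skeleton meets all isomorphism classes.
\<close>

lemma cover:
  assumes X: "X \<in> Ob A"
  obtains I :: "('o \<times> 'm) set" and E inc e where "small U I" "is_coproduct A I fst E inc" "\<forall>k\<in>I. fst k \<in> fg_proj U A"
    "e \<in> Hom A E X" "\<forall>k\<in>I. e \<cdot> inc k = snd k" "epic A e" "\<forall>k\<in>I. snd k \<in> Hom A (fst k) X"
    "\<And>P. P \<in> fg_proj U A \<Longrightarrow> \<exists>P'. (\<exists>f g. inverse_pair P P' f g) \<and> (\<forall>x\<in>Hom A P' X. (P', x) \<in> I)"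
proof -
  obtain \<P> where \<P>: "\<P> \<subseteq> fg_proj U A" "small U \<P>" "\<And>P. P \<in> fg_proj U A \<Longrightarrow> \<exists>P'\<in>\<P>. \<exists>f g. inverse_pair P P' f g"
    by (rule skeleton) blast
  let ?I = "SIGMA P:\<P>. Hom A P X"
  have sI: "small U ?I" by (rule small_Sigma[OF \<P>(2) small_Hom_fg_proj[OF _ X]]) (use \<P>(1) in blast)
  have IP: "\<forall>k\<in>?I. fst k \<in> fg_proj U A" and Ix: "\<forall>k\<in>?I. snd k \<in> Hom A (fst k) X" using \<P>(1) by auto
  obtain E inc where E: "is_coproduct A ?I fst E inc" using coproducts[OF sI, of fst] IP fg_projD(3) by blast
  note i = coprodD(3)[OF E]
  from coprod_exB[OF E X Ix] obtain e where e: "e \<in> Hom A E X" "\<forall>k\<in>?I. e \<cdot> inc k = snd k" by blast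
  have "epic A e"
  proof (rule epicI[OF e(1)])
    fix M g assume g: "g \<in> Hom A X M" "g \<cdot> e = zr E M"
    note M = Hom_Ob(2)[OF g(1)]
    show "g = zr X M"
    proof (rule gen_zero[OF g(1)])
      fix P x assume P: "P \<in> fg_proj U A" and x: "x \<in> Hom A P X"
      obtain P' a b where P': "P' \<in> \<P>" and ab: "inverse_pair P P' a b" using \<P>(3)[OF P] by blast
      note ip = inverse_pairD[OF ab]
      note xb = Comp_Hom[OF ip(2) x]
      have k: "(P', x \<cdot> b) \<in> ?I" using P' xb by simp
      have "g \<cdot> (x \<cdot> b) = zr P' M"
        using Comp_assoc[OF i[OF k] e(1) g(1)] e(2) k g(2) zr_comp[OF i[OF k] M] by simp
      then have "(g \<cdot> (x \<cdot> b)) \<cdot> a = zr P M" using zr_comp[OF ip(1) M] by simp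
      then show "g \<cdot> x = zr P M" using Comp_assoc[OF ip(1) xb g(1)] ip(5)[OF x] by simp
    qed
  qed
  then show ?thesis using that[OF sI E IP e _ Ix] \<P>(3) by blast
qed

lemma enough_proj: "enough_projectives A"
  unfolding enough_projectives_def
proof
  fix X assume X: "X \<in> Ob A"
  show "\<exists>P\<in>Proj A. \<exists>e\<in>Hom A P X. epic A e"
  proof (rule cover[OF X])
    fix I :: "('o \<times> 'm) set" and E inc e
    assume E: "is_coproduct A I fst E inc" "\<forall>k\<in>I. fst k \<in> fg_proj U A" and e: "e \<in> Hom A E X" "epic A e"
    have "projective A E" by (rule coprod_projective[OF E(1)]) (use E(2) fg_projD in blast)
    then show ?thesis using e by (auto simp: Proj_def)
  qed
qed

lemma fg_proj_sum:
  assumes P: "P \<in> fg_proj U A" "P' \<in> fg_proj U A"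
  obtains B i j where "B \<in> fg_proj U A" "sum2 P P' B i j"
proof -
  have "\<exists>B i. is_coproduct A UNIV (\<lambda>b. if b then P else P') B i"
    by (rule coproducts[OF small_finite]) (use P fg_projD in auto)
  then obtain B i where B: "is_coproduct A UNIV (\<lambda>b. if b then P else P') B i" by blast
  have "B \<in> fg_proj U A" by (rule fg_proj_coprod[OF B]) (use P in auto)
  moreover have "sum2 P P' B (i True) (i False)" by (rule coprod_cong[OF B]) auto
  ultimately show ?thesis by (rule that)
qed

text \<open>
  The finitely generated projective objects are dense: an assignment that is compatible with
  precomposition is additive, because it is so on the two injections of a direct sum, and hence
  respects the relations in a presentation of \<open>X\<close> by such objects.
\<close>

lemma fg_proj_dense:
  assumes X: "X \<in> Ob A" and M: "M \<in> Ob A"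
    and mH: "\<And>P x. P \<in> fg_proj U A \<Longrightarrow> x \<in> Hom A P X \<Longrightarrow> m P x \<in> Hom A P M"
    and mn: "\<And>P P' g x. P \<in> fg_proj U A \<Longrightarrow> P' \<in> fg_proj U A \<Longrightarrow> g \<in> Hom A P' P \<Longrightarrow> x \<in> Hom A P X \<Longrightarrow>
      m P' (x \<cdot> g) = m P x \<cdot> g"
  shows "\<exists>!h. h \<in> Hom A X M \<and> (\<forall>P\<in>fg_proj U A. \<forall>x\<in>Hom A P X. h \<cdot> x = m P x)"
proof -
  have add: "m P (x \<oplus> y) = m P x \<oplus> m P y" if P: "P \<in> fg_proj U A" and x: "x \<in> Hom A P X" and y: "y \<in> Hom A P X" for P x y
  proof -
    obtain B i j where B: "B \<in> fg_proj U A" and S: "sum2 P P B i j" by (rule fg_proj_sum[OF P P])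
    note ij = sum2_Hom[OF S]
    have "\<forall>b\<in>UNIV. (if b then x else y) \<in> Hom A (if b then P else P) X" using x y by simp
    from coprod_exB[OF S X this] obtain z where z: "z \<in> Hom A B X" and
      zb: "\<forall>b. z \<cdot> (if b then i else j) = (if b then x else y)" by auto
    have zi: "z \<cdot> i = x" "z \<cdot> j = y" using zb[rule_format, of True] zb[rule_format, of False] by auto
    have "m P (x \<oplus> y) = m P (z \<cdot> (i \<oplus> j))" using comp_pl[OF ij z] zi by simp
    also have "\<dots> = m B z \<cdot> (i \<oplus> j)" by (rule mn[OF B P pl_Hom[OF ij] z])
    also have "\<dots> = m P x \<oplus> m P y"
      using comp_pl[OF ij mH[OF B z]] mn[OF B P ij(1) z] mn[OF B P ij(2) z] zi by simp
    finally show ?thesis .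
  qed
  have mz: "m P (zr P X) = zr P M" if P: "P \<in> fg_proj U A" for P
  proof -
    note z = zr_Hom[OF fg_projD(3)[OF P] X] and z' = zr_Hom[OF fg_projD(3)[OF P] M]
    have "m P (zr P X) \<oplus> m P (zr P X) = zr P M \<oplus> m P (zr P X)"
      using add[OF P z z] pl_zr[OF z] pl_zr[OF mH[OF P z]] by simp
    then show ?thesis using pl_cancel[OF mH[OF P z] mH[OF P z] z'] by simp
  qed
  show ?thesis
  proof (rule cover[OF X])
    fix I :: "('o \<times> 'm) set" and E inc e
    assume I: "small U I" and E: "is_coproduct A I fst E inc" and IP: "\<forall>k\<in>I. fst k \<in> fg_proj U A"
      and e: "e \<in> Hom A E X" "\<forall>k\<in>I. e \<cdot> inc k = snd k" "epic A e" and Ix: "\<forall>k\<in>I. snd k \<in> Hom A (fst k) X"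
      and full: "\<And>P. P \<in> fg_proj U A \<Longrightarrow> \<exists>P'. (\<exists>f g. inverse_pair P P' f g) \<and> (\<forall>x\<in>Hom A P' X. (P', x) \<in> I)"
    note i = coprodD(3)[OF E]
    have "\<forall>k\<in>I. m (fst k) (snd k) \<in> Hom A (fst k) M" using mH IP Ix by blast
    from coprod_exB[OF E M this] obtain n where n: "n \<in> Hom A E M" "\<forall>k\<in>I. n \<cdot> inc k = m (fst k) (snd k)" by blast
    have nx: "n \<cdot> x = m P (e \<cdot> x)" if P: "P \<in> fg_proj U A" and x: "x \<in> Hom A P E" for P x
    proof (rule finite_support_induct[OF fg_projD(2)[OF P] E I x])
      show "n \<cdot> zr P E = m P (e \<cdot> zr P E)"
        using comp_zr[OF n(1) fg_projD(3)[OF P]] comp_zr[OF e(1) fg_projD(3)[OF P]] mz[OF P] by simp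
      fix x' k y assume x': "x' \<in> Hom A P E" and IH: "n \<cdot> x' = m P (e \<cdot> x')" and k: "k \<in> I" and y: "y \<in> Hom A P (fst k)"
      have kP: "fst k \<in> fg_proj U A" and kx: "snd k \<in> Hom A (fst k) X" using IP Ix k by auto
      note iy = Comp_Hom[OF y i[OF k]]
      have "n \<cdot> (x' \<oplus> (inc k \<cdot> y)) = m P (e \<cdot> x') \<oplus> (m (fst k) (snd k) \<cdot> y)"
        using comp_pl[OF x' iy n(1)] IH Comp_assoc[OF y i[OF k] n(1)] n(2) k by simp
      also have "\<dots> = m P ((e \<cdot> x') \<oplus> (snd k \<cdot> y))"
        using mn[OF kP P y kx] add[OF P Comp_Hom[OF x' e(1)] Comp_Hom[OF y kx]] by simp
      also have "(e \<cdot> x') \<oplus> (snd k \<cdot> y) = e \<cdot> (x' \<oplus> (inc k \<cdot> y))"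
        using comp_pl[OF x' iy e(1)] Comp_assoc[OF y i[OF k] e(1)] e(2) k by simp
      finally show "n \<cdot> (x' \<oplus> (inc k \<cdot> y)) = m P (e \<cdot> (x' \<oplus> (inc k \<cdot> y)))" .
    qed
    obtain Kr k where k: "k \<in> Hom A Kr E" "is_kernel A e k" by (rule kernel_exists[OF e(1)])
    have "n \<cdot> k = zr Kr M"
    proof (rule gen_zero[OF Comp_Hom[OF k(1) n(1)]])
      fix P g assume P: "P \<in> fg_proj U A" and g: "g \<in> Hom A P Kr"
      show "(n \<cdot> k) \<cdot> g = zr P M"
        using Comp_assoc[OF g k(1) n(1)] nx[OF P Comp_Hom[OF g k(1)]] Comp_assoc[OF g k(1) e(1)]
          kernelD(1)[OF k(2) e(1) k(1)] zr_comp[OF g X] mz[OF P] by simp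
    qed
    then obtain h where h: "h \<in> Hom A X M" "h \<cdot> e = n" using epic_cokernel[OF e(3,1) k(2,1) n(1)] by blast
    have hx: "h \<cdot> x = m P x" if P: "P \<in> fg_proj U A" and x: "x \<in> Hom A P X" for P x
    proof -
      obtain P' a b where ab: "inverse_pair P P' a b" and P'I: "\<forall>x\<in>Hom A P' X. (P', x) \<in> I" using full[OF P] by blast
      note ip = inverse_pairD[OF ab]
      note xb = Comp_Hom[OF ip(2) x]
      have k: "(P', x \<cdot> b) \<in> I" using P'I xb by blast
      then have P': "P' \<in> fg_proj U A" using IP by auto
      have "h \<cdot> (x \<cdot> b) = m P' (x \<cdot> b)"
        using Comp_assoc[OF i[OF k] e(1) h(1)] e(2) k h(2) n(2) by auto
      then have "(h \<cdot> (x \<cdot> b)) \<cdot> a = m P ((x \<cdot> b) \<cdot> a)" using mn[OF P' P ip(1) xb] by simp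
      then show ?thesis using Comp_assoc[OF ip(1) xb h(1)] ip(5)[OF x] by simp
    qed
    show ?thesis
    proof (rule ex1I[of _ h])
      show "h \<in> Hom A X M \<and> (\<forall>P\<in>fg_proj U A. \<forall>x\<in>Hom A P X. h \<cdot> x = m P x)" using h(1) hx by blast
      fix h' assume h': "h' \<in> Hom A X M \<and> (\<forall>P\<in>fg_proj U A. \<forall>x\<in>Hom A P X. h' \<cdot> x = m P x)"
      then have h'M: "h' \<in> Hom A X M" by blast
      show "h' = h" by (rule gen_eq[OF h'M h(1)]) (use h' hx in simp)
    qed
  qed
qed

text \<open>
  A projective object may take the place of the finitely generated one in the definition of flatness: it is
  a retract of a sum of finitely generated ones, and a map to that sum lives on finitely many summands.
\<close>

lemma flatI:
  assumes X: "X \<in> Ob A"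
    and ex: "\<And>P P' f g. P \<in> fg_proj U A \<Longrightarrow> P' \<in> fg_proj U A \<Longrightarrow> f \<in> Hom A P X \<Longrightarrow> g \<in> Hom A P' P \<Longrightarrow>
      f \<cdot> g = zr P' X \<Longrightarrow> \<exists>P''\<in>Proj A. \<exists>h\<in>Hom A P P''. \<exists>y\<in>Hom A P'' X. y \<cdot> h = f \<and> h \<cdot> g = zr P' P''"
  shows "flat X"
  unfolding flat_def
proof (intro conjI ballI impI)
  fix P P' f g assume P: "P \<in> fg_proj U A" "P' \<in> fg_proj U A" and f: "f \<in> Hom A P X" and g: "g \<in> Hom A P' P" and z: "f \<cdot> g = zr P' X"
  obtain P'' h y where P'': "P'' \<in> Proj A" and h: "h \<in> Hom A P P''" "h \<cdot> g = zr P' P''" and y: "y \<in> Hom A P'' X" "y \<cdot> h = f"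
    using ex[OF P f g z] by blast
  have pr: "projective A P''" and PO: "P'' \<in> Ob A" using P'' by (auto simp: Proj_def projective_def)
  show "\<exists>P''\<in>fg_proj U A. \<exists>h\<in>Hom A P P''. \<exists>y\<in>Hom A P'' X. y \<cdot> h = f \<and> h \<cdot> g = zr P' P''"
  proof (rule cover[OF PO])
    fix I :: "('o \<times> 'm) set" and E inc e
    assume I: "small U I" and E: "is_coproduct A I fst E inc" and IP: "\<forall>k\<in>I. fst k \<in> fg_proj U A"
      and e: "e \<in> Hom A E P''" "epic A e"
    obtain s where s: "s \<in> Hom A P'' E" "e \<cdot> s = Ide A P''" by (rule projectiveD[OF pr e(2,1) Ide_Hom[OF PO]])
    note sh = Comp_Hom[OF h(1) s(1)]
    obtain T S inc' a b where T: "finite T" "T \<subseteq> I" "is_coproduct A T fst S inc'" and ab: "a \<in> Hom A S E" "b \<in> Hom A E S"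
      "a \<cdot> (b \<cdot> (s \<cdot> h)) = s \<cdot> h" by (rule finite_factor[OF fg_projD(2)[OF P(1)] E I sh])
    have S: "S \<in> fg_proj U A" by (rule fg_proj_coprod[OF T(3,1)]) (use T(2) IP in blast)
    note ye = Comp_Hom[OF e(1) y(1)] and bsh = Comp_Hom[OF sh ab(2)]
    have "((y \<cdot> e) \<cdot> a) \<cdot> (b \<cdot> (s \<cdot> h)) = f"
      using Comp_assoc[OF bsh ab(1) ye] ab(3) Comp_assoc[OF sh e(1) y(1)] Comp_assoc[OF h(1) s(1) e(1)] s(2)
        Ide_Comp[OF h(1)] y(2) by simp
    moreover have "(b \<cdot> (s \<cdot> h)) \<cdot> g = zr P' S"
      using Comp_assoc[OF g sh ab(2)] Comp_assoc[OF g h(1) s(1)] h(2) comp_zr[OF s(1) fg_projD(3)[OF P(2)]]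
        comp_zr[OF ab(2) fg_projD(3)[OF P(2)]] by simp
    ultimately show ?thesis using S bsh Comp_Hom[OF ab(1) ye] by blast
  qed
qed (rule X)

text \<open>
  Flatness is the condition that parallel arrows of the comma category of finitely generated projective
  objects over \<open>X\<close> can be coequalized.
\<close>

lemma flat_Filt_colims:
  assumes X: "flat X"
  shows "X \<in> Filt_colims U A (fg_proj U A)"
proof -
  have XO: "X \<in> Ob A" using X by (simp add: flat_def)
  obtain \<P> where \<P>: "\<P> \<subseteq> fg_proj U A" "small U \<P>" "\<And>P. P \<in> fg_proj U A \<Longrightarrow> \<exists>P'\<in>\<P>. \<exists>f g. inverse_pair P P' f g"
    by (rule skeleton) blast
  show ?thesis
  proof (rule canonical_filtered_colimit[OF A_cat XO _ \<P>(1,2)])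
    show "fg_proj U A \<subseteq> Ob A" using fg_projD(3) by blast
    show "small U (Hom A P Y)" if "P \<in> \<P>" "Y \<in> Ob A" for P Y using small_Hom_fg_proj that \<P>(1) by blast
    show "\<exists>P'\<in>\<P>. \<exists>f g. inverse_pair P P' f g" if "P \<in> fg_proj U A" for P by (rule \<P>(3)[OF that])
    show "\<exists>P\<in>fg_proj U A. Hom A P X \<noteq> {}"
    proof -
      obtain S inc where S: "is_coproduct A {} (\<lambda>_::nat. X) S inc" using coproducts[OF small_finite, of "{}" "\<lambda>_. X"] by auto
      have "S \<in> fg_proj U A" by (rule fg_proj_coprod[OF S]) auto
      then show ?thesis using zr_Hom[OF coprodD(1)[OF S] XO] by blast
    qed
    fix P P' x x' assume P: "P \<in> fg_proj U A" "P' \<in> fg_proj U A"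
    {
      assume x: "x \<in> Hom A P X" "x' \<in> Hom A P' X"
      obtain B i j where B: "B \<in> fg_proj U A" and S: "sum2 P P' B i j" by (rule fg_proj_sum[OF P])
      have "\<forall>b\<in>UNIV. (if b then x else x') \<in> Hom A (if b then P else P') X" using x by simp
      from coprod_exB[OF S XO this] obtain z where z: "z \<in> Hom A B X" and
        zb: "\<forall>b. z \<cdot> (if b then i else j) = (if b then x else x')" by auto
      have "z \<cdot> i = x" "z \<cdot> j = x'" using zb[rule_format, of True] zb[rule_format, of False] by auto
      then show "\<exists>H\<in>fg_proj U A. \<exists>z\<in>Hom A H X. \<exists>i\<in>Hom A P H. \<exists>j\<in>Hom A P' H. z \<cdot> i = x \<and> z \<cdot> j = x'"
        using B z sum2_Hom[OF S] by blast
    }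
    {
      fix u v assume x: "x \<in> Hom A P' X" and u: "u \<in> Hom A P P'" and v: "v \<in> Hom A P P'" and e: "x \<cdot> u = x \<cdot> v"
      have "x \<cdot> (u \<ominus> v) = zr P X" using comp_mi[OF u v x] e mi_self[OF Comp_Hom[OF v x]] by simp
      then obtain H w z where H: "H \<in> fg_proj U A" and w: "w \<in> Hom A P' H" "w \<cdot> (u \<ominus> v) = zr P H"
        and z: "z \<in> Hom A H X" "z \<cdot> w = x"
        using X P x mi_Hom[OF u v] unfolding flat_def by blast
      have "w \<cdot> u = w \<cdot> v" using w(2) comp_mi[OF u v w(1)] mi_eq_zr[OF Comp_Hom[OF u w(1)] Comp_Hom[OF v w(1)]] by simp
      then show "\<exists>H\<in>fg_proj U A. \<exists>w\<in>Hom A P' H. \<exists>z\<in>Hom A H X. z \<cdot> w = x \<and> w \<cdot> u = w \<cdot> v"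
        using H w(1) z by blast
    }
  next
    fix M m assume M: "M \<in> Ob A" and m: "\<And>P x. P \<in> fg_proj U A \<Longrightarrow> x \<in> Hom A P X \<Longrightarrow> m x \<in> Hom A P M"
      "\<And>P P' g x. P \<in> fg_proj U A \<Longrightarrow> P' \<in> fg_proj U A \<Longrightarrow> g \<in> Hom A P' P \<Longrightarrow> x \<in> Hom A P X \<Longrightarrow> m (x \<cdot> g) = m x \<cdot> g"
    show "\<exists>!h. h \<in> Hom A X M \<and> (\<forall>P\<in>fg_proj U A. \<forall>x\<in>Hom A P X. h \<cdot> x = m x)"
      by (rule fg_proj_dense[OF XO M, of "\<lambda>_. m"]) (use m in auto)
  qed
qed

lemma Filt_colims_iff: "X \<in> Filt_colims U A (fg_proj U A) \<longleftrightarrow> flat X"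
  using Filt_colims_flat flat_Filt_colims by blast

end

section \<open>Filtered colimits of finitely generated projective representations\<close>

locale fg_quiver_reps = quiver_reps A pl U Q + fg_generated A pl U G
  for A :: "('o, 'm) cat" (structure) and pl (infixl "\<oplus>" 65) and U :: "'u itself"
    and Q :: "('v, 'e) quiver" and G :: 'o
begin

text \<open>
  Maps from finitely generated projective objects to \<open>F(w)\<close> and \<open>\<Oplus> F(src a)\<close> lift to some stage, where the
  canonical map is monic with projective cokernel, and relations between them hold at a later stage. So
  the canonical map of the colimit is monic with flat cokernel.
\<close>

lemma Filt_colims_Phi:
  assumes F: "F \<in> Filt_colims U R (fg_proj U R)"
  shows "F \<in> Phi Q A (Filt_colims U A (fg_proj U A))"
proof -
  obtain K :: "('u, 'u) cat" and D l where fs: "filtered_system U R K D" and DP: "\<forall>j\<in>Ob K. fob D j \<in> fg_proj U R"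
    and L: "is_colimit R K D F l" using F unfolding Filt_colims_def by blast
  have K: "small_filtered U K" and D: "is_functor K R D"
    using fs by (auto simp: filtered_system_def small_filtered_def)
  have Ks: "small_cat U K" using K by (simp add: small_filtered_def)
  note K' = small_filteredD[OF K] and c = coconeD[OF colim_cocone[OF L]] and d = functorD[OF D]
  interpret K: category K by (rule K'(1))
  have DPhi: "fob D j \<in> Phi Q A (Proj A)" if "j \<in> Ob K" for j
    using DP that Phi_Proj[OF enough_proj] by (auto simp: fg_proj_def Proj_def)
  have FO: "F \<in> Ob R" by (rule c)
  note DO = functor_ev[OF D, simplified]
  note Lv = colimit_cmp[OF Ks D L, simplified]
  note lH = cmp_Hom[OF c(2), simplified] and dH = cmp_Hom[OF d(2), simplified]
  have ld: "cmp (l j) x \<cdot> cmp (fmor D u) x = cmp (l i) x" if "u \<in> Hom K i j" "x \<in> verts Q" for u i j x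
    using cmp_comp[OF d(2)[OF that(1)] c(2)[OF K.Hom_Ob(2)[OF that(1)]], of x] c(3)[OF that(1)] that(2) by simp
  show ?thesis
    unfolding Phi_def
  proof (intro CollectI conjI ballI)
    show "F \<in> Ob R" by (rule FO)
    fix w assume w: "w \<in> verts Q"
    obtain S inc p where p: "canonical F w S inc p" by (rule canonical_exists[OF FO w])
    note pD = canonicalD[OF p] and i = coprodD(3)[OF canonicalD(1)[OF p]]
    have SO: "S \<in> Ob A" using coprodD(1)[OF pD(1)] .
    have "\<forall>j\<in>Ob K. \<exists>t. case t of (Sj, incj, pj, Zj, cj, gj) \<Rightarrow> canonical (fob D j) w Sj incj pj \<and> monic A pj \<and>
        is_cokernel A pj cj \<and> cj \<in> Hom A (fob (fob D j) w) Zj \<and> Zj \<in> Proj A \<and> gj \<in> Hom A Sj S \<and>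
        (\<forall>a\<in>into w. gj \<cdot> incj a = inc a \<cdot> cmp (l j) (src Q a)) \<and> p \<cdot> gj = cmp (l j) w \<cdot> pj"
    proof
      fix j assume j: "j \<in> Ob K"
      obtain Sj incj pj Zj cj where 1: "canonical (fob D j) w Sj incj pj" "monic A pj" "is_cokernel A pj cj"
        "cj \<in> Hom A (fob (fob D j) w) Zj" "Zj \<in> Proj A" by (rule PhiD[OF DPhi[OF j] w])
      obtain gj where "gj \<in> Hom A Sj S" "\<forall>a\<in>into w. gj \<cdot> incj a = inc a \<cdot> cmp (l j) (src Q a)"
        "p \<cdot> gj = cmp (l j) w \<cdot> pj" by (rule canonical_nat[OF 1(1) p c(2)[OF j] w])
      with 1 show "\<exists>t. case t of (Sj, incj, pj, Zj, cj, gj) \<Rightarrow> canonical (fob D j) w Sj incj pj \<and> monic A pj \<and>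
        is_cokernel A pj cj \<and> cj \<in> Hom A (fob (fob D j) w) Zj \<and> Zj \<in> Proj A \<and> gj \<in> Hom A Sj S \<and>
        (\<forall>a\<in>into w. gj \<cdot> incj a = inc a \<cdot> cmp (l j) (src Q a)) \<and> p \<cdot> gj = cmp (l j) w \<cdot> pj"
        by (intro exI[of _ "(Sj, incj, pj, Zj, cj, gj)"]) simp
    qed
    then obtain t where t: "\<forall>j\<in>Ob K. case t j of (Sj, incj, pj, Zj, cj, gj) \<Rightarrow> canonical (fob D j) w Sj incj pj \<and>
        monic A pj \<and> is_cokernel A pj cj \<and> cj \<in> Hom A (fob (fob D j) w) Zj \<and> Zj \<in> Proj A \<and> gj \<in> Hom A Sj S \<and>
        (\<forall>a\<in>into w. gj \<cdot> incj a = inc a \<cdot> cmp (l j) (src Q a)) \<and> p \<cdot> gj = cmp (l j) w \<cdot> pj"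
      by (rule bchoice[THEN exE])
    define Sj incj pj Zj cj gj where "Sj j = fst (t j)" and "incj j = fst (snd (t j))" and
      "pj j = fst (snd (snd (t j)))" and "Zj j = fst (snd (snd (snd (t j))))" and
      "cj j = fst (snd (snd (snd (snd (t j)))))" and "gj j = snd (snd (snd (snd (snd (t j)))))" for j
    have stage: "canonical (fob D j) w (Sj j) (incj j) (pj j)" "monic A (pj j)" "is_cokernel A (pj j) (cj j)"
      "cj j \<in> Hom A (fob (fob D j) w) (Zj j)" "Zj j \<in> Proj A" "gj j \<in> Hom A (Sj j) S"
      "\<forall>a\<in>into w. gj j \<cdot> incj j a = inc a \<cdot> cmp (l j) (src Q a)" "p \<cdot> gj j = cmp (l j) w \<cdot> pj j"
      if "j \<in> Ob K" for j
      using t that by (auto simp: Sj_def incj_def pj_def Zj_def cj_def gj_def split_def)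
    note stD = canonicalD[OF stage(1)]
    note ij = coprodD(3)[OF stD(1)]
    have trans: "\<exists>g. g \<in> Hom A (Sj j) (Sj k) \<and> pj k \<cdot> g = cmp (fmor D u) w \<cdot> pj j \<and> gj k \<cdot> g = gj j \<and>
        (\<forall>a\<in>into w. g \<cdot> incj j a = incj k a \<cdot> cmp (fmor D u) (src Q a))" if u: "u \<in> Hom K j k" for u j k
    proof -
      have j: "j \<in> Ob K" and k: "k \<in> Ob K" using K.Hom_Ob[OF u] by auto
      obtain g where g: "g \<in> Hom A (Sj j) (Sj k)" "\<forall>a\<in>into w. g \<cdot> incj j a = incj k a \<cdot> cmp (fmor D u) (src Q a)"
        "pj k \<cdot> g = cmp (fmor D u) w \<cdot> pj j" by (rule canonical_nat[OF stage(1)[OF j] stage(1)[OF k] d(2)[OF u] w])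
      have "gj k \<cdot> g = gj j"
      proof (rule coprod_eq[OF stD(1)[OF j] Comp_Hom[OF g(1) stage(6)[OF k]] stage(6)[OF j]])
        fix a assume a: "a \<in> into w"
        note x = intoD(3)[OF a]
        show "(gj k \<cdot> g) \<cdot> incj j a = gj j \<cdot> incj j a"
          using Comp_assoc[OF ij[OF j a] g(1) stage(6)[OF k]] g(2) a
            Comp_assoc[OF dH[OF u x] ij[OF k a] stage(6)[OF k]] stage(7)[OF k] stage(7)[OF j]
            Comp_assoc[OF dH[OF u x] lH[OF k x] i[OF a]] ld[OF u x] by simp
      qed
      with g show ?thesis by blast
    qed
    have lift: "\<exists>j y. j \<in> Ob K \<and> y \<in> Hom A P (Sj j) \<and> gj j \<cdot> y = x" if P: "P \<in> fg_proj U A" and x: "x \<in> Hom A P S" for P x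
    proof (rule finite_support_induct[OF fg_projD(2)[OF P] pD(1) small_into x])
      note PO = fg_projD(3)[OF P]
      obtain j where j: "j \<in> Ob K" using filtered_nonempty[OF K'(4)] by blast
      show "\<exists>j y. j \<in> Ob K \<and> y \<in> Hom A P (Sj j) \<and> gj j \<cdot> y = zr P S"
        using j zr_Hom[OF PO coprodD(1)[OF stD(1)[OF j]]] comp_zr[OF stage(6)[OF j] PO] by blast
      fix x' a y assume x': "x' \<in> Hom A P S" and IH: "\<exists>j y. j \<in> Ob K \<and> y \<in> Hom A P (Sj j) \<and> gj j \<cdot> y = x'"
        and a: "a \<in> into w" and y: "y \<in> Hom A P (fob F (src Q a))"
      obtain j z where j: "j \<in> Ob K" and z: "z \<in> Hom A P (Sj j)" "gj j \<cdot> z = x'" using IH by blast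
      note s = intoD(3)[OF a]
      obtain k y' where k: "k \<in> Ob K" and y': "y' \<in> Hom A P (fob (fob D k) (src Q a))" "cmp (l k) (src Q a) \<cdot> y' = y"
        using fg_proj_factor[OF P K DO[OF s] Lv[OF s] y] by auto
      obtain m u v where u: "u \<in> Hom K j m" and v: "v \<in> Hom K k m" by (rule filtered_bound[OF K'(4) j k])
      have m: "m \<in> Ob K" using K.Hom_Ob[OF u] by blast
      obtain g where g: "g \<in> Hom A (Sj j) (Sj m)" "gj m \<cdot> g = gj j" using trans[OF u] by blast
      note gz = Comp_Hom[OF z(1) g(1)] and vy = Comp_Hom[OF y'(1) dH[OF v s]]
      note ivy = Comp_Hom[OF vy ij[OF m a]]
      have "gj m \<cdot> ((g \<cdot> z) \<oplus> (incj m a \<cdot> (cmp (fmor D v) (src Q a) \<cdot> y'))) = x' \<oplus> (inc a \<cdot> y)"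
        using comp_pl[OF gz ivy stage(6)[OF m]] Comp_assoc[OF z(1) g(1) stage(6)[OF m]] g(2) z(2)
          Comp_assoc[OF vy ij[OF m a] stage(6)[OF m]] stage(7)[OF m] a Comp_assoc[OF vy lH[OF m s] i[OF a]]
          Comp_assoc[OF y'(1) dH[OF v s] lH[OF m s]] ld[OF v s] y'(2) by simp
      then show "\<exists>j z. j \<in> Ob K \<and> z \<in> Hom A P (Sj j) \<and> gj j \<cdot> z = x' \<oplus> (inc a \<cdot> y)"
        using m pl_Hom[OF gz ivy] by blast
    qed
    have equal: "\<exists>k. \<exists>u\<in>Hom K j k. cmp (fmor D u) w \<cdot> x = cmp (fmor D u) w \<cdot> y"
      if P: "P \<in> fg_proj U A" and j: "j \<in> Ob K" and x: "x \<in> Hom A P (fob (fob D j) w)" and y: "y \<in> Hom A P (fob (fob D j) w)"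
        and e: "cmp (l j) w \<cdot> x = cmp (l j) w \<cdot> y" for P j x y
      using fin_generatedD[OF fg_projD(2)[OF P] A_cat K DO[OF w] Lv[OF w] j] x y e by simp
    have mono: "monic A p"
    proof (rule monicI[OF pD(2)])
      fix W g assume g: "g \<in> Hom A W S" "p \<cdot> g = zr W (fob F w)"
      show "g = zr W S"
      proof (rule gen_zero[OF g(1)])
        fix P z assume P: "P \<in> fg_proj U A" and z: "z \<in> Hom A P W"
        note PO = fg_projD(3)[OF P]
        obtain j y where j: "j \<in> Ob K" and y: "y \<in> Hom A P (Sj j)" "gj j \<cdot> y = g \<cdot> z" using lift[OF P Comp_Hom[OF z g(1)]] by blast
        note py = Comp_Hom[OF y(1) stD(2)[OF j]]
        have "cmp (l j) w \<cdot> (pj j \<cdot> y) = p \<cdot> (g \<cdot> z)"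
          using Comp_assoc[OF y(1) stD(2)[OF j] lH[OF j w]] stage(8)[OF j] Comp_assoc[OF y(1) stage(6)[OF j] pD(2)] y(2) by simp
        also have "\<dots> = zr P (fob F w)"
          using Comp_assoc[OF z g(1) pD(2)] g(2) zr_comp[OF z Hom_Ob(2)[OF pD(2)]] by simp
        also have "\<dots> = cmp (l j) w \<cdot> zr P (fob (fob D j) w)" using comp_zr[OF lH[OF j w] PO] by simp
        finally obtain k u where u: "u \<in> Hom K j k" and ku: "cmp (fmor D u) w \<cdot> (pj j \<cdot> y) = cmp (fmor D u) w \<cdot> zr P (fob (fob D j) w)"
          using equal[OF P j py zr_Hom[OF PO Hom_Ob(2)[OF py]]] by blast
        have k: "k \<in> Ob K" using K.Hom_Ob[OF u] by blast
        obtain g' where g': "g' \<in> Hom A (Sj j) (Sj k)" "pj k \<cdot> g' = cmp (fmor D u) w \<cdot> pj j" "gj k \<cdot> g' = gj j" using trans[OF u] by blast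
        have "pj k \<cdot> (g' \<cdot> y) = zr P (fob (fob D k) w)"
          using Comp_assoc[OF y(1) g'(1) stD(2)[OF k]] g'(2) Comp_assoc[OF y(1) stD(2)[OF j] dH[OF u w]] ku
            comp_zr[OF dH[OF u w] PO] by simp
        then have "g' \<cdot> y = zr P (Sj k)" by (rule monic_zrD[OF stage(2)[OF k] stD(2)[OF k] Comp_Hom[OF y(1) g'(1)]])
        then have "gj k \<cdot> (g' \<cdot> y) = zr P S" using comp_zr[OF stage(6)[OF k] PO] by simp
        then show "g \<cdot> z = zr P S" using Comp_assoc[OF y(1) g'(1) stage(6)[OF k]] g'(3) y(2) by simp
      qed
    qed
    obtain Z q where q: "q \<in> Hom A (fob F w) Z" "is_cokernel A p q" by (rule cokernel_exists[OF pD(2)])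
    note qD = cokernelD[OF q(2) pD(2) q(1)]
    have ZO: "Z \<in> Ob A" using Hom_Ob(2)[OF q(1)] .
    have "flat Z"
    proof (rule flatI[OF ZO])
      fix P P' f g assume P: "P \<in> fg_proj U A" and P': "P' \<in> fg_proj U A" and f: "f \<in> Hom A P Z" and g: "g \<in> Hom A P' P"
        and fg: "f \<cdot> g = zr P' Z"
      obtain x where x: "x \<in> Hom A P (fob F w)" "q \<cdot> x = f" by (rule projectiveD[OF fg_projD(1)[OF P] qD(2) q(1) f])
      have "q \<cdot> (x \<cdot> g) = zr P' Z" using Comp_assoc[OF g x(1) q(1)] x(2) fg by simp
      then obtain y where y: "y \<in> Hom A P' S" "p \<cdot> y = x \<cdot> g"
        using monic_kernel[OF mono pD(2) q(2,1) Comp_Hom[OF g x(1)]] by blast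
      obtain j x' where j: "j \<in> Ob K" and x': "x' \<in> Hom A P (fob (fob D j) w)" "cmp (l j) w \<cdot> x' = x"
        using fg_proj_factor[OF P K DO[OF w] Lv[OF w] x(1)] by auto
      obtain k y' where k: "k \<in> Ob K" and y': "y' \<in> Hom A P' (Sj k)" "gj k \<cdot> y' = y" using lift[OF P' y(1)] by blast
      obtain m u v where u: "u \<in> Hom K j m" and v: "v \<in> Hom K k m" by (rule filtered_bound[OF K'(4) j k])
      have m: "m \<in> Ob K" using K.Hom_Ob[OF u] by blast
      obtain h where h: "h \<in> Hom A (Sj k) (Sj m)" "gj m \<cdot> h = gj k" using trans[OF v] by blast
      note hy = Comp_Hom[OF y'(1) h(1)] and ux = Comp_Hom[OF x'(1) dH[OF u w]]
      note phy = Comp_Hom[OF hy stD(2)[OF m]] and uxg = Comp_Hom[OF g ux]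
      have lux: "cmp (l m) w \<cdot> (cmp (fmor D u) w \<cdot> x') = x"
        using Comp_assoc[OF x'(1) dH[OF u w] lH[OF m w]] ld[OF u w] x'(2) by simp
      have "cmp (l m) w \<cdot> ((cmp (fmor D u) w \<cdot> x') \<cdot> g) = x \<cdot> g" using Comp_assoc[OF g ux lH[OF m w]] lux by simp
      also have "\<dots> = p \<cdot> (gj m \<cdot> (h \<cdot> y'))" using y(2) y'(2) h(2) Comp_assoc[OF y'(1) h(1) stage(6)[OF m]] by simp
      also have "\<dots> = cmp (l m) w \<cdot> (pj m \<cdot> (h \<cdot> y'))"
        using Comp_assoc[OF hy stage(6)[OF m] pD(2)] stage(8)[OF m] Comp_assoc[OF hy stD(2)[OF m] lH[OF m w]] by simp
      finally obtain n r where r: "r \<in> Hom K m n" and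
        rr: "cmp (fmor D r) w \<cdot> ((cmp (fmor D u) w \<cdot> x') \<cdot> g) = cmp (fmor D r) w \<cdot> (pj m \<cdot> (h \<cdot> y'))"
        using equal[OF P' m uxg phy] by blast
      have n: "n \<in> Ob K" using K.Hom_Ob[OF r] by blast
      obtain g' where g': "g' \<in> Hom A (Sj m) (Sj n)" "pj n \<cdot> g' = cmp (fmor D r) w \<cdot> pj m" using trans[OF r] by blast
      note rux = Comp_Hom[OF ux dH[OF r w]]
      note cD = cokernelD[OF stage(3)[OF n] stD(2)[OF n] stage(4)[OF n]]
      let ?h = "cj n \<cdot> (cmp (fmor D r) w \<cdot> (cmp (fmor D u) w \<cdot> x'))"
      have ZnO: "Zj n \<in> Ob A" using Hom_Ob(2)[OF stage(4)[OF n]] .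
      have "(cmp (fmor D r) w \<cdot> (cmp (fmor D u) w \<cdot> x')) \<cdot> g = pj n \<cdot> (g' \<cdot> (h \<cdot> y'))"
        using Comp_assoc[OF g ux dH[OF r w]] rr Comp_assoc[OF hy stD(2)[OF m] dH[OF r w]] g'(2)
          Comp_assoc[OF hy g'(1) stD(2)[OF n]] by simp
      then have hg: "?h \<cdot> g = zr P' (Zj n)"
        using Comp_assoc[OF g rux stage(4)[OF n]] Comp_assoc[OF Comp_Hom[OF hy g'(1)] stD(2)[OF n] stage(4)[OF n]]
          cD(1) zr_comp[OF Comp_Hom[OF hy g'(1)] ZnO] by simp
      have "(q \<cdot> cmp (l n) w) \<cdot> pj n = zr (Sj n) Z"
        using Comp_assoc[OF stD(2)[OF n] lH[OF n w] q(1)] stage(8)[OF n] Comp_assoc[OF stage(6)[OF n] pD(2) q(1)]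
          qD(1) zr_comp[OF stage(6)[OF n] ZO] by simp
      then obtain y'' where y'': "y'' \<in> Hom A (Zj n) Z" "y'' \<cdot> cj n = q \<cdot> cmp (l n) w"
        using cD(3)[OF Comp_Hom[OF lH[OF n w] q(1)]] by blast
      have "y'' \<cdot> ?h = f"
        using Comp_assoc[OF rux stage(4)[OF n] y''(1)] y''(2) Comp_assoc[OF rux lH[OF n w] q(1)]
          Comp_assoc[OF ux dH[OF r w] lH[OF n w]] ld[OF r w] lux x(2) by simp
      then show "\<exists>P''\<in>Proj A. \<exists>h\<in>Hom A P P''. \<exists>y\<in>Hom A P'' Z. y \<cdot> h = f \<and> h \<cdot> g = zr P' P''"
        using stage(5)[OF n] Comp_Hom[OF rux stage(4)[OF n]] y''(1) hg by blast
    qed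
    then show "\<exists>p c. canonical_map Q A F w p \<and> monic A p \<and> is_cokernel A p c \<and>
        Cod A c \<in> Filt_colims U A (fg_proj U A)"
      unfolding canonical_map_iff Filt_colims_iff using p mono q HomD[OF q(1)]
      by (intro exI[of _ p] exI[of _ q]) auto
  qed
qed

end

section \<open>Representations with flat cokernels\<close>

context fg_quiver_reps
begin

text \<open>
  The finite direct sums of representations \<open>f\<^sub>v(P)\<close> with \<open>P\<close> finitely generated projective. Indices are natural
  numbers, so that the class does not depend on a type of indices.
\<close>

definition finite_free where
  "finite_free = {F. \<exists>n v X u. (\<forall>k\<in>{..<n::nat}. X k \<in> fg_proj U A) \<and> free_on {..<n} v X F u}"

lemma finite_freeI:
  assumes F: "free_on K v X F u" and K: "finite K" and X: "\<And>k. k \<in> K \<Longrightarrow> X k \<in> fg_proj U A"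
  shows "F \<in> finite_free"
proof -
  obtain b where b: "bij_betw b {..<card K} K" using ex_bij_betw_nat_finite[OF K] by (auto simp: atLeast0LessThan)
  have "\<forall>k\<in>{..<card K}. X (b k) \<in> fg_proj U A" using X bij_betwE[OF b] by simp
  with free_reindex[OF F b] show ?thesis unfolding finite_free_def by (intro CollectI exI conjI)
qed

lemma finite_freeE:
  assumes "F \<in> finite_free"
  obtains n v X u where "\<forall>k\<in>{..<n::nat}. X k \<in> fg_proj U A" "free_on {..<n} v X F u"
  using assms unfolding finite_free_def by blast

lemma finite_free_exists:
  assumes K: "finite K" and X: "\<And>k. k \<in> K \<Longrightarrow> X k \<in> fg_proj U A" and v: "\<And>k. k \<in> K \<Longrightarrow> v k \<in> verts Q"
  obtains F u where "free_on K v X F u" "F \<in> finite_free"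
proof -
  obtain F u where F: "free_on K v X F u"
    by (rule free_exists[of K v X]) (use small_finite[OF K] v X fg_projD(3) in auto)
  then show ?thesis using that finite_freeI[OF F K X] by blast
qed

text \<open>
  A map out of \<open>F\<close> amounts to finitely many maps out of finitely generated objects, and colimits are computed
  pointwise.
\<close>

lemma finite_free_fg_proj: "finite_free \<subseteq> fg_proj U R"
proof
  fix F assume "F \<in> finite_free"
  then obtain n v X u where X: "\<forall>k\<in>{..<n::nat}. X k \<in> fg_proj U A" and F: "free_on {..<n} v X F u" by (rule finite_freeE)
  note D = freeD[OF F, simplified] and uH = freeD(3)[OF F]
  have "fin_generated U R F"
  proof (rule fin_generatedI[OF R.category_axioms D(1)])
    fix K :: "('u, 'u) cat" and E L l j x y
    assume K: "small_filtered U K" and E: "is_functor K R E" and L: "is_colimit R K E L l" and j: "j \<in> Ob K"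
      and x: "x \<in> Hom R F (fob E j)" and y: "y \<in> Hom R F (fob E j)" and e: "l j \<cdot>\<^bsub>R\<^esub> x = l j \<cdot>\<^bsub>R\<^esub> y"
    have Ks: "small_cat U K" using K by (simp add: small_filtered_def)
    note K' = small_filteredD[OF K] and lj = coconeD(2)[OF colim_cocone[OF L] j] and EH = functorD(2)[OF E]
    have xu: "cmp x (v k) \<cdot> u k \<in> Hom A (X k) (fob (fob E j) (v k))" "cmp y (v k) \<cdot> u k \<in> Hom A (X k) (fob (fob E j) (v k))"
      if "k \<in> {..<n}" for k
      using Comp_Hom[OF uH[OF that] cmp_Hom[OF x freeD(2)[OF F that]]]
        Comp_Hom[OF uH[OF that] cmp_Hom[OF y freeD(2)[OF F that]]] by auto
    have "\<exists>k. \<exists>r\<in>Hom K j k. \<forall>i\<in>{..<n}. cmp (fmor E r) (v i) \<cdot> (cmp x (v i) \<cdot> u i) = cmp (fmor E r) (v i) \<cdot> (cmp y (v i) \<cdot> u i)"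
    proof (rule filtered_finite[OF K'(1,4) j])
      fix i assume i: "i \<in> {..<n}"
      note vi = freeD(2)[OF F i]
      have "cmp (l j) (v i) \<cdot> (cmp z (v i) \<cdot> u i) = cmp (l j \<cdot>\<^bsub>R\<^esub> z) (v i) \<cdot> u i" if z: "z \<in> Hom R F (fob E j)" for z
        using cmp_comp[OF z lj vi] Comp_assoc[OF uH[OF i] cmp_Hom[OF z vi] cmp_Hom[OF lj vi]] by simp
      then have "cmp (l j) (v i) \<cdot> (cmp x (v i) \<cdot> u i) = cmp (l j) (v i) \<cdot> (cmp y (v i) \<cdot> u i)" using x y e by simp
      moreover have "fin_generated U A (X i)" using X i fg_projD(2) by blast
      ultimately show "\<exists>k. \<exists>r\<in>Hom K j k. cmp (fmor E r) (v i) \<cdot> (cmp x (v i) \<cdot> u i) = cmp (fmor E r) (v i) \<cdot> (cmp y (v i) \<cdot> u i)"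
        using fin_generatedD[OF _ A_cat K functor_ev[OF E vi] colimit_cmp[OF Ks E L vi] j, of "X i"] xu[OF i] by simp
      fix r k w k' assume r: "r \<in> Hom K j k" and w: "w \<in> Hom K k k'"
        and eq: "cmp (fmor E r) (v i) \<cdot> (cmp x (v i) \<cdot> u i) = cmp (fmor E r) (v i) \<cdot> (cmp y (v i) \<cdot> u i)"
      have "cmp (fmor E (w \<cdot>\<^bsub>K\<^esub> r)) (v i) = cmp (fmor E w) (v i) \<cdot> cmp (fmor E r) (v i)"
        using functorD(4)[OF E r w] cmp_comp[OF EH[OF r] EH[OF w] vi] by simp
      then show "cmp (fmor E (w \<cdot>\<^bsub>K\<^esub> r)) (v i) \<cdot> (cmp x (v i) \<cdot> u i) = cmp (fmor E (w \<cdot>\<^bsub>K\<^esub> r)) (v i) \<cdot> (cmp y (v i) \<cdot> u i)"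
        using eq Comp_assoc[OF xu(1)[OF i] cmp_Hom[OF EH[OF r] vi] cmp_Hom[OF EH[OF w] vi]]
          Comp_assoc[OF xu(2)[OF i] cmp_Hom[OF EH[OF r] vi] cmp_Hom[OF EH[OF w] vi]] by simp
    qed simp
    then obtain k r where r: "r \<in> Hom K j k" "\<forall>i\<in>{..<n}. cmp (fmor E r) (v i) \<cdot> (cmp x (v i) \<cdot> u i) =
        cmp (fmor E r) (v i) \<cdot> (cmp y (v i) \<cdot> u i)" by blast
    have "fmor E r \<cdot>\<^bsub>R\<^esub> x = fmor E r \<cdot>\<^bsub>R\<^esub> y"
    proof (rule free_eq[OF F R.Comp_Hom[OF x EH[OF r(1)]] R.Comp_Hom[OF y EH[OF r(1)]]])
      fix i assume i: "i \<in> {..<n}"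
      note vi = freeD(2)[OF F i]
      show "cmp (fmor E r \<cdot>\<^bsub>R\<^esub> x) (v i) \<cdot> u i = cmp (fmor E r \<cdot>\<^bsub>R\<^esub> y) (v i) \<cdot> u i"
        using cmp_comp[OF x EH[OF r(1)] vi] cmp_comp[OF y EH[OF r(1)] vi]
          Comp_assoc[OF uH[OF i] cmp_Hom[OF x vi] cmp_Hom[OF EH[OF r(1)] vi]]
          Comp_assoc[OF uH[OF i] cmp_Hom[OF y vi] cmp_Hom[OF EH[OF r(1)] vi]] r(2) i by simp
    qed
    then show "\<exists>k. \<exists>u\<in>Hom K j k. fmor E u \<cdot>\<^bsub>R\<^esub> x = fmor E u \<cdot>\<^bsub>R\<^esub> y" using r(1) by blast
  qed
  moreover have "projective R F" by (rule free_projective[OF F]) (use X fg_projD(1) in blast)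
  ultimately show "F \<in> fg_proj U R" by (simp add: fg_proj_def)
qed

lemma finite_free_Ob: "F \<in> finite_free \<Longrightarrow> F \<in> Ob R"
  by (elim finite_freeE) (rule freeD(1))

lemma small_Hom_finite_free:
  assumes F: "F \<in> finite_free" and Y: "Y \<in> Ob R"
  shows "small U (Hom R F Y)"
proof -
  obtain n v X u where X: "\<forall>k\<in>{..<n::nat}. X k \<in> fg_proj U A" and F': "free_on {..<n} v X F u" by (rule finite_freeE[OF F])
  note vk = freeD(2)[OF F'] and uH = freeD(3)[OF F']
  let ?T = "\<Union>k\<in>{..<n}. Hom A (X k) (fob Y (v k))"
  have "small U ?T"
    by (rule small_UN[OF small_finite]) (use X small_Hom_fg_proj R_Ob(2)[OF Y vk] in auto)
  then have "small U (lists ?T)" by (rule small_lists)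
  then show ?thesis
  proof (rule small_inj)
    show "inj_on (\<lambda>h. map (\<lambda>k. cmp h (v k) \<cdot> u k) [0..<n]) (Hom R F Y)"
    proof (rule inj_onI)
      fix h h' assume h: "h \<in> Hom R F Y" "h' \<in> Hom R F Y"
        and e: "map (\<lambda>k. cmp h (v k) \<cdot> u k) [0..<n] = map (\<lambda>k. cmp h' (v k) \<cdot> u k) [0..<n]"
      show "h = h'" by (rule free_eq[OF F' h]) (use e in simp)
    qed
    show "(\<lambda>h. map (\<lambda>k. cmp h (v k) \<cdot> u k) [0..<n]) ` Hom R F Y \<subseteq> lists ?T"
      using Comp_Hom[OF uH cmp_Hom[OF _ vk]] by fastforce
  qed
qed

lemma finite_free_skeleton:
  obtains \<F> where "\<F> \<subseteq> finite_free" "small U \<F>" "\<forall>F\<in>finite_free. \<exists>F'\<in>\<F>. \<exists>f g. R.inverse_pair F F' f g"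
proof -
  obtain \<P> where \<P>: "\<P> \<subseteq> fg_proj U A" "small U \<P>" "\<And>P. P \<in> fg_proj U A \<Longrightarrow> \<exists>P'\<in>\<P>. \<exists>f g. inverse_pair P P' f g"
    by (rule skeleton) blast
  let ?L = "lists (verts Q \<times> \<P>)"
  have nth: "fst (xs ! k) \<in> verts Q \<and> snd (xs ! k) \<in> fg_proj U A" if "xs \<in> ?L" "k < length xs" for xs k
  proof -
    have "xs ! k \<in> verts Q \<times> \<P>" using that nth_mem by auto
    then show ?thesis using \<P>(1) by auto
  qed
  have "\<forall>xs\<in>?L. \<exists>F. F \<in> finite_free \<and> (\<exists>u. free_on {..<length xs} (\<lambda>k. fst (xs ! k)) (\<lambda>k. snd (xs ! k)) F u)"
  proof
    fix xs assume xs: "xs \<in> ?L"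
    obtain F u where "free_on {..<length xs} (\<lambda>k. fst (xs ! k)) (\<lambda>k. snd (xs ! k)) F u" "F \<in> finite_free"
      by (rule finite_free_exists[of "{..<length xs}" "\<lambda>k. snd (xs ! k)" "\<lambda>k. fst (xs ! k)"]) (use nth[OF xs] in auto)
    then show "\<exists>F. F \<in> finite_free \<and> (\<exists>u. free_on {..<length xs} (\<lambda>k. fst (xs ! k)) (\<lambda>k. snd (xs ! k)) F u)" by blast
  qed
  then obtain E where E: "\<forall>xs\<in>?L. E xs \<in> finite_free \<and>
      (\<exists>u. free_on {..<length xs} (\<lambda>k. fst (xs ! k)) (\<lambda>k. snd (xs ! k)) (E xs) u)" by (rule bchoice[THEN exE])
  show ?thesis
  proof (rule that[of "E ` ?L"])
    show "E ` ?L \<subseteq> finite_free" using E by blast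
    show "small U (E ` ?L)" by (intro small_image small_lists small_Times small_verts \<P>(2))
    show "\<forall>F\<in>finite_free. \<exists>F'\<in>E ` ?L. \<exists>f g. R.inverse_pair F F' f g"
    proof
      fix F assume "F \<in> finite_free"
      then obtain n v X u where X: "\<forall>k\<in>{..<n::nat}. X k \<in> fg_proj U A" and F: "free_on {..<n} v X F u" by (rule finite_freeE)
      have "\<forall>k\<in>{..<n}. \<exists>t. fst t \<in> \<P> \<and> inverse_pair (X k) (fst t) (fst (snd t)) (snd (snd t))"
      proof
        fix k assume "k \<in> {..<n}"
        then obtain P f g where "P \<in> \<P>" "inverse_pair (X k) P f g" using X \<P>(3) by blast
        then show "\<exists>t. fst t \<in> \<P> \<and> inverse_pair (X k) (fst t) (fst (snd t)) (snd (snd t))"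
          by (intro exI[of _ "(P, f, g)"]) simp
      qed
      then obtain t where t: "\<forall>k\<in>{..<n}. fst (t k) \<in> \<P> \<and> inverse_pair (X k) (fst (t k)) (fst (snd (t k))) (snd (snd (t k)))"
        by (rule bchoice[THEN exE])
      have F': "free_on {..<n} v (\<lambda>k. fst (t k)) F (\<lambda>k. u k \<cdot> snd (snd (t k)))"
        by (rule free_transport[OF F]) (use t in blast)
      let ?xs = "map (\<lambda>k. (v k, fst (t k))) [0..<n]"
      have xs: "?xs \<in> ?L" using freeD(2)[OF F] t by auto
      have len: "length ?xs = n" by simp
      obtain u' where "free_on {..<length ?xs} (\<lambda>k. fst (?xs ! k)) (\<lambda>k. snd (?xs ! k)) (E ?xs) u'" using E xs by blast
      then have u': "free_on {..<n} (\<lambda>k. fst (?xs ! k)) (\<lambda>k. snd (?xs ! k)) (E ?xs) u'" unfolding len .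
      have E': "free_on {..<n} v (\<lambda>k. fst (t k)) (E ?xs) u'" by (rule free_cong[OF u']) simp_all
      obtain f g where "R.inverse_pair F (E ?xs) f g" by (rule free_unique[OF F' E'])
      then show "\<exists>F'\<in>E ` ?L. \<exists>f g. R.inverse_pair F F' f g" using xs by blast
    qed
  qed
qed

text \<open>\<open>B\<close> is the direct sum of \<open>H\<close> and \<open>H'\<close>, with the map to \<open>F\<close> induced by the given ones.\<close>

lemma finite_free_sum:
  assumes H: "H \<in> finite_free" "H' \<in> finite_free" and f: "f \<in> Hom R H F" "f' \<in> Hom R H' F"
  shows "\<exists>B\<in>finite_free. \<exists>z\<in>Hom R B F. \<exists>i\<in>Hom R H B. \<exists>j\<in>Hom R H' B. z \<cdot>\<^bsub>R\<^esub> i = f \<and> z \<cdot>\<^bsub>R\<^esub> j = f'"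
proof -
  obtain n v X u where X: "\<forall>k\<in>{..<n::nat}. X k \<in> fg_proj U A" and HF: "free_on {..<n} v X H u" by (rule finite_freeE[OF H(1)])
  obtain n' v' X' u' where X': "\<forall>k\<in>{..<n'::nat}. X' k \<in> fg_proj U A" and HF': "free_on {..<n'} v' X' H' u'" by (rule finite_freeE[OF H(2)])
  note D = freeD[OF HF] and D' = freeD[OF HF'] and FO = R.Hom_Ob(2)[OF f(1)]
  let ?K = "{..<n} <+> {..<n'}"
  obtain B e where B: "free_on ?K (case_sum v v') (case_sum X X') B e" "B \<in> finite_free"
    by (rule finite_free_exists[of ?K "case_sum X X'" "case_sum v v'"]) (use X X' D(2) D'(2) in auto)
  note DB = freeD[OF B(1)]
  have e: "e (Inl k) \<in> Hom A (X k) (fob B (v k))" if "k \<in> {..<n}" for k using DB(3)[OF InlI[OF that]] by simp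
  have e': "e (Inr k) \<in> Hom A (X' k) (fob B (v' k))" if "k \<in> {..<n'}" for k using DB(3)[OF InrI[OF that]] by simp
  have "\<forall>k\<in>{..<n}. e (Inl k) \<in> Hom A (X k) (fob B (v k))" using e by blast
  from free_ex[OF HF DB(1) this] obtain i where i: "i \<in> Hom R H B" "\<forall>k\<in>{..<n}. cmp i (v k) \<cdot> u k = e (Inl k)" by blast
  have "\<forall>k\<in>{..<n'}. e (Inr k) \<in> Hom A (X' k) (fob B (v' k))" using e' by blast
  from free_ex[OF HF' DB(1) this] obtain j where j: "j \<in> Hom R H' B" "\<forall>k\<in>{..<n'}. cmp j (v' k) \<cdot> u' k = e (Inr k)" by blast
  let ?g = "case_sum (\<lambda>k. cmp f (v k) \<cdot> u k) (\<lambda>k. cmp f' (v' k) \<cdot> u' k)"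
  have "\<forall>k\<in>?K. ?g k \<in> Hom A (case_sum X X' k) (fob F (case_sum v v' k))"
    using Comp_Hom[OF D(3) cmp_Hom[OF f(1) D(2)]] Comp_Hom[OF D'(3) cmp_Hom[OF f(2) D'(2)]] by auto
  from free_ex[OF B(1) FO this] obtain z where z: "z \<in> Hom R B F"
    "\<forall>k\<in>?K. cmp z (case_sum v v' k) \<cdot> e k = ?g k" by blast
  have zl: "cmp z (v k) \<cdot> e (Inl k) = cmp f (v k) \<cdot> u k" if "k \<in> {..<n}" for k
    using z(2)[rule_format, OF InlI[OF that]] by simp
  have zr: "cmp z (v' k) \<cdot> e (Inr k) = cmp f' (v' k) \<cdot> u' k" if "k \<in> {..<n'}" for k
    using z(2)[rule_format, OF InrI[OF that]] by simp
  have "z \<cdot>\<^bsub>R\<^esub> i = f"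
  proof (rule free_eq[OF HF R.Comp_Hom[OF i(1) z(1)] f(1)])
    fix k assume k: "k \<in> {..<n}"
    show "cmp (z \<cdot>\<^bsub>R\<^esub> i) (v k) \<cdot> u k = cmp f (v k) \<cdot> u k"
      using cmp_comp[OF i(1) z(1) D(2)[OF k]] Comp_assoc[OF D(3)[OF k] cmp_Hom[OF i(1) D(2)[OF k]] cmp_Hom[OF z(1) D(2)[OF k]]]
        i(2) k zl[OF k] by simp
  qed
  moreover have "z \<cdot>\<^bsub>R\<^esub> j = f'"
  proof (rule free_eq[OF HF' R.Comp_Hom[OF j(1) z(1)] f(2)])
    fix k assume k: "k \<in> {..<n'}"
    show "cmp (z \<cdot>\<^bsub>R\<^esub> j) (v' k) \<cdot> u' k = cmp f' (v' k) \<cdot> u' k"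
      using cmp_comp[OF j(1) z(1) D'(2)[OF k]] Comp_assoc[OF D'(3)[OF k] cmp_Hom[OF j(1) D'(2)[OF k]] cmp_Hom[OF z(1) D'(2)[OF k]]]
        j(2) k zr[OF k] by simp
  qed
  ultimately show ?thesis using B(2) z(1) i(1) j(1) by blast
qed

lemma free_element:
  assumes P: "P \<in> fg_proj U A" and v: "v \<in> verts Q"
  obtains H u where "free_on {()} (\<lambda>_. v) (\<lambda>_. P) H (\<lambda>_. u)" "H \<in> finite_free" "u \<in> Hom A P (fob H v)"
proof -
  obtain H u where H: "free_on {()} (\<lambda>_. v) (\<lambda>_. P) H u" "H \<in> finite_free"
    by (rule finite_free_exists[of "{()}" "\<lambda>_. P" "\<lambda>_. v"]) (use P v in auto)
  have "free_on {()} (\<lambda>_. v) (\<lambda>_. P) H (\<lambda>_. u ())" by (rule free_cong[OF H(1)]) auto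
  then show ?thesis using H(2) by (rule that) (use freeD(3)[OF H(1), of "()"] in simp)
qed

lemma finite_free_add_element:
  assumes H: "H \<in> finite_free" and f: "f \<in> Hom R H F" and P: "P \<in> fg_proj U A" and w: "w \<in> verts Q"
    and y: "y \<in> Hom A P (fob F w)"
  obtains B z i t where "B \<in> finite_free" "z \<in> Hom R B F" "i \<in> Hom R H B" "z \<cdot>\<^bsub>R\<^esub> i = f"
    "t \<in> Hom A P (fob B w)" "cmp z w \<cdot> t = y"
proof -
  obtain E u where E: "free_on {()} (\<lambda>_. w) (\<lambda>_. P) E (\<lambda>_. u)" "E \<in> finite_free" "u \<in> Hom A P (fob E w)"
    by (rule free_element[OF P w])
  obtain f' where f': "f' \<in> Hom R E F" "cmp f' w \<cdot> u = y"
    using free_ex[OF E(1) R.Hom_Ob(2)[OF f], of "\<lambda>_. y"] y by auto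
  obtain B z i j where B: "B \<in> finite_free" "z \<in> Hom R B F" "i \<in> Hom R H B" and j: "j \<in> Hom R E B"
    and e: "z \<cdot>\<^bsub>R\<^esub> i = f" "z \<cdot>\<^bsub>R\<^esub> j = f'"
    using finite_free_sum[OF H E(2) f f'(1)] by blast
  have w': "w \<in> Ob (path_cat Q)" using w by simp
  have "cmp z w \<cdot> (cmp j w \<cdot> u) = y"
    using Comp_assoc[OF E(3) cmp_Hom[OF j w'] cmp_Hom[OF B(2) w']] cmp_comp[OF j B(2) w'] e(2) f'(2) by simp
  then show ?thesis using that[OF B e(1) Comp_Hom[OF E(3) cmp_Hom[OF j w']]] by blast
qed

text \<open>
  As \<open>P\<close> is finitely generated, the map \<open>z\<close> to \<open>S = \<Oplus> F(src a)\<close> has finitely many components. Each of them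
  becomes a new generator at a source, so that \<open>z\<close> factors through the corresponding sum for \<open>B\<close>.
\<close>

lemma lift_source:
  assumes F: "canonical F w S inc p" and w: "w \<in> verts Q" and H: "H \<in> finite_free" and f: "f \<in> Hom R H F"
    and P: "P \<in> fg_proj U A" and z: "z \<in> Hom A P S"
  shows "\<exists>B g i S' inc' p' k z'. B \<in> finite_free \<and> g \<in> Hom R B F \<and> i \<in> Hom R H B \<and> g \<cdot>\<^bsub>R\<^esub> i = f \<and>
    canonical B w S' inc' p' \<and> k \<in> Hom A S' S \<and> (\<forall>a\<in>into w. k \<cdot> inc' a = inc a \<cdot> cmp g (src Q a)) \<and>
    z' \<in> Hom A P S' \<and> k \<cdot> z' = z"
proof -
  note FD = canonicalD[OF F] and iF = coprodD(3)[OF canonicalD(1)[OF F]]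
  note PO = fg_projD(3)[OF P]
  show ?thesis
  proof (rule finite_support_induct[OF fg_projD(2)[OF P] FD(1) small_into z])
    obtain S' inc' p' where S': "canonical H w S' inc' p'" by (rule canonical_exists[OF finite_free_Ob[OF H] w])
    obtain k where k: "k \<in> Hom A S' S" "\<forall>a\<in>into w. k \<cdot> inc' a = inc a \<cdot> cmp f (src Q a)" by (rule canonical_nat[OF S' F f w])
    have S'O: "S' \<in> Ob A" using Hom_Ob(1)[OF k(1)] .
    have "k \<cdot> zr P S' = zr P S" by (rule comp_zr[OF k(1) PO])
    with H f R.Ide_Hom[OF finite_free_Ob[OF H]] R.Comp_Ide[OF f] S' k zr_Hom[OF PO S'O]
    show "\<exists>B g i S' inc' p' k z'. B \<in> finite_free \<and> g \<in> Hom R B F \<and> i \<in> Hom R H B \<and> g \<cdot>\<^bsub>R\<^esub> i = f \<and>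
      canonical B w S' inc' p' \<and> k \<in> Hom A S' S \<and> (\<forall>a\<in>into w. k \<cdot> inc' a = inc a \<cdot> cmp g (src Q a)) \<and>
      z' \<in> Hom A P S' \<and> k \<cdot> z' = zr P S"
      by (intro exI[of _ H] exI[of _ f] exI[of _ "Ide R H"] exI[of _ S'] exI[of _ inc'] exI[of _ p'] exI[of _ k]
          exI[of _ "zr P S'"] conjI)
  next
    fix x a y
    assume x: "x \<in> Hom A P S" and a: "a \<in> into w" and y: "y \<in> Hom A P (fob F (src Q a))"
      and "\<exists>B g i S' inc' p' k z'. B \<in> finite_free \<and> g \<in> Hom R B F \<and> i \<in> Hom R H B \<and> g \<cdot>\<^bsub>R\<^esub> i = f \<and>
      canonical B w S' inc' p' \<and> k \<in> Hom A S' S \<and> (\<forall>a\<in>into w. k \<cdot> inc' a = inc a \<cdot> cmp g (src Q a)) \<and>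
      z' \<in> Hom A P S' \<and> k \<cdot> z' = x"
    then obtain B g i S' inc' p' k z' where B: "B \<in> finite_free" "g \<in> Hom R B F" "i \<in> Hom R H B" "g \<cdot>\<^bsub>R\<^esub> i = f"
      and S': "canonical B w S' inc' p'" and k: "k \<in> Hom A S' S" "\<forall>a\<in>into w. k \<cdot> inc' a = inc a \<cdot> cmp g (src Q a)"
      and z': "z' \<in> Hom A P S'" "k \<cdot> z' = x" by blast
    note s = intoD(3)[OF a]
    obtain C h j t where C: "C \<in> finite_free" "h \<in> Hom R C F" "j \<in> Hom R B C" "h \<cdot>\<^bsub>R\<^esub> j = g"
      and t: "t \<in> Hom A P (fob C (src Q a))" "cmp h (src Q a) \<cdot> t = y"
      by (rule finite_free_add_element[OF B(1,2) P s y])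
    obtain T incT pT where T: "canonical C w T incT pT" by (rule canonical_exists[OF finite_free_Ob[OF C(1)] w])
    obtain k' where k': "k' \<in> Hom A T S" "\<forall>a\<in>into w. k' \<cdot> incT a = inc a \<cdot> cmp h (src Q a)" by (rule canonical_nat[OF T F C(2) w])
    obtain m where m: "m \<in> Hom A S' T" "\<forall>a\<in>into w. m \<cdot> inc' a = incT a \<cdot> cmp j (src Q a)" by (rule canonical_nat[OF S' T C(3) w])
    note iT = coprodD(3)[OF canonicalD(1)[OF T]] and iS = coprodD(3)[OF canonicalD(1)[OF S']]
    note hH = cmp_Hom[OF C(2), simplified] and jH = cmp_Hom[OF C(3), simplified]
    have km: "k' \<cdot> m = k"
    proof (rule coprod_eq[OF canonicalD(1)[OF S'] Comp_Hom[OF m(1) k'(1)] k(1)])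
      fix b assume b: "b \<in> into w"
      note sb = intoD(3)[OF b]
      show "(k' \<cdot> m) \<cdot> inc' b = k \<cdot> inc' b"
        using Comp_assoc[OF iS[OF b] m(1) k'(1)] m(2) b Comp_assoc[OF jH[OF sb] iT[OF b] k'(1)] k'(2)
          Comp_assoc[OF jH[OF sb] hH[OF sb] iF[OF b]] cmp_comp[OF C(3,2), of "src Q b"] sb C(4) k(2) by simp
    qed
    note mz = Comp_Hom[OF z'(1) m(1)] and it = Comp_Hom[OF t(1) iT[OF a]]
    have "k' \<cdot> ((m \<cdot> z') \<oplus> (incT a \<cdot> t)) = x \<oplus> (inc a \<cdot> y)"
      using comp_pl[OF mz it k'(1)] Comp_assoc[OF z'(1) m(1) k'(1)] km z'(2) Comp_assoc[OF t(1) iT[OF a] k'(1)]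
        k'(2) a Comp_assoc[OF t(1) hH[OF s] iF[OF a]] t(2) by simp
    moreover have "h \<cdot>\<^bsub>R\<^esub> (j \<cdot>\<^bsub>R\<^esub> i) = f" using R.Comp_assoc[OF B(3) C(3,2)] C(4) B(4) by simp
    ultimately show "\<exists>B g i S' inc' p' k z'. B \<in> finite_free \<and> g \<in> Hom R B F \<and> i \<in> Hom R H B \<and> g \<cdot>\<^bsub>R\<^esub> i = f \<and>
      canonical B w S' inc' p' \<and> k \<in> Hom A S' S \<and> (\<forall>a\<in>into w. k \<cdot> inc' a = inc a \<cdot> cmp g (src Q a)) \<and>
      z' \<in> Hom A P S' \<and> k \<cdot> z' = x \<oplus> (inc a \<cdot> y)"
      using C(1,2) R.Comp_Hom[OF B(3) C(3)] T k' pl_Hom[OF mz it]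
      by (intro exI[of _ C] exI[of _ h] exI[of _ "j \<cdot>\<^bsub>R\<^esub> i"] exI[of _ T] exI[of _ incT] exI[of _ pT] exI[of _ k']
          exI[of _ "(m \<cdot> z') \<oplus> (incT a \<cdot> t)"] conjI)
  qed
qed

text \<open>
  The relations are removed one after the other; those already removed stay so under further maps. That a
  single relation can be removed is a hypothesis here, as it is only known by induction when this is used.
\<close>

lemma kill_many:
  assumes T: "finite T" and H: "H \<in> finite_free" and f: "f \<in> Hom R H F"
    and r: "\<And>k. k \<in> T \<Longrightarrow> v k \<in> verts Q" "\<And>k. k \<in> T \<Longrightarrow> r k \<in> Hom A (X k) (fob H (v k))"
      "\<And>k. k \<in> T \<Longrightarrow> cmp f (v k) \<cdot> r k = zr (X k) (fob F (v k))"
    and kill: "\<And>k B g s. k \<in> T \<Longrightarrow> B \<in> finite_free \<Longrightarrow> g \<in> Hom R B F \<Longrightarrow> s \<in> Hom A (X k) (fob B (v k)) \<Longrightarrow>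
      cmp g (v k) \<cdot> s = zr (X k) (fob F (v k)) \<Longrightarrow>
      \<exists>C\<in>finite_free. \<exists>h\<in>Hom R B C. \<exists>g'\<in>Hom R C F. g' \<cdot>\<^bsub>R\<^esub> h = g \<and> cmp h (v k) \<cdot> s = zr (X k) (fob C (v k))"
  shows "\<exists>B\<in>finite_free. \<exists>h\<in>Hom R H B. \<exists>g\<in>Hom R B F. g \<cdot>\<^bsub>R\<^esub> h = f \<and>
    (\<forall>k\<in>T. cmp h (v k) \<cdot> r k = zr (X k) (fob B (v k)))"
  using T r kill
proof (induction T)
  case empty
  then show ?case using H f R.Ide_Hom[OF finite_free_Ob[OF H]] R.Comp_Ide[OF f] by blast
next
  case (insert k T)
  have "\<exists>B\<in>finite_free. \<exists>h\<in>Hom R H B. \<exists>g\<in>Hom R B F. g \<cdot>\<^bsub>R\<^esub> h = f \<and>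
    (\<forall>k\<in>T. cmp h (v k) \<cdot> r k = zr (X k) (fob B (v k)))"
  proof (rule insert.IH)
    fix i assume "i \<in> T"
    then have i: "i \<in> insert k T" by simp
    show "v i \<in> verts Q" by (rule insert.prems(1)[OF i])
    show "r i \<in> Hom A (X i) (fob H (v i))" by (rule insert.prems(2)[OF i])
    show "cmp f (v i) \<cdot> r i = zr (X i) (fob F (v i))" by (rule insert.prems(3)[OF i])
    fix B g s assume "B \<in> finite_free" "g \<in> Hom R B F" "s \<in> Hom A (X i) (fob B (v i))" "cmp g (v i) \<cdot> s = zr (X i) (fob F (v i))"
    then show "\<exists>C\<in>finite_free. \<exists>h\<in>Hom R B C. \<exists>g'\<in>Hom R C F. g' \<cdot>\<^bsub>R\<^esub> h = g \<and> cmp h (v i) \<cdot> s = zr (X i) (fob C (v i))"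
      by (rule insert.prems(4)[OF i])
  qed
  then obtain B h g where B: "B \<in> finite_free" "h \<in> Hom R H B" "g \<in> Hom R B F" "g \<cdot>\<^bsub>R\<^esub> h = f"
    and hT: "\<forall>k\<in>T. cmp h (v k) \<cdot> r k = zr (X k) (fob B (v k))" by blast
  have kI: "k \<in> insert k T" by simp
  note rk = insert.prems(2)[OF kI]
  have vk: "v k \<in> Ob (path_cat Q)" using insert.prems(1) by simp
  note hr = Comp_Hom[OF rk cmp_Hom[OF B(2) vk]]
  have "cmp g (v k) \<cdot> (cmp h (v k) \<cdot> r k) = zr (X k) (fob F (v k))"
    using Comp_assoc[OF rk cmp_Hom[OF B(2) vk] cmp_Hom[OF B(3) vk]] cmp_comp[OF B(2,3) vk] B(4)
      insert.prems(3)[OF kI] by simp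
  from insert.prems(4)[OF kI B(1,3) hr this] obtain C h' g' where C: "C \<in> finite_free" "h' \<in> Hom R B C" "g' \<in> Hom R C F"
    "g' \<cdot>\<^bsub>R\<^esub> h' = g" "cmp h' (v k) \<cdot> (cmp h (v k) \<cdot> r k) = zr (X k) (fob C (v k))" by blast
  have z: "cmp (h' \<cdot>\<^bsub>R\<^esub> h) (v i) \<cdot> r i = zr (X i) (fob C (v i))" if i: "i \<in> insert k T" for i
  proof -
    have vi: "v i \<in> Ob (path_cat Q)" using insert.prems(1) i by simp
    note ri = insert.prems(2)[OF i]
    have 1: "cmp (h' \<cdot>\<^bsub>R\<^esub> h) (v i) \<cdot> r i = cmp h' (v i) \<cdot> (cmp h (v i) \<cdot> r i)"
      using cmp_comp[OF B(2) C(2) vi] Comp_assoc[OF ri cmp_Hom[OF B(2) vi] cmp_Hom[OF C(2) vi]] by simp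
    show ?thesis
    proof (cases "i = k")
      case True
      then show ?thesis using 1 C(5) by simp
    next
      case False
      then show ?thesis using 1 hT i comp_zr[OF cmp_Hom[OF C(2) vi] Hom_Ob(1)[OF ri]] by simp
    qed
  qed
  have "g' \<cdot>\<^bsub>R\<^esub> (h' \<cdot>\<^bsub>R\<^esub> h) = f" using R.Comp_assoc[OF B(2) C(2,3)] C(4) B(4) by simp
  then show ?case using C(1,3) R.Comp_Hom[OF B(2) C(2)] z by blast
qed

text \<open>
  The image of the relation \<open>r\<close> in the flat cokernel at \<open>w\<close> is removed first, at the cost of new generators
  at \<open>w\<close> and at the sources of the arrows into \<open>w\<close>. What remains of \<open>r\<close> comes from the sources and is still a
  relation there, as the canonical map of \<open>F\<close> is monic. It has finitely many components, which are removed
  by induction.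
\<close>

lemma kill:
  assumes F: "F \<in> Phi Q A (Filt_colims U A (fg_proj U A))"
  shows "w \<in> verts Q \<Longrightarrow> H \<in> finite_free \<Longrightarrow> f \<in> Hom R H F \<Longrightarrow> P \<in> fg_proj U A \<Longrightarrow> r \<in> Hom A P (fob H w) \<Longrightarrow>
    cmp f w \<cdot> r = zr P (fob F w) \<Longrightarrow>
    \<exists>B\<in>finite_free. \<exists>h\<in>Hom R H B. \<exists>g\<in>Hom R B F. g \<cdot>\<^bsub>R\<^esub> h = f \<and> cmp h w \<cdot> r = zr P (fob B w)"
proof (induction w arbitrary: H f P r rule: vertex_induct)
  case (1 w H f P r)
  note w = 1(2) and HF = 1(3) and f = 1(4) and P = 1(5) and r = 1(6) and fr = 1(7)
  note PO = fg_projD(3)[OF P] and HO = finite_free_Ob[OF HF]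
  have w': "w \<in> Ob (path_cat Q)" using w by simp
  have FO: "F \<in> Ob R" by (rule Phi_Ob[OF F])
  note fw = cmp_Hom[OF f w']
  \<comment> \<open>\<open>H(w)\<close> is the direct sum of the part \<open>S\<close> from the sources and the sum \<open>T\<close> of the generators at \<open>w\<close>.\<close>
  obtain n v X u where X: "\<forall>k\<in>{..<n::nat}. X k \<in> fg_proj U A" and H: "free_on {..<n} v X H u" by (rule finite_freeE[OF HF])
  note HD = freeD[OF H]
  obtain S inc p where S: "canonical H w S inc p" by (rule canonical_exists[OF HO w])
  note SD = canonicalD[OF S]
  let ?I = "{k \<in> {..<n}. v k = w}"
  have XO: "X k \<in> Ob A" if "k \<in> ?I" for k using HD(4) that by blast
  obtain T incT where T: "is_coproduct A ?I X T incT" using coproducts[OF small_finite, of ?I X] XO by auto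
  note iT = coprodD(3)[OF T] and TO = coprodD(1)[OF T]
  have TP: "T \<in> fg_proj U A" by (rule fg_proj_coprod[OF T]) (use X in auto)
  have "\<forall>k\<in>?I. u k \<in> Hom A (X k) (fob H w)" using HD(3) by auto
  from coprod_exB[OF T R_Ob(2)[OF HO w'] this] obtain s where s: "s \<in> Hom A T (fob H w)" "\<forall>k\<in>?I. s \<cdot> incT k = u k" by blast
  have sum: "sum2 S T (fob H w) p s"
    by (rule layered_sum2[OF free_layered[OF H small_finite] w S T s(1)]) (use s(2) in auto)
  obtain c where c: "monic A p" "is_cokernel A p c" "c \<in> Hom A (fob H w) T" "c \<cdot> s = Ide A T" by (rule sum2_cokernel[OF sum])
  obtain SF incF pF Z cF where SF: "canonical F w SF incF pF" and pF: "monic A pF" and cF: "is_cokernel A pF cF"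
    "cF \<in> Hom A (fob F w) Z" and Z: "Z \<in> Filt_colims U A (fg_proj U A)" by (rule PhiD[OF F w])
  note SFD = canonicalD[OF SF]
  have flat: "flat Z" using Z Filt_colims_iff by blast
  have ZO: "Z \<in> Ob A" using Hom_Ob(2)[OF cF(2)] .
  note cFD = cokernelD[OF cF(1) SFD(2) cF(2)]
  obtain fS where fS: "fS \<in> Hom A S SF" "\<forall>a\<in>into w. fS \<cdot> inc a = incF a \<cdot> cmp f (src Q a)" "pF \<cdot> fS = cmp f w \<cdot> p"
    by (rule canonical_nat[OF S SF f w])
  \<comment> \<open>\<open>r\<close> is the sum of a part \<open>p \<cdot> r1\<close> from the sources and a part \<open>s \<cdot> (c \<cdot> r)\<close> from the generators at \<open>w\<close>.\<close>
  note r0 = Comp_Hom[OF r c(3)]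
  note sr0 = Comp_Hom[OF r0 s(1)]
  have "c \<cdot> (r \<ominus> (s \<cdot> (c \<cdot> r))) = zr P T"
    using comp_mi[OF r sr0 c(3)] Comp_assoc[OF r0 s(1) c(3)] c(4) Ide_Comp[OF r0] mi_self[OF r0] by simp
  then obtain r1 where r1: "r1 \<in> Hom A P S" "p \<cdot> r1 = r \<ominus> (s \<cdot> (c \<cdot> r))"
    using monic_kernel[OF c(1) SD(2) c(2,3) mi_Hom[OF r sr0]] by blast
  note pr1 = Comp_Hom[OF r1(1) SD(2)]
  have rr: "r = (p \<cdot> r1) \<oplus> (s \<cdot> (c \<cdot> r))" using r1(2) mi_pl[OF r sr0] by simp
  note fs = Comp_Hom[OF s(1) fw]
  note cfs = Comp_Hom[OF fs cF(2)]
  have "cF \<cdot> (cmp f w \<cdot> (p \<cdot> r1)) = zr P Z"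
    using Comp_assoc[OF r1(1) SD(2) fw] fS(3) Comp_assoc[OF r1(1) fS(1) SFD(2)]
      Comp_assoc[OF Comp_Hom[OF r1(1) fS(1)] SFD(2) cF(2)] cFD(1) zr_comp[OF Comp_Hom[OF r1(1) fS(1)] ZO] by simp
  moreover have "cF \<cdot> (cmp f w \<cdot> r) = zr P Z" using fr comp_zr[OF cF(2) PO] by simp
  moreover have "cmp f w \<cdot> r = (cmp f w \<cdot> (p \<cdot> r1)) \<oplus> (cmp f w \<cdot> (s \<cdot> (c \<cdot> r)))"
    using comp_pl[OF pr1 sr0 fw] rr by simp
  ultimately have "zr P Z = zr P Z \<oplus> (cF \<cdot> (cmp f w \<cdot> (s \<cdot> (c \<cdot> r))))"
    using comp_pl[OF Comp_Hom[OF pr1 fw] Comp_Hom[OF sr0 fw] cF(2)] by simp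
  then have z0: "(cF \<cdot> (cmp f w \<cdot> s)) \<cdot> (c \<cdot> r) = zr P Z"
    using pl_zr(2)[OF Comp_Hom[OF Comp_Hom[OF sr0 fw] cF(2)]] Comp_assoc[OF r0 fs cF(2)] Comp_assoc[OF r0 s(1) fw] by simp
  obtain P2 h y where P2: "P2 \<in> fg_proj U A" and h: "h \<in> Hom A T P2" "h \<cdot> (c \<cdot> r) = zr P P2"
    and y: "y \<in> Hom A P2 Z" "y \<cdot> h = cF \<cdot> (cmp f w \<cdot> s)"
    using flat TP P cfs r0 z0 unfolding flat_def by blast
  obtain y' where y': "y' \<in> Hom A P2 (fob F w)" "cF \<cdot> y' = y"
    by (rule projectiveD[OF fg_projD(1)[OF P2] cFD(2) cF(2) y(1)])
  note y'h = Comp_Hom[OF h(1) y'(1)]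
  have "cF \<cdot> ((cmp f w \<cdot> s) \<ominus> (y' \<cdot> h)) = zr T Z"
    using comp_mi[OF fs y'h cF(2)] Comp_assoc[OF h(1) y'(1) cF(2)] y'(2) y(2) mi_self[OF cfs] by simp
  then obtain z where z: "z \<in> Hom A T SF" "pF \<cdot> z = (cmp f w \<cdot> s) \<ominus> (y' \<cdot> h)"
    using monic_kernel[OF pF SFD(2) cF mi_Hom[OF fs y'h]] by blast
  have fse: "cmp f w \<cdot> s = (pF \<cdot> z) \<oplus> (y' \<cdot> h)" using z(2) mi_pl[OF fs y'h] by simp
  \<comment> \<open>\<open>B1\<close> gets the generators at the sources that \<open>z\<close> needs, \<open>B2\<close> moreover a generator \<open>P2\<close> at \<open>w\<close> for \<open>y'\<close>.\<close>
  obtain B1 g1 i1 S1 inc1 p1 k1 z1 where B1: "B1 \<in> finite_free" "g1 \<in> Hom R B1 F" "i1 \<in> Hom R H B1" "g1 \<cdot>\<^bsub>R\<^esub> i1 = f"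
    and S1: "canonical B1 w S1 inc1 p1" and k1: "k1 \<in> Hom A S1 SF" "\<forall>a\<in>into w. k1 \<cdot> inc1 a = incF a \<cdot> cmp g1 (src Q a)"
    and z1: "z1 \<in> Hom A T S1" "k1 \<cdot> z1 = z"
    using lift_source[OF SF w HF f TP z(1)] by blast
  obtain B2 g2 i2 t where B2: "B2 \<in> finite_free" "g2 \<in> Hom R B2 F" "i2 \<in> Hom R B1 B2" "g2 \<cdot>\<^bsub>R\<^esub> i2 = g1"
    and t: "t \<in> Hom A P2 (fob B2 w)" "cmp g2 w \<cdot> t = y'"
    by (rule finite_free_add_element[OF B1(1,2) P2 w y'(1)])
  note B2O = finite_free_Ob[OF B2(1)]
  obtain S2 inc2 p2 where S2: "canonical B2 w S2 inc2 p2" by (rule canonical_exists[OF B2O w])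
  note S2D = canonicalD[OF S2]
  obtain k2 where k2: "k2 \<in> Hom A S2 SF" "\<forall>a\<in>into w. k2 \<cdot> inc2 a = incF a \<cdot> cmp g2 (src Q a)" "pF \<cdot> k2 = cmp g2 w \<cdot> p2"
    by (rule canonical_nat[OF S2 SF B2(2) w])
  obtain m where m: "m \<in> Hom A S1 S2" "\<forall>a\<in>into w. m \<cdot> inc1 a = inc2 a \<cdot> cmp i2 (src Q a)" by (rule canonical_nat[OF S1 S2 B2(3) w])
  note i1' = coprodD(3)[OF canonicalD(1)[OF S1]] and i2' = coprodD(3)[OF S2D(1)] and iF = coprodD(3)[OF SFD(1)]
  have km: "k2 \<cdot> m = k1"
  proof (rule coprod_eq[OF canonicalD(1)[OF S1] Comp_Hom[OF m(1) k2(1)] k1(1)])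
    fix b assume b: "b \<in> into w"
    have sb: "src Q b \<in> Ob (path_cat Q)" using intoD(3)[OF b] by simp
    show "(k2 \<cdot> m) \<cdot> inc1 b = k1 \<cdot> inc1 b"
      using Comp_assoc[OF i1'[OF b] m(1) k2(1)] m(2) b Comp_assoc[OF cmp_Hom[OF B2(3) sb] i2'[OF b] k2(1)] k2(2)
        Comp_assoc[OF cmp_Hom[OF B2(3) sb] cmp_Hom[OF B2(2) sb] iF[OF b]] cmp_comp[OF B2(3,2) sb] B2(4) k1(2) by simp
  qed
  note z2 = Comp_Hom[OF z1(1) m(1)]
  have kz2: "k2 \<cdot> (m \<cdot> z1) = z" using Comp_assoc[OF z1(1) m(1) k2(1)] km z1(2) by simp
  note g2w = cmp_Hom[OF B2(2) w']
  note pz2 = Comp_Hom[OF z2 S2D(2)] and th = Comp_Hom[OF h(1) t(1)]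
  \<comment> \<open>The generators at \<open>w\<close>, rewritten according to \<open>cmp f w \<cdot> s = (pF \<cdot> z) \<oplus> (y' \<cdot> h)\<close>.\<close>
  define q where "q = (p2 \<cdot> (m \<cdot> z1)) \<oplus> (t \<cdot> h)"
  have q: "q \<in> Hom A T (fob B2 w)" unfolding q_def by (rule pl_Hom[OF pz2 th])
  have gq: "cmp g2 w \<cdot> q = cmp f w \<cdot> s"
    unfolding q_def using comp_pl[OF pz2 th g2w] Comp_assoc[OF z2 S2D(2) g2w] k2(3) Comp_assoc[OF z2 k2(1) SFD(2)] kz2
      Comp_assoc[OF h(1) t(1) g2w] t(2) fse by simp
  note i21 = R.Comp_Hom[OF B1(3) B2(3)]
  have gi: "g2 \<cdot>\<^bsub>R\<^esub> (i2 \<cdot>\<^bsub>R\<^esub> i1) = f" using R.Comp_assoc[OF B1(3) B2(3,2)] B2(4) B1(4) by simp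
  \<comment> \<open>\<open>H\<close> is sent to \<open>B2\<close> in the evident way, except for its generators at \<open>w\<close>.\<close>
  have "\<forall>k\<in>{..<n}. (if v k = w then q \<cdot> incT k else cmp (i2 \<cdot>\<^bsub>R\<^esub> i1) (v k) \<cdot> u k) \<in> Hom A (X k) (fob B2 (v k))"
    using Comp_Hom[OF iT q] Comp_Hom[OF HD(3) cmp_Hom[OF i21 HD(2)]] by auto
  from free_ex[OF H B2O this] obtain \<eta> where \<eta>: "\<eta> \<in> Hom R H B2"
    "\<forall>k\<in>{..<n}. cmp \<eta> (v k) \<cdot> u k = (if v k = w then q \<cdot> incT k else cmp (i2 \<cdot>\<^bsub>R\<^esub> i1) (v k) \<cdot> u k)" by blast
  note \<eta>w = cmp_Hom[OF \<eta>(1) w']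
  have g\<eta>: "g2 \<cdot>\<^bsub>R\<^esub> \<eta> = f"
  proof (rule free_eq[OF H R.Comp_Hom[OF \<eta>(1) B2(2)] f])
    fix k assume k: "k \<in> {..<n}"
    note vk = HD(2)[OF k] and uk = HD(3)[OF k]
    have 1: "cmp (g2 \<cdot>\<^bsub>R\<^esub> \<eta>) (v k) \<cdot> u k = cmp g2 (v k) \<cdot> (cmp \<eta> (v k) \<cdot> u k)"
      using cmp_comp[OF \<eta>(1) B2(2) vk] Comp_assoc[OF uk cmp_Hom[OF \<eta>(1) vk] cmp_Hom[OF B2(2) vk]] by simp
    show "cmp (g2 \<cdot>\<^bsub>R\<^esub> \<eta>) (v k) \<cdot> u k = cmp f (v k) \<cdot> u k"
    proof (cases "v k = w")
      case True
      then have kI: "k \<in> ?I" using k by simp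
      have "cmp g2 w \<cdot> (q \<cdot> incT k) = cmp f w \<cdot> u k"
        using Comp_assoc[OF iT[OF kI] q g2w] gq Comp_assoc[OF iT[OF kI] s(1) fw] s(2) kI by simp
      moreover have "cmp \<eta> w \<cdot> u k = q \<cdot> incT k" using \<eta>(2)[rule_format, OF k] True by simp
      ultimately show ?thesis using 1 True by simp
    next
      case False
      then show ?thesis
        using 1 \<eta>(2) k Comp_assoc[OF uk cmp_Hom[OF i21 vk] cmp_Hom[OF B2(2) vk]] cmp_comp[OF i21 B2(2) vk] gi by simp
    qed
  qed
  have \<eta>s: "cmp \<eta> w \<cdot> s = q"
  proof (rule coprod_eq[OF T Comp_Hom[OF s(1) \<eta>w] q])
    fix k assume k: "k \<in> ?I"
    show "(cmp \<eta> w \<cdot> s) \<cdot> incT k = q \<cdot> incT k"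
      using Comp_assoc[OF iT[OF k] s(1) \<eta>w] s(2) k \<eta>(2) by auto
  qed
  obtain \<eta>S where \<eta>S: "\<eta>S \<in> Hom A S S2" "p2 \<cdot> \<eta>S = cmp \<eta> w \<cdot> p" by (rule canonical_nat[OF S S2 \<eta>(1) w])
  \<comment> \<open>In \<open>B2\<close> the relation becomes \<open>p2 \<cdot> r2\<close>, so it comes from the sources.\<close>
  note e1 = Comp_Hom[OF r1(1) \<eta>S(1)] and e2 = Comp_Hom[OF r0 z2]
  define r2 where "r2 = (\<eta>S \<cdot> r1) \<oplus> ((m \<cdot> z1) \<cdot> (c \<cdot> r))"
  have r2: "r2 \<in> Hom A P S2" unfolding r2_def by (rule pl_Hom[OF e1 e2])
  have "q \<cdot> (c \<cdot> r) = p2 \<cdot> ((m \<cdot> z1) \<cdot> (c \<cdot> r))"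
    unfolding q_def using pl_comp[OF r0 pz2 th] Comp_assoc[OF r0 z2 S2D(2)] Comp_assoc[OF r0 h(1) t(1)] h(2)
      comp_zr[OF t(1) PO] pl_zr(1)[OF Comp_Hom[OF e2 S2D(2)]] by simp
  moreover have "cmp \<eta> w \<cdot> (p \<cdot> r1) = p2 \<cdot> (\<eta>S \<cdot> r1)"
    using Comp_assoc[OF r1(1) SD(2) \<eta>w] \<eta>S(2) Comp_assoc[OF r1(1) \<eta>S(1) S2D(2)] by simp
  moreover have "cmp \<eta> w \<cdot> r = (cmp \<eta> w \<cdot> (p \<cdot> r1)) \<oplus> (cmp \<eta> w \<cdot> (s \<cdot> (c \<cdot> r)))"
    using comp_pl[OF pr1 sr0 \<eta>w] rr by simp
  ultimately have \<eta>r: "cmp \<eta> w \<cdot> r = p2 \<cdot> r2"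
    unfolding r2_def using Comp_assoc[OF r0 s(1) \<eta>w] \<eta>s comp_pl[OF e1 e2 S2D(2)] by simp
  have "pF \<cdot> (k2 \<cdot> r2) = cmp g2 w \<cdot> (cmp \<eta> w \<cdot> r)"
    using \<eta>r Comp_assoc[OF r2 k2(1) SFD(2)] k2(3) Comp_assoc[OF r2 S2D(2) g2w] by simp
  also have "\<dots> = zr P (fob F w)"
    using Comp_assoc[OF r \<eta>w g2w] cmp_comp[OF \<eta>(1) B2(2) w'] g\<eta> fr by simp
  finally have k2r2: "k2 \<cdot> r2 = zr P SF" by (rule monic_zrD[OF pF SFD(2) Comp_Hom[OF r2 k2(1)]])
  have "\<forall>a\<in>into w. \<exists>\<pi>. \<pi> \<in> Hom A S2 (fob B2 (src Q a)) \<and> \<pi> \<cdot> inc2 a = Ide A (fob B2 (src Q a)) \<and>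
      (\<forall>b\<in>into w. b \<noteq> a \<longrightarrow> \<pi> \<cdot> inc2 b = zr (fob B2 (src Q b)) (fob B2 (src Q a)))"
  proof
    fix a assume a: "a \<in> into w"
    show "\<exists>\<pi>. \<pi> \<in> Hom A S2 (fob B2 (src Q a)) \<and> \<pi> \<cdot> inc2 a = Ide A (fob B2 (src Q a)) \<and>
      (\<forall>b\<in>into w. b \<noteq> a \<longrightarrow> \<pi> \<cdot> inc2 b = zr (fob B2 (src Q b)) (fob B2 (src Q a)))"
      by (rule coprod_proj[OF S2D(1) a]) blast
  qed
  then obtain \<pi> where \<pi>': "\<forall>a\<in>into w. \<pi> a \<in> Hom A S2 (fob B2 (src Q a)) \<and> \<pi> a \<cdot> inc2 a = Ide A (fob B2 (src Q a)) \<and>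
      (\<forall>b\<in>into w. b \<noteq> a \<longrightarrow> \<pi> a \<cdot> inc2 b = zr (fob B2 (src Q b)) (fob B2 (src Q a)))" by (rule bchoice[THEN exE])
  then have \<pi>: "\<And>a. a \<in> into w \<Longrightarrow> \<pi> a \<in> Hom A S2 (fob B2 (src Q a))"
    "\<And>a. a \<in> into w \<Longrightarrow> \<pi> a \<cdot> inc2 a = Ide A (fob B2 (src Q a))"
    "\<And>a b. a \<in> into w \<Longrightarrow> b \<in> into w \<Longrightarrow> a \<noteq> b \<Longrightarrow> \<pi> a \<cdot> inc2 b = zr (fob B2 (src Q b)) (fob B2 (src Q a))" by auto
  have \<pi>r: "cmp g2 (src Q a) \<cdot> (\<pi> a \<cdot> r2) = zr P (fob F (src Q a))" if a: "a \<in> into w" for a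
  proof -
    have sa: "src Q a \<in> Ob (path_cat Q)" using intoD(3)[OF a] by simp
    note ga = cmp_Hom[OF B2(2) sa]
    obtain \<pi>F where \<pi>F: "\<pi>F \<in> Hom A SF (fob F (src Q a))" "\<pi>F \<cdot> incF a = Ide A (fob F (src Q a))"
      "\<forall>b\<in>into w. b \<noteq> a \<longrightarrow> \<pi>F \<cdot> incF b = zr (fob F (src Q b)) (fob F (src Q a))"
      by (rule coprod_proj[OF SFD(1) a]) blast
    have "cmp g2 (src Q a) \<cdot> \<pi> a = \<pi>F \<cdot> k2"
    proof (rule coprod_eq[OF S2D(1) Comp_Hom[OF \<pi>(1)[OF a] ga] Comp_Hom[OF k2(1) \<pi>F(1)]])
      fix b assume b: "b \<in> into w"
      have sb: "src Q b \<in> Ob (path_cat Q)" using intoD(3)[OF b] by simp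
      note gb = cmp_Hom[OF B2(2) sb]
      have 1: "(cmp g2 (src Q a) \<cdot> \<pi> a) \<cdot> inc2 b = cmp g2 (src Q a) \<cdot> (\<pi> a \<cdot> inc2 b)"
        by (rule Comp_assoc[OF i2'[OF b] \<pi>(1)[OF a] ga])
      have 2: "(\<pi>F \<cdot> k2) \<cdot> inc2 b = (\<pi>F \<cdot> incF b) \<cdot> cmp g2 (src Q b)"
        using Comp_assoc[OF i2'[OF b] k2(1) \<pi>F(1)] k2(2) b Comp_assoc[OF gb iF[OF b] \<pi>F(1)] by simp
      show "(cmp g2 (src Q a) \<cdot> \<pi> a) \<cdot> inc2 b = (\<pi>F \<cdot> k2) \<cdot> inc2 b"
      proof (cases "b = a")
        case True
        then show ?thesis using 1 2 \<pi>(2)[OF a] \<pi>F(2) Comp_Ide[OF ga] Ide_Comp[OF ga] by simp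
      next
        case False
        then show ?thesis
          using 1 2 \<pi>(3)[OF a b] \<pi>F(3) b comp_zr[OF ga Hom_Ob(1)[OF gb]] zr_comp[OF gb Hom_Ob(2)[OF ga]] by auto
      qed
    qed
    then show ?thesis
      using Comp_assoc[OF r2 \<pi>(1)[OF a] ga] Comp_assoc[OF r2 k2(1) \<pi>F(1)] k2r2 comp_zr[OF \<pi>F(1) PO] by simp
  qed
  obtain N where N: "finite N" "N \<subseteq> into w"
    "\<forall>M g. g \<in> Hom A S2 M \<longrightarrow> (\<forall>a\<in>N. g \<cdot> (inc2 a \<cdot> (\<pi> a \<cdot> r2)) = zr P M) \<longrightarrow> g \<cdot> r2 = zr P M"
    using component_support[OF fg_projD(2)[OF P] S2D(1) small_into r2 \<pi>] by blast
  have "\<exists>B\<in>finite_free. \<exists>\<zeta>\<in>Hom R B2 B. \<exists>g\<in>Hom R B F. g \<cdot>\<^bsub>R\<^esub> \<zeta> = g2 \<and>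
      (\<forall>a\<in>N. cmp \<zeta> (src Q a) \<cdot> (\<pi> a \<cdot> r2) = zr P (fob B (src Q a)))"
  proof (rule kill_many[OF N(1) B2(1,2)])
    fix a assume "a \<in> N"
    then have a: "a \<in> into w" using N(2) by blast
    show "src Q a \<in> verts Q" by (rule intoD(3)[OF a])
    show "\<pi> a \<cdot> r2 \<in> Hom A P (fob B2 (src Q a))" by (rule Comp_Hom[OF r2 \<pi>(1)[OF a]])
    show "cmp g2 (src Q a) \<cdot> (\<pi> a \<cdot> r2) = zr P (fob F (src Q a))" by (rule \<pi>r[OF a])
    fix B g s assume "B \<in> finite_free" "g \<in> Hom R B F" "s \<in> Hom A P (fob B (src Q a))" "cmp g (src Q a) \<cdot> s = zr P (fob F (src Q a))"
    then show "\<exists>C\<in>finite_free. \<exists>h\<in>Hom R B C. \<exists>g'\<in>Hom R C F. g' \<cdot>\<^bsub>R\<^esub> h = g \<and> cmp h (src Q a) \<cdot> s = zr P (fob C (src Q a))"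
      using 1(1)[OF a intoD(3)[OF a] _ _ P] by blast
  qed
  then obtain B \<zeta> g where B: "B \<in> finite_free" "\<zeta> \<in> Hom R B2 B" "g \<in> Hom R B F" "g \<cdot>\<^bsub>R\<^esub> \<zeta> = g2"
    and \<zeta>N: "\<forall>a\<in>N. cmp \<zeta> (src Q a) \<cdot> (\<pi> a \<cdot> r2) = zr P (fob B (src Q a))" by blast
  obtain S3 inc3 p3 where S3: "canonical B w S3 inc3 p3" by (rule canonical_exists[OF finite_free_Ob[OF B(1)] w])
  note S3D = canonicalD[OF S3] and i3 = coprodD(3)[OF canonicalD(1)[OF S3]]
  obtain \<zeta>S where \<zeta>S: "\<zeta>S \<in> Hom A S2 S3" "\<forall>a\<in>into w. \<zeta>S \<cdot> inc2 a = inc3 a \<cdot> cmp \<zeta> (src Q a)" "p3 \<cdot> \<zeta>S = cmp \<zeta> w \<cdot> p2"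
    by (rule canonical_nat[OF S2 S3 B(2) w])
  have "\<zeta>S \<cdot> (inc2 a \<cdot> (\<pi> a \<cdot> r2)) = zr P S3" if aN: "a \<in> N" for a
  proof -
    have a: "a \<in> into w" using aN N(2) by blast
    have sa: "src Q a \<in> Ob (path_cat Q)" using intoD(3)[OF a] by simp
    note pr = Comp_Hom[OF r2 \<pi>(1)[OF a]]
    show ?thesis
      using Comp_assoc[OF pr i2'[OF a] \<zeta>S(1)] \<zeta>S(2) a Comp_assoc[OF pr cmp_Hom[OF B(2) sa] i3[OF a]] \<zeta>N aN
        comp_zr[OF i3[OF a] PO] by simp
  qed
  then have \<zeta>r: "\<zeta>S \<cdot> r2 = zr P S3" using N(3) \<zeta>S(1) by blast
  note \<zeta>w = cmp_Hom[OF B(2) w']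
  have "cmp (\<zeta> \<cdot>\<^bsub>R\<^esub> \<eta>) w \<cdot> r = cmp \<zeta> w \<cdot> (p2 \<cdot> r2)"
    using cmp_comp[OF \<eta>(1) B(2) w'] Comp_assoc[OF r \<eta>w \<zeta>w] \<eta>r by simp
  also have "\<dots> = zr P (fob B w)"
    using Comp_assoc[OF r2 S2D(2) \<zeta>w] \<zeta>S(3) Comp_assoc[OF r2 \<zeta>S(1) S3D(2)] \<zeta>r comp_zr[OF S3D(2) PO] by simp
  finally have "cmp (\<zeta> \<cdot>\<^bsub>R\<^esub> \<eta>) w \<cdot> r = zr P (fob B w)" .
  moreover have "g \<cdot>\<^bsub>R\<^esub> (\<zeta> \<cdot>\<^bsub>R\<^esub> \<eta>) = f" using R.Comp_assoc[OF \<eta>(1) B(2,3)] B(4) g\<eta> by simp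
  ultimately show ?case using B(1,3) R.Comp_Hom[OF \<eta>(1) B(2)] by blast
qed

text \<open>
  Density of the finitely generated free representations is inherited from the one of the finitely
  generated projective objects, vertex by vertex: an element \<open>x : P \<rightarrow> F(v)\<close> is a map to \<open>F\<close> from
  the free representation on one generator.
\<close>

lemma finite_free_dense:
  assumes F: "F \<in> Ob R" and M: "M \<in> Ob R"
    and mH: "\<And>H x. H \<in> finite_free \<Longrightarrow> x \<in> Hom R H F \<Longrightarrow> m x \<in> Hom R H M"
    and mn: "\<And>H H' g x. H \<in> finite_free \<Longrightarrow> H' \<in> finite_free \<Longrightarrow> g \<in> Hom R H' H \<Longrightarrow> x \<in> Hom R H F \<Longrightarrow>
      m (x \<cdot>\<^bsub>R\<^esub> g) = m x \<cdot>\<^bsub>R\<^esub> g"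
  shows "\<exists>!h. h \<in> Hom R F M \<and> (\<forall>H\<in>finite_free. \<forall>x\<in>Hom R H F. h \<cdot>\<^bsub>R\<^esub> x = m x)"
proof -
  have "\<forall>k \<in> fg_proj U A \<times> verts Q. \<exists>t. free_on {()} (\<lambda>_. snd k) (\<lambda>_. fst k) (fst t) (\<lambda>_. snd t) \<and> fst t \<in> finite_free"
  proof
    fix k assume "k \<in> fg_proj U A \<times> verts Q"
    then have k: "fst k \<in> fg_proj U A" "snd k \<in> verts Q" by auto
    obtain E e where "free_on {()} (\<lambda>_. snd k) (\<lambda>_. fst k) E (\<lambda>_. e)" "E \<in> finite_free" "e \<in> Hom A (fst k) (fob E (snd k))"
      by (rule free_element[OF k])
    then show "\<exists>t. free_on {()} (\<lambda>_. snd k) (\<lambda>_. fst k) (fst t) (\<lambda>_. snd t) \<and> fst t \<in> finite_free"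
      by (intro exI[of _ "(E, e)"]) simp
  qed
  then obtain t where t: "\<forall>k \<in> fg_proj U A \<times> verts Q.
      free_on {()} (\<lambda>_. snd k) (\<lambda>_. fst k) (fst (t k)) (\<lambda>_. snd (t k)) \<and> fst (t k) \<in> finite_free"
    by (rule bchoice[THEN exE])
  define E e where "E P v = fst (t (P, v))" and "e P v = snd (t (P, v))" for P v
  have E: "free_on {()} (\<lambda>_. v) (\<lambda>_. P) (E P v) (\<lambda>_. e P v)" "E P v \<in> finite_free" if "P \<in> fg_proj U A" "v \<in> verts Q" for P v
    using t[rule_format, of "(P, v)"] that by (auto simp: E_def e_def)
  have EO: "E P v \<in> Ob R" and eH: "e P v \<in> Hom A P (fob (E P v) v)" if "P \<in> fg_proj U A" "v \<in> verts Q" for P v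
    using freeD(1)[OF E(1)[OF that]] freeD(3)[OF E(1)[OF that], of "()"] by auto
  have ex: "\<exists>h \<in> Hom R (E P v) Y. cmp h v \<cdot> e P v = x" if "P \<in> fg_proj U A" "v \<in> verts Q" "Y \<in> Ob R" "x \<in> Hom A P (fob Y v)" for P v Y x
    using free_ex[OF E(1)[OF that(1,2)] that(3), of "\<lambda>_. x"] that(4) by simp
  have eq: "h = h'" if "P \<in> fg_proj U A" "v \<in> verts Q" "h \<in> Hom R (E P v) Y" "h' \<in> Hom R (E P v) Y"
      "cmp h v \<cdot> e P v = cmp h' v \<cdot> e P v" for P v Y h h'
    by (rule free_eq[OF E(1)[OF that(1,2)] that(3,4)]) (use that(5) in simp)
  define hat where "hat P v x = (SOME h. h \<in> Hom R (E P v) F \<and> cmp h v \<cdot> e P v = x)" for P v x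
  have hat: "hat P v x \<in> Hom R (E P v) F" "cmp (hat P v x) v \<cdot> e P v = x"
    if "P \<in> fg_proj U A" "v \<in> verts Q" "x \<in> Hom A P (fob F v)" for P v x
    using someI_ex[of "\<lambda>h. h \<in> Hom R (E P v) F \<and> cmp h v \<cdot> e P v = x"] ex[OF that(1,2) F that(3)] by (auto simp: hat_def)
  define n where "n v P x = cmp (m (hat P v x)) v \<cdot> e P v" for v P x
  have nH: "n v P x \<in> Hom A P (fob M v)" if "v \<in> verts Q" "P \<in> fg_proj U A" "x \<in> Hom A P (fob F v)" for v P x
    unfolding n_def using Comp_Hom[OF eH[OF that(2,1)] cmp_Hom[OF mH[OF E(2)[OF that(2,1)] hat(1)[OF that(2,1,3)]]]] that(1) by simp
  \<comment> \<open>\<open>n\<close> is defined by free representations on one generator; all others over \<open>F\<close> yield the same values.\<close>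
  have nm: "n v P (cmp x v \<cdot> y) = cmp (m x) v \<cdot> y"
    if v: "v \<in> verts Q" and P: "P \<in> fg_proj U A" and H: "H \<in> finite_free" and x: "x \<in> Hom R H F" and y: "y \<in> Hom A P (fob H v)" for v P H x y
  proof -
    have v': "v \<in> Ob (path_cat Q)" using v by simp
    note xy = Comp_Hom[OF y cmp_Hom[OF x v']]
    obtain g where g: "g \<in> Hom R (E P v) H" "cmp g v \<cdot> e P v = y" using ex[OF P v finite_free_Ob[OF H] y] by blast
    note ev = eH[OF P v] and gv = cmp_Hom[OF g(1) v']
    have "hat P v (cmp x v \<cdot> y) = x \<cdot>\<^bsub>R\<^esub> g"
      by (rule eq[OF P v hat(1)[OF P v xy] R.Comp_Hom[OF g(1) x]])
        (simp add: hat(2)[OF P v xy] cmp_comp[OF g(1) x v'] Comp_assoc[OF ev gv cmp_Hom[OF x v']] g(2))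
    then show ?thesis
      using mn[OF H E(2)[OF P v] g(1) x] cmp_comp[OF g(1) mH[OF H x] v']
        Comp_assoc[OF ev gv cmp_Hom[OF mH[OF H x] v']] g(2) by (simp add: n_def)
  qed
  have nn: "n v P' (x \<cdot> g) = n v P x \<cdot> g" if v: "v \<in> verts Q" and P: "P \<in> fg_proj U A" "P' \<in> fg_proj U A" and g: "g \<in> Hom A P' P"
    and x: "x \<in> Hom A P (fob F v)" for v P P' g x
  proof -
    have v': "v \<in> Ob (path_cat Q)" using v by simp
    note h = hat[OF P(1) v x] and ev = eH[OF P(1) v]
    have "n v P' (cmp (hat P v x) v \<cdot> (e P v \<cdot> g)) = cmp (m (hat P v x)) v \<cdot> (e P v \<cdot> g)"
      by (rule nm[OF v P(2) E(2)[OF P(1) v] h(1) Comp_Hom[OF g ev]])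
    then show ?thesis
      using Comp_assoc[OF g ev cmp_Hom[OF h(1) v']] h(2) Comp_assoc[OF g ev cmp_Hom[OF mH[OF E(2)[OF P(1) v] h(1)] v']]
      by (simp add: n_def)
  qed
  have "\<forall>v\<in>verts Q. \<exists>h. h \<in> Hom A (fob F v) (fob M v) \<and> (\<forall>P\<in>fg_proj U A. \<forall>x\<in>Hom A P (fob F v). h \<cdot> x = n v P x)"
  proof
    fix v assume v: "v \<in> verts Q"
    have "\<exists>!h. h \<in> Hom A (fob F v) (fob M v) \<and> (\<forall>P\<in>fg_proj U A. \<forall>x\<in>Hom A P (fob F v). h \<cdot> x = n v P x)"
      by (rule fg_proj_dense) (use v R_Ob(2)[OF F] R_Ob(2)[OF M] nH[OF v] nn[OF v] in simp_all)
    then show "\<exists>h. h \<in> Hom A (fob F v) (fob M v) \<and> (\<forall>P\<in>fg_proj U A. \<forall>x\<in>Hom A P (fob F v). h \<cdot> x = n v P x)"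
      by (rule ex1_implies_ex)
  qed
  then obtain h where "\<forall>v\<in>verts Q. h v \<in> Hom A (fob F v) (fob M v) \<and> (\<forall>P\<in>fg_proj U A. \<forall>x\<in>Hom A P (fob F v). h v \<cdot> x = n v P x)"
    by (rule bchoice[THEN exE])
  then have hH: "\<And>v. v \<in> verts Q \<Longrightarrow> h v \<in> Hom A (fob F v) (fob M v)"
    and hx: "\<And>v P x. v \<in> verts Q \<Longrightarrow> P \<in> fg_proj U A \<Longrightarrow> x \<in> Hom A P (fob F v) \<Longrightarrow> h v \<cdot> x = n v P x" by auto
  have hnat: "h y \<cdot> fmor F p = fmor M p \<cdot> h x" if p: "p \<in> Hom (path_cat Q) x y" for x y p
  proof -
    have x: "x \<in> verts Q" and y: "y \<in> verts Q" using J.Hom_Ob[OF p] by auto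
    note Fp = R_Ob(3)[OF F p] and Mp = R_Ob(3)[OF M p]
    show ?thesis
    proof (rule gen_eq[OF Comp_Hom[OF Fp hH[OF y]] Comp_Hom[OF hH[OF x] Mp]])
      fix P z assume P: "P \<in> fg_proj U A" and z: "z \<in> Hom A P (fob F x)"
      note t = hat[OF P x z] and ee = eH[OF P x] and EE = E(2)[OF P x]
      have x': "x \<in> Ob (path_cat Q)" and y': "y \<in> Ob (path_cat Q)" using x y by auto
      note Ep = R_Ob(3)[OF EO[OF P x] p]
      note mt = mH[OF EE t(1)]
      have "fmor F p \<cdot> z = cmp (hat P x z) y \<cdot> (fmor (E P x) p \<cdot> e P x)"
        using t(2) Comp_assoc[OF ee cmp_Hom[OF t(1) x'] Fp] cmp_nat[OF t(1) p]
          Comp_assoc[OF ee Ep cmp_Hom[OF t(1) y']] by simp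
      then have "n y P (fmor F p \<cdot> z) = cmp (m (hat P x z)) y \<cdot> (fmor (E P x) p \<cdot> e P x)"
        using nm[OF y P EE t(1) Comp_Hom[OF ee Ep]] by simp
      also have "\<dots> = fmor M p \<cdot> n x P z"
        using Comp_assoc[OF ee Ep cmp_Hom[OF mt y']] cmp_nat[OF mt p] Comp_assoc[OF ee cmp_Hom[OF mt x'] Mp] by (simp add: n_def)
      finally show "(h y \<cdot> fmor F p) \<cdot> z = (fmor M p \<cdot> h x) \<cdot> z"
        using Comp_assoc[OF z Fp hH[OF y]] Comp_assoc[OF z hH[OF x] Mp] hx[OF x P z] hx[OF y P Comp_Hom[OF z Fp]] by simp
    qed
  qed
  obtain h' where h': "h' \<in> Hom R F M" "\<And>v. v \<in> verts Q \<Longrightarrow> cmp h' v = h v"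
    by (rule R_homI[OF F M, of h]) (use hH hnat in auto)
  show ?thesis
  proof (rule ex1I[of _ h'], intro conjI ballI)
    show "h' \<in> Hom R F M" by (rule h')
    fix H x assume H: "H \<in> finite_free" and x: "x \<in> Hom R H F"
    obtain k v X u where X: "\<forall>i\<in>{..<k::nat}. X i \<in> fg_proj U A" and HF: "free_on {..<k} v X H u" by (rule finite_freeE[OF H])
    show "h' \<cdot>\<^bsub>R\<^esub> x = m x"
    proof (rule free_eq[OF HF R.Comp_Hom[OF x h'(1)] mH[OF H x]])
      fix i assume i: "i \<in> {..<k}"
      note vi' = freeD(2)[OF HF i] and ui = freeD(3)[OF HF i]
      have vi: "v i \<in> verts Q" using vi' by simp
      have Xi: "X i \<in> fg_proj U A" using X i by blast
      show "cmp (h' \<cdot>\<^bsub>R\<^esub> x) (v i) \<cdot> u i = cmp (m x) (v i) \<cdot> u i"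
        using cmp_comp[OF x h'(1) vi'] h'(2)[OF vi] Comp_assoc[OF ui cmp_Hom[OF x vi'] hH[OF vi]]
          hx[OF vi Xi Comp_Hom[OF ui cmp_Hom[OF x vi']]] nm[OF vi Xi H x ui] by simp
    qed
  next
    fix g assume g: "g \<in> Hom R F M \<and> (\<forall>H\<in>finite_free. \<forall>x\<in>Hom R H F. g \<cdot>\<^bsub>R\<^esub> x = m x)"
    then have gM: "g \<in> Hom R F M" by blast
    show "g = h'"
    proof (rule R_ext[OF gM h'(1)])
      fix v assume v': "v \<in> Ob (path_cat Q)"
      then have v: "v \<in> verts Q" by simp
      show "cmp g v = cmp h' v"
        unfolding h'(2)[OF v]
      proof (rule gen_eq[OF cmp_Hom[OF gM v'] hH[OF v]])
        fix P x assume P: "P \<in> fg_proj U A" and x: "x \<in> Hom A P (fob F v)"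
        note t = hat[OF P v x]
        have "g \<cdot>\<^bsub>R\<^esub> hat P v x = m (hat P v x)" using g E(2)[OF P v] t(1) by blast
        then show "cmp g v \<cdot> x = h v \<cdot> x"
          using hx[OF v P x] cmp_comp[OF t(1) gM v'] Comp_assoc[OF eH[OF P v] cmp_Hom[OF t(1) v'] cmp_Hom[OF gM v']] t(2)
          by (simp add: n_def)
      qed
    qed
  qed
qed

text \<open>
  Two maps that become equal over \<open>F\<close> are equalized by killing their differences on the finitely many
  generators.
\<close>

lemma Phi_Filt_colims:
  "Phi Q A (Filt_colims U A (fg_proj U A)) = Filt_colims U R (fg_proj U R)"
proof (intro equalityI subsetI)
  fix F assume F: "F \<in> Phi Q A (Filt_colims U A (fg_proj U A))"
  have FO: "F \<in> Ob R" by (rule Phi_Ob[OF F])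
  obtain \<F> where \<F>: "\<F> \<subseteq> finite_free" "small U \<F>" "\<forall>F\<in>finite_free. \<exists>F'\<in>\<F>. \<exists>f g. R.inverse_pair F F' f g"
    by (rule finite_free_skeleton)
  have "F \<in> Filt_colims U R finite_free"
  proof (rule canonical_filtered_colimit[OF R.category_axioms FO _ \<F>(1,2)])
    show "finite_free \<subseteq> Ob R" using finite_free_Ob by blast
    show "small U (Hom R H Y)" if "H \<in> \<F>" "Y \<in> Ob R" for H Y using small_Hom_finite_free that \<F>(1) by blast
    show "\<exists>F'\<in>\<F>. \<exists>f g. R.inverse_pair H F' f g" if "H \<in> finite_free" for H using \<F>(3) that by blast
    obtain H u where H: "free_on {} (\<lambda>_::nat. undefined) (\<lambda>_. undefined) H u" "H \<in> finite_free"
      by (rule finite_free_exists[of "{}::nat set" "\<lambda>_. undefined" "\<lambda>_. undefined"]) auto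
    have "Hom R H F \<noteq> {}" using free_ex[OF H(1) FO] by auto
    then show "\<exists>H\<in>finite_free. Hom R H F \<noteq> {}" using H(2) by blast
    show "\<exists>B\<in>finite_free. \<exists>z\<in>Hom R B F. \<exists>i\<in>Hom R H B. \<exists>j\<in>Hom R H' B. z \<cdot>\<^bsub>R\<^esub> i = x \<and> z \<cdot>\<^bsub>R\<^esub> j = x'"
      if "H \<in> finite_free" "H' \<in> finite_free" "x \<in> Hom R H F" "x' \<in> Hom R H' F" for H H' x x'
      by (rule finite_free_sum[OF that])
    show "\<exists>B\<in>finite_free. \<exists>w\<in>Hom R H' B. \<exists>z\<in>Hom R B F. z \<cdot>\<^bsub>R\<^esub> w = x \<and> w \<cdot>\<^bsub>R\<^esub> a = w \<cdot>\<^bsub>R\<^esub> b"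
      if H: "H \<in> finite_free" and H': "H' \<in> finite_free" and x: "x \<in> Hom R H' F" and a: "a \<in> Hom R H H'" and b: "b \<in> Hom R H H'"
        and e: "x \<cdot>\<^bsub>R\<^esub> a = x \<cdot>\<^bsub>R\<^esub> b" for H H' x a b
    proof -
      obtain n v X u where X: "\<forall>i\<in>{..<n::nat}. X i \<in> fg_proj U A" and HF: "free_on {..<n} v X H u" by (rule finite_freeE[OF H])
      note vi = freeD(2)[OF HF] and ui = freeD(3)[OF HF]
      let ?r = "\<lambda>i. (cmp a (v i) \<cdot> u i) \<ominus> (cmp b (v i) \<cdot> u i)"
      have au: "cmp a (v i) \<cdot> u i \<in> Hom A (X i) (fob H' (v i))" and bu: "cmp b (v i) \<cdot> u i \<in> Hom A (X i) (fob H' (v i))"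
        if "i \<in> {..<n}" for i
        using Comp_Hom[OF ui[OF that] cmp_Hom[OF a vi[OF that]]] Comp_Hom[OF ui[OF that] cmp_Hom[OF b vi[OF that]]] by auto
      have "\<exists>B\<in>finite_free. \<exists>h\<in>Hom R H' B. \<exists>g\<in>Hom R B F. g \<cdot>\<^bsub>R\<^esub> h = x \<and>
          (\<forall>i\<in>{..<n}. cmp h (v i) \<cdot> ?r i = zr (X i) (fob B (v i)))"
      proof (rule kill_many[OF _ H' x])
        show "finite {..<n}" by simp
        fix i assume i: "i \<in> {..<n}"
        show "v i \<in> verts Q" using vi[OF i] by simp
        show "?r i \<in> Hom A (X i) (fob H' (v i))" by (rule mi_Hom[OF au[OF i] bu[OF i]])
        have 1: "cmp x (v i) \<cdot> (cmp c (v i) \<cdot> u i) = cmp (x \<cdot>\<^bsub>R\<^esub> c) (v i) \<cdot> u i" if c: "c \<in> Hom R H H'" for c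
          using cmp_comp[OF c x vi[OF i]] Comp_assoc[OF ui[OF i] cmp_Hom[OF c vi[OF i]] cmp_Hom[OF x vi[OF i]]] by simp
        show "cmp x (v i) \<cdot> ?r i = zr (X i) (fob F (v i))"
          using comp_mi[OF au[OF i] bu[OF i] cmp_Hom[OF x vi[OF i]]] 1[OF a] 1[OF b] e
            mi_self[OF Comp_Hom[OF au[OF i] cmp_Hom[OF x vi[OF i]]]] by simp
        fix B g s assume "B \<in> finite_free" "g \<in> Hom R B F" "s \<in> Hom A (X i) (fob B (v i))" "cmp g (v i) \<cdot> s = zr (X i) (fob F (v i))"
        moreover have "X i \<in> fg_proj U A" using X i by blast
        moreover have "v i \<in> verts Q" using vi[OF i] by simp
        ultimately show "\<exists>C\<in>finite_free. \<exists>h\<in>Hom R B C. \<exists>g'\<in>Hom R C F. g' \<cdot>\<^bsub>R\<^esub> h = g \<and> cmp h (v i) \<cdot> s = zr (X i) (fob C (v i))"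
          using kill[OF F] by blast
      qed
      then obtain B w z where B: "B \<in> finite_free" and w: "w \<in> Hom R H' B" and z: "z \<in> Hom R B F" "z \<cdot>\<^bsub>R\<^esub> w = x"
        and wr: "\<forall>i\<in>{..<n}. cmp w (v i) \<cdot> ?r i = zr (X i) (fob B (v i))" by blast
      have "w \<cdot>\<^bsub>R\<^esub> a = w \<cdot>\<^bsub>R\<^esub> b"
      proof (rule free_eq[OF HF R.Comp_Hom[OF a w] R.Comp_Hom[OF b w]])
        fix i assume i: "i \<in> {..<n}"
        note wi = cmp_Hom[OF w vi[OF i]]
        have 1: "cmp w (v i) \<cdot> (cmp c (v i) \<cdot> u i) = cmp (w \<cdot>\<^bsub>R\<^esub> c) (v i) \<cdot> u i" if c: "c \<in> Hom R H H'" for c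
          using cmp_comp[OF c w vi[OF i]] Comp_assoc[OF ui[OF i] cmp_Hom[OF c vi[OF i]] wi] by simp
        have "cmp w (v i) \<cdot> (cmp a (v i) \<cdot> u i) = cmp w (v i) \<cdot> (cmp b (v i) \<cdot> u i)"
          using wr i comp_mi[OF au[OF i] bu[OF i] wi] mi_eq_zr[OF Comp_Hom[OF au[OF i] wi] Comp_Hom[OF bu[OF i] wi]] by simp
        then show "cmp (w \<cdot>\<^bsub>R\<^esub> a) (v i) \<cdot> u i = cmp (w \<cdot>\<^bsub>R\<^esub> b) (v i) \<cdot> u i" using 1[OF a] 1[OF b] by simp
      qed
      then show ?thesis using B w z by blast
    qed
    show "\<exists>!h. h \<in> Hom R F M \<and> (\<forall>H\<in>finite_free. \<forall>x\<in>Hom R H F. h \<cdot>\<^bsub>R\<^esub> x = m x)"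
      if "M \<in> Ob R" "\<And>H x. H \<in> finite_free \<Longrightarrow> x \<in> Hom R H F \<Longrightarrow> m x \<in> Hom R H M"
        "\<And>H H' g x. H \<in> finite_free \<Longrightarrow> H' \<in> finite_free \<Longrightarrow> g \<in> Hom R H' H \<Longrightarrow> x \<in> Hom R H F \<Longrightarrow> m (x \<cdot>\<^bsub>R\<^esub> g) = m x \<cdot>\<^bsub>R\<^esub> g" for M m
      by (rule finite_free_dense[OF FO that])
  qed
  then show "F \<in> Filt_colims U R (fg_proj U R)" using finite_free_fg_proj unfolding Filt_colims_def by blast
qed (rule Filt_colims_Phi)

end

theorem lemma2p12:
  fixes U :: "'u itself"
    and A :: "('o, 'm) cat"
    and Q :: "('v, 'e) quiver"
    and \<X> :: "'o set"
  assumes univ: "regular_universe U"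
    and AB5: "AB5 U A"
    and quiver: "is_quiver Q" "small U (verts Q)" "small U (arrs Q)" "left_rooted Q"
    and X: "\<X> \<subseteq> Proj A"
  shows
    "(Phi Q A (Sums U A \<X>) = Sums U (Rep Q A) (f_star Q A \<X>) \<and>
      Sums U (Rep Q A) (Phi Q A \<X>) \<subseteq> Sums U (Rep Q A) (f_star Q A \<X>) \<and>
      ((\<exists>Z \<in> \<X>. zero_ob A Z) \<longrightarrow>
         Sums U (Rep Q A) (f_star Q A \<X>) = Sums U (Rep Q A) (Phi Q A \<X>))) \<and>
     (Phi Q A (Add U A \<X>) = Add U (Rep Q A) (f_star Q A \<X>) \<and>
      Add U (Rep Q A) (f_star Q A \<X>) = Add U (Rep Q A) (Phi Q A \<X>)) \<and>
     (enough_projectives A \<longrightarrow> Phi Q A (Proj A) = Proj (Rep Q A)) \<and>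
     (loc_fin_presented U A \<and> generates A (fg_proj U A) \<longrightarrow>
      Phi Q A (Filt_colims U A (fg_proj U A)) = Filt_colims U (Rep Q A) (fg_proj U (Rep Q A)))"
proof -
  have ab: "abelian A" "cocomplete U A" using AB5 by (auto simp: AB5_def)
  then obtain pl where pl: "preadditive A pl" unfolding abelian_def by blast
  have cat: "category A" using pl by (simp add: preadditive_def)
  have abc: "abelian_cat A pl" using cat pl ab(1) by (simp add: abelian_cat_def abelian_cat_axioms_def)
  have u: "universe U" using univ by (simp add: universe_def)
  interpret quiver_reps A pl U Q
    using abc u ab(2) quiver by (simp add: quiver_reps_def quiver_reps_axioms_def)
  have iv: "Phi Q A (Filt_colims U A (fg_proj U A)) = Filt_colims U R (fg_proj U R)"
    if lfp: "loc_fin_presented U A" and gen: "generates A (fg_proj U A)"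
  proof -
    obtain G where G: "G \<in> Ob A" "generates A {G}" "\<forall>X \<in> Ob A. small U (Hom A G X)"
      using lfp unfolding loc_fin_presented_def grothendieck_def by blast
    have "cocomplete_abelian A pl U"
      using abc u ab(2) by (simp add: cocomplete_abelian_def cocomplete_abelian_axioms_def)
    then interpret fg_quiver_reps A pl U Q G
      using quiver_reps_axioms G gen by (simp add: fg_quiver_reps_def fg_generated_def fg_generated_axioms_def)
    show ?thesis by (rule Phi_Filt_colims)
  qed
  have i: "Sums U R (f_star Q A \<X>) = Sums U R (Phi Q A \<X>)" if "\<exists>Z \<in> \<X>. zero_ob A Z"
    using Sums_Phi[OF X] Sums_mono[OF f_star_Phi] that by blast
  show ?thesis
    using Phi_Sums[OF X] Sums_Phi[OF X] i Phi_Add[OF X] Add_Phi[OF X] Phi_Proj iv by blast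
qed

end
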